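(* Let $s\in(0,2n+2)$ and let $\mu$ be a nonzero Radon measure on the Heisenberg group $\mathbb{H}^n$ such that for $\mu$-a.e. $p\in\mathbb{H}^n$, $$0<\liminf_{r\to0}\frac{\mu(B(p,r))}{r^s}\le\limsup_{r\to0}\frac{\mu(B(p,r))}{r^s}<\infty$$ and $$\sup_{0<\varepsilon<1}\left\|\left(\int_{B(p,1)\setminus B(p,\varepsilon)}R_{s,i}(p^{-1}\cdot q)\,d\mu(q)\right)_{i=1}^{2n+1}\right\|<\infty .$$ Then: (1) $s$ is an integer in $[1,2n+1]$; (2) for $\mu$-a.e. $a\in\mathbb{H}^n$, the set $\operatorname{Tan}(\mu,a)$ of tangent measures of $\mu$ at $a$ contains measures in $\mathcal{H}(n,s)$, i.e. $\operatorname{Tan}(\mu,a)\cap\mathcal{H}(n,s)\neq\emptyset$.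
   Context: $n\ge1$ is an integer. The Heisenberg group $\mathbb{H}^n$ is $\mathbb{R}^{2n+1}$, with points $p=(p',p_{2n+1})$, $p'\in\mathbb{R}^{2n}$, and group law $p\cdot q=(p'+q',\,p_{2n+1}+q_{2n+1}+A(p,q))$, where $A(p,q)=-2\sum_{i=1}^n(p_iq_{i+n}-p_{i+n}q_i)$. Put $\|p\|=(|p'|^4+p_{2n+1}^2)^{1/4}$ and $d(p,q)=\|p^{-1}\cdot q\|$; this is a left-invariant metric. $B(p,r)$ is the closed $d$-ball. Dilations: $\delta_r(p)=(rp',r^2p_{2n+1})$, $r>0$. Riesz kernels: $R_{s,i}(p)=p_i/\|p\|^{s+1}$ for $i=1,\dots,2n$ and $R_{s,2n+1}(p)=p_{2n+1}/\|p\|^{s+2}$. A homogeneous subgroup of $\mathbb{H}^n$ is a closed subgroup $G$ with $\delta_r(G)=G$ for all $r>0$. For an integer $m$, $\mathcal{H}(n,m)$ denotes the set of all measures of the form $c\,\mathcal{H}^m\lfloor V$ (Haar measures of $V$), where $c>0$, $V$ is a homogeneous subgroup of Hausdorff dimension $m$ (with respect to $d$), and $\mathcal{H}^m\lfloor V$ is the restriction to $V$ of the $m$-dimensional Hausdorff measure with respect to $d$. Tangent measures: for $a\in\mathbb{H}^n$, $r>0$ let $T_{a,r}(p)=\delta_{1/r}(a^{-1}\cdot p)$, and let $f_\#\mu(A)=\mu(f^{-1}(A))$. A Radon measure $\nu$ on $\mathbb{H}^n$ with $\nu(\mathbb{H}^n)>0$ is a tangent measure of $\mu$ at $a$, written $\nu\in\operatorname{Tan}(\mu,a)$,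 if there are $c_i>0$ and $r_i>0$ with $r_i\to0$ such that $c_iT_{a,r_i\#}\mu\to\nu$ weakly as $i\to\infty$. *)

theory Defs
  imports "HOL-Analysis.Analysis" "HOL-Algebra.Group"
begin

text \<open>
  A point \<open>p = (p', t)\<close> of the Heisenberg group is \<open>((x, y), t)\<close> with \<open>x = (p\<^sub>1, \<dots>, p\<^sub>n)\<close>,
  \<open>y = (p\<^bsub>n+1\<^esub>, \<dots>, p\<^bsub>2n\<^esub>)\<close> and \<open>t = p\<^bsub>2n+1\<^esub>\<close>, where \<open>n = CARD('n)\<close>.  The library norm of
  \<open>p' = (x, y)\<close> is the Euclidean norm of \<open>\<real>\<^sup>2\<^sup>n\<close>.  Topology and Borel sets are those of the
  Euclidean space \<open>\<real>\<^bsup>2n+1\<^esup>\<close>; the metric \<open>hdist\<close> below induces the same topology.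
\<close>
type_synonym 'n heis = "((real ^ 'n) \<times> (real ^ 'n)) \<times> real"

definition hform :: "('n::finite) heis \<Rightarrow> 'n heis \<Rightarrow> real" where
  "hform p q =
    - 2 * (\<Sum>i\<in>UNIV. fst (fst p) $ i * snd (fst q) $ i - snd (fst p) $ i * fst (fst q) $ i)"

definition heisenberg :: "('n::finite) heis monoid" where
  "heisenberg =
    \<lparr>carrier = UNIV,
     mult = (\<lambda>p q. (fst p + fst q, snd p + snd q + hform p q)),
     one = 0\<rparr>"

lemma group_heisenberg: "group (heisenberg :: ('n::finite) heis monoid)"
proof (rule groupI)
  fix p q r :: "'n heis"
  show "p \<otimes>\<^bsub>heisenberg\<^esub> q \<otimes>\<^bsub>heisenberg\<^esub> r = p \<otimes>\<^bsub>heisenberg\<^esub> (q \<otimes>\<^bsub>heisenberg\<^esub> r)"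
    by (simp add: heisenberg_def hform_def algebra_simps sum.distrib sum_subtractf)
next
  fix p :: "'n heis"
  have "(- p) \<otimes>\<^bsub>heisenberg\<^esub> p = \<one>\<^bsub>heisenberg\<^esub>"
    by (simp add: heisenberg_def hform_def prod_eq_iff mult.commute)
  then show "\<exists>q\<in>carrier heisenberg. q \<otimes>\<^bsub>heisenberg\<^esub> p = \<one>\<^bsub>heisenberg\<^esub>"
    by (intro bexI[of _ "- p"]) (simp_all add: heisenberg_def)
qed (simp_all add: heisenberg_def hform_def)

lemma inv_heisenberg: "inv\<^bsub>heisenberg\<^esub> p = - (p :: ('n::finite) heis)"
proof (rule group.inv_equality[OF group_heisenberg])
  show "(- p) \<otimes>\<^bsub>heisenberg\<^esub> p = \<one>\<^bsub>heisenberg\<^esub>"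
    by (simp add: heisenberg_def hform_def prod_eq_iff mult.commute)
qed (simp_all add: heisenberg_def)

definition hnorm :: "('n::finite) heis \<Rightarrow> real" where
  "hnorm p = root 4 (norm (fst p) ^ 4 + (snd p)\<^sup>2)"

definition hdist :: "('n::finite) heis \<Rightarrow> 'n heis \<Rightarrow> real" where
  "hdist p q = hnorm (inv\<^bsub>heisenberg\<^esub> p \<otimes>\<^bsub>heisenberg\<^esub> q)"

definition hball :: "('n::finite) heis \<Rightarrow> real \<Rightarrow> 'n heis set" where
  "hball p r = {q. hdist p q \<le> r}"

definition hdilation :: "real \<Rightarrow> ('n::finite) heis \<Rightarrow> 'n heis" where
  "hdilation r p = (r *\<^sub>R fst p, r\<^sup>2 * snd p)"

definition homogeneous_subgroup :: "('n::finite) heis set \<Rightarrow> bool" where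
  "homogeneous_subgroup V \<longleftrightarrow>
    subgroup V heisenberg \<and> closed V \<and> (\<forall>r>0. hdilation r ` V = V)"

text \<open>
  The vector \<open>(R\<^bsub>s,1\<^esub>, \<dots>, R\<^bsub>s,2n+1\<^esub>)\<close> of all kernels.  Its Bochner integral is taken
  coordinatewise.
\<close>
definition riesz_kernel :: "real \<Rightarrow> ('n::finite) heis \<Rightarrow> 'n heis" where
  "riesz_kernel s p =
    (fst p /\<^sub>R (hnorm p powr (s + 1)), snd p / hnorm p powr (s + 2))"

definition truncated_riesz ::
    "real \<Rightarrow> ('n::finite) heis measure \<Rightarrow> real \<Rightarrow> 'n heis \<Rightarrow> 'n heis" where
  "truncated_riesz s \<mu> \<epsilon> p =
    (LINT q : hball p 1 - hball p \<epsilon> | \<mu>. riesz_kernel s (inv\<^bsub>heisenberg\<^esub> p \<otimes>\<^bsub>heisenberg\<^esub> q))"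

text \<open>
  These are defined for an arbitrary distance function \<open>d\<close>, as they are needed for \<open>hdist\<close>
  rather than for the Euclidean \<open>dist\<close> of the underlying type.
\<close>
definition diam_wrt :: "('a \<Rightarrow> 'a \<Rightarrow> real) \<Rightarrow> 'a set \<Rightarrow> ennreal" where
  "diam_wrt d E = (SUP x\<in>E. SUP y\<in>E. ennreal (d x y))"

text \<open>
  \<open>diam(E)\<^sup>m\<close> for sets of finite diameter, with \<open>0\<^sup>0 = 1\<close> (whereas \<open>0 powr 0 = 0\<close>) and value \<open>0\<close>
  on the empty set, so that the 0-dimensional Hausdorff measure is counting measure.
\<close>
definition diam_power :: "('a \<Rightarrow> 'a \<Rightarrow> real) \<Rightarrow> real \<Rightarrow> 'a set \<Rightarrow> ennreal" where
  "diam_power d m E =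
    (if E = {} then 0 else if m = 0 then 1 else ennreal (enn2real (diam_wrt d E) powr m))"

definition hausdorff_content ::
    "('a \<Rightarrow> 'a \<Rightarrow> real) \<Rightarrow> real \<Rightarrow> real \<Rightarrow> 'a set \<Rightarrow> ennreal" where
  "hausdorff_content d m \<delta> A =
    (INF E\<in>{E :: nat \<Rightarrow> 'a set. A \<subseteq> (\<Union>i. E i) \<and> (\<forall>i. diam_wrt d (E i) \<le> ennreal \<delta>)}.
       \<Sum>i. diam_power d m (E i))"

text \<open>The supremum is the limit for \<open>\<delta> \<rightarrow> 0\<close>, as the contents increase when \<open>\<delta>\<close> decreases.\<close>
definition hausdorff_measure :: "('a \<Rightarrow> 'a \<Rightarrow> real) \<Rightarrow> real \<Rightarrow> 'a set \<Rightarrow> ennreal" where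
  "hausdorff_measure d m A = (SUP \<delta>\<in>{0<..}. hausdorff_content d m \<delta> A)"

definition hausdorff_dim :: "('a \<Rightarrow> 'a \<Rightarrow> real) \<Rightarrow> 'a set \<Rightarrow> ennreal" where
  "hausdorff_dim d A = Inf (ennreal ` {t. 0 < t \<and> hausdorff_measure d t A = 0})"

text \<open>
  \<open>c \<H>\<^sup>m\<lfloor>V\<close> is specified by its values on Borel sets, so that the definition does not
  presuppose countable additivity of \<open>\<H>\<^sup>m\<close> (as \<open>measure_of\<close> would).
\<close>
definition haar_measures :: "nat \<Rightarrow> ('n::finite) heis measure set" where
  "haar_measures m =
    {\<nu>. sets \<nu> = sets borel \<and>
      (\<exists>c>0. \<exists>V. homogeneous_subgroup V \<and> hausdorff_dim hdist V = of_nat m \<and>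
        (\<forall>A\<in>sets borel. emeasure \<nu> A = ennreal c * hausdorff_measure hdist (real m) (A \<inter> V)))}"

definition radon_measure :: "'a::topological_space measure \<Rightarrow> bool" where
  "radon_measure \<mu> \<longleftrightarrow>
    sets \<mu> = sets borel \<and>
    (\<forall>K. compact K \<longrightarrow> emeasure \<mu> K < \<infinity>) \<and>
    (\<forall>U. open U \<longrightarrow> emeasure \<mu> U = (SUP K\<in>{K. compact K \<and> K \<subseteq> U}. emeasure \<mu> K)) \<and>
    (\<forall>A\<in>sets borel. emeasure \<mu> A = (INF U\<in>{U. open U \<and> A \<subseteq> U}. emeasure \<mu> U))"

text \<open>
  Weak convergence of Radon measures: the test functions are the continuous functions of compact
  support, in contrast to the weak convergence of probability measures.
\<close>
definition weakly_converges ::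
    "(nat \<Rightarrow> 'a::topological_space measure) \<Rightarrow> 'a measure \<Rightarrow> bool" where
  "weakly_converges \<mu> \<nu> \<longleftrightarrow>
    (\<forall>\<phi> :: 'a \<Rightarrow> real. continuous_on UNIV \<phi> \<longrightarrow> compact (closure {x. \<phi> x \<noteq> 0}) \<longrightarrow>
      (\<lambda>i. LINT x|\<mu> i. \<phi> x) \<longlonglongrightarrow> (LINT x|\<nu>. \<phi> x))"

definition blowup :: "('n::finite) heis \<Rightarrow> real \<Rightarrow> 'n heis \<Rightarrow> 'n heis" where
  "blowup a r p = hdilation (1 / r) (inv\<^bsub>heisenberg\<^esub> a \<otimes>\<^bsub>heisenberg\<^esub> p)"

definition Tan :: "('n::finite) heis measure \<Rightarrow> 'n heis \<Rightarrow> 'n heis measure set" where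
  "Tan \<mu> a =
    {\<nu>. radon_measure \<nu> \<and> emeasure \<nu> UNIV > 0 \<and>
      (\<exists>c r :: nat \<Rightarrow> real. (\<forall>i. 0 < c i) \<and> (\<forall>i. 0 < r i) \<and> r \<longlonglongrightarrow> 0 \<and>
        weakly_converges
          (\<lambda>i. scale_measure (ennreal (c i)) (distr \<mu> borel (blowup a (r i)))) \<nu>)}"

end

theory Submission
  imports Defs "HOL-Library.Diagonal_Subsequence"
begin

text \<open>
  Blow-ups of \<open>\<mu>\<close> are studied as positive linear functionals on \<open>C\<^sub>c\<close>, so that limits need no
  representing measures. At almost every \<open>a\<close> the limits of the functionals
  \<open>f \<mapsto> r\<^sup>-\<^sup>s \<integral> f \<circ> blowup a r d\<mu>\<close> form a compact class which is closed under dilations and, by an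
  argument of Preiss based on the almost everywhere absence of holes, under left translations by
  points of the support; on this class the truncated Riesz integrals are uniformly bounded.

  Among the homogeneous subgroups that contain the support of some member of the class take a minimal
  one, \<open>V\<close>. If the support missed a point of \<open>V\<close>, a Koranyi ball in the complement would touch the
  support; blowing up there confines the support to a half space, on which a component of the kernel
  has a sign. Boundedness of its integrals makes it vanish on the support after one more blow-up, so
  a smaller subgroup would do. Hence every member of the class living on \<open>V\<close> has support \<open>V\<close>, and
  so do its translates by points of \<open>V\<close>; averaging it against the Haar measure \<open>L\<close> of \<open>V\<close> compares the
  growth exponents and gives \<open>s = dim V\<close>. A member of
  maximal mass on the unit bump is then dominated by a multiple of \<open>L\<close> and agrees with it near the
  origin, so its own blow-up is that multiple. By uniqueness of Haar measure, \<open>L\<close> is a multiple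
  of the Hausdorff measure on \<open>V\<close>.
\<close>

section \<open>The Heisenberg group\<close>

text \<open>The reduction to smaller subgroups is shaped by the poles of the gauge ball, the points
  with \<open>fst b = 0\<close>, where its boundary is tangent to the horizontal directions. Away
  from the poles the gauge has a nonzero horizontal derivative, so a touching ball yields a half
  space with vertical boundary, and the first 2n kernels collapse the support to that boundary. At a
  pole the derivative vanishes and the next order sees only the vertical coordinate; the last kernel
  then collapses the support to \<open>snd q = 0\<close>, which is in general no subgroup.
  Translating by a support point \<open>p\<close> and blowing up once more tilts this plane to the
  hyperplane orthogonal to \<open>rot (fst p)\<close>. Either some such hyperplane cuts
  \<open>W\<close> down, or the support already lies in an isotropic horizontal subgroup. Averages
  over small translated bumps link the two exponents: they grow like \<open>r powr s\<close> because
  all translates stay in the class, and like \<open>r ^ m\<close> because Haar measure is invariant.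
  For a maximiser the same averages give domination by Haar measure, and equality on the unit bump
  leaves no room for strict inequality below it.\<close>

definition hmul :: "('n::finite) heis \<Rightarrow> 'n heis \<Rightarrow> 'n heis" (infixl "\<odot>" 70) where
  "p \<odot> q = (fst p + fst q, snd p + snd q + hform p q)"

lemma heisenberg_mult: "p \<otimes>\<^bsub>heisenberg\<^esub> q = p \<odot> q"
  by (simp add: heisenberg_def hmul_def)

lemma heisenberg_carrier [simp]: "carrier heisenberg = UNIV"
  and heisenberg_one: "\<one>\<^bsub>heisenberg\<^esub> = 0"
  by (simp_all add: heisenberg_def)

text \<open>Multiplication by -i when \<open>(x, y)\<close> is read as x + iy. The group form is
  twice the symplectic form \<open>rot z \<bullet> w\<close>, and a subspace is isotropic when this
  form vanishes on it.\<close>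

definition rot :: "(real ^ 'n) \<times> (real ^ 'n) \<Rightarrow> (real ^ 'n) \<times> (real ^ 'n)" where
  "rot z = (snd z, - fst z)"

lemma hform_rot: "hform p q = 2 * (rot (fst p) \<bullet> fst q)"
  by (simp add: hform_def rot_def inner_prod_def inner_vec_def sum_subtractf sum_negf)

lemma rot_simps: "rot (z + w) = rot z + rot w" "rot (- z) = - rot z" "rot (c *\<^sub>R z) = c *\<^sub>R rot z"
    "rot 0 = 0"
  by (simp_all add: rot_def prod_eq_iff)

lemma rot_inner_swap: "rot z \<bullet> w = - (rot w \<bullet> z)"
  by (simp add: rot_def inner_prod_def inner_commute)

lemma rot_self [simp]: "rot z \<bullet> z = 0"
  using rot_inner_swap[of z z] by simp

lemma rot_inner_rot [simp]: "rot z \<bullet> rot w = z \<bullet> w"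
  by (simp add: rot_def inner_prod_def)

lemma hmul_assoc: "p \<odot> q \<odot> r = p \<odot> (q \<odot> r)"
  using monoid.m_assoc[OF group.is_monoid[OF group_heisenberg], of p q r] by (simp add: heisenberg_mult)

lemma hmul_0 [simp]: "p \<odot> 0 = p" "0 \<odot> p = p"
  by (simp_all add: hmul_def hform_rot rot_simps)

lemma hmul_uminus [simp]: "p \<odot> (- p) = 0" "(- p) \<odot> p = 0"
  by (simp_all add: hmul_def hform_rot rot_simps prod_eq_iff)

lemma hmul_cancel [simp]: "- p \<odot> (p \<odot> q) = q" "p \<odot> (- p \<odot> q) = q"
  by (simp_all flip: hmul_assoc)

lemma uminus_hmul: "- (p \<odot> q) = - q \<odot> - p"
  by (simp add: hmul_def hform_rot rot_simps prod_eq_iff) (metis rot_inner_swap)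

lemma hdist_eq: "hdist p q = hnorm (- p \<odot> q)"
  by (simp add: hdist_def inv_heisenberg heisenberg_mult)

lemma hnorm_nonneg [simp]: "0 \<le> hnorm p"
  by (simp add: hnorm_def)

lemma hnorm_pow4: "hnorm p ^ 4 = norm (fst p) ^ 4 + (snd p)\<^sup>2"
  by (simp add: hnorm_def)

lemma hnorm_eq_0_iff [simp]: "hnorm p = 0 \<longleftrightarrow> p = 0"
proof -
  have "hnorm p = 0 \<longleftrightarrow> hnorm p ^ 4 = 0" by simp
  also have "\<dots> \<longleftrightarrow> p = 0"
    unfolding hnorm_pow4 by (auto simp: prod_eq_iff add_nonneg_eq_0_iff)
  finally show ?thesis .
qed

lemma hnorm_0 [simp]: "hnorm 0 = 0" by simp

lemma hnorm_pos_iff [simp]: "0 < hnorm p \<longleftrightarrow> p \<noteq> 0"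
  using hnorm_nonneg[of p] hnorm_eq_0_iff[of p] by linarith

lemma hnorm_uminus [simp]: "hnorm (- p) = hnorm p"
  by (simp add: hnorm_def)

lemma hnorm_hdilation: "0 \<le> r \<Longrightarrow> hnorm (hdilation r p) = r * hnorm p"
proof -
  assume r: "0 \<le> r"
  have "hnorm (hdilation r p) ^ 4 = (r * hnorm p) ^ 4"
    unfolding power_mult_distrib hnorm_pow4 using r by (simp add: hdilation_def power_mult_distrib algebra_simps)
  then show ?thesis using r by (simp add: power_eq_iff_eq_base)
qed

lemma norm_fst_le_hnorm: "norm (fst p) \<le> hnorm p"
proof (rule power_le_imp_le_base)
  have "norm (fst p) ^ 4 \<le> hnorm p ^ 4" by (simp add: hnorm_pow4)
  then show "norm (fst p) ^ Suc 3 \<le> hnorm p ^ Suc 3" by simp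
qed simp

lemma abs_snd_le_hnorm: "\<bar>snd p\<bar> \<le> (hnorm p)\<^sup>2"
proof -
  have "\<bar>snd p\<bar>\<^sup>2 \<le> ((hnorm p)\<^sup>2)\<^sup>2"
    by (simp add: hnorm_pow4 flip: power_mult)
  then show ?thesis by (rule power2_le_imp_le) simp
qed

text \<open>Cauchy-Schwarz for the hermitian product, whose real and imaginary parts are, up to
  sign, the two inner products. The vector \<open>v\<close> in the proof is
  \<open>(norm z)\<^sup>2\<close> times the projection of \<open>w\<close> to the complex line
  through \<open>z\<close>.\<close>

lemma hermitian_cauchy_schwarz: "(z \<bullet> w)\<^sup>2 + (rot z \<bullet> w)\<^sup>2 \<le> (norm z)\<^sup>2 * (norm w)\<^sup>2"
proof -
  define D where "D = (z \<bullet> w)\<^sup>2 + (rot z \<bullet> w)\<^sup>2"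
  define v where "v = (z \<bullet> w) *\<^sub>R z + (rot z \<bullet> w) *\<^sub>R rot z"
  have "v \<bullet> w = D" by (simp add: v_def D_def inner_left_distrib power2_eq_square)
  moreover have "v \<bullet> v = D * (norm z)\<^sup>2"
    unfolding power2_norm_eq_inner
    by (simp add: v_def D_def inner_left_distrib inner_right_distrib power2_eq_square
        inner_commute[of z "rot z"] algebra_simps)
  ultimately have "D\<^sup>2 \<le> D * (norm z)\<^sup>2 * (norm w)\<^sup>2"
    using Cauchy_Schwarz_ineq[of v w] by (simp add: power2_norm_eq_inner)
  moreover have "D \<ge> 0" by (simp add: D_def)
  ultimately have "D \<le> (norm z)\<^sup>2 * (norm w)\<^sup>2"
    by (cases "D = 0") (auto simp: power2_eq_square mult.assoc)
  then show ?thesis by (simp add: D_def)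
qed

(* With |.| the modulus of a complex number, hnorm p squared is | |p'|^2 + i p_t |. *)
lemma hnorm_power2: "(hnorm p)\<^sup>2 = cmod (Complex ((norm (fst p))\<^sup>2) (snd p))"
proof -
  have "((hnorm p)\<^sup>2)\<^sup>2 = (cmod (Complex ((norm (fst p))\<^sup>2) (snd p)))\<^sup>2"
    by (simp add: cmod_def hnorm_pow4 flip: power_mult)
  then show ?thesis by (rule power2_eq_imp_eq) auto
qed

text \<open>The complex number that represents a product is \<open>P + Q + I\<close>, where the
  cross term \<open>I\<close> is twice a hermitian product of the horizontal parts. Hence
  \<open>cmod I\<close> is at most the mixed term of the square of
  \<open>hnorm p + hnorm q\<close>.\<close>

lemma hnorm_triangle: "hnorm (p \<odot> q) \<le> hnorm p + hnorm q"
proof -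
  define P where "P = Complex ((norm (fst p))\<^sup>2) (snd p)"
  define Q where "Q = Complex ((norm (fst q))\<^sup>2) (snd q)"
  define I where "I = Complex (2 * (fst p \<bullet> fst q)) (2 * (rot (fst p) \<bullet> fst q))"
  have "(hnorm (p \<odot> q))\<^sup>2 = cmod (P + Q + I)"
    unfolding hnorm_power2 P_def Q_def I_def complex_add
    by (simp add: hmul_def hform_rot power2_norm_eq_inner inner_left_distrib inner_right_distrib
        inner_commute[of "fst q" "fst p"] algebra_simps)
  also have "\<dots> \<le> cmod P + cmod Q + cmod I"
    by (meson add_mono norm_triangle_ineq order_refl order_trans)
  also have "cmod I \<le> 2 * (norm (fst p) * norm (fst q))"
    unfolding I_def cmod_def using hermitian_cauchy_schwarz[of "fst p" "fst q"]
    by (intro real_le_lsqrt) (auto simp: power_mult_distrib)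
  also have "\<dots> \<le> 2 * (hnorm p * hnorm q)"
    by (intro mult_left_mono mult_mono norm_fst_le_hnorm) auto
  also have "cmod P + cmod Q + 2 * (hnorm p * hnorm q) = (hnorm p + hnorm q)\<^sup>2"
    by (simp add: P_def Q_def power2_sum flip: hnorm_power2)
  finally have "(hnorm (p \<odot> q))\<^sup>2 \<le> (hnorm p + hnorm q)\<^sup>2" by simp
  then show ?thesis by (rule power2_le_imp_le) simp
qed

lemma hdist_nonneg [simp]: "0 \<le> hdist p q"
  and hdist_self [simp]: "hdist p p = 0"
  and hdist_0 [simp]: "hdist 0 p = hnorm p"
  by (simp_all add: hdist_eq)

lemma hdist_commute: "hdist p q = hdist q p"
proof -
  have "- p \<odot> q = - (- q \<odot> p)" by (simp add: uminus_hmul)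
  then show ?thesis unfolding hdist_eq by (metis hnorm_uminus)
qed

lemma hdist_triangle: "hdist p r \<le> hdist p q + hdist q r"
proof -
  have "- p \<odot> r = (- p \<odot> q) \<odot> (- q \<odot> r)" by (simp add: hmul_assoc)
  then show ?thesis unfolding hdist_eq by (metis hnorm_triangle)
qed

lemma hdist_left [simp]: "hdist (a \<odot> p) (a \<odot> q) = hdist p q"
  by (simp add: hdist_eq uminus_hmul hmul_assoc)

lemma hdilation_hmul: "hdilation r (p \<odot> q) = hdilation r p \<odot> hdilation r q"
  by (simp add: hdilation_def hmul_def hform_rot rot_simps power2_eq_square algebra_simps)

lemma hdilation_uminus: "hdilation r (- p) = - hdilation r p"
  by (simp add: hdilation_def)

lemma hdilation_hdilation [simp]: "hdilation r (hdilation t p) = hdilation (r * t) p"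
  by (simp add: hdilation_def power_mult_distrib mult.assoc)

lemma hdilation_1 [simp]: "hdilation 1 p = p"
  and hdilation_0 [simp]: "hdilation r 0 = 0"
  by (simp_all add: hdilation_def prod_eq_iff)

lemma blowup_eq: "blowup a r p = hdilation (1 / r) (- a \<odot> p)"
  by (simp add: blowup_def inv_heisenberg heisenberg_mult)

section \<open>Continuity, compactness of gauge balls and comparison of the two topologies\<close>

lemma continuous_on_hform [continuous_intros]:
  "continuous_on S f \<Longrightarrow> continuous_on S g \<Longrightarrow> continuous_on S (\<lambda>x. hform (f x) (g x))"
  unfolding hform_def by (intro continuous_intros)

lemma continuous_on_hmul [continuous_intros]:
  "continuous_on S f \<Longrightarrow> continuous_on S g \<Longrightarrow> continuous_on S (\<lambda>x. f x \<odot> g x)"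
  unfolding hmul_def by (intro continuous_intros)

lemma continuous_on_hnorm [continuous_intros]:
  "continuous_on S f \<Longrightarrow> continuous_on S (\<lambda>x. hnorm (f x))"
  unfolding hnorm_def by (intro continuous_intros)

lemma continuous_on_hdilation [continuous_intros]:
  "continuous_on S r \<Longrightarrow> continuous_on S f \<Longrightarrow> continuous_on S (\<lambda>x. hdilation (r x) (f x))"
  unfolding hdilation_def by (intro continuous_intros)

lemma continuous_on_hdist [continuous_intros]:
  "continuous_on S f \<Longrightarrow> continuous_on S g \<Longrightarrow> continuous_on S (\<lambda>x. hdist (f x) (g x))"
  unfolding hdist_eq by (intro continuous_intros)

lemma closed_hball: "closed (hball p r)"
  unfolding hball_def by (intro closed_Collect_le continuous_intros)

lemma norm_le_of_hnorm: "hnorm p \<le> R \<Longrightarrow> norm p \<le> R + R\<^sup>2"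
proof -
  assume R: "hnorm p \<le> R"
  have "norm p \<le> norm (fst p) + \<bar>snd p\<bar>" by (metis norm_Pair_le prod.collapse real_norm_def)
  also have "\<dots> \<le> hnorm p + (hnorm p)\<^sup>2" by (intro add_mono norm_fst_le_hnorm abs_snd_le_hnorm)
  also have "\<dots> \<le> R + R\<^sup>2" using R by (intro add_mono power_mono) auto
  finally show ?thesis .
qed

lemma hnorm_le_of_norm:
  obtains R' where "R' > 0" "\<And>p :: ('n::finite) heis. norm p \<le> R \<Longrightarrow> hnorm p \<le> R'"
proof -
  have "compact ((hnorm :: 'n heis \<Rightarrow> real) ` cball 0 R)"
    by (intro compact_continuous_image continuous_intros) auto
  then have "bounded ((hnorm :: 'n heis \<Rightarrow> real) ` cball 0 R)" by (rule compact_imp_bounded)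
  then obtain B where "B > 0" "\<And>p :: 'n heis. p \<in> cball 0 R \<Longrightarrow> norm (hnorm p) \<le> B"
    unfolding bounded_pos by blast
  then show thesis by (intro that[of B]) auto
qed

lemma bounded_hball: "bounded (hball p r)"
proof -
  have "norm q \<le> (hnorm p + r) + (hnorm p + r)\<^sup>2" if "q \<in> hball p r" for q
  proof (rule norm_le_of_hnorm)
    have "hdist 0 q \<le> hdist 0 p + hdist p q" by (rule hdist_triangle)
    then show "hnorm q \<le> hnorm p + r" using that by (simp add: hball_def)
  qed
  then show ?thesis unfolding bounded_iff by blast
qed

lemma compact_hball: "compact (hball p r)"
  by (simp add: compact_eq_bounded_closed closed_hball bounded_hball)

lemma hball_borel [measurable]: "hball p r \<in> sets borel"
  by (simp add: borel_closed closed_hball)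

lemma hdist_eq_0_iff: "hdist p q = 0 \<longleftrightarrow> p = q"
  unfolding hdist_eq by (metis hmul_cancel(2) hmul_0(1) hnorm_eq_0_iff hmul_uminus(2))

lemma open_hdist_ball: "open {q. hdist p q < r}"
  by (intro open_Collect_less continuous_intros)

text \<open>The compact set \<open>hball p 1 - U\<close> does not contain \<open>p\<close>, so
  \<open>hdist p\<close> has a positive minimum on it; half of this minimum is a safe radius.
  Together with \<open>open_hdist_ball\<close> this identifies the two topologies.\<close>

lemma hdist_ball_subset:
  fixes p :: "('n::finite) heis"
  assumes "open U" "p \<in> U"
  obtains \<epsilon> where "\<epsilon> > 0" "hball p \<epsilon> \<subseteq> U"
proof (cases "hball p 1 - U = {}")
  case True
  then show ?thesis by (intro that[of 1]) auto
next
  case False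
  have "compact (hball p 1 - U)" by (intro compact_diff compact_hball assms)
  then obtain q where q: "q \<in> hball p 1 - U" "\<And>x. x \<in> hball p 1 - U \<Longrightarrow> hdist p q \<le> hdist p x"
    using continuous_attains_inf[OF \<open>compact (hball p 1 - U)\<close> False, of "hdist p"]
      continuous_on_hdist[OF continuous_on_const continuous_on_id, of "hball p 1 - U" p] by auto
  have "hdist p q > 0" using q(1) assms hdist_eq_0_iff[of p q] hdist_nonneg[of p q]
    by (metis DiffD2 less_eq_real_def)
  moreover have "hball p (min 1 (hdist p q) / 2) \<subseteq> U"
  proof
    fix x assume x: "x \<in> hball p (min 1 (hdist p q) / 2)"
    show "x \<in> U"
    proof (rule ccontr)
      assume "x \<notin> U"
      moreover have "hdist p x \<le> min 1 (hdist p q) / 2" using x by (simp add: hball_def)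
      moreover then have "hdist p x \<le> 1" "hdist p x < hdist p q" using \<open>hdist p q > 0\<close> by (auto simp: min_def split: if_splits)
      ultimately show False using q(2)[of x] by (auto simp: hball_def)
    qed
  qed
  ultimately show ?thesis by (intro that[of "min 1 (hdist p q) / 2"]) auto
qed

section \<open>Positive functionals on compactly supported functions\<close>

text \<open>Vanishing outside a ball replaces compactness of the closed support: it passes to sums,
  products and compositions by taking the larger radius.\<close>

definition Cc :: "('a::euclidean_space \<Rightarrow> real) set" where
  "Cc = {f. continuous_on UNIV f \<and> (\<exists>R. \<forall>x. R < norm x \<longrightarrow> f x = 0)}"

lemma CcI: "continuous_on UNIV f \<Longrightarrow> (\<And>x. R < norm x \<Longrightarrow> f x = 0) \<Longrightarrow> f \<in> Cc"
  by (auto simp: Cc_def)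

lemma Cc_cont: "f \<in> Cc \<Longrightarrow> continuous_on UNIV f"
  by (simp add: Cc_def)

lemma Cc_supp:
  assumes "f \<in> Cc" obtains R where "R > 0" "\<And>x. R < norm x \<Longrightarrow> f x = 0"
proof -
  obtain R where "\<And>x. R < norm x \<Longrightarrow> f x = 0" using assms by (auto simp: Cc_def)
  then show thesis by (intro that[of "max R 1"]) auto
qed

lemma Cc_mult_cont:
  assumes "f \<in> Cc" "continuous_on UNIV g" shows "(\<lambda>x. g x * f x) \<in> Cc"
proof -
  obtain R where "\<And>x. R < norm x \<Longrightarrow> f x = 0" by (metis Cc_supp assms(1))
  then show ?thesis using assms Cc_cont by (intro CcI[of _ R] continuous_intros) auto
qed

lemma Cc_cmult [simp]: "f \<in> Cc \<Longrightarrow> (\<lambda>x. c * f x) \<in> Cc"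
  by (intro Cc_mult_cont) auto

lemma Cc_add [simp]:
  assumes "f \<in> Cc" "g \<in> Cc" shows "(\<lambda>x. f x + g x) \<in> Cc"
proof -
  obtain R where R: "\<And>x. R < norm x \<Longrightarrow> f x = 0" by (metis Cc_supp assms(1))
  obtain R' where "\<And>x. R' < norm x \<Longrightarrow> g x = 0" by (metis Cc_supp assms(2))
  with R show ?thesis using assms Cc_cont by (intro CcI[of _ "max R R'"] continuous_intros) auto
qed

lemma Cc_0 [simp]: "(\<lambda>x. 0) \<in> Cc" by (intro CcI) auto

lemma Cc_diff [simp]: "f \<in> Cc \<Longrightarrow> g \<in> Cc \<Longrightarrow> (\<lambda>x. f x - g x) \<in> Cc"
  using Cc_add[of f "\<lambda>x. - 1 * g x"] Cc_cmult[of g "-1"] by simp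

lemma Cc_sum: "(\<And>i. i \<in> I \<Longrightarrow> f i \<in> Cc) \<Longrightarrow> (\<lambda>x. \<Sum>i\<in>I. f i x) \<in> Cc"
  by (induction I rule: infinite_finite_induct) auto

lemma Cc_compose_0:
  assumes "f \<in> Cc" "continuous_on UNIV h" "h 0 = 0" shows "(\<lambda>x. h (f x)) \<in> Cc"
proof -
  obtain R where "\<And>x. R < norm x \<Longrightarrow> f x = 0" by (metis Cc_supp assms(1))
  moreover have "continuous_on UNIV (\<lambda>x. h (f x))"
    by (rule continuous_on_compose2[OF assms(2) Cc_cont[OF assms(1)]]) auto
  ultimately show ?thesis using assms by (intro CcI[of _ R]) auto
qed

lemma Cc_pos [simp]: "f \<in> Cc \<Longrightarrow> (\<lambda>x. max 0 (f x)) \<in> Cc"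
  by (rule Cc_compose_0) (auto intro: continuous_intros)

lemma Cc_uniform:
  assumes "f \<in> Cc" "\<epsilon> > 0"
  obtains \<delta> where "\<delta> > 0" "\<And>x y. dist x y < \<delta> \<Longrightarrow> \<bar>f x - f y\<bar> < \<epsilon>"
proof -
  obtain R where R: "R > 0" "\<And>x. R < norm x \<Longrightarrow> f x = 0" by (metis Cc_supp assms(1))
  have "uniformly_continuous_on (cball 0 (R + 1)) f"
    using Cc_cont[OF assms(1)] by (intro compact_uniformly_continuous) (auto intro: continuous_on_subset)
  then obtain d where d: "d > 0" "\<And>x y. x \<in> cball 0 (R + 1) \<Longrightarrow> y \<in> cball 0 (R + 1) \<Longrightarrow> dist y x < d \<Longrightarrow> dist (f y) (f x) < \<epsilon>"
    using assms(2) unfolding uniformly_continuous_on_def by metis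
  have "\<bar>f x - f y\<bar> < \<epsilon>" if "dist x y < min d 1" for x y
  proof (cases "norm x \<le> R + 1 \<and> norm y \<le> R + 1")
    case True
    then show ?thesis using d(2)[of y x] that by (simp add: dist_real_def dist_commute)
  next
    case False
    moreover have "\<bar>norm x - norm y\<bar> < 1" using that norm_triangle_ineq3[of x y] by (simp add: dist_norm)
    ultimately have "norm x > R" "norm y > R" by linarith+
    then show ?thesis using R assms by simp
  qed
  then show thesis using d by (intro that[of "min d 1"]) auto
qed

section \<open>Cut-offs, finite partitions of unity and a countable dense family\<close>

definition cutoff :: "real \<Rightarrow> 'a::euclidean_space \<Rightarrow> real" where
  "cutoff R x = max 0 (min 1 (R + 1 - norm x))"

lemma cutoff_Cc [simp]: "cutoff R \<in> Cc"
  unfolding cutoff_def[abs_def] by (intro CcI[of _ "R + 1"] continuous_intros) auto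

lemma cutoff_props: "0 \<le> cutoff R x" "cutoff R x \<le> 1" "norm x \<le> R \<Longrightarrow> cutoff R x = 1"
    "norm x \<ge> R + 1 \<Longrightarrow> cutoff R x = 0"
  by (auto simp: cutoff_def)

lemma Cc_le_cutoff:
  assumes "f \<in> Cc"
  obtains B R where "B > 0" "R > 0" "\<And>x. \<bar>f x\<bar> \<le> B * cutoff R x"
proof -
  obtain R where R: "R > 0" "\<And>x. R < norm x \<Longrightarrow> f x = 0" by (metis Cc_supp assms(1))
  have "compact (f ` cball 0 R)"
    by (intro compact_continuous_image continuous_on_subset[OF Cc_cont[OF assms]]) auto
  then have "bounded (f ` cball 0 R)" by (rule compact_imp_bounded)
  then obtain B where "B > 0" "\<And>x. x \<in> cball 0 R \<Longrightarrow> norm (f x) \<le> B"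
    unfolding bounded_pos by blast
  then have "\<bar>f x\<bar> \<le> B * cutoff R x" for x
    using R cutoff_props[where R=R and x=x] by (cases "norm x \<le> R") auto
  then show thesis using \<open>B > 0\<close> R by (intro that[of B R]) auto
qed

text \<open>Summing to 1 is required only on the ball of radius \<open>R\<close>, so that finitely
  many parts suffice; outside, the sum may be anything up to 1.\<close>

definition unity_part :: "real \<Rightarrow> real \<Rightarrow> 'a::euclidean_space set \<Rightarrow> ('a \<Rightarrow> 'a \<Rightarrow> real) \<Rightarrow> bool" where
  "unity_part R \<delta> Z u \<longleftrightarrow> finite Z \<and> (\<forall>z\<in>Z. u z \<in> Cc) \<and> (\<forall>z x. 0 \<le> u z x) \<and>
     (\<forall>x. (\<Sum>z\<in>Z. u z x) \<le> 1) \<and> (\<forall>x. norm x \<le> R \<longrightarrow> (\<Sum>z\<in>Z. u z x) = 1) \<and>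
     (\<forall>z x. u z x \<noteq> 0 \<longrightarrow> dist z x < \<delta>)"

lemma unity_part_exists:
  assumes "\<delta> > 0" shows "\<exists>(Z :: 'a::euclidean_space set) u. unity_part R \<delta> Z u"
proof -
  have "\<exists>Z\<subseteq>cball (0::'a) R. finite Z \<and> cball 0 R \<subseteq> (\<Union>z\<in>Z. ball z (\<delta> / 2))"
  proof -
    have "cball (0::'a) R \<subseteq> (\<Union>z\<in>cball 0 R. ball z (\<delta> / 2))" using assms by force
    then obtain Z where "Z \<subseteq> cball (0::'a) R" "finite Z" "cball 0 R \<subseteq> (\<Union>z\<in>Z. ball z (\<delta> / 2))"
      using compactE_image[OF compact_cball, of "cball 0 R" "\<lambda>z. ball z (\<delta> / 2)" 0 R] by auto
    then show ?thesis by blast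
  qed
  then obtain Z :: "'a set" where Z: "finite Z" "cball 0 R \<subseteq> (\<Union>z\<in>Z. ball z (\<delta> / 2))" by blast
  define b where "b z x = max 0 (\<delta> - dist z x)" for z x :: 'a
  define S where "S x = (\<Sum>z\<in>Z. b z x)" for x
  \<comment> \<open>On the ball of radius \<open>R\<close> some centre is closer than
    \<open>\<delta> / 2\<close>, so \<open>S x\<close> is at least \<open>\<delta> / 2\<close> and
    the quotient normalises exactly. Elsewhere the maximum keeps the denominator away from 0 and the
    quotients continuous.\<close>
  define u where "u z x = b z x / max (S x) (\<delta> / 2)" for z x
  have b0: "0 \<le> b z x" for z x by (simp add: b_def)
  have S0: "0 \<le> S x" for x by (simp add: S_def sum_nonneg b0)
  have sum: "(\<Sum>z\<in>Z. u z x) = S x / max (S x) (\<delta> / 2)" for x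
    by (simp add: u_def S_def sum_divide_distrib)
  have "u z \<in> Cc" for z
  proof (rule CcI)
    have "max (S x) (\<delta> / 2) \<noteq> 0" for x using assms by (simp add: max_def)
    then show "continuous_on UNIV (u z)"
      unfolding u_def[abs_def] b_def S_def by (intro continuous_intros) auto
    show "u z x = 0" if "norm z + \<delta> < norm x" for x
      using that norm_triangle_ineq2[of x z] by (simp add: u_def b_def dist_norm norm_minus_commute)
  qed
  moreover have "0 \<le> u z x" for z x using S0[of x] assms b0[of z x] by (simp add: u_def le_max_iff_disj)
  moreover have "(\<Sum>z\<in>Z. u z x) \<le> 1" for x
    unfolding sum using S0[of x] assms by (simp add: divide_le_eq less_max_iff_disj)
  moreover have "(\<Sum>z\<in>Z. u z x) = 1" if "norm x \<le> R" for x
  proof -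
    have "x \<in> cball 0 R" using that by simp
    then have "x \<in> (\<Union>z\<in>Z. ball z (\<delta> / 2))" using Z(2) by blast
    then obtain z where z: "z \<in> Z" "dist z x < \<delta> / 2" by (auto simp del: ball_subset_cball)
    then have "\<delta> / 2 \<le> b z x" unfolding b_def by linarith
    also have "\<dots> \<le> S x" unfolding S_def using z Z b0 by (intro member_le_sum) auto
    finally show ?thesis unfolding sum using assms by simp
  qed
  moreover have "dist z x < \<delta>" if "u z x \<noteq> 0" for z x
    using that by (auto simp: u_def b_def max_def split: if_splits)
  ultimately show ?thesis using Z(1) unfolding unity_part_def by blast
qed

lemma unity_part_approx:
  assumes U: "unity_part R \<delta> Z u" and "\<delta> \<le> 1"
    and g0: "\<And>x. R < norm x \<Longrightarrow> g x = 0"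
    and osc: "\<And>x y. dist x y < \<delta> \<Longrightarrow> \<bar>g x - g y\<bar> \<le> \<epsilon>" and "\<delta> > 0"
  shows "\<bar>g x - (\<Sum>z\<in>Z. g z * u z x)\<bar> \<le> \<epsilon> * cutoff (R + 1) x"
proof -
  have u: "0 \<le> u z x" "u z x \<noteq> 0 \<Longrightarrow> dist z x < \<delta>" "(\<Sum>z\<in>Z. u z x) \<le> 1" for z
    using U by (auto simp: unity_part_def)
  have "\<epsilon> \<ge> 0" using osc[of 0 0] \<open>\<delta> > 0\<close> by simp
  have *: "(\<Sum>z\<in>Z. \<epsilon> * u z x) \<le> \<epsilon>"
    using mult_left_mono[OF u(3) \<open>\<epsilon> \<ge> 0\<close>] by (simp add: sum_distrib_left)
  have **: "\<bar>\<Sum>z\<in>Z. (g x - g z) * u z x\<bar> \<le> \<epsilon>"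
  proof -
    have "\<bar>\<Sum>z\<in>Z. (g x - g z) * u z x\<bar> \<le> (\<Sum>z\<in>Z. \<bar>(g x - g z) * u z x\<bar>)" by (rule sum_abs)
    also have "\<dots> \<le> (\<Sum>z\<in>Z. \<epsilon> * u z x)"
    proof (rule sum_mono)
      fix z
      show "\<bar>(g x - g z) * u z x\<bar> \<le> \<epsilon> * u z x"
        using u(1,2)[of z] osc[of z x] by (cases "u z x = 0") (auto simp: abs_mult abs_minus_commute intro!: mult_right_mono)
    qed
    finally show ?thesis using * by linarith
  qed
  \<comment> \<open>In the shell between \<open>R\<close> and \<open>R + 1\<close> the function
    \<open>g\<close> vanishes but the sum need not: its parts reach up to
    \<open>\<delta> \<le> 1\<close> beyond their centres. This is why the error is bounded by the
    cut-off at \<open>R + 1\<close>.\<close>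
  consider "norm x \<le> R" | "R < norm x" "norm x \<le> R + 1" | "R + 1 < norm x" by linarith
  then show ?thesis
  proof cases
    case 1
    then have "(\<Sum>z\<in>Z. u z x) = 1" using U by (simp add: unity_part_def)
    then have "g x - (\<Sum>z\<in>Z. g z * u z x) = (\<Sum>z\<in>Z. (g x - g z) * u z x)"
      by (simp add: left_diff_distrib sum_subtractf flip: sum_distrib_left)
    then show ?thesis using ** 1 by (simp add: cutoff_props)
  next
    case 2
    then have "g x - (\<Sum>z\<in>Z. g z * u z x) = (\<Sum>z\<in>Z. (g x - g z) * u z x)"
      by (simp add: g0 sum_negf)
    then show ?thesis using ** 2 by (simp add: cutoff_props)
  next
    case 3
    have "g z * u z x = 0" for z
    proof (cases "u z x = 0")
      case False
      then have "dist z x < 1" using u(2) \<open>\<delta> \<le> 1\<close> by force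
      then have "norm z > R" using 3 norm_triangle_ineq2[of x z] by (simp add: dist_norm norm_minus_commute)
      then show ?thesis by (simp add: g0)
    qed simp
    then have "(\<Sum>z\<in>Z. g z * u z x) = 0" by (intro sum.neutral) blast
    then show ?thesis using 3 g0[of x] cutoff_props(1)[of "R+1" x] \<open>\<epsilon> \<ge> 0\<close> by simp
  qed
qed

text \<open>The linear span of the following countable family is dense in \<open>Cc\<close>.\<close>

definition unity_Z :: "nat \<Rightarrow> nat \<Rightarrow> 'a::euclidean_space set" where
  "unity_Z R k = fst (SOME (Z, u). unity_part (real R) (1 / real (Suc k)) Z u)"
definition unity_u :: "nat \<Rightarrow> nat \<Rightarrow> 'a::euclidean_space \<Rightarrow> 'a \<Rightarrow> real" where
  "unity_u R k = snd (SOME (Z, u). unity_part (real R) (1 / real (Suc k)) Z u)"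

lemma unity_Zu: "unity_part (real R) (1 / real (Suc k)) (unity_Z R k :: 'a::euclidean_space set) (unity_u R k)"
proof -
  have "\<exists>Zu. case Zu of (Z :: 'a set, u) \<Rightarrow> unity_part (real R) (1 / real (Suc k)) Z u"
    using unity_part_exists[of "1 / real (Suc k)" "real R"] by auto
  from someI_ex[OF this] show ?thesis by (simp add: unity_Z_def unity_u_def case_prod_beta case_prod_unfold)
qed

text \<open>The zero function guarantees that the set is nonempty, as the enumeration by
  \<open>from_nat_into\<close> demands.\<close>

definition test_set :: "('a::euclidean_space \<Rightarrow> real) set" where
  "test_set = insert (\<lambda>x. 0) (\<Union>R. \<Union>k. unity_u R k ` unity_Z R k)"

definition test_fun :: "nat \<Rightarrow> 'a::euclidean_space \<Rightarrow> real" where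
  "test_fun = from_nat_into test_set"

lemma range_test_fun: "range (test_fun :: nat \<Rightarrow> 'a::euclidean_space \<Rightarrow> real) = test_set"
proof -
  have "finite (unity_Z R k :: 'a set)" for R k using unity_Zu by (auto simp: unity_part_def)
  then have "countable (test_set :: ('a \<Rightarrow> real) set)"
    unfolding test_set_def by (intro countable_insert countable_UN countable_image) (auto intro: countable_finite)
  then show ?thesis unfolding test_fun_def by (intro range_from_nat_into) (auto simp: test_set_def)
qed

lemma test_fun_Cc [simp]: "test_fun j \<in> Cc"
proof -
  have "test_fun j \<in> (test_set :: ('a \<Rightarrow> real) set)" using range_test_fun by blast
  then show ?thesis using unity_Zu[where ?'a='a] unfolding test_set_def unity_part_def by auto
qed

lemma test_fun_dense:
  fixes f :: "'a::euclidean_space \<Rightarrow> real"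
  assumes "f \<in> Cc"
  obtains R where "\<And>\<epsilon>. \<epsilon> > 0 \<Longrightarrow> \<exists>J c. finite J \<and> (\<forall>x. \<bar>f x - (\<Sum>j\<in>J. c j * test_fun j x)\<bar> \<le> \<epsilon> * cutoff R x)"
proof -
  obtain R0 where R0: "R0 > 0" "\<And>x. R0 < norm x \<Longrightarrow> f x = 0" by (metis Cc_supp assms(1))
  define R where "R = nat \<lceil>R0\<rceil>"
  have R: "f x = 0" if "real R < norm x" for x using that R0 unfolding R_def by (intro R0(2)) linarith
  show thesis
  proof (rule that[of "real R + 1"])
    fix \<epsilon> :: real assume "\<epsilon> > 0"
    then obtain \<delta> where \<delta>: "\<delta> > 0" "\<And>x y. dist x y < \<delta> \<Longrightarrow> \<bar>f x - f y\<bar> < \<epsilon>" by (metis Cc_uniform assms)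
    obtain k where k: "1 / real (Suc k) < \<delta>" using \<delta>(1) by (metis nat_approx_posE)
    let ?Z = "unity_Z R k :: 'a set" and ?u = "unity_u R k :: 'a \<Rightarrow> _"
    have appr: "\<bar>f x - (\<Sum>z\<in>?Z. f z * ?u z x)\<bar> \<le> \<epsilon> * cutoff (real R + 1) x" for x
      proof (rule unity_part_approx[OF unity_Zu])
      show "\<bar>f x - f y\<bar> \<le> \<epsilon>" if "dist x y < 1 / real (Suc k)" for x y
        using \<delta>(2)[of x y] that k by simp
    qed (use R in auto)
    have "\<forall>z\<in>?Z. \<exists>j. ?u z = test_fun j"
      using range_test_fun unfolding test_set_def by (metis (no_types, lifting) UN_I UNIV_I imageE imageI insertI2)
    then obtain j where j: "\<And>z. z \<in> ?Z \<Longrightarrow> ?u z = test_fun (j z)" by metis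
    have fin: "finite ?Z" using unity_Zu by (auto simp: unity_part_def)
    \<comment> \<open>Different centres may carry the same test function, so \<open>j\<close> can
      fail to be injective and coefficients with equal index are collected.\<close>
    define c where "c i = (\<Sum>z\<in>{z\<in>?Z. j z = i}. f z)" for i
    have "(\<Sum>z\<in>?Z. f z * ?u z x) = (\<Sum>i\<in>j ` ?Z. c i * test_fun i x)" for x
    proof -
      have "(\<Sum>i\<in>j ` ?Z. c i * test_fun i x) = (\<Sum>i\<in>j ` ?Z. \<Sum>z\<in>{z\<in>?Z. j z = i}. f z * ?u z x)"
        unfolding c_def sum_distrib_right using j by (intro sum.cong) auto
      then show ?thesis using fin by (subst sum.image_gen[of ?Z _ j]) auto
    qed
    then show "\<exists>J c. finite J \<and> (\<forall>x. \<bar>f x - (\<Sum>j\<in>J. c j * test_fun j x)\<bar> \<le> \<epsilon> * cutoff (real R + 1) x)"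
      using appr fin by (intro exI[of _ "j ` ?Z"] exI[of _ c]) auto
  qed
qed

section \<open>Positive functionals, determined on \<open>Cc\<close> only, and their weak
  compactness\<close>

definition posfun :: "(('a::euclidean_space \<Rightarrow> real) \<Rightarrow> real) \<Rightarrow> bool" where
  "posfun \<Lambda> \<longleftrightarrow> (\<forall>f\<in>Cc. \<forall>g\<in>Cc. \<Lambda> (\<lambda>x. f x + g x) = \<Lambda> f + \<Lambda> g) \<and>
     (\<forall>f\<in>Cc. \<forall>c. \<Lambda> (\<lambda>x. c * f x) = c * \<Lambda> f) \<and> (\<forall>f\<in>Cc. (\<forall>x. 0 \<le> f x) \<longrightarrow> 0 \<le> \<Lambda> f)"

context
  fixes \<Lambda> :: "('a::euclidean_space \<Rightarrow> real) \<Rightarrow> real"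
  assumes pos: "posfun \<Lambda>"
begin

lemma posfun_add: "f \<in> Cc \<Longrightarrow> g \<in> Cc \<Longrightarrow> \<Lambda> (\<lambda>x. f x + g x) = \<Lambda> f + \<Lambda> g"
  and posfun_cmult: "f \<in> Cc \<Longrightarrow> \<Lambda> (\<lambda>x. c * f x) = c * \<Lambda> f"
  and posfun_nonneg: "f \<in> Cc \<Longrightarrow> (\<And>x. 0 \<le> f x) \<Longrightarrow> 0 \<le> \<Lambda> f"
  using pos by (auto simp: posfun_def)

lemma posfun_0: "\<Lambda> (\<lambda>x. 0) = 0"
  using posfun_cmult[of "\<lambda>x. 0" 0] by simp

lemma posfun_diff: "f \<in> Cc \<Longrightarrow> g \<in> Cc \<Longrightarrow> \<Lambda> (\<lambda>x. f x - g x) = \<Lambda> f - \<Lambda> g"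
  using posfun_add[of f "\<lambda>x. -1 * g x"] posfun_cmult[of g "-1"] Cc_cmult[of g "-1"] by simp

lemma posfun_mono: "f \<in> Cc \<Longrightarrow> g \<in> Cc \<Longrightarrow> (\<And>x. f x \<le> g x) \<Longrightarrow> \<Lambda> f \<le> \<Lambda> g"
  using posfun_diff[of g f] posfun_nonneg[of "\<lambda>x. g x - f x"] by simp

lemma posfun_abs: "f \<in> Cc \<Longrightarrow> g \<in> Cc \<Longrightarrow> (\<And>x. \<bar>f x\<bar> \<le> g x) \<Longrightarrow> \<bar>\<Lambda> f\<bar> \<le> \<Lambda> g"
  using posfun_mono[of f g] posfun_mono[of "\<lambda>x. -1 * f x" g] posfun_cmult[of f "-1"] Cc_cmult[of f "-1"]
  by (auto simp: abs_le_iff)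

lemma posfun_approx: "f \<in> Cc \<Longrightarrow> g \<in> Cc \<Longrightarrow> (\<And>x. \<bar>f x - g x\<bar> \<le> \<epsilon> * cutoff R x) \<Longrightarrow>
    \<bar>\<Lambda> f - \<Lambda> g\<bar> \<le> \<epsilon> * \<Lambda> (cutoff R)"
  using posfun_abs[of "\<lambda>x. f x - g x" "\<lambda>x. \<epsilon> * cutoff R x"] by (simp add: posfun_diff posfun_cmult)

lemma posfun_sum: "(\<And>i. i \<in> I \<Longrightarrow> f i \<in> Cc) \<Longrightarrow> \<Lambda> (\<lambda>x. \<Sum>i\<in>I. f i x) = (\<Sum>i\<in>I. \<Lambda> (f i))"
  by (induction I rule: infinite_finite_induct) (auto simp: posfun_0 posfun_add Cc_sum)

lemma posfun_cutoff: "0 \<le> \<Lambda> (cutoff R)"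
  by (rule posfun_nonneg) (auto simp: cutoff_props)

end

lemma posfun_lim:
  assumes "\<And>i::nat. posfun (\<Lambda>i i)" "\<And>f. f \<in> Cc \<Longrightarrow> (\<lambda>i. \<Lambda>i i f) \<longlonglongrightarrow> \<Lambda> f"
  shows "posfun \<Lambda>"
  unfolding posfun_def
proof (intro conjI ballI allI impI)
  fix f g :: "'a \<Rightarrow> real" and c assume fg: "f \<in> Cc" "g \<in> Cc"
  have "(\<lambda>i. \<Lambda>i i f + \<Lambda>i i g) \<longlonglongrightarrow> \<Lambda> f + \<Lambda> g" using assms fg by (intro tendsto_intros)
  moreover have "(\<lambda>i. \<Lambda>i i f + \<Lambda>i i g) \<longlonglongrightarrow> \<Lambda> (\<lambda>x. f x + g x)"
    using assms(2)[of "\<lambda>x. f x + g x"] fg by (simp add: posfun_add[OF assms(1)])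
  ultimately show "\<Lambda> (\<lambda>x. f x + g x) = \<Lambda> f + \<Lambda> g" by (metis LIMSEQ_unique)
next
  fix f :: "'a \<Rightarrow> real" and c assume f: "f \<in> Cc"
  have "(\<lambda>i. c * \<Lambda>i i f) \<longlonglongrightarrow> c * \<Lambda> f" using assms f by (intro tendsto_intros)
  moreover have "(\<lambda>i. c * \<Lambda>i i f) \<longlonglongrightarrow> \<Lambda> (\<lambda>x. c * f x)"
    using assms(2)[of "\<lambda>x. c * f x"] f by (simp add: posfun_cmult[OF assms(1)])
  ultimately show "\<Lambda> (\<lambda>x. c * f x) = c * \<Lambda> f" by (metis LIMSEQ_unique)
next
  fix f :: "'a \<Rightarrow> real" assume f: "f \<in> Cc" "\<forall>x. 0 \<le> f x"
  then show "0 \<le> \<Lambda> f" using assms(2)[OF f(1)] posfun_nonneg[OF assms(1) f(1)]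
    by (intro LIMSEQ_le_const[of _ _ 0]) auto
qed

text \<open>A combination \<open>g\<close> of test functions lies within
  \<open>\<epsilon> * cutoff R\<close> of \<open>f\<close>, so by positivity the values at
  \<open>f\<close> and \<open>g\<close> differ by at most \<open>\<epsilon>\<close> times the mass
  of the cut-off. That mass is bounded in \<open>i\<close>; hence the values at \<open>f\<close>
  inherit the Cauchy property from those at \<open>g\<close>.\<close>

lemma posfun_convergent:
  fixes \<Lambda> :: "nat \<Rightarrow> ('a::euclidean_space \<Rightarrow> real) \<Rightarrow> real"
  assumes pos: "\<And>i. posfun (\<Lambda> i)" and bd: "\<And>R. \<exists>C. \<forall>i. \<Lambda> i (cutoff R) \<le> C"
    and conv: "\<And>j. convergent (\<lambda>i. \<Lambda> i (test_fun j))" and f: "f \<in> Cc"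
  shows "convergent (\<lambda>i. \<Lambda> i f)"
proof -
  obtain R where R: "\<And>\<epsilon>. \<epsilon> > 0 \<Longrightarrow> \<exists>J c. finite J \<and> (\<forall>x. \<bar>f x - (\<Sum>j\<in>J. c j * test_fun j x)\<bar> \<le> \<epsilon> * cutoff R x)"
    using test_fun_dense[OF f] by blast
  obtain C where C: "\<And>i. \<Lambda> i (cutoff R) \<le> C" using bd by blast
  have "C \<ge> 0" using C[of 0] posfun_cutoff[OF pos, of 0 R] by linarith
  have "Cauchy (\<lambda>i. \<Lambda> i f)"
  proof (rule metric_CauchyI)
    fix e :: real assume "e > 0"
    define \<epsilon> where "\<epsilon> = e / (4 * (C + 1))"
    have "\<epsilon> > 0" using \<open>e > 0\<close> \<open>C \<ge> 0\<close> by (simp add: \<epsilon>_def)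
    then obtain J c where Jc: "finite J" "\<And>x. \<bar>f x - (\<Sum>j\<in>J. c j * test_fun j x)\<bar> \<le> \<epsilon> * cutoff R x"
      using R by metis
    define g where "g x = (\<Sum>j\<in>J. c j * test_fun j x)" for x :: 'a
    have g: "g \<in> Cc" unfolding g_def[abs_def] by (intro Cc_sum) auto
    have "\<bar>\<Lambda> i f - \<Lambda> i g\<bar> \<le> \<epsilon> * \<Lambda> i (cutoff R)" for i
      by (rule posfun_approx[OF pos f g]) (use Jc in \<open>simp add: g_def\<close>)
    moreover have "\<epsilon> * \<Lambda> i (cutoff R) \<le> \<epsilon> * (C + 1)" for i using C[of i] \<open>\<epsilon> > 0\<close> by (intro mult_left_mono) auto
    moreover have "\<epsilon> * (C + 1) = e / 4" using \<open>C \<ge> 0\<close> by (simp add: \<epsilon>_def field_simps)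
    ultimately have ap: "\<bar>\<Lambda> i f - \<Lambda> i g\<bar> \<le> e / 4" for i by (metis order_trans)
    have "\<Lambda> i g = (\<Sum>j\<in>J. c j * \<Lambda> i (test_fun j))" for i
      unfolding g_def[abs_def] by (simp add: posfun_sum[OF pos] posfun_cmult[OF pos])
    moreover have "convergent (\<lambda>i. \<Sum>j\<in>J. c j * \<Lambda> i (test_fun j))"
      by (intro convergent_sum convergent_mult convergent_const conv)
    ultimately have "Cauchy (\<lambda>i. \<Lambda> i g)" by (simp add: convergent_Cauchy)
    then obtain M where M: "\<And>m n. m \<ge> M \<Longrightarrow> n \<ge> M \<Longrightarrow> dist (\<Lambda> m g) (\<Lambda> n g) < e / 4"
      using \<open>e > 0\<close> unfolding Cauchy_def by (metis zero_less_divide_iff zero_less_numeral)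
    show "\<exists>M. \<forall>m\<ge>M. \<forall>n\<ge>M. dist (\<Lambda> m f) (\<Lambda> n f) < e"
    proof (intro exI allI impI)
      fix m n assume "M \<le> m" "M \<le> n"
      then show "dist (\<Lambda> m f) (\<Lambda> n f) < e"
        using M[of m n] ap[of m] ap[of n] \<open>e > 0\<close> unfolding dist_real_def by linarith
    qed
  qed
  then show ?thesis by (simp add: Cauchy_convergent)
qed

lemma posfun_tendsto:
  fixes \<Lambda> :: "nat \<Rightarrow> ('a::euclidean_space \<Rightarrow> real) \<Rightarrow> real"
  assumes pos: "\<And>i. posfun (\<Lambda> i)" and pos': "posfun M" and bd: "\<And>R. \<exists>C. \<forall>i. \<Lambda> i (cutoff R) \<le> C"
    and conv: "\<And>j. (\<lambda>i. \<Lambda> i (test_fun j)) \<longlonglongrightarrow> M (test_fun j)" and f: "f \<in> Cc"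
  shows "(\<lambda>i. \<Lambda> i f) \<longlonglongrightarrow> M f"
proof -
  \<comment> \<open>interleave the sequence with its candidate limit\<close>
  define N where "N i = (if even i then \<Lambda> (i div 2) else M)" for i
  have lim_iff: "(\<lambda>i. N i g) \<longlonglongrightarrow> l" if "(\<lambda>i. \<Lambda> i g) \<longlonglongrightarrow> l" "M g = l" for g l
  proof (rule tendstoI)
    fix e :: real assume "e > 0"
    have "(\<lambda>i. \<Lambda> (i div 2) g) \<longlonglongrightarrow> l"
      by (rule filterlim_compose[OF that(1)]) (simp add: filterlim_at_top_div_const_nat)
    from tendstoD[OF this \<open>e > 0\<close>] show "\<forall>\<^sub>F i in sequentially. dist (N i g) l < e"
      by eventually_elim (use that(2) \<open>e > 0\<close> in \<open>auto simp: N_def\<close>)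
  qed
  have "convergent (\<lambda>i. N i f)"
  proof (rule posfun_convergent[of N])
    show "posfun (N i)" for i using pos pos' by (simp add: N_def)
    show "\<exists>C. \<forall>i. N i (cutoff R) \<le> C" for R
    proof -
      obtain C where "\<And>i. \<Lambda> i (cutoff R) \<le> C" using bd by blast
      then have "N i (cutoff R) \<le> max C (M (cutoff R))" for i by (auto simp: N_def le_max_iff_disj)
      then show ?thesis by blast
    qed
    show "convergent (\<lambda>i. N i (test_fun j))" for j
      using lim_iff[OF conv refl] by (auto simp: convergent_def)
  qed (use f in auto)
  then obtain l where l: "(\<lambda>i. N i f) \<longlonglongrightarrow> l" by (auto simp: convergent_def)
  have "(\<lambda>i. N (2 * i + 1) f) \<longlonglongrightarrow> l" "(\<lambda>i. N (2 * i) f) \<longlonglongrightarrow> l"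
    using LIMSEQ_subseq_LIMSEQ[OF l, of "\<lambda>i. 2 * i + 1"] LIMSEQ_subseq_LIMSEQ[OF l, of "\<lambda>i. 2 * i"]
    by (auto simp: strict_mono_def o_def)
  then show ?thesis by (simp add: N_def LIMSEQ_const_iff)
qed

text \<open>A sequential Banach-Alaoglu theorem. Positivity makes the values at each test function
  bounded, a diagonal sequence converges at all of them, and density extends convergence to
  \<open>Cc\<close>.\<close>

lemma posfun_compact:
  fixes \<Lambda> :: "nat \<Rightarrow> ('a::euclidean_space \<Rightarrow> real) \<Rightarrow> real"
  assumes pos: "\<And>i. posfun (\<Lambda> i)" and bd: "\<And>R. \<exists>C. \<forall>i. \<Lambda> i (cutoff R) \<le> C"
  obtains \<sigma> M where "strict_mono \<sigma>" "posfun M" "\<And>f. f \<in> Cc \<Longrightarrow> (\<lambda>i. \<Lambda> (\<sigma> i) f) \<longlonglongrightarrow> M f"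
proof -
  have bdf: "\<exists>C. \<forall>i. \<bar>\<Lambda> i f\<bar> \<le> C" if f: "f \<in> Cc" for f
  proof -
    obtain B R where BR: "B > 0" "\<And>x. \<bar>f x\<bar> \<le> B * cutoff R x" using Cc_le_cutoff[OF f] by metis
    obtain C where C: "\<And>i. \<Lambda> i (cutoff R) \<le> C" using bd by blast
    have "\<bar>\<Lambda> i f\<bar> \<le> B * C" for i
    proof -
      have "\<bar>\<Lambda> i f\<bar> \<le> \<Lambda> i (\<lambda>x. B * cutoff R x)" using BR f by (intro posfun_abs[OF pos]) auto
      also have "\<dots> = B * \<Lambda> i (cutoff R)" by (simp add: posfun_cmult[OF pos])
      also have "\<dots> \<le> B * C" using C BR by (intro mult_left_mono) auto
      finally show ?thesis .
    qed
    then show ?thesis by blast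
  qed
  interpret subseqs "\<lambda>n s. convergent (\<lambda>i. \<Lambda> (s i) (test_fun n))"
  proof
    fix n :: nat and s :: "nat \<Rightarrow> nat"
    obtain C where "\<And>i. \<bar>\<Lambda> i (test_fun n)\<bar> \<le> C" using bdf[OF test_fun_Cc] by blast
    then have "bounded (range (\<lambda>i. \<Lambda> (s i) (test_fun n)))" unfolding bounded_iff by auto
    from bounded_imp_convergent_subsequence[OF this] obtain l r
      where "strict_mono r" "((\<lambda>i. \<Lambda> (s i) (test_fun n)) \<circ> r) \<longlonglongrightarrow> l" by blast
    then show "\<exists>r'. strict_mono r' \<and> convergent (\<lambda>i. \<Lambda> ((s \<circ> r') i) (test_fun n))"
      by (auto simp: convergent_def o_def)
  qed
  have "convergent (\<lambda>i. \<Lambda> (diagseq i) (test_fun n))" for n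
  proof -
    have "convergent (\<lambda>i. \<Lambda> ((diagseq \<circ> (+) (Suc n)) i) (test_fun n))"
    proof (rule diagseq_holds)
      fix r s :: "nat \<Rightarrow> nat" and n assume "strict_mono r" "convergent (\<lambda>i. \<Lambda> (s i) (test_fun n))"
      then show "convergent (\<lambda>i. \<Lambda> ((s \<circ> r) i) (test_fun n))"
        using convergent_subseq_convergent[of "\<lambda>i. \<Lambda> (s i) (test_fun n)" r] by (simp add: o_def)
    qed
    then have "convergent (\<lambda>i. \<Lambda> (diagseq (i + Suc n)) (test_fun n))" by (simp add: o_def add.commute)
    then show ?thesis using convergent_ignore_initial_segment[of "\<lambda>i. \<Lambda> (diagseq i) (test_fun n)"] by blast
  qed
  moreover have "\<exists>C. \<forall>i. \<Lambda> (diagseq i) (cutoff R) \<le> C" for R using bd by blast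
  ultimately have conv: "convergent (\<lambda>i. \<Lambda> (diagseq i) f)" if "f \<in> Cc" for f
    using posfun_convergent[of "\<lambda>i. \<Lambda> (diagseq i)" f] pos that by blast
  define M where "M f = lim (\<lambda>i. \<Lambda> (diagseq i) f)" for f
  have lim: "(\<lambda>i. \<Lambda> (diagseq i) f) \<longlonglongrightarrow> M f" if "f \<in> Cc" for f
    using conv[OF that] by (simp add: M_def convergent_LIMSEQ_iff)
  moreover have "posfun M" by (rule posfun_lim[of "\<lambda>i. \<Lambda> (diagseq i)"]) (use pos lim in auto)
  ultimately show thesis using subseq_diagseq that by blast
qed

section \<open>The support of a functional\<close>

definition fsupp :: "(('a::euclidean_space \<Rightarrow> real) \<Rightarrow> real) \<Rightarrow> 'a set" where
  "fsupp \<Lambda> = {p. \<forall>f\<in>Cc. (\<forall>x. 0 \<le> f x) \<longrightarrow> 0 < f p \<longrightarrow> 0 < \<Lambda> f}"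

lemma not_fsupp:
  assumes "posfun \<Lambda>" "p \<notin> fsupp \<Lambda>"
  obtains f where "f \<in> Cc" "\<And>x. 0 \<le> f x" "0 < f p" "\<Lambda> f = 0"
  using assms(2) posfun_nonneg[OF assms(1)] by (fastforce simp: fsupp_def)

lemma closed_fsupp: assumes "posfun \<Lambda>" shows "closed (fsupp \<Lambda>)"
proof -
  have "\<exists>T. open T \<and> p \<in> T \<and> T \<subseteq> - fsupp \<Lambda>" if "p \<in> - fsupp \<Lambda>" for p
  proof -
    obtain f where f: "f \<in> Cc" "\<And>x. 0 \<le> f x" "0 < f p" "\<Lambda> f = 0"
      using not_fsupp[OF assms, of p] \<open>p \<in> - fsupp \<Lambda>\<close> by blast
    have "open {x. 0 < f x}" using Cc_cont[OF f(1)] by (intro open_Collect_less) auto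
    moreover have "{x. 0 < f x} \<subseteq> - fsupp \<Lambda>" using f by (auto simp: fsupp_def)
    ultimately show ?thesis using f by blast
  qed
  then have "open (- fsupp \<Lambda>)" by (subst open_subopen) blast
  then show ?thesis by (simp add: closed_def)
qed

text \<open>The compact set where \<open>f\<close> is at least \<open>\<epsilon>\<close> in absolute
  value misses the support, so finitely many functions of value 0 under \<open>\<Lambda>\<close>
  have a sum \<open>G\<close> that is positive on it. Then a multiple of \<open>G\<close> plus
  \<open>\<epsilon> * cutoff R\<close> dominates \<open>\<bar>f\<bar>\<close>, and only the second
  summand contributes.\<close>

lemma fsupp_null:
  assumes pos: "posfun \<Lambda>" and f: "f \<in> Cc" and f0: "\<And>p. p \<in> fsupp \<Lambda> \<Longrightarrow> f p = 0"
  shows "\<Lambda> f = 0"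
proof -
  obtain R where R0: "\<And>x. R < norm x \<Longrightarrow> f x = 0" by (metis Cc_supp f)
  obtain B R' where BR: "B > 0" "\<And>x. \<bar>f x\<bar> \<le> B * cutoff R' x" using Cc_le_cutoff[OF f] by metis
  have "\<bar>\<Lambda> f\<bar> \<le> \<epsilon> * \<Lambda> (cutoff R)" if "\<epsilon> > 0" for \<epsilon>
  proof -
    let ?K = "{x. \<epsilon> \<le> \<bar>f x\<bar>}"
    have "norm x \<le> R" if "x \<in> ?K" for x
      using that R0[of x] \<open>\<epsilon> > 0\<close> by force
    then have "bounded ?K" unfolding bounded_iff by auto
    moreover have "closed ?K" using Cc_cont[OF f] by (intro closed_Collect_le continuous_intros) auto
    ultimately have K: "compact ?K" by (simp add: compact_eq_bounded_closed)
    have "\<forall>p\<in>?K. \<exists>g. g \<in> Cc \<and> (\<forall>x. 0 \<le> g x) \<and> 0 < g p \<and> \<Lambda> g = 0"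
    proof
      fix p assume "p \<in> ?K"
      then have "p \<notin> fsupp \<Lambda>" using f0 that by force
      then show "\<exists>g. g \<in> Cc \<and> (\<forall>x. 0 \<le> g x) \<and> 0 < g p \<and> \<Lambda> g = 0" by (metis not_fsupp pos)
    qed
    then obtain g where g: "\<And>p. p \<in> ?K \<Longrightarrow> g p \<in> Cc \<and> (\<forall>x. 0 \<le> g p x) \<and> 0 < g p p \<and> \<Lambda> (g p) = 0"
      by metis
    have op: "open {x. 0 < g p x}" if "p \<in> ?K" for p
      by (intro open_Collect_less continuous_on_const Cc_cont) (use g[OF that] in blast)
    have cov: "?K \<subseteq> (\<Union>p\<in>?K. {x. 0 < g p x})" using g by blast
    obtain P where P: "P \<subseteq> ?K" "finite P" "?K \<subseteq> (\<Union>p\<in>P. {x. 0 < g p x})"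
      by (rule compactE_image[of ?K ?K "\<lambda>p. {x. 0 < g p x}", OF K op cov])
    define G where "G x = (\<Sum>p\<in>P. g p x)" for x
    have GC: "G \<in> Cc" unfolding G_def[abs_def] using g P by (intro Cc_sum) auto
    have G0: "0 \<le> G x" for x unfolding G_def using g P by (intro sum_nonneg) auto
    have LG: "\<Lambda> G = 0" unfolding G_def[abs_def] using g P by (subst posfun_sum[OF pos]) (blast, auto intro!: sum.neutral)
    have Gpos: "0 < G x" if "x \<in> ?K" for x
    proof -
      have "x \<in> (\<Union>p\<in>P. {x. 0 < g p x})" using P(3) that by blast
      then obtain p where "p \<in> P" "0 < g p x" by blast
      then show ?thesis unfolding G_def using g P by (intro sum_pos2[of P p]) auto
    qed
    obtain m where m: "m > 0" "\<And>x. x \<in> ?K \<Longrightarrow> m \<le> G x"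
    proof (cases "?K = {}")
      case False
      then obtain x where "x \<in> ?K" "\<And>y. y \<in> ?K \<Longrightarrow> G x \<le> G y"
        using continuous_attains_inf[OF K, of G] continuous_on_subset[OF Cc_cont[OF GC]] by blast
      then show thesis using Gpos that by blast
    qed (use that[of 1] in auto)
    define c where "c = B / m"
    have "\<bar>f x\<bar> \<le> c * G x + \<epsilon> * cutoff R x" for x
    proof (cases "x \<in> ?K")
      case True
      have "\<bar>f x\<bar> \<le> B" using BR(1) BR(2)[of x] cutoff_props(2)[of R' x] by (smt (verit) mult_left_le)
      also have "B \<le> c * G x" using m(2)[OF True] m(1) BR(1) by (simp add: c_def field_simps)
      finally show ?thesis using cutoff_props(1)[of R x] that by (smt (verit) mult_nonneg_nonneg)
    next
      case False
      then have "\<bar>f x\<bar> \<le> \<epsilon> * cutoff R x"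
        using R0[of x] cutoff_props(3)[of x R] cutoff_props(1)[of R x] that by (cases "norm x \<le> R") auto
      moreover have "0 \<le> c * G x" using m BR G0[of x] by (simp add: c_def)
      ultimately show ?thesis by linarith
    qed
    then have "\<bar>\<Lambda> f\<bar> \<le> \<Lambda> (\<lambda>x. c * G x + \<epsilon> * cutoff R x)"
      using GC f by (intro posfun_abs[OF pos] Cc_add Cc_cmult cutoff_Cc) auto
    also have "\<dots> = \<epsilon> * \<Lambda> (cutoff R)" using GC LG by (simp add: posfun_add[OF pos] posfun_cmult[OF pos])
    finally show ?thesis .
  qed
  then have "\<bar>\<Lambda> f\<bar> \<le> 0 + e" if "e > 0" for e
  proof -
    define L where "L = \<Lambda> (cutoff R)"
    have L: "0 \<le> L" using posfun_cutoff[OF pos] by (simp add: L_def)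
    then have "e / (L + 1) > 0" "e / (L + 1) * L \<le> e" using that by (auto simp: field_simps)
    then show ?thesis
      using \<open>\<And>\<epsilon>. 0 < \<epsilon> \<Longrightarrow> \<bar>\<Lambda> f\<bar> \<le> \<epsilon> * \<Lambda> (cutoff R)\<close>[of "e / (L + 1)"] unfolding L_def by linarith
  qed
  then have "\<bar>\<Lambda> f\<bar> \<le> 0" by (rule field_le_epsilon)
  then show ?thesis by simp
qed

lemma fsupp_mono:
  assumes "posfun \<Lambda>" "f \<in> Cc" "g \<in> Cc" "\<And>p. p \<in> fsupp \<Lambda> \<Longrightarrow> f p \<le> g p"
  shows "\<Lambda> f \<le> \<Lambda> g"
proof -
  have "\<Lambda> (\<lambda>x. max 0 (f x - g x)) = 0" using assms by (intro fsupp_null[OF assms(1)]) auto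
  moreover have "\<Lambda> (\<lambda>x. f x - g x) \<le> \<Lambda> (\<lambda>x. max 0 (f x - g x))" using assms by (intro posfun_mono[OF assms(1)]) auto
  ultimately show ?thesis using assms by (simp add: posfun_diff)
qed

lemma fsupp_meets:
  assumes "posfun \<Lambda>" "f \<in> Cc" "\<Lambda> f \<noteq> 0"
  obtains p where "p \<in> fsupp \<Lambda>" "f p \<noteq> 0"
  using fsupp_null[OF assms(1,2)] assms(3) by metis

text \<open>Lower semicontinuity of the support: a tent around \<open>p\<close> inside
  \<open>U\<close> has a positive limit value, so eventually all functionals charge it.\<close>

lemma fsupp_lim:
  assumes "\<And>i::nat. posfun (\<Lambda> i)" "\<And>f. f \<in> Cc \<Longrightarrow> (\<lambda>i. \<Lambda> i f) \<longlonglongrightarrow> M f" "p \<in> fsupp M" "open U" "p \<in> U"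
  shows "\<forall>\<^sub>F i in sequentially. fsupp (\<Lambda> i) \<inter> U \<noteq> {}"
proof -
  obtain \<epsilon> where \<epsilon>: "\<epsilon> > 0" "ball p \<epsilon> \<subseteq> U" using assms(4,5) openE by blast
  define f where "f x = max 0 (\<epsilon> - dist p x)" for x
  have f: "f \<in> Cc" unfolding f_def[abs_def]
  proof (rule CcI[of _ "norm p + \<epsilon>"])
    show "max 0 (\<epsilon> - dist p x) = 0" if "norm p + \<epsilon> < norm x" for x
      using that norm_triangle_ineq2[of x p] by (simp add: dist_norm norm_minus_commute)
  qed (intro continuous_intros)
  have "0 < M f" using assms(3) f \<epsilon>(1) by (simp add: fsupp_def f_def)
  then have "\<forall>\<^sub>F i in sequentially. 0 < \<Lambda> i f" using assms(2)[OF f] order_tendstoD(1) by blast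
  then show ?thesis
  proof eventually_elim
    case (elim i)
    then obtain q where q: "q \<in> fsupp (\<Lambda> i)" "f q \<noteq> 0" using fsupp_meets[OF assms(1) f] by (metis less_irrefl)
    then have "q \<in> ball p \<epsilon>" by (auto simp: f_def max_def split: if_splits)
    then show ?case using q \<epsilon> by blast
  qed
qed

lemma fsupp_lim_closed:
  assumes "\<And>i::nat. posfun (\<Lambda> i)" "\<And>f. f \<in> Cc \<Longrightarrow> (\<lambda>i. \<Lambda> i f) \<longlonglongrightarrow> M f" "closed S" "\<And>i. fsupp (\<Lambda> i) \<subseteq> S"
  shows "fsupp M \<subseteq> S"
proof
  fix p assume p: "p \<in> fsupp M"
  show "p \<in> S"
  proof (rule ccontr)
    assume "p \<notin> S"
    then have "\<forall>\<^sub>F i in sequentially. fsupp (\<Lambda> i) \<inter> - S \<noteq> {}"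
      using assms p by (intro fsupp_lim[of \<Lambda> M p]) auto
    then show False using assms(4) by (auto simp: disjoint_eq_subset_Compl)
  qed
qed

section \<open>Functionals in two variables and Fubini's theorem\<close>

lemma Cc_prod_support:
  fixes F :: "'a::euclidean_space \<times> 'b::euclidean_space \<Rightarrow> real"
  assumes "F \<in> Cc"
  obtains R where "R > 0" "\<And>p q. R < norm p \<or> R < norm q \<Longrightarrow> F (p, q) = 0"
proof -
  obtain R where R: "R > 0" "\<And>x. R < norm x \<Longrightarrow> F x = 0" by (metis Cc_supp assms)
  have "norm p \<le> norm (p, q)" "norm q \<le> norm (p, q)" for p :: 'a and q :: 'b
    by (simp_all add: norm_fst_le norm_snd_le)
  then have "F (p, q) = 0" if "R < norm p \<or> R < norm q" for p q
    using that by (intro R(2)) (metis order_less_le_trans)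
  then show thesis using R(1) that by blast
qed

lemma Cc_section:
  fixes F :: "'a::euclidean_space \<times> 'b::euclidean_space \<Rightarrow> real"
  assumes "F \<in> Cc"
  shows "(\<lambda>q. F (p, q)) \<in> Cc" "(\<lambda>p. F (p, q)) \<in> Cc"
proof -
  obtain R where R: "\<And>p q. R < norm p \<or> R < norm q \<Longrightarrow> F (p, q) = 0" using Cc_prod_support[OF assms] by metis
  show "(\<lambda>q. F (p, q)) \<in> Cc" "(\<lambda>p. F (p, q)) \<in> Cc"
    using R by (intro CcI[of _ R] continuous_on_compose2[OF Cc_cont[OF assms]] continuous_intros; force)+
qed

lemma Cc_partial_posfun:
  fixes F :: "'a::euclidean_space \<times> 'b::euclidean_space \<Rightarrow> real"
  assumes pos: "posfun \<Lambda>" and F: "F \<in> Cc"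
  shows "(\<lambda>p. \<Lambda> (\<lambda>q. F (p, q))) \<in> Cc"
proof -
  obtain R where R: "\<And>p q. R < norm p \<or> R < norm q \<Longrightarrow> F (p, q) = 0" using Cc_prod_support[OF F] by metis
  show ?thesis
  proof (rule CcI)
    show "\<Lambda> (\<lambda>q. F (p, q)) = 0" if "R < norm p" for p using R that posfun_0[OF pos] by simp
    show "continuous_on UNIV (\<lambda>p. \<Lambda> (\<lambda>q. F (p, q)))"
      unfolding continuous_on_iff
    proof (intro ballI allI impI)
      fix p :: 'a and e :: real assume "e > 0"
      define \<epsilon> where "\<epsilon> = e / (\<Lambda> (cutoff R) + 1)"
      have L0: "0 \<le> \<Lambda> (cutoff R)" by (rule posfun_cutoff[OF pos])
      then have "\<epsilon> > 0" using \<open>e > 0\<close> by (simp add: \<epsilon>_def)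
      then obtain \<delta> where \<delta>: "\<delta> > 0" "\<And>x y. dist x y < \<delta> \<Longrightarrow> \<bar>F x - F y\<bar> < \<epsilon>" using Cc_uniform[OF F \<open>\<epsilon> > 0\<close>] by blast
      have "dist (\<Lambda> (\<lambda>q. F (p', q))) (\<Lambda> (\<lambda>q. F (p, q))) < e" if "dist p' p < \<delta>" for p'
      proof -
        have "\<bar>F (p', q) - F (p, q)\<bar> \<le> \<epsilon> * cutoff R q" for q
          using \<delta>(2)[of "(p', q)" "(p, q)"] that R[of p' q] R[of p q] \<open>\<epsilon> > 0\<close>
          by (cases "norm q \<le> R") (auto simp: dist_Pair_Pair cutoff_props)
        then have "\<bar>\<Lambda> (\<lambda>q. F (p', q)) - \<Lambda> (\<lambda>q. F (p, q))\<bar> \<le> \<epsilon> * \<Lambda> (cutoff R)"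
          by (intro posfun_approx[OF pos] Cc_section F)
        also have "\<dots> < e" using L0 \<open>e > 0\<close> by (simp add: \<epsilon>_def field_simps)
        finally show ?thesis by (simp add: dist_real_def)
      qed
      then show "\<exists>d>0. \<forall>x'\<in>UNIV. dist x' p < d \<longrightarrow> dist (\<Lambda> (\<lambda>q. F (x', q))) (\<Lambda> (\<lambda>q. F (p, q))) < e"
        using \<delta>(1) by blast
    qed
  qed
qed

lemma Cc_swap:
  fixes F :: "'a::euclidean_space \<times> 'b::euclidean_space \<Rightarrow> real"
  assumes "F \<in> Cc" shows "(\<lambda>x. F (snd x, fst x)) \<in> Cc"
proof -
  obtain R where R: "\<And>x. R < norm x \<Longrightarrow> F x = 0" by (metis Cc_supp assms)
  have "continuous_on UNIV (\<lambda>x. F (snd x, fst x))"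
    by (rule continuous_on_compose2[OF Cc_cont[OF assms]]) (auto intro!: continuous_intros)
  moreover have "norm (snd x, fst x) = norm x" for x :: "'b \<times> 'a" by (simp add: norm_prod_def add.commute)
  ultimately show ?thesis using R by (intro CcI[of _ R]) auto
qed

text \<open>For a sum of products the two orders agree by linearity. A partition of unity in the
  first variable approximates \<open>F\<close> uniformly by the sum of the products
  \<open>F (z, q) * u z p\<close>, and both iterated values stay within
  \<open>\<epsilon> * m\<close> of its value \<open>S\<close>.\<close>

lemma posfun_Fubini:
  fixes F :: "'a::euclidean_space \<times> 'b::euclidean_space \<Rightarrow> real"
  assumes pos: "posfun \<Lambda>" and pos': "posfun \<Lambda>'" and F: "F \<in> Cc"
  shows "\<Lambda> (\<lambda>p. \<Lambda>' (\<lambda>q. F (p, q))) = \<Lambda>' (\<lambda>q. \<Lambda> (\<lambda>p. F (p, q)))"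
proof -
  obtain R where R: "\<And>p q. R < norm p \<or> R < norm q \<Longrightarrow> F (p, q) = 0" using Cc_prod_support[OF F] by metis
  define m where "m = \<Lambda> (cutoff (R + 1)) * \<Lambda>' (cutoff (R + 1))"
  have L0: "0 \<le> \<Lambda> (cutoff r)" "0 \<le> \<Lambda>' (cutoff r)" for r by (rule posfun_cutoff[OF pos], rule posfun_cutoff[OF pos'])
  then have "m \<ge> 0" by (simp add: m_def)
  let ?A = "\<Lambda> (\<lambda>p. \<Lambda>' (\<lambda>q. F (p, q)))" and ?B = "\<Lambda>' (\<lambda>q. \<Lambda> (\<lambda>p. F (p, q)))"
  have key: "\<bar>?A - ?B\<bar> \<le> 2 * \<epsilon> * m" if "\<epsilon> > 0" for \<epsilon>
  proof -
    obtain \<delta>0 where \<delta>0: "\<delta>0 > 0" "\<And>x y. dist x y < \<delta>0 \<Longrightarrow> \<bar>F x - F y\<bar> < \<epsilon>" using Cc_uniform[OF F \<open>\<epsilon> > 0\<close>] by blast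
    define \<delta> where "\<delta> = min \<delta>0 1"
    have \<delta>: "\<delta> > 0" "\<delta> \<le> 1" "\<delta> \<le> \<delta>0" using \<delta>0 by (auto simp: \<delta>_def)
    obtain Z u where U: "unity_part R \<delta> (Z :: 'a set) u" using unity_part_exists[OF \<delta>(1)] by blast
    then have fin: "finite Z" and uC: "\<And>z. z \<in> Z \<Longrightarrow> u z \<in> Cc" by (auto simp: unity_part_def)
    have appr: "\<bar>F (p, q) - (\<Sum>z\<in>Z. F (z, q) * u z p)\<bar> \<le> (\<epsilon> * cutoff (R + 1) p) * cutoff (R + 1) q" for p q
    proof (cases "norm q \<le> R")
      case True
      have "\<bar>F (p, q) - (\<Sum>z\<in>Z. F (z, q) * u z p)\<bar> \<le> \<epsilon> * cutoff (R + 1) p"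
      proof (rule unity_part_approx[OF U \<delta>(2)])
        fix x y :: 'a assume "dist x y < \<delta>"
        then show "\<bar>F (x, q) - F (y, q)\<bar> \<le> \<epsilon>"
          using \<delta>0(2)[of "(x, q)" "(y, q)"] \<delta> by (force simp: dist_Pair_Pair)
      qed (use R \<delta> in auto)
      then show ?thesis using True by (simp add: cutoff_props)
    next
      case False
      then show ?thesis using R that by (simp add: cutoff_props)
    qed
    define S where "S = (\<Sum>z\<in>Z. \<Lambda>' (\<lambda>q. F (z, q)) * \<Lambda> (u z))"
    have 1: "\<bar>?A - S\<bar> \<le> \<epsilon> * m"
    proof -
      have "\<bar>\<Lambda>' (\<lambda>q. F (p, q)) - (\<Sum>z\<in>Z. \<Lambda>' (\<lambda>q. F (z, q)) * u z p)\<bar> \<le> (\<epsilon> * \<Lambda>' (cutoff (R + 1))) * cutoff (R + 1) p" for p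
      proof -
        have C: "(\<lambda>q. F (z, q) * u z p) \<in> Cc" for z
          using Cc_cmult[OF Cc_section(1)[OF F], of "u z p" z] by (simp add: mult.commute)
        have "\<bar>\<Lambda>' (\<lambda>q. F (p, q)) - \<Lambda>' (\<lambda>q. \<Sum>z\<in>Z. F (z, q) * u z p)\<bar> \<le> (\<epsilon> * cutoff (R + 1) p) * \<Lambda>' (cutoff (R + 1))"
          by (rule posfun_approx[OF pos']) (use appr C Cc_section[OF F] in \<open>auto intro!: Cc_sum\<close>)
        moreover have "\<Lambda>' (\<lambda>q. \<Sum>z\<in>Z. F (z, q) * u z p) = (\<Sum>z\<in>Z. \<Lambda>' (\<lambda>q. F (z, q)) * u z p)"
          using C posfun_cmult[OF pos' Cc_section(1)[OF F]]
          by (subst posfun_sum[OF pos']) (auto simp: mult.commute)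
        ultimately show ?thesis by (simp add: mult_ac)
      qed
      moreover have C: "(\<lambda>p. \<Lambda>' (\<lambda>q. F (z, q)) * u z p) \<in> Cc" if "z \<in> Z" for z using uC[OF that] by simp
      ultimately have "\<bar>?A - \<Lambda> (\<lambda>p. \<Sum>z\<in>Z. \<Lambda>' (\<lambda>q. F (z, q)) * u z p)\<bar> \<le> (\<epsilon> * \<Lambda>' (cutoff (R + 1))) * \<Lambda> (cutoff (R + 1))"
        using uC by (intro posfun_approx[OF pos] Cc_partial_posfun pos' F) (auto intro!: Cc_sum)
      moreover have "\<Lambda> (\<lambda>p. \<Sum>z\<in>Z. \<Lambda>' (\<lambda>q. F (z, q)) * u z p) = S"
        unfolding S_def using C uC posfun_cmult[OF pos] by (subst posfun_sum[OF pos]) auto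
      ultimately show ?thesis by (simp add: m_def mult_ac)
    qed
    have 2: "\<bar>?B - S\<bar> \<le> \<epsilon> * m"
    proof -
      have Cz: "(\<lambda>p. F (z, q) * u z p) \<in> Cc" if "z \<in> Z" for z q using uC[OF that] by simp
      have "\<bar>\<Lambda> (\<lambda>p. F (p, q)) - (\<Sum>z\<in>Z. F (z, q) * \<Lambda> (u z))\<bar> \<le> (\<epsilon> * \<Lambda> (cutoff (R + 1))) * cutoff (R + 1) q" for q
      proof -
        have "\<bar>\<Lambda> (\<lambda>p. F (p, q)) - \<Lambda> (\<lambda>p. \<Sum>z\<in>Z. F (z, q) * u z p)\<bar> \<le> (\<epsilon> * cutoff (R + 1) q) * \<Lambda> (cutoff (R + 1))"
          by (rule posfun_approx[OF pos]) (use appr Cz Cc_section[OF F] in \<open>auto simp: mult_ac intro!: Cc_sum\<close>)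
        moreover have "\<Lambda> (\<lambda>p. \<Sum>z\<in>Z. F (z, q) * u z p) = (\<Sum>z\<in>Z. F (z, q) * \<Lambda> (u z))"
          using Cz uC posfun_cmult[OF pos] by (subst posfun_sum[OF pos]) auto
        ultimately show ?thesis by (simp add: mult_ac)
      qed
      moreover have C: "(\<lambda>q. F (z, q) * \<Lambda> (u z)) \<in> Cc" for z
        using Cc_cmult[OF Cc_section(1)[OF F], of "\<Lambda> (u z)" z] by (simp add: mult.commute)
      moreover have "(\<lambda>q. \<Lambda> (\<lambda>p. F (p, q))) \<in> Cc"
        using Cc_partial_posfun[OF pos Cc_swap[OF F]] by simp
      ultimately have "\<bar>?B - \<Lambda>' (\<lambda>q. \<Sum>z\<in>Z. F (z, q) * \<Lambda> (u z))\<bar> \<le> (\<epsilon> * \<Lambda> (cutoff (R + 1))) * \<Lambda>' (cutoff (R + 1))"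
        by (intro posfun_approx[OF pos']) (auto intro!: Cc_sum)
      moreover have "\<Lambda>' (\<lambda>q. \<Sum>z\<in>Z. F (z, q) * \<Lambda> (u z)) = S"
        unfolding S_def using C posfun_cmult[OF pos' Cc_section(1)[OF F]]
        by (subst posfun_sum[OF pos']) (auto simp: mult.commute)
      ultimately show ?thesis by (simp add: m_def mult_ac)
    qed
    show ?thesis using 1 2 by linarith
  qed
  have "\<bar>?A - ?B\<bar> \<le> 0 + e" if "e > 0" for e
  proof -
    have "e / (2 * (m + 1)) > 0" using that \<open>m \<ge> 0\<close> by simp
    moreover have "2 * (e / (2 * (m + 1))) * m \<le> e" using that \<open>m \<ge> 0\<close> by (simp add: field_simps)
    ultimately show ?thesis using key[of "e / (2 * (m + 1))"] by linarith
  qed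
  then have "\<bar>?A - ?B\<bar> \<le> 0" by (rule field_le_epsilon)
  then show ?thesis by simp
qed

section \<open>Blow-ups\<close>

declare split_paired_All [simp del] split_paired_Ex [simp del]

text \<open>A cut-off that depends on the gauge only: it is 1 on the ball of radius
  \<open>r\<close>, 0 outside radius \<open>2 * r\<close>, and dilations merely change
  \<open>r\<close>. The euclidean \<open>cutoff\<close> has no such scaling.\<close>

definition bump :: "real \<Rightarrow> ('n::finite) heis \<Rightarrow> real" where
  "bump r q = max 0 (min 1 (2 - hnorm q / r))"

lemma bump_bounds: "0 \<le> bump r q" "bump r q \<le> 1"
  by (auto simp: bump_def)

lemma bump_eq_1: "r > 0 \<Longrightarrow> hnorm q \<le> r \<Longrightarrow> bump r q = 1"
  and bump_eq_0: "r > 0 \<Longrightarrow> 2 * r \<le> hnorm q \<Longrightarrow> bump r q = 0"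
  by (auto simp: bump_def field_simps min_def max_def)

lemma bump_0 [simp]: "bump r 0 = 1"
  by (simp add: bump_def)

lemma bump_uminus [simp]: "bump r (- q) = bump r q"
  by (simp add: bump_def)

lemma continuous_on_bump [continuous_intros]:
  "continuous_on S f \<Longrightarrow> continuous_on S (\<lambda>x. bump r (f x))"
  unfolding bump_def by (cases "r = 0") (auto intro!: continuous_intros)

lemma CcI_hnorm:
  fixes f :: "('n::finite) heis \<Rightarrow> real"
  shows "continuous_on UNIV f \<Longrightarrow> (\<And>x. R < hnorm x \<Longrightarrow> f x = 0) \<Longrightarrow> f \<in> Cc"
proof (rule CcI)
  fix x :: "'n heis" assume "\<And>x. R < hnorm x \<Longrightarrow> f x = 0" "R + R\<^sup>2 < norm x"
  moreover then have "\<not> hnorm x \<le> R" using norm_le_of_hnorm[of x R] by linarith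
  ultimately show "f x = 0" by simp
qed

lemma bump_Cc [simp]: "r > 0 \<Longrightarrow> bump r \<in> Cc"
  by (rule CcI_hnorm[of _ "2 * r"]) (auto intro!: bump_eq_0 continuous_on_bump continuous_on_id)

lemma bump_hdilation: "r > 0 \<Longrightarrow> bump t (hdilation (1 / r) q) = bump (t * r) q"
  by (simp add: bump_def hnorm_hdilation field_simps)

lemma Cc_supp_hnorm:
  fixes f :: "('n::finite) heis \<Rightarrow> real"
  assumes "f \<in> Cc" obtains R where "R > 0" "\<And>x. R < hnorm x \<Longrightarrow> f x = 0"
proof -
  obtain R where R: "\<And>x. R < norm x \<Longrightarrow> f x = 0" using Cc_supp[OF assms] by blast
  obtain R' where R': "R' > 0" "\<And>p :: 'n heis. norm p \<le> R \<Longrightarrow> hnorm p \<le> R'" using hnorm_le_of_norm by blast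
  show thesis by (rule that[OF R'(1)]) (meson R R'(2) linorder_not_le)
qed

lemma Cc_left:
  fixes f :: "('n::finite) heis \<Rightarrow> real" and p :: "'n heis"
  assumes "f \<in> Cc" "t > 0" shows "(\<lambda>q. f (hdilation t (p \<odot> q))) \<in> Cc"
proof -
  obtain R where R: "R > 0" "\<And>x. R < hnorm x \<Longrightarrow> f x = 0" using Cc_supp_hnorm[OF assms(1)] by blast
  show ?thesis
  proof (rule CcI_hnorm)
    show "continuous_on UNIV (\<lambda>q. f (hdilation t (p \<odot> q)))"
      by (rule continuous_on_compose2[OF Cc_cont[OF assms(1)]]) (auto intro!: continuous_intros)
    fix q :: "'n heis" assume q: "hnorm p + R / t < hnorm q"
    have "hnorm q \<le> hnorm (- p) + hnorm (p \<odot> q)" by (metis hmul_cancel(1) hnorm_triangle)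
    then have "R / t < hnorm (p \<odot> q)" using q by simp
    then have "R < hnorm (hdilation t (p \<odot> q))" using assms(2) by (simp add: hnorm_hdilation field_simps)
    then show "f (hdilation t (p \<odot> q)) = 0" by (rule R)
  qed
qed

lemma Cc_translate: "f \<in> Cc \<Longrightarrow> (\<lambda>q. f (p \<odot> q)) \<in> Cc"
  using Cc_left[of f 1 p] by simp

lemma Cc_hdilation: "f \<in> Cc \<Longrightarrow> t > 0 \<Longrightarrow> (\<lambda>q. f (hdilation t q)) \<in> Cc"
  using Cc_left[of f t 0] by simp

lemma Cc_prodI:
  fixes F :: "'a::euclidean_space \<times> 'b::euclidean_space \<Rightarrow> real"
  assumes "continuous_on UNIV F" "\<And>p q. R < norm p \<or> R < norm q \<Longrightarrow> F (p, q) = 0"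
  shows "F \<in> Cc"
proof (rule CcI)
  fix x :: "'a \<times> 'b" assume "2 * R < norm x"
  then have "R < norm (fst x) \<or> R < norm (snd x)" using norm_Pair_le[of "fst x" "snd x"] by auto
  then show "F x = 0" using assms(2)[of "fst x" "snd x"] by simp
qed (rule assms)

text \<open>The integrand of a convolution as a function of two variables, in the form needed for
  Fubini. Bounds on \<open>p\<close> and on \<open>- p \<odot> q\<close> bound \<open>q\<close> by
  the triangle inequality.\<close>

lemma Cc_translation_kernel:
  fixes f g :: "('n::finite) heis \<Rightarrow> real"
  assumes "f \<in> Cc" "g \<in> Cc"
  shows "(\<lambda>x. g (fst x) * f (- fst x \<odot> snd x)) \<in> Cc"
proof -
  obtain R where R: "\<And>x. R < hnorm x \<Longrightarrow> f x = 0" using Cc_supp_hnorm[OF assms(1)] by blast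
  obtain S where S: "\<And>x. S < hnorm x \<Longrightarrow> g x = 0" using Cc_supp_hnorm[OF assms(2)] by blast
  define T where "T = max S (S + R)"
  have z: "g p * f (- p \<odot> q) = 0" if "T < hnorm p \<or> T < hnorm q" for p q
  proof (rule ccontr)
    assume "g p * f (- p \<odot> q) \<noteq> 0"
    then have "hnorm p \<le> S" "hnorm (- p \<odot> q) \<le> R" using R[of "- p \<odot> q"] S[of p] by (auto simp flip: not_less)
    moreover have "hnorm q \<le> hnorm p + hnorm (- p \<odot> q)" by (metis hmul_cancel(2) hnorm_triangle)
    ultimately show False using that by (auto simp: T_def)
  qed
  show ?thesis
  proof (rule Cc_prodI[where R="T + T\<^sup>2"])
    have "continuous_on UNIV (\<lambda>x :: 'n heis \<times> 'n heis. f (- fst x \<odot> snd x))"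
      by (rule continuous_on_compose2[OF Cc_cont[OF assms(1)]]) (auto intro!: continuous_intros)
    moreover have "continuous_on UNIV (\<lambda>x :: 'n heis \<times> 'n heis. g (fst x))"
      by (rule continuous_on_compose2[OF Cc_cont[OF assms(2)]]) (auto intro!: continuous_intros)
    ultimately show "continuous_on UNIV (\<lambda>x. g (fst x) * f (- fst x \<odot> snd x))" by (rule continuous_on_mult[rotated])
  next
    fix p q :: "'n heis" assume "T + T\<^sup>2 < norm p \<or> T + T\<^sup>2 < norm q"
    then have "T < hnorm p \<or> T < hnorm q" using norm_le_of_hnorm[of p T] norm_le_of_hnorm[of q T] by linarith
    then show "g (fst (p, q)) * f (- fst (p, q) \<odot> snd (p, q)) = 0" using z by simp
  qed
qed

text \<open>The order of quantifiers matters: \<open>R\<close> does not depend on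
  \<open>\<eta>\<close>, so that the mass of \<open>cutoff R\<close> is known before
  \<open>\<eta>\<close> is chosen in terms of it.\<close>

lemma translate_uniform:
  fixes f :: "('n::finite) heis \<Rightarrow> real"
  assumes "f \<in> Cc"
  obtains R where "\<And>\<eta>. \<eta> > 0 \<Longrightarrow> \<exists>\<epsilon>>0. \<forall>p'\<in>hball p \<epsilon>. \<forall>x. \<bar>f (- p' \<odot> x) - f (- p \<odot> x)\<bar> \<le> \<eta> * cutoff R x"
proof -
  \<comment> \<open>The cut-off factor is 1 for base points within distance 1 of \<open>p\<close>
    and makes the translated function compactly supported in both variables jointly.\<close>
  define F where "F x = cutoff (norm p + 1) (fst x) * f (- fst x \<odot> snd x)" for x :: "'n heis \<times> 'n heis"
  have F: "F \<in> Cc" unfolding F_def[abs_def] by (rule Cc_translation_kernel[OF assms cutoff_Cc])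
  obtain R where R: "\<And>p q. R < norm p \<or> R < norm q \<Longrightarrow> F (p, q) = 0" using Cc_prod_support[OF F] by metis
  show thesis
  proof (rule that[of R])
    fix \<eta> :: real assume "\<eta> > 0"
    obtain \<delta> where \<delta>: "\<delta> > 0" "\<And>x y. dist x y < \<delta> \<Longrightarrow> \<bar>F x - F y\<bar> < \<eta>" using Cc_uniform[OF F \<open>\<eta> > 0\<close>] by blast
    obtain \<epsilon> where \<epsilon>: "\<epsilon> > 0" "hball p \<epsilon> \<subseteq> ball p (min \<delta> 1)" using hdist_ball_subset[of "ball p (min \<delta> 1)" p] \<delta>(1) by auto
    have "\<bar>f (- p' \<odot> x) - f (- p \<odot> x)\<bar> \<le> \<eta> * cutoff R x" if "p' \<in> hball p \<epsilon>" for p' x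
    proof -
      have d: "dist p p' < \<delta>" "dist p p' < 1" using that \<epsilon> by auto
      then have n: "norm p' \<le> norm p + 1" using norm_triangle_ineq2[of p' p] by (simp add: dist_norm norm_minus_commute)
      have Fe: "F (p', x) = f (- p' \<odot> x)" "F (p, x) = f (- p \<odot> x)" using n by (simp_all add: F_def cutoff_props)
      moreover have "dist (p', x) (p, x) < \<delta>" using d by (simp add: dist_Pair_Pair dist_commute)
      ultimately have "\<bar>f (- p' \<odot> x) - f (- p \<odot> x)\<bar> < \<eta>" using \<delta>(2)[of "(p', x)" "(p, x)"] by simp
      then show ?thesis using Fe R[of p' x] R[of p x] \<open>\<eta> > 0\<close>
        by (cases "norm x \<le> R") (auto simp: cutoff_props)
    qed
    then show "\<exists>\<epsilon>>0. \<forall>p'\<in>hball p \<epsilon>. \<forall>x. \<bar>f (- p' \<odot> x) - f (- p \<odot> x)\<bar> \<le> \<eta> * cutoff R x" using \<epsilon>(1) by blast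
  qed
qed

text \<open>The covering lemma with enlargement factor 5, by Zorn's lemma. Only bounded radii are
  assumed, so there need not be a largest ball; a ball of more than half the supremal radius takes
  its place.\<close>

lemma hball_Vitali:
  fixes c :: "'i \<Rightarrow> ('n::finite) heis"
  assumes \<rho>: "\<And>i. i \<in> I \<Longrightarrow> 0 < \<rho> i \<and> \<rho> i \<le> B"
  obtains J where "J \<subseteq> I" "countable J" "disjoint_family_on (\<lambda>i. hball (c i) (\<rho> i)) J"
    "\<And>i. i \<in> I \<Longrightarrow> \<exists>j\<in>J. hball (c i) (\<rho> i) \<subseteq> hball (c j) (5 * \<rho> j)"
proof -
  let ?b = "\<lambda>i. hball (c i) (\<rho> i)"
  define meets where "meets i j \<longleftrightarrow> ?b i \<inter> ?b j \<noteq> {}" for i j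
  have self: "c i \<in> ?b i" if "i \<in> I" for i using \<rho>[OF that] by (simp add: hball_def)
  \<comment> \<open>The last condition is the one that survives unions of chains: whatever meets the
    family also meets a member of at least half its radius.\<close>
  define Fam where "Fam = {J. J \<subseteq> I \<and> disjoint_family_on ?b J \<and>
    (\<forall>i\<in>I. (\<exists>j\<in>J. meets i j) \<longrightarrow> (\<exists>j\<in>J. meets i j \<and> \<rho> i \<le> 2 * \<rho> j))}"
  have "{} \<in> Fam" by (simp add: Fam_def disjoint_family_on_def)
  have "\<exists>M\<in>Fam. \<forall>X\<in>Fam. M \<subseteq> X \<longrightarrow> X = M"
  proof (rule subset_Zorn_nonempty)
    fix C assume C: "C \<noteq> {}" "subset.chain Fam C"
    have chF: "C \<subseteq> Fam" and ch: "\<And>A A'. A \<in> C \<Longrightarrow> A' \<in> C \<Longrightarrow> A \<subseteq> A' \<or> A' \<subseteq> A"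
      using C(2) unfolding subset_chain_def by auto
    have dis: "?b i \<inter> ?b j = {}" if ij: "i \<in> \<Union>C" "j \<in> \<Union>C" "i \<noteq> j" for i j
    proof -
      obtain A where "A \<in> C" "i \<in> A" using ij(1) by blast
      moreover obtain A' where "A' \<in> C" "j \<in> A'" using ij(2) by blast
      ultimately have "\<exists>D\<in>C. i \<in> D \<and> j \<in> D" using ch[of A A'] by (metis subsetD)
      then obtain D where D: "D \<in> C" "i \<in> D" "j \<in> D" by (elim bexE conjE)
      then have "D \<in> Fam" using subsetD[OF chF] by simp
      then have "disjoint_family_on ?b D" by (simp add: Fam_def)
      then show ?thesis using D ij(3) unfolding disjoint_family_on_def by simp
    qed
    have "\<exists>j\<in>\<Union>C. meets i j \<and> \<rho> i \<le> 2 * \<rho> j" if i: "i \<in> I" "j \<in> \<Union>C" "meets i j" for i j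
    proof -
      obtain A where A: "A \<in> C" "j \<in> A" using i by blast
      then have "A \<in> Fam" using subsetD[OF chF] by simp
      then have "\<exists>j\<in>A. meets i j \<and> \<rho> i \<le> 2 * \<rho> j" using i A unfolding Fam_def by blast
      then show ?thesis using A by blast
    qed
    moreover have "\<Union>C \<subseteq> I" using chF by (auto simp: Fam_def)
    ultimately show "\<Union>C \<in> Fam" using dis unfolding Fam_def disjoint_family_on_def by blast
  qed (use \<open>{} \<in> Fam\<close> in blast)
  then obtain J where J: "J \<in> Fam" "\<And>X. X \<in> Fam \<Longrightarrow> J \<subseteq> X \<Longrightarrow> X = J" by blast
  have JI: "J \<subseteq> I" and Jd: "disjoint_family_on ?b J" using J(1) by (auto simp: Fam_def)
  have all: "\<exists>j\<in>J. meets i j" if "i \<in> I" for i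
  proof (rule ccontr)
    assume "\<not> (\<exists>j\<in>J. meets i j)"
    \<comment> \<open>Among the balls that miss the family, one of more than half the supremal
      radius can be added without leaving \<open>Fam\<close>, against maximality.\<close>
    define I' where "I' = {i\<in>I. \<not> (\<exists>j\<in>J. meets i j)}"
    have "i \<in> I'" using that \<open>\<not> _\<close> by (simp add: I'_def)
    have bdd: "bdd_above (\<rho> ` I')" using \<rho> by (intro bdd_aboveI[of _ B]) (auto simp: I'_def)
    have "0 < \<rho> i" using \<rho> that by blast
    also have "\<rho> i \<le> Sup (\<rho> ` I')" using \<open>i \<in> I'\<close> bdd by (intro cSup_upper) auto
    finally have "Sup (\<rho> ` I') / 2 < Sup (\<rho> ` I')" by simp
    then obtain k where k: "k \<in> I'" "Sup (\<rho> ` I') / 2 < \<rho> k"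
      using less_cSupD[of "\<rho> ` I'", OF _ \<open>Sup (\<rho> ` I') / 2 < _\<close>] \<open>i \<in> I'\<close> by blast
    have big: "\<rho> i' \<le> 2 * \<rho> k" if "i' \<in> I'" for i'
    proof -
      have "\<rho> i' \<le> Sup (\<rho> ` I')" using that bdd by (intro cSup_upper) auto
      then show ?thesis using k by simp
    qed
    have kJ: "k \<notin> J" using k(1) self[of k] by (auto simp: I'_def meets_def)
    have "insert k J \<in> Fam"
      unfolding Fam_def
    proof (intro CollectI conjI ballI impI)
      show "insert k J \<subseteq> I" using JI k by (auto simp: I'_def)
      show "disjoint_family_on ?b (insert k J)" using Jd k(1)
        unfolding disjoint_family_on_def I'_def meets_def by blast
      fix i' assume i': "i' \<in> I" "\<exists>j\<in>insert k J. meets i' j"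
      show "\<exists>j\<in>insert k J. meets i' j \<and> \<rho> i' \<le> 2 * \<rho> j"
      proof (cases "\<exists>j\<in>J. meets i' j")
        case True
        then show ?thesis using J(1) i' unfolding Fam_def by blast
      next
        case False
        then have "i' \<in> I'" using i' by (simp add: I'_def)
        then show ?thesis using big False i' by blast
      qed
    qed
    then show False using J(2)[of "insert k J"] kJ by blast
  qed
  have cover: "\<exists>j\<in>J. ?b i \<subseteq> hball (c j) (5 * \<rho> j)" if "i \<in> I" for i
  proof -
    obtain j where j: "j \<in> J" "meets i j" "\<rho> i \<le> 2 * \<rho> j"
      using all[OF \<open>i \<in> I\<close>] J(1) \<open>i \<in> I\<close> unfolding Fam_def by blast
    then obtain x where x: "hdist (c i) x \<le> \<rho> i" "hdist (c j) x \<le> \<rho> j" by (auto simp: meets_def hball_def)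
    \<comment> \<open>A point of the smaller ball is within \<open>\<rho> j + 2 * \<rho> i\<close>
      of the larger centre, and \<open>\<rho> i \<le> 2 * \<rho> j\<close>; this gives the factor
      5.\<close>
    have "hdist (c j) y \<le> 5 * \<rho> j" if "hdist (c i) y \<le> \<rho> i" for y
      using hdist_triangle[of "c j" y x] hdist_triangle[of x y "c i"] hdist_commute[of x "c i"] x j(3) that by linarith
    then have "?b i \<subseteq> hball (c j) (5 * \<rho> j)" unfolding hball_def by blast
    then show ?thesis using j(1) by blast
  qed
  have "countable J"
  proof -
    \<comment> \<open>Disjoint balls with positive radii contain different points of a countable
      dense set.\<close>
    obtain D :: "'n heis set" where D: "countable D" "\<And>X. open X \<Longrightarrow> X \<noteq> {} \<Longrightarrow> \<exists>d\<in>D. d \<in> X"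
      using countable_dense_setE by blast
    have "\<exists>d\<in>D. hdist (c j) d < \<rho> j" if "j \<in> J" for j
      using D(2)[OF open_hdist_ball, of "c j" "\<rho> j"] \<rho>[of j] JI that by (force intro: exI[of _ "c j"])
    then obtain d where d: "\<And>j. j \<in> J \<Longrightarrow> d j \<in> D \<and> hdist (c j) (d j) < \<rho> j" by metis
    have "inj_on d J"
    proof (rule inj_onI)
      fix i j assume ij: "i \<in> J" "j \<in> J" "d i = d j"
      then have "d i \<in> ?b i \<inter> ?b j" using d[of i] d[of j] by (auto simp: hball_def)
      then show "i = j" using Jd ij unfolding disjoint_family_on_def by blast
    qed
    moreover have "countable (d ` J)" using d by (intro countable_subset[OF _ D(1)]) auto
    ultimately show ?thesis by (metis countable_image_inj_eq)
  qed
  then show thesis using that JI Jd cover by blast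
qed

section \<open>Blow-ups of a locally finite measure and their cluster points\<close>

locale heis_measure =
  fixes \<mu> :: "('n::finite) heis measure" and s :: real
  assumes sets_\<mu> [measurable_cong]: "sets \<mu> = sets borel"
    and fin_compact: "compact K \<Longrightarrow> emeasure \<mu> K < \<infinity>"
    and s_pos: "s > 0"
begin

lemma space_\<mu> [simp]: "space \<mu> = UNIV"
  using sets_eq_imp_space_eq[OF sets_\<mu>] by simp

lemma borel_sets [simp]: "A \<in> sets borel \<Longrightarrow> A \<in> sets \<mu>" by (simp add: sets_\<mu>)

lemma borel_meas [simp]: "f \<in> borel_measurable borel \<Longrightarrow> f \<in> borel_measurable \<mu>"
  using measurable_cong_sets[OF sets_\<mu> refl] by blast

lemma hball_fin [simp]: "emeasure \<mu> (hball p r) < \<infinity>" "emeasure \<mu> (hball p r) \<noteq> \<infinity>"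
  using fin_compact[OF compact_hball, of p r] by (simp_all only: infinity_ennreal_def less_top)

lemma hball_fmeas [simp]: "hball p r \<in> fmeasurable \<mu>"
  by (intro fmeasurableI hball_fin) auto

lemma integrable_indicator_hball [simp]: "integrable \<mu> (indicator (hball p r) :: _ \<Rightarrow> real)"
  by (rule integrable_real_indicator) (use hball_fin(1) in \<open>auto simp flip: infinity_ennreal_def\<close>)

lemma integrable_bounded_support:
  fixes f :: "'n heis \<Rightarrow> real"
  assumes "f \<in> borel_measurable borel" "\<And>q. \<bar>f q\<bar> \<le> B" "\<And>q. q \<notin> hball a r \<Longrightarrow> f q = 0"
  shows "integrable \<mu> f"
proof (rule Bochner_Integration.integrable_bound)
  show "integrable \<mu> (\<lambda>q. B * indicator (hball a r) q :: real)" by (intro integrable_mult_right integrable_indicator_hball)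
  show "f \<in> borel_measurable \<mu>" using assms(1) by simp
  have "0 \<le> B" using assms(2)[of undefined] by linarith
  then show "AE x in \<mu>. norm (f x) \<le> norm (B * indicator (hball a r) x :: real)"
    using assms by (auto simp: indicator_def)
qed

lemma integral_bounded_support:
  fixes f :: "'n heis \<Rightarrow> real"
  assumes "f \<in> borel_measurable borel" "\<And>q. \<bar>f q\<bar> \<le> B" "\<And>q. q \<notin> hball a r \<Longrightarrow> f q = 0"
  shows "\<bar>LINT q|\<mu>. f q\<bar> \<le> B * measure \<mu> (hball a r)"
proof -
  have "0 \<le> B" using assms(2)[of undefined] by linarith
  have "norm (LINT q|\<mu>. f q) \<le> (LINT q|\<mu>. norm (f q))" by simp
  also have "\<dots> \<le> (LINT q|\<mu>. B * indicator (hball a r) q)"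
    using assms \<open>0 \<le> B\<close> by (intro integral_mono integrable_norm integrable_bounded_support[OF assms] integrable_mult_right integrable_indicator_hball)
      (auto simp: indicator_def)
  also have "\<dots> = B * measure \<mu> (hball a r)" by simp
  finally show ?thesis by simp
qed

lemma integrable_Cc: assumes "f \<in> Cc" shows "integrable \<mu> f"
proof -
  obtain R where R: "R > 0" "\<And>x. R < hnorm x \<Longrightarrow> f x = 0" using Cc_supp_hnorm[OF assms] by blast
  obtain B S where B: "B > 0" "\<And>x. \<bar>f x\<bar> \<le> B * cutoff S x" using Cc_le_cutoff[OF assms] by metis
  have "\<bar>f x\<bar> \<le> B" for x using B(2)[of x] cutoff_props(2)[of S x] B(1) by (smt (verit) mult_left_le)
  then show ?thesis using R
    by (intro integrable_bounded_support[of f B 0 R] borel_measurable_continuous_onI Cc_cont assms) (auto simp: hball_def)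
qed

definition blow :: "'n heis \<Rightarrow> real \<Rightarrow> ('n heis \<Rightarrow> real) \<Rightarrow> real" where
  "blow a r f = r powr (- s) * (LINT q|\<mu>. f (blowup a r q))"

lemma Cc_blowup: "f \<in> Cc \<Longrightarrow> r > 0 \<Longrightarrow> (\<lambda>q. f (blowup a r q)) \<in> Cc"
  unfolding blowup_eq by (rule Cc_left) auto

lemma posfun_blow: "r > 0 \<Longrightarrow> posfun (blow a r)"
  unfolding posfun_def blow_def
  by (auto simp: Cc_blowup integrable_Cc algebra_simps simp del: zero_le_mult_iff intro!: mult_nonneg_nonneg Bochner_Integration.integral_nonneg)

lemma blow_hdilation:
  assumes "r > 0" "t > 0"
  shows "blow a (r * t) f = t powr (- s) * blow a r (\<lambda>q. f (hdilation (1 / t) q))"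
  using assms by (simp add: blow_def blowup_eq powr_mult mult_ac)

text \<open>Moving the base point by \<open>hdilation r p\<close> changes the blow-up at scale
  \<open>r\<close> by a translation by \<open>p\<close> of unit size. The translation invariance of
  tangent functionals rests on this.\<close>

lemma blow_translate:
  assumes "r > 0"
  shows "blow (a \<odot> hdilation r p) r f = blow a r (\<lambda>q. f (- p \<odot> q))"
  using assms by (simp add: blow_def blowup_eq uminus_hmul hmul_assoc hdilation_hmul flip: hdilation_uminus)

definition upper_ad :: "'n heis \<Rightarrow> real \<Rightarrow> real \<Rightarrow> bool" where
  "upper_ad a M \<rho> \<longleftrightarrow> 0 < M \<and> 0 < \<rho> \<and> (\<forall>r. 0 < r \<longrightarrow> r < \<rho> \<longrightarrow> measure \<mu> (hball a r) \<le> M * r powr s)"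

lemma blow_le:
  fixes f :: "'n heis \<Rightarrow> real"
  assumes "f \<in> Cc" "\<And>x. f x \<le> 1" "\<And>x. 0 \<le> f x" "\<And>x. hdist p x > \<epsilon> \<Longrightarrow> f x = 0" "r > 0"
  shows "blow a r f \<le> r powr (- s) * measure \<mu> (hball (a \<odot> hdilation r p) (\<epsilon> * r))"
proof -
  have "\<bar>LINT q|\<mu>. f (blowup a r q)\<bar> \<le> 1 * measure \<mu> (hball (a \<odot> hdilation r p) (\<epsilon> * r))"
  proof (rule integral_bounded_support)
    show "(\<lambda>q. f (blowup a r q)) \<in> borel_measurable borel"
      using assms by (intro borel_measurable_continuous_onI Cc_cont Cc_blowup)
    show "\<bar>f (blowup a r q)\<bar> \<le> 1" for q using assms by simp
    fix q assume "q \<notin> hball (a \<odot> hdilation r p) (\<epsilon> * r)"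
    then have "\<epsilon> * r < hnorm (- hdilation r p \<odot> (- a \<odot> q))" by (simp add: hball_def hdist_eq uminus_hmul hmul_assoc)
    also have "- hdilation r p \<odot> (- a \<odot> q) = hdilation r (- p \<odot> blowup a r q)"
      using assms(5) by (simp add: blowup_eq hdilation_hmul hdilation_uminus)
    finally have "\<epsilon> < hdist p (blowup a r q)" using assms(5) by (simp add: hdist_eq hnorm_hdilation mult.commute)
    then show "f (blowup a r q) = 0" by (rule assms)
  qed
  then show ?thesis unfolding blow_def using assms(5) by (intro mult_left_mono) auto
qed

lemma blow_cutoff_bound:
  assumes "upper_ad a M \<rho>"
  obtains C where "\<And>r. 0 < r \<Longrightarrow> r < 1 / C \<Longrightarrow> blow a r (cutoff R) \<le> C" "C > 0"
proof -
  obtain S where S: "S > 0" "\<And>p :: 'n heis. norm p \<le> R + 1 \<Longrightarrow> hnorm p \<le> S" using hnorm_le_of_norm by blast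
  \<comment> \<open>One constant plays two roles, as a bound and as the reciprocal of the admissible
    radius; the second entry of the maximum ensures \<open>S * r < \<rho>\<close>.\<close>
  define C where "C = max (M * S powr s) (S / \<rho>)"
  have \<rho>: "\<rho> > 0" "M > 0" using assms by (auto simp: upper_ad_def)
  have C: "C > 0" using S \<rho> by (auto simp: C_def less_max_iff_disj)
  have "blow a r (cutoff R) \<le> C" if r: "0 < r" "r < 1 / C" for r
  proof -
    have "blow a r (cutoff R) \<le> r powr (- s) * measure \<mu> (hball (a \<odot> hdilation r 0) (S * r))"
    proof (rule blow_le)
      fix x :: "'n heis" assume "S < hdist 0 x"
      then have "R + 1 < norm x" using S(2)[of x] by force
      then show "cutoff R x = 0" by (simp add: cutoff_props)
    qed (auto simp: cutoff_props r)
    also have "S * r < \<rho>"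
    proof -
      have "r * (S / \<rho>) \<le> r * C" using r by (intro mult_left_mono) (auto simp: C_def)
      also have "\<dots> < 1" using r C by (simp add: field_simps)
      finally show ?thesis using \<rho> by (simp add: field_simps)
    qed
    then have "r powr (- s) * measure \<mu> (hball (a \<odot> hdilation r 0) (S * r)) \<le> r powr (- s) * (M * (S * r) powr s)"
      using assms r S by (intro mult_left_mono) (auto simp: upper_ad_def)
    also have "\<dots> = M * S powr s" using r S by (simp add: powr_mult powr_minus)
    also have "\<dots> \<le> C" by (simp add: C_def)
    finally show ?thesis .
  qed
  then show thesis using C that by blast
qed

text \<open>The cluster points of \<open>blow a r\<close> as \<open>r \<rightarrow> 0\<close>. Convergence on the test functions suffices, as the
  upper density bounds the masses locally.\<close>
definition Tanf :: "'n heis \<Rightarrow> (('n heis \<Rightarrow> real) \<Rightarrow> real) set" where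
  "Tanf a = {\<Lambda>. posfun \<Lambda> \<and> (\<forall>k::nat. \<exists>r. 0 < r \<and> r < 1 / real (Suc k) \<and>
     (\<forall>j\<le>k. \<bar>blow a r (test_fun j) - \<Lambda> (test_fun j)\<bar> < 1 / real (Suc k)))}"

lemma Tanf_I:
  assumes "posfun \<Lambda>" "\<And>i. 0 < r i" "r \<longlonglongrightarrow> 0" "\<And>j. (\<lambda>i::nat. blow a (r i) (test_fun j)) \<longlonglongrightarrow> \<Lambda> (test_fun j)"
  shows "\<Lambda> \<in> Tanf a"
  unfolding Tanf_def
proof (intro CollectI conjI allI)
  fix k :: nat
  have "\<forall>\<^sub>F i in sequentially. \<forall>j\<in>{..k}. dist (blow a (r i) (test_fun j)) (\<Lambda> (test_fun j)) < 1 / real (Suc k)"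
    by (intro eventually_ball_finite ballI tendstoD[OF assms(4)]) auto
  moreover have "\<forall>\<^sub>F i in sequentially. r i < 1 / real (Suc k)" by (rule order_tendstoD[OF assms(3)]) auto
  ultimately have "\<forall>\<^sub>F i in sequentially. r i < 1 / real (Suc k) \<and> (\<forall>j\<in>{..k}. dist (blow a (r i) (test_fun j)) (\<Lambda> (test_fun j)) < 1 / real (Suc k))"
    by (rule eventually_elim2) auto
  then obtain i where "r i < 1 / real (Suc k) \<and> (\<forall>j\<in>{..k}. dist (blow a (r i) (test_fun j)) (\<Lambda> (test_fun j)) < 1 / real (Suc k))"
    unfolding eventually_sequentially by blast
  then show "\<exists>r. 0 < r \<and> r < 1 / real (Suc k) \<and> (\<forall>j\<le>k. \<bar>blow a r (test_fun j) - \<Lambda> (test_fun j)\<bar> < 1 / real (Suc k))"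
    using assms(2)[of i] by (intro exI[of _ "r i"]) (auto simp: dist_real_def)
qed (rule assms)

lemma Tanf_seq:
  assumes a: "upper_ad a M \<rho>" and "\<Lambda> \<in> Tanf a"
  obtains r where "\<And>i::nat. 0 < r i" "r \<longlonglongrightarrow> 0" "\<And>f. f \<in> Cc \<Longrightarrow> (\<lambda>i. blow a (r i) f) \<longlonglongrightarrow> \<Lambda> f"
proof -
  have pos: "posfun \<Lambda>" using assms by (simp add: Tanf_def)
  have "\<forall>k. \<exists>r. 0 < r \<and> r < 1 / real (Suc k) \<and> (\<forall>j\<le>k. \<bar>blow a r (test_fun j) - \<Lambda> (test_fun j)\<bar> < 1 / real (Suc k))"
    using assms by (simp add: Tanf_def)
  then obtain r where r: "\<And>k. 0 < r k" "\<And>k. r k < 1 / real (Suc k)"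
    "\<And>k j. j \<le> k \<Longrightarrow> \<bar>blow a (r k) (test_fun j) - \<Lambda> (test_fun j)\<bar> < 1 / real (Suc k)" by metis
  have "(\<lambda>k. 1 / real (Suc k)) \<longlonglongrightarrow> 0" by (rule LIMSEQ_Suc[OF lim_1_over_n])
  then have r0: "r \<longlonglongrightarrow> 0" by (rule tendsto_sandwich[rotated 3, where f="\<lambda>_. 0"]) (use r in \<open>auto intro!: always_eventually less_imp_le\<close>)
  have lim: "(\<lambda>i. blow a (r i) (test_fun j)) \<longlonglongrightarrow> \<Lambda> (test_fun j)" for j
  proof -
    have "\<forall>\<^sub>F k in sequentially. norm (blow a (r k) (test_fun j) - \<Lambda> (test_fun j)) \<le> 1 / real (Suc k)"
      using eventually_ge_at_top[of j] by eventually_elim (use r(3) in \<open>auto intro: less_imp_le\<close>)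
    then have "(\<lambda>k. blow a (r k) (test_fun j) - \<Lambda> (test_fun j)) \<longlonglongrightarrow> 0"
      by (rule Lim_null_comparison) (rule \<open>(\<lambda>k. 1 / real (Suc k)) \<longlonglongrightarrow> 0\<close>)
    then show ?thesis by (simp add: LIM_zero_iff)
  qed
  have bd: "\<exists>C. \<forall>i. blow a (r i) (cutoff R) \<le> C" for R
  proof -
    obtain C where C: "\<And>r. 0 < r \<Longrightarrow> r < 1 / C \<Longrightarrow> blow a r (cutoff R) \<le> C" "C > 0" using blow_cutoff_bound[OF a] by metis
    have "\<forall>\<^sub>F i in sequentially. r i < 1 / C" using C(2) by (intro order_tendstoD[OF r0]) auto
    then obtain N where N: "\<And>i. i \<ge> N \<Longrightarrow> r i < 1 / C" by (auto simp: eventually_sequentially)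
    have "blow a (r i) (cutoff R) \<le> Max (insert C ((\<lambda>i. blow a (r i) (cutoff R)) ` {..<N}))" for i
    proof (cases "i < N")
      case False
      then show ?thesis using C(1)[of "r i"] r(1) N[of i] by (simp add: Max_ge_iff)
    qed (auto intro!: Max_ge)
    then show ?thesis by blast
  qed
  show thesis
    by (rule that[OF r(1) r0], rule posfun_tendsto[OF posfun_blow[OF r(1)] pos bd lim])
qed

lemma Tanf_closed:
  assumes "\<And>i::nat. \<Lambda>i i \<in> Tanf a" "posfun \<Lambda>" "\<And>j. (\<lambda>i. \<Lambda>i i (test_fun j)) \<longlonglongrightarrow> \<Lambda> (test_fun j)"
  shows "\<Lambda> \<in> Tanf a"
  unfolding Tanf_def
proof (intro CollectI conjI allI)
  fix k :: nat
  have "\<forall>\<^sub>F i in sequentially. \<forall>j\<in>{..k}. dist (\<Lambda>i i (test_fun j)) (\<Lambda> (test_fun j)) < 1 / real (2 * Suc k)"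
    by (intro eventually_ball_finite ballI tendstoD[OF assms(3)]) auto
  then obtain i where i: "\<And>j. j \<le> k \<Longrightarrow> \<bar>\<Lambda>i i (test_fun j) - \<Lambda> (test_fun j)\<bar> < 1 / real (2 * Suc k)"
    by (auto simp: eventually_sequentially dist_real_def)
  \<comment> \<open>The index \<open>2 * k + 1\<close> halves the tolerance, since its successor is
    \<open>2 * Suc k\<close>; it also includes all test functions up to \<open>k\<close>.\<close>
  obtain r where r: "0 < r" "r < 1 / real (Suc (2 * k + 1))"
    "\<And>j. j \<le> 2 * k + 1 \<Longrightarrow> \<bar>blow a r (test_fun j) - \<Lambda>i i (test_fun j)\<bar> < 1 / real (Suc (2 * k + 1))"
    using assms(1)[of i] unfolding Tanf_def by blast
  define d where "d = 1 / real (Suc k)"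
  have e: "1 / real (Suc (2 * k + 1)) = d / 2" "1 / real (2 * Suc k) = d / 2" "1 / real (Suc k) = d" "d > 0"
    by (auto simp: d_def field_simps)
  have "\<bar>blow a r (test_fun j) - \<Lambda> (test_fun j)\<bar> < 1 / real (Suc k)" if "j \<le> k" for j
  proof -
    have "j \<le> 2 * k + 1" using that by simp
    then show ?thesis
      using i[OF that] r(3)[OF \<open>j \<le> 2 * k + 1\<close>] unfolding e by linarith
  qed
  moreover have "r < 1 / real (Suc k)" using r(2) e(4) unfolding e by linarith
  ultimately show "\<exists>r. 0 < r \<and> r < 1 / real (Suc k) \<and> (\<forall>j\<le>k. \<bar>blow a r (test_fun j) - \<Lambda> (test_fun j)\<bar> < 1 / real (Suc k))"
    using r(1) by blast
qed (rule assms)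

lemma Tanf_posfun: "\<Lambda> \<in> Tanf a \<Longrightarrow> posfun \<Lambda>"
  by (simp add: Tanf_def)

lemma Tanf_bound:
  assumes a: "upper_ad a M \<rho>"
  obtains C where "\<And>\<Lambda>. \<Lambda> \<in> Tanf a \<Longrightarrow> \<Lambda> (cutoff R) \<le> C"
proof -
  obtain C where C: "\<And>r. 0 < r \<Longrightarrow> r < 1 / C \<Longrightarrow> blow a r (cutoff R) \<le> C" "C > 0" using blow_cutoff_bound[OF a] by metis
  have "\<Lambda> (cutoff R) \<le> C" if "\<Lambda> \<in> Tanf a" for \<Lambda>
  proof -
    obtain r where r: "\<And>i::nat. 0 < r i" "r \<longlonglongrightarrow> 0" "\<And>f. f \<in> Cc \<Longrightarrow> (\<lambda>i. blow a (r i) f) \<longlonglongrightarrow> \<Lambda> f"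
      using Tanf_seq[OF a \<open>\<Lambda> \<in> Tanf a\<close>] by blast
    have "\<forall>\<^sub>F i in sequentially. r i < 1 / C" using C(2) by (intro order_tendstoD[OF r(2)]) auto
    then have "\<forall>\<^sub>F i in sequentially. blow a (r i) (cutoff R) \<le> C" by eventually_elim (use C r in auto)
    then show ?thesis using r(3)[OF cutoff_Cc] by (intro tendsto_upperbound[of _ _ sequentially]) auto
  qed
  then show thesis using that by blast
qed

lemma Tanf_compact:
  assumes a: "upper_ad a M \<rho>" and "\<And>i::nat. \<Lambda> i \<in> Tanf a"
  obtains \<sigma> N where "strict_mono \<sigma>" "N \<in> Tanf a" "\<And>f. f \<in> Cc \<Longrightarrow> (\<lambda>i. \<Lambda> (\<sigma> i) f) \<longlonglongrightarrow> N f"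
proof -
  have "\<exists>C. \<forall>i. \<Lambda> i (cutoff R) \<le> C" for R using Tanf_bound[OF a] assms(2) by metis
  then obtain \<sigma> N where N: "strict_mono \<sigma>" "posfun N" "\<And>f. f \<in> Cc \<Longrightarrow> (\<lambda>i. \<Lambda> (\<sigma> i) f) \<longlonglongrightarrow> N f"
    using posfun_compact[of \<Lambda>] Tanf_posfun[OF assms(2)] by blast
  moreover have "N \<in> Tanf a" by (rule Tanf_closed[of "\<lambda>i. \<Lambda> (\<sigma> i)"]) (use N assms(2) in auto)
  ultimately show thesis using that by blast
qed

lemma Tanf_nonempty:
  assumes a: "upper_ad a M \<rho>" shows "Tanf a \<noteq> {}"
proof -
  define \<Lambda> where "\<Lambda> i = blow a (1 / real (Suc i))" for i :: nat
  have lim: "(\<lambda>k. 1 / real (Suc k)) \<longlonglongrightarrow> 0" by (rule LIMSEQ_Suc[OF lim_1_over_n])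
  have "\<exists>C. \<forall>i. \<Lambda> i (cutoff R) \<le> C" for R
  proof -
    obtain C where C: "\<And>r. 0 < r \<Longrightarrow> r < 1 / C \<Longrightarrow> blow a r (cutoff R) \<le> C" "C > 0" using blow_cutoff_bound[OF a] by metis
    have "\<forall>\<^sub>F i in sequentially. 1 / real (Suc i) < 1 / C" using C(2) by (intro order_tendstoD[OF lim]) auto
    then obtain N where N: "\<And>i. i \<ge> N \<Longrightarrow> 1 / real (Suc i) < 1 / C" by (auto simp: eventually_sequentially)
    have "\<Lambda> i (cutoff R) \<le> Max (insert C ((\<lambda>i. \<Lambda> i (cutoff R)) ` {..<N}))" for i
    proof (cases "i < N")
      case False
      then show ?thesis using C(1)[of "1 / real (Suc i)"] N[of i] by (simp add: Max_ge_iff \<Lambda>_def)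
    qed (auto intro!: Max_ge)
    then show ?thesis by blast
  qed
  moreover have "posfun (\<Lambda> i)" for i unfolding \<Lambda>_def by (rule posfun_blow) simp
  ultimately obtain \<sigma> N where N: "strict_mono \<sigma>" "posfun N" "\<And>f. f \<in> Cc \<Longrightarrow> (\<lambda>i. \<Lambda> (\<sigma> i) f) \<longlonglongrightarrow> N f"
    using posfun_compact[of \<Lambda>] by blast
  have "N \<in> Tanf a"
  proof (rule Tanf_I[where r="\<lambda>i. 1 / real (Suc (\<sigma> i))"])
    show "(\<lambda>i. 1 / real (Suc (\<sigma> i))) \<longlonglongrightarrow> 0"
      using LIMSEQ_subseq_LIMSEQ[OF lim N(1)] by (simp add: o_def)
    show "(\<lambda>i. blow a (1 / real (Suc (\<sigma> i))) (test_fun j)) \<longlonglongrightarrow> N (test_fun j)" for j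
      using N(3)[OF test_fun_Cc] by (simp add: \<Lambda>_def)
  qed (use N in auto)
  then show ?thesis by blast
qed

lemma Tanf_dilate:
  assumes a: "upper_ad a M \<rho>" and \<Lambda>: "\<Lambda> \<in> Tanf a" and t: "t > 0"
  shows "(\<lambda>f. t powr (- s) * \<Lambda> (\<lambda>q. f (hdilation (1 / t) q))) \<in> Tanf a"
proof -
  obtain r where r: "\<And>i::nat. 0 < r i" "r \<longlonglongrightarrow> 0" "\<And>f. f \<in> Cc \<Longrightarrow> (\<lambda>i. blow a (r i) f) \<longlonglongrightarrow> \<Lambda> f"
    using Tanf_seq[OF a \<Lambda>] by blast
  have lim: "(\<lambda>i. blow a (r i * t) f) \<longlonglongrightarrow> t powr (- s) * \<Lambda> (\<lambda>q. f (hdilation (1 / t) q))" if "f \<in> Cc" for f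
    unfolding blow_hdilation[OF r(1) t] by (intro tendsto_intros r(3) Cc_hdilation that) (use t in auto)
  show ?thesis
  proof (rule Tanf_I[where r="\<lambda>i. r i * t"])
    show "posfun (\<lambda>f. t powr (- s) * \<Lambda> (\<lambda>q. f (hdilation (1 / t) q)))"
      by (rule posfun_lim[of "\<lambda>i. blow a (r i * t)"]) (use r t lim in \<open>auto intro!: posfun_blow\<close>)
    show "(\<lambda>i. r i * t) \<longlonglongrightarrow> 0" using tendsto_mult_left_zero[OF r(2)] by simp
  qed (use r t lim in auto)
qed

lemma Tanf_bump_le:
  assumes a: "upper_ad a M \<rho>" and \<Lambda>: "\<Lambda> \<in> Tanf a"
  shows "\<Lambda> (bump 1) \<le> M * 2 powr s"
proof -
  obtain r where r: "\<And>i::nat. 0 < r i" "r \<longlonglongrightarrow> 0" "\<And>f. f \<in> Cc \<Longrightarrow> (\<lambda>i. blow a (r i) f) \<longlonglongrightarrow> \<Lambda> f"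
    using Tanf_seq[OF a \<Lambda>] by blast
  have "\<forall>\<^sub>F i in sequentially. r i < \<rho> / 2" using a by (intro order_tendstoD[OF r(2)]) (auto simp: upper_ad_def)
  then have "\<forall>\<^sub>F i in sequentially. blow a (r i) (bump 1) \<le> M * 2 powr s"
  proof eventually_elim
    case (elim i)
    have "blow a (r i) (bump 1) \<le> r i powr (- s) * measure \<mu> (hball (a \<odot> hdilation (r i) 0) (2 * r i))"
      by (rule blow_le) (auto simp: bump_bounds r bump_eq_0)
    also have "\<dots> \<le> r i powr (- s) * (M * (2 * r i) powr s)"
      using a elim r(1)[of i] by (intro mult_left_mono) (auto simp: upper_ad_def)
    also have "\<dots> = M * 2 powr s" using r(1)[of i] by (simp add: powr_mult powr_minus)
    finally show ?case .
  qed
  then show ?thesis using r(3)[OF bump_Cc, of 1] by (intro tendsto_upperbound[of _ _ sequentially]) auto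
qed

lemma Tanf_bump_ge:
  assumes a: "upper_ad a M \<rho>" and \<Lambda>: "\<Lambda> \<in> Tanf a"
    and c: "\<And>r. 0 < r \<Longrightarrow> r < \<rho> \<Longrightarrow> c * r powr s \<le> measure \<mu> (hball a r)"
  shows "c \<le> \<Lambda> (bump 1)"
proof -
  obtain r where r: "\<And>i::nat. 0 < r i" "r \<longlonglongrightarrow> 0" "\<And>f. f \<in> Cc \<Longrightarrow> (\<lambda>i. blow a (r i) f) \<longlonglongrightarrow> \<Lambda> f"
    using Tanf_seq[OF a \<Lambda>] by blast
  have "\<forall>\<^sub>F i in sequentially. r i < \<rho>" using a by (intro order_tendstoD[OF r(2)]) (auto simp: upper_ad_def)
  then have "\<forall>\<^sub>F i in sequentially. c \<le> blow a (r i) (bump 1)"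
  proof eventually_elim
    case (elim i)
    have "measure \<mu> (hball a (r i)) = (LINT q|\<mu>. indicator (hball a (r i)) q)" by simp
    also have "\<dots> \<le> (LINT q|\<mu>. bump 1 (blowup a (r i) q))"
    proof (rule integral_mono)
      show "integrable \<mu> (\<lambda>q. bump 1 (blowup a (r i) q))" by (intro integrable_Cc Cc_blowup r) auto
      show "indicator (hball a (r i)) q \<le> bump 1 (blowup a (r i) q)" for q
        using r(1)[of i] bump_bounds(1)[of 1 "blowup a (r i) q"]
        by (cases "q \<in> hball a (r i)") (auto simp: hball_def hdist_eq blowup_eq hnorm_hdilation bump_eq_1)
    qed auto
    finally have "c * r i powr s \<le> (LINT q|\<mu>. bump 1 (blowup a (r i) q))" using c[of "r i"] elim r(1)[of i] by linarith
    then have "r i powr (- s) * (c * r i powr s) \<le> blow a (r i) (bump 1)" unfolding blow_def by (intro mult_left_mono) auto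
    then show ?case using r(1)[of i] by (simp add: powr_minus field_simps)
  qed
  then show ?thesis using r(3)[OF bump_Cc, of 1] by (intro tendsto_lowerbound[of _ _ sequentially]) auto
qed

end

section \<open>Bounded kernel integrals and translations of tangent functionals\<close>

lemma posfun_compose:
  assumes pos: "posfun \<Lambda>" and h: "\<And>f. f \<in> Cc \<Longrightarrow> (\<lambda>q. f (h q)) \<in> Cc"
  shows "posfun (\<lambda>f. \<Lambda> (\<lambda>q. f (h q)))"
  unfolding posfun_def
  by (intro conjI ballI allI impI posfun_add[OF pos] posfun_cmult[OF pos] posfun_nonneg[OF pos] h; blast)

text \<open>Homogeneity of degree \<open>- s\<close> is what cancels the normalisation of blow-ups.
  As \<open>0 powr x = 0\<close>, the size bound also fixes the value 0 at the origin, where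
  continuity is not asked for.\<close>

definition homogeneous_kernel :: "real \<Rightarrow> (('n::finite) heis \<Rightarrow> real) \<Rightarrow> bool" where
  "homogeneous_kernel s k \<longleftrightarrow> k \<in> borel_measurable borel \<and> continuous_on (- {0}) k \<and>
     (\<exists>C. \<forall>q. \<bar>k q\<bar> \<le> C * hnorm q powr (- s)) \<and>
     (\<forall>r>0. \<forall>q. k (hdilation r q) = r powr (- s) * k q)"

lemma Cc_times_vanishing:
  fixes k :: "('n::finite) heis \<Rightarrow> real"
  assumes k: "continuous_on (- {0}) k" and g: "g \<in> Cc" and t: "t > 0" "\<And>q. hnorm q \<le> t \<Longrightarrow> g q = 0"
  shows "(\<lambda>q. k q * g q) \<in> Cc"
proof -
  obtain R where R: "\<And>x. R < norm x \<Longrightarrow> g x = 0" using Cc_supp[OF g] by blast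
  have "continuous_on ({q. hnorm q < t} \<union> - {0}) (\<lambda>q. k q * g q)"
  proof (rule continuous_on_open_Un)
    show "open {q :: 'n heis. hnorm q < t}" by (intro open_Collect_less continuous_intros)
    have "continuous_on {q. hnorm q < t} (\<lambda>q :: 'n heis. 0 :: real)" by simp
    then show "continuous_on {q. hnorm q < t} (\<lambda>q. k q * g q)"
      by (rule continuous_on_eq) (simp add: t)
    show "continuous_on (- {0}) (\<lambda>q. k q * g q)"
      by (intro continuous_on_mult k continuous_on_subset[OF Cc_cont[OF g]]) auto
  qed auto
  moreover have "{q :: 'n heis. hnorm q < t} \<union> - {0} = UNIV" using t by auto
  ultimately show ?thesis using R by (intro CcI[of _ R]) auto
qed

text \<open>On the range of \<open>t\<close> up to 1 it increases as \<open>t\<close> decreases, and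
  differences of two such cut-offs are differences of bumps. The monotonicity argument for kernels
  of one sign relies on both.\<close>

definition annulus_cutoff :: "real \<Rightarrow> ('n::finite) heis \<Rightarrow> real" where
  "annulus_cutoff t q = bump 1 q - bump t q"

lemma annulus_cutoff_Cc: "t > 0 \<Longrightarrow> annulus_cutoff t \<in> Cc"
  unfolding annulus_cutoff_def[abs_def] by simp

lemma annulus_cutoff_0: "0 < t \<Longrightarrow> t \<le> 1 \<Longrightarrow> hnorm q \<le> t \<Longrightarrow> annulus_cutoff t q = 0"
  by (simp add: annulus_cutoff_def bump_eq_1)

lemma kernel_annulus_Cc:
  "homogeneous_kernel s k \<Longrightarrow> 0 < t \<Longrightarrow> t \<le> 1 \<Longrightarrow> (\<lambda>q. k q * annulus_cutoff t q) \<in> Cc"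
  by (rule Cc_times_vanishing[of k _ t]) (auto simp: homogeneous_kernel_def annulus_cutoff_Cc annulus_cutoff_0)

context heis_measure begin

lemma emeasure_hball: "emeasure \<mu> (hball p r) = ennreal (measure \<mu> (hball p r))"
  by (rule emeasure_eq_ennreal_measure) (use hball_fin(2) in simp)

lemma left_translate_borel: "k \<in> borel_measurable borel \<Longrightarrow> (\<lambda>q. k (- a \<odot> q)) \<in> borel_measurable borel"
  by (rule measurable_compose[of _ borel borel]) (auto intro!: borel_measurable_continuous_onI continuous_intros)

text \<open>The sharp truncations differ from the continuous ones by integrals over annuli of bounded
  ratio, on which the kernel is controlled by the upper density.\<close>
lemma Tanf_kernel_bound:
  fixes k :: "'n heis \<Rightarrow> real"
  assumes a: "upper_ad a M \<rho>" and k: "homogeneous_kernel s k"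
    and T: "\<And>\<epsilon>. 0 < \<epsilon> \<Longrightarrow> \<epsilon> < 1 \<Longrightarrow> \<bar>LINT q:hball a 1 - hball a \<epsilon>|\<mu>. k (- a \<odot> q)\<bar> \<le> T"
  obtains C where "\<And>\<Lambda> t. \<Lambda> \<in> Tanf a \<Longrightarrow> 0 < t \<Longrightarrow> t \<le> 1 \<Longrightarrow> \<bar>\<Lambda> (\<lambda>q. k q * annulus_cutoff t q)\<bar> \<le> C"
proof -
  obtain K where K0: "\<And>q. \<bar>k q\<bar> \<le> K * hnorm q powr (- s)" using k by (auto simp: homogeneous_kernel_def)
  have "\<bar>k (0, 1)\<bar> \<le> K * hnorm (0 :: (real^'n) \<times> (real^'n), 1 :: real) powr (- s)" by (rule K0)
  then have K: "K \<ge> 0" by (simp add: hnorm_def)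
  have kb [measurable]: "(\<lambda>q. k (- a \<odot> q)) \<in> borel_measurable borel"
    using k by (intro left_translate_borel) (simp add: homogeneous_kernel_def)
  have bb [measurable]: "(\<lambda>q. bump r (- a \<odot> q)) \<in> borel_measurable borel" for r
    by (intro borel_measurable_continuous_onI continuous_intros)
  have M: "M > 0" "\<rho> > 0" using a by (auto simp: upper_ad_def)
  define ind where "ind r q = (indicator (hball a r) q :: real)" for r q
  have ind: "ind r q = (if hnorm (- a \<odot> q) \<le> r then 1 else 0)" for r q
    by (auto simp: ind_def hball_def hdist_eq indicator_def)
  have [measurable]: "ind r \<in> borel_measurable borel" for r unfolding ind_def by measurable
  have kle: "\<bar>k (- a \<odot> q)\<bar> \<le> K * t powr (- s)" if "0 < t" "t \<le> hnorm (- a \<odot> q)" for t q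
  proof -
    have "hnorm (- a \<odot> q) powr (- s) \<le> t powr (- s)" using that s_pos by (intro powr_mono2') auto
    then show ?thesis using K0[of "- a \<odot> q"] K by (meson mult_left_mono order_trans)
  qed
  \<comment> \<open>The error between continuous and sharp truncation at radius \<open>r\<close>. It
    lives between \<open>r\<close> and \<open>2 * r\<close>, where the kernel is at most
    \<open>K * r powr (- s)\<close> and the mass at most \<open>M * (2 * r) powr s\<close>, so its
    integral is bounded independently of \<open>r\<close>.\<close>
  define E where "E r q = k (- a \<odot> q) * (bump r (- a \<odot> q) - ind r q)" for r q
  have E0: "E r q = 0" if "0 < r" "hnorm (- a \<odot> q) \<le> r \<or> 2 * r \<le> hnorm (- a \<odot> q)" for r q
    using that by (auto simp: E_def ind bump_eq_1 bump_eq_0)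
  have Eb: "\<bar>E r q\<bar> \<le> K * r powr (- s)" if "0 < r" for r q
  proof (cases "hnorm (- a \<odot> q) \<le> r")
    case True then show ?thesis using E0[OF that] K by simp
  next
    case False
    then have "\<bar>k (- a \<odot> q)\<bar> * \<bar>bump r (- a \<odot> q) - ind r q\<bar> \<le> (K * r powr (- s)) * 1"
      using kle[OF that, of q] bump_bounds[of r "- a \<odot> q"] K by (intro mult_mono) (auto simp: ind)
    then show ?thesis by (simp add: E_def abs_mult)
  qed
  have Emeas: "E r \<in> borel_measurable borel" for r unfolding E_def by measurable
  have Eout: "q \<notin> hball a (2 * r) \<Longrightarrow> E r q = 0" if "0 < r" for r q
    using E0[OF that, of q] by (simp add: hball_def hdist_eq)
  have Ei: "integrable \<mu> (E r)" if "0 < r" for r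
    by (rule integrable_bounded_support[OF Emeas Eb[OF that] Eout[OF that]])
  have EI: "\<bar>LINT q|\<mu>. E r q\<bar> \<le> K * M * 2 powr s" if "0 < r" "2 * r < \<rho>" for r
  proof -
    have "\<bar>LINT q|\<mu>. E r q\<bar> \<le> K * r powr (- s) * measure \<mu> (hball a (2 * r))"
      by (rule integral_bounded_support[OF Emeas Eb[OF that(1)] Eout[OF that(1)]])
    also have "\<dots> \<le> K * r powr (- s) * (M * (2 * r) powr s)"
      using a that K by (intro mult_left_mono) (auto simp: upper_ad_def)
    also have "\<dots> = K * M * 2 powr s" using that by (simp add: powr_mult powr_minus)
    finally show ?thesis .
  qed
  define G where "G r q = k (- a \<odot> q) * (ind 1 q - ind r q)" for r q
  have Geq: "indicator (hball a 1 - hball a r) q *\<^sub>R k (- a \<odot> q) = G r q" if "r \<le> 1" for r q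
    using that by (auto simp: G_def ind hball_def hdist_eq indicator_def)
  have Gi: "integrable \<mu> (G r)" if "0 < r" "r \<le> 1" for r
  proof (rule integrable_bounded_support)
    show "G r \<in> borel_measurable borel" unfolding G_def by measurable
    show "\<bar>G r q\<bar> \<le> K * r powr (- s)" for q
    proof (cases "hnorm (- a \<odot> q) \<le> r")
      case True then show ?thesis using that K by (simp add: G_def ind)
    next
      case False
      then have "\<bar>k (- a \<odot> q)\<bar> * \<bar>ind 1 q - ind r q\<bar> \<le> (K * r powr (- s)) * 1"
        using kle[OF that(1), of q] K by (intro mult_mono) (auto simp: ind)
      then show ?thesis by (simp add: G_def abs_mult)
    qed
    show "G r q = 0" if "q \<notin> hball a 1" for q
      using that \<open>r \<le> 1\<close> by (simp add: G_def ind hball_def hdist_eq)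
  qed
  have GI: "\<bar>LINT q|\<mu>. G r q\<bar> \<le> T" if "0 < r" "r < 1" for r
    using T[OF that] that unfolding set_lebesgue_integral_def by (simp only: Geq[of r] less_imp_le)
  \<comment> \<open>Two truncation errors, at \<open>r\<close> and \<open>t * r\<close>, and two
    sharply truncated integrals: the annulus from \<open>t * r\<close> to \<open>r\<close> is the
    difference of the annuli that end at radius 1.\<close>
  define C where "C = 2 * T + 2 * (K * M * 2 powr s)"
  have main: "\<bar>blow a r (\<lambda>q. k q * annulus_cutoff t q)\<bar> \<le> C"
    if r: "0 < r" "r < 1" "2 * r < \<rho>" and t: "0 < t" "t \<le> 1" for r t
  proof -
    have rt: "0 < t * r" "t * r \<le> r" using r t by (auto simp: mult_le_cancel_right1)
    have rt': "t * r < 1" "2 * (t * r) < \<rho>" using rt r by linarith+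
    have "k (blowup a r q) * annulus_cutoff t (blowup a r q)
          = r powr s * (k (- a \<odot> q) * (bump r (- a \<odot> q) - bump (t * r) (- a \<odot> q)))" for q
    proof -
      have "k (blowup a r q) = (1 / r) powr (- s) * k (- a \<odot> q)"
        using k r by (simp add: homogeneous_kernel_def blowup_eq)
      moreover have "(1 / r) powr (- s) = r powr s" using r by (simp add: powr_minus powr_divide)
      ultimately show ?thesis using r by (simp add: annulus_cutoff_def blowup_eq bump_hdilation)
    qed
    then have "blow a r (\<lambda>q. k q * annulus_cutoff t q) =
        r powr (- s) * (LINT q|\<mu>. r powr s * (k (- a \<odot> q) * (bump r (- a \<odot> q) - bump (t * r) (- a \<odot> q))))"
      unfolding blow_def by simp
    also have "\<dots> = (LINT q|\<mu>. k (- a \<odot> q) * (bump r (- a \<odot> q) - bump (t * r) (- a \<odot> q)))"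
      using r by (simp add: powr_minus)
    also have "\<dots> = (LINT q|\<mu>. E r q - E (t * r) q + G (t * r) q - G r q)"
      by (intro Bochner_Integration.integral_cong refl) (simp add: E_def G_def algebra_simps)
    also have "\<dots> = (LINT q|\<mu>. E r q) - (LINT q|\<mu>. E (t * r) q) + (LINT q|\<mu>. G (t * r) q) - (LINT q|\<mu>. G r q)"
      using Ei Gi r rt rt' by simp
    finally show ?thesis
      using EI[of r] EI[of "t * r"] GI[of r] GI[of "t * r"] r rt rt' unfolding C_def by linarith
  qed
  have "\<bar>\<Lambda> (\<lambda>q. k q * annulus_cutoff t q)\<bar> \<le> C" if \<Lambda>: "\<Lambda> \<in> Tanf a" and t: "0 < t" "t \<le> 1" for \<Lambda> t
  proof -
    obtain r where r: "\<And>i::nat. 0 < r i" "r \<longlonglongrightarrow> 0" "\<And>f. f \<in> Cc \<Longrightarrow> (\<lambda>i. blow a (r i) f) \<longlonglongrightarrow> \<Lambda> f"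
      using Tanf_seq[OF a \<Lambda>] by blast
    have "\<forall>\<^sub>F i in sequentially. r i < min 1 (\<rho> / 2)" using M by (intro order_tendstoD[OF r(2)]) auto
    then have "\<forall>\<^sub>F i in sequentially. \<bar>blow a (r i) (\<lambda>q. k q * annulus_cutoff t q)\<bar> \<le> C"
      by eventually_elim (rule main; use r t in auto)
    then show ?thesis using r(3)[OF kernel_annulus_Cc[OF k t]]
      by (intro tendsto_upperbound[OF tendsto_rabs]) auto
  qed
  then show thesis using that by blast
qed

section \<open>Almost every point of a set sees no holes of positive density\<close>

lemma null_if_small_covers:
  assumes "\<And>\<eta>. \<eta> > 0 \<Longrightarrow> \<exists>S\<in>sets \<mu>. B \<subseteq> S \<and> emeasure \<mu> S \<le> ennreal \<eta>"
  shows "\<exists>N\<in>null_sets \<mu>. B \<subseteq> N"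
proof -
  have "\<forall>n::nat. \<exists>S\<in>sets \<mu>. B \<subseteq> S \<and> emeasure \<mu> S \<le> ennreal (1 / real (Suc n))" using assms by simp
  then obtain S where S: "\<And>n. S n \<in> sets \<mu>" "\<And>n. B \<subseteq> S n" "\<And>n. emeasure \<mu> (S n) \<le> ennreal (1 / real (Suc n))"
    by metis
  have "emeasure \<mu> (\<Inter>n. S n) \<le> ennreal (1 / real (Suc n))" for n
    using S emeasure_mono[of "\<Inter>n. S n" "S n" \<mu>] by (meson INF_lower UNIV_I order_trans)
  then have "emeasure \<mu> (\<Inter>n. S n) \<le> ennreal 0"
    by (intro LIMSEQ_le_const[of "\<lambda>n. ennreal (1 / real (Suc n))"] tendsto_ennrealI LIMSEQ_Suc[OF lim_1_over_n]) auto
  then have "(\<Inter>n. S n) \<in> null_sets \<mu>" using S by (intro null_setsI) auto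
  then show ?thesis using S by (intro bexI[of _ "\<Inter>n. S n"]) auto
qed

lemma emeasure_UN_le_finite_sums:
  fixes J :: "'i set"
  assumes J: "countable J" and S: "\<And>j. j \<in> J \<Longrightarrow> S j \<in> sets \<mu>"
    and le: "\<And>F. finite F \<Longrightarrow> F \<subseteq> J \<Longrightarrow> (\<Sum>j\<in>F. emeasure \<mu> (S j)) \<le> C"
  shows "emeasure \<mu> (\<Union>j\<in>J. S j) \<le> C"
proof (cases "J = {}")
  case False
  define F where "F n = from_nat_into J ` {..n::nat}" for n
  have F: "finite (F n)" "F n \<subseteq> J" for n using from_nat_into[OF False] by (auto simp: F_def)
  have U: "(\<Union>j\<in>J. S j) = (\<Union>n. \<Union>j\<in>F n. S j)"
  proof -
    have "J = (\<Union>n. F n)" using range_from_nat_into[OF False J] by (fastforce simp: F_def)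
    then show ?thesis by blast
  qed
  have "incseq (\<lambda>n. \<Union>j\<in>F n. S j)"
    by (intro incseq_SucI UN_mono) (auto simp: F_def)
  then have "emeasure \<mu> (\<Union>j\<in>J. S j) = (SUP n. emeasure \<mu> (\<Union>j\<in>F n. S j))"
    unfolding U using F S by (intro SUP_emeasure_incseq[symmetric]) (auto intro!: sets.finite_UN)
  also have "\<dots> \<le> C"
  proof (rule SUP_least)
    fix n
    have "emeasure \<mu> (\<Union>j\<in>F n. S j) \<le> (\<Sum>j\<in>F n. emeasure \<mu> (S j))"
      using F S by (intro emeasure_subadditive_finite) auto
    also have "\<dots> \<le> C" using F by (intro le) auto
    finally show "emeasure \<mu> (\<Union>j\<in>F n. S j) \<le> C" .
  qed
  finally show ?thesis .
qed (use le[of "{}"] in simp)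

text \<open>No ball of radius \<open>\<epsilon> * r\<close> that is heavy at scale \<open>r\<close>
  and at distance comparable to \<open>r\<close> misses \<open>E\<close>. A single constant
  \<open>c\<close> governs heaviness and distance, so one sequence of constants tending to 0 covers
  all cases.\<close>

definition porosity_free :: "'n heis set \<Rightarrow> real \<Rightarrow> real \<Rightarrow> real \<Rightarrow> 'n heis \<Rightarrow> bool" where
  "porosity_free E \<epsilon> c \<delta> a \<longleftrightarrow> (\<forall>r q. 0 < r \<longrightarrow> r < \<delta> \<longrightarrow> hdist a q \<le> r / c \<longrightarrow>
     c * r powr s \<le> measure \<mu> (hball q (\<epsilon> * r)) \<longrightarrow> E \<inter> hball q (\<epsilon> * r) \<noteq> {})"

text \<open>Let \<open>t\<close> be the outer measure of \<open>B\<close> and \<open>U\<close> an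
  open neighbourhood of measure below \<open>t + \<eta>\<close>. Disjoint holes inside
  \<open>U\<close> can be removed without uncovering \<open>B\<close>, so their total mass is less
  than \<open>\<eta>\<close>. The enlarged Vitali balls around the corresponding points cover
  \<open>B\<close>, and the upper density bounds their mass by a multiple of that of the
  holes.\<close>

lemma porous_part_null:
  fixes E :: "'n heis set"
  assumes "\<epsilon> > 0" "c > 0" "M > 0" "\<rho> > 0"
    and B: "B \<subseteq> E" "B \<subseteq> hball 0 D" "\<And>a. a \<in> B \<Longrightarrow> upper_ad a M \<rho>" "\<And>a \<delta>. a \<in> B \<Longrightarrow> \<delta> > 0 \<Longrightarrow> \<not> porosity_free E \<epsilon> c \<delta> a"
  shows "\<exists>N\<in>null_sets \<mu>. B \<subseteq> N"
proof (rule null_if_small_covers)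
  fix \<eta>0 :: real assume "\<eta>0 > 0"
  \<comment> \<open>The ball of radius \<open>\<kappa> * r\<close> about a point contains its hole,
    whose centre is within \<open>r / c\<close> and whose radius is
    \<open>\<epsilon> * r\<close>.\<close>
  define \<kappa> where "\<kappa> = 1 / c + \<epsilon>"
  have \<kappa>: "\<kappa> > 0" using assms by (simp add: \<kappa>_def add_pos_pos)
  \<comment> \<open>The ratio of the upper bound for the mass of an enlarged ball to the lower bound
    for the mass of its hole.\<close>
  define Q where "Q = M * (5 * \<kappa>) powr s / c"
  have Q: "Q > 0" using assms \<kappa> by (simp add: Q_def)
  define \<eta> where "\<eta> = \<eta>0 / Q"
  have \<eta>: "\<eta> > 0" using \<open>\<eta>0 > 0\<close> Q by (simp add: \<eta>_def)
  define t where "t = (INF U\<in>{U. open U \<and> B \<subseteq> U}. emeasure \<mu> U)"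
  have opn: "open {q :: 'n heis. hnorm q < D + 1}" by (intro open_Collect_less continuous_intros)
  have "hnorm q < D + 1" if "q \<in> B" for q using B(2) that by (force simp: hball_def)
  then have "B \<subseteq> {q. hnorm q < D + 1}" by blast
  then have "t \<le> emeasure \<mu> {q. hnorm q < D + 1}" unfolding t_def using opn by (intro INF_lower) auto
  also have "\<dots> \<le> emeasure \<mu> (hball 0 (D + 1))" by (intro emeasure_mono borel_sets hball_borel) (auto simp: hball_def)
  also have "\<dots> < \<infinity>" by (rule hball_fin)
  finally have t: "t < \<infinity>" .
  then have "t < t + ennreal \<eta>" using \<eta> by (simp add: ennreal_add_left_cancel_less less_top)
  then obtain U where U: "open U" "B \<subseteq> U" "emeasure \<mu> U < t + ennreal \<eta>"
    unfolding t_def INF_less_iff by auto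
  have Ufin: "emeasure \<mu> U < \<infinity>" using U(3) t by (metis ennreal_add_less_top ennreal_less_top infinity_ennreal_def order_less_trans)
  have "\<exists>r q. 0 < r \<and> 5 * \<kappa> * r < \<rho> \<and> \<kappa> * r \<le> 1 \<and> hball a (\<kappa> * r) \<subseteq> U \<and> hdist a q \<le> r / c \<and>
      c * r powr s \<le> measure \<mu> (hball q (\<epsilon> * r)) \<and> E \<inter> hball q (\<epsilon> * r) = {}" if a: "a \<in> B" for a
  proof -
    have "a \<in> U" using a U by blast
    then obtain e where e: "e > 0" "hball a e \<subseteq> U" using hdist_ball_subset[OF U(1)] by blast
    define \<delta> where "\<delta> = min (\<rho> / (5 * \<kappa>)) (min (1 / \<kappa>) (e / \<kappa>))"
    have "\<delta> > 0" using \<kappa> assms e by (simp add: \<delta>_def)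
    from B(4)[OF a this] obtain r q where r: "0 < r" "r < \<delta>" "hdist a q \<le> r / c"
      "c * r powr s \<le> measure \<mu> (hball q (\<epsilon> * r))" "E \<inter> hball q (\<epsilon> * r) = {}"
      unfolding porosity_free_def by blast
    have "r < \<rho> / (5 * \<kappa>)" "r < 1 / \<kappa>" "r < e / \<kappa>" using r(2) by (auto simp: \<delta>_def)
    then have "5 * \<kappa> * r < \<rho>" "\<kappa> * r \<le> 1" "\<kappa> * r \<le> e" using \<kappa> by (auto simp: field_simps)
    moreover then have "hball a (\<kappa> * r) \<subseteq> U" using e(2) by (auto simp: hball_def)
    ultimately show ?thesis using r by blast
  qed
  then obtain r q where rq: "\<And>a. a \<in> B \<Longrightarrow> 0 < r a \<and> 5 * \<kappa> * r a < \<rho> \<and> \<kappa> * r a \<le> 1 \<and> hball a (\<kappa> * r a) \<subseteq> U \<and>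
      hdist a (q a) \<le> r a / c \<and> c * r a powr s \<le> measure \<mu> (hball (q a) (\<epsilon> * r a)) \<and> E \<inter> hball (q a) (\<epsilon> * r a) = {}"
    by metis
  obtain J where J: "J \<subseteq> B" "countable J" "disjoint_family_on (\<lambda>a. hball a (\<kappa> * r a)) J"
    "\<And>i. i \<in> B \<Longrightarrow> \<exists>j\<in>J. hball i (\<kappa> * r i) \<subseteq> hball j (5 * (\<kappa> * r j))"
    using hball_Vitali[of B "\<lambda>a. \<kappa> * r a" 1 "\<lambda>a. a"] rq \<kappa> by auto
  have sub: "hball (q a) (\<epsilon> * r a) \<subseteq> hball a (\<kappa> * r a)" if "a \<in> B" for a
  proof
    fix x assume "x \<in> hball (q a) (\<epsilon> * r a)"
    then have "hdist a x \<le> r a / c + \<epsilon> * r a" using hdist_triangle[of a x "q a"] rq[OF that] by (simp add: hball_def)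
    then show "x \<in> hball a (\<kappa> * r a)" by (simp add: hball_def \<kappa>_def algebra_simps)
  qed
  have fin: "(\<Sum>a\<in>F. r a powr s) \<le> \<eta> / c" if F: "finite F" "F \<subseteq> J" for F
  proof -
    let ?H = "\<lambda>a. hball (q a) (\<epsilon> * r a)"
    have FB: "F \<subseteq> B" using F J by blast
    have "disjoint_family_on ?H F"
      unfolding disjoint_family_on_def
    proof (intro ballI impI)
      fix m n assume "m \<in> F" "n \<in> F" "m \<noteq> n"
      then have "hball m (\<kappa> * r m) \<inter> hball n (\<kappa> * r n) = {}" using J(3) F(2) by (auto simp: disjoint_family_on_def)
      then show "?H m \<inter> ?H n = {}" using sub[of m] sub[of n] FB \<open>m \<in> F\<close> \<open>n \<in> F\<close> by blast
    qed
    then have sumH: "(\<Sum>a\<in>F. emeasure \<mu> (?H a)) = emeasure \<mu> (\<Union>a\<in>F. ?H a)"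
      using F by (intro sum_emeasure) auto
    have cl: "closed (\<Union>a\<in>F. ?H a)" using F by (intro closed_UN ballI closed_hball)
    have "?H a \<subseteq> U" if "a \<in> F" for a using sub[of a] rq[of a] that FB by blast
    then have HU: "(\<Union>a\<in>F. ?H a) \<subseteq> U" by blast
    \<comment> \<open>The holes miss \<open>E\<close> and hence \<open>B\<close>, so what remains of
      \<open>U\<close> still competes in the infimum that defines \<open>t\<close>.\<close>
    have "B \<subseteq> U - (\<Union>a\<in>F. ?H a)" using U(2) B(1) rq FB by blast
    then have "t \<le> emeasure \<mu> (U - (\<Union>a\<in>F. ?H a))" unfolding t_def
      using U(1) cl by (intro INF_lower) (auto intro: open_Diff)
    then have "t + (\<Sum>a\<in>F. emeasure \<mu> (?H a)) \<le> emeasure \<mu> (U - (\<Union>a\<in>F. ?H a)) + emeasure \<mu> (\<Union>a\<in>F. ?H a)"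
      unfolding sumH by (rule add_right_mono)
    also have "\<dots> = emeasure \<mu> U"
      using U(1) cl HU by (subst plus_emeasure) (auto simp: Un_absorb2 intro!: arg_cong[of _ _ "emeasure \<mu>"])
    also have "\<dots> < t + ennreal \<eta>" by (rule U)
    finally have "(\<Sum>a\<in>F. emeasure \<mu> (?H a)) < ennreal \<eta>" by (simp add: ennreal_add_left_cancel_less)
    moreover have "(\<Sum>a\<in>F. ennreal (c * r a powr s)) \<le> (\<Sum>a\<in>F. emeasure \<mu> (?H a))"
    proof (rule sum_mono)
      fix a assume "a \<in> F"
      then have "ennreal (c * r a powr s) \<le> ennreal (measure \<mu> (?H a))" using rq[of a] FB by (intro ennreal_leI) blast
      then show "ennreal (c * r a powr s) \<le> emeasure \<mu> (?H a)" by (simp add: emeasure_hball)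
    qed
    ultimately have "ennreal (\<Sum>a\<in>F. c * r a powr s) < ennreal \<eta>"
      using assms by (subst sum_ennreal[symmetric]) auto
    then have "c * (\<Sum>a\<in>F. r a powr s) < \<eta>" using assms by (simp add: ennreal_less_iff sum_nonneg flip: sum_distrib_left)
    then show ?thesis using assms by (simp add: field_simps)
  qed
  let ?S = "\<Union>j\<in>J. hball j (5 * (\<kappa> * r j))"
  have "?S \<in> sets \<mu>" using J(2) by (intro sets.countable_UN') auto
  moreover have "B \<subseteq> ?S"
  proof
    fix a assume a: "a \<in> B"
    then obtain j where "j \<in> J" "hball a (\<kappa> * r a) \<subseteq> hball j (5 * (\<kappa> * r j))" using J(4) by blast
    moreover have "a \<in> hball a (\<kappa> * r a)" using rq[OF a] \<kappa> by (simp add: hball_def)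
    ultimately show "a \<in> ?S" by blast
  qed
  moreover have "emeasure \<mu> ?S \<le> ennreal \<eta>0"
  proof (rule emeasure_UN_le_finite_sums[OF J(2)])
    fix F assume F: "finite F" "F \<subseteq> J"
    have "(\<Sum>j\<in>F. emeasure \<mu> (hball j (5 * (\<kappa> * r j)))) \<le> (\<Sum>j\<in>F. ennreal (M * (5 * \<kappa>) powr s * r j powr s))"
    proof (rule sum_mono)
      fix j assume "j \<in> F"
      then have j: "j \<in> B" using F J by blast
      have "measure \<mu> (hball j (5 * (\<kappa> * r j))) \<le> M * (5 * (\<kappa> * r j)) powr s"
        using B(3)[OF j] rq[OF j] \<kappa> unfolding upper_ad_def by (auto simp: mult.assoc)
      also have "\<dots> = M * (5 * \<kappa>) powr s * r j powr s" using rq[OF j] \<kappa> by (simp add: powr_mult)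
      finally show "emeasure \<mu> (hball j (5 * (\<kappa> * r j))) \<le> ennreal (M * (5 * \<kappa>) powr s * r j powr s)"
        by (simp add: emeasure_hball ennreal_leI)
    qed
    also have "\<dots> = ennreal (M * (5 * \<kappa>) powr s * (\<Sum>j\<in>F. r j powr s))"
      using assms by (subst sum_ennreal) (auto simp: sum_distrib_left)
    also have "\<dots> \<le> ennreal (M * (5 * \<kappa>) powr s * (\<eta> / c))"
      using assms by (intro ennreal_leI mult_left_mono fin F) auto
    also have "M * (5 * \<kappa>) powr s * (\<eta> / c) = \<eta>0" using assms \<kappa> by (simp add: \<eta>_def Q_def)
    finally show "(\<Sum>j\<in>F. emeasure \<mu> (hball j (5 * (\<kappa> * r j)))) \<le> ennreal \<eta>0" .
  qed auto
  ultimately show "\<exists>S\<in>sets \<mu>. B \<subseteq> S \<and> emeasure \<mu> S \<le> ennreal \<eta>0" by blast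
qed

text \<open>Radius and constant in \<open>upper_ad\<close> vary with the point; countably many
  bounded pieces on which both are uniform exhaust the exceptional set.\<close>

lemma AE_porosity_free:
  assumes "\<epsilon> > 0" "c > 0"
  shows "AE a in \<mu>. a \<in> E \<longrightarrow> (\<exists>M \<rho>. upper_ad a M \<rho>) \<longrightarrow> (\<exists>\<delta>>0. porosity_free E \<epsilon> c \<delta> a)"
proof -
  define B where "B N = {a \<in> E. hnorm a \<le> real N \<and> upper_ad a (real (Suc N)) (1 / real (Suc N)) \<and>
    \<not> (\<exists>\<delta>>0. porosity_free E \<epsilon> c \<delta> a)}" for N :: nat
  have "\<forall>N. \<exists>S\<in>null_sets \<mu>. B N \<subseteq> S"
  proof
    fix N show "\<exists>S\<in>null_sets \<mu>. B N \<subseteq> S"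
      by (rule porous_part_null[OF assms, where M="real (Suc N)" and \<rho>="1 / real (Suc N)" and D="real N" and E=E])
        (auto simp: B_def hball_def)
  qed
  then obtain S where S: "\<And>N. S N \<in> null_sets \<mu>" "\<And>N. B N \<subseteq> S N" by metis
  have "(\<Union>N. S N) \<in> null_sets \<mu>" using S by auto
  then show ?thesis
  proof (rule AE_I'[of _ _ _])
    show "{a \<in> space \<mu>. \<not> (a \<in> E \<longrightarrow> (\<exists>M \<rho>. upper_ad a M \<rho>) \<longrightarrow> (\<exists>\<delta>>0. porosity_free E \<epsilon> c \<delta> a))} \<subseteq> (\<Union>N. S N)"
    proof
      fix a assume "a \<in> {a \<in> space \<mu>. \<not> (a \<in> E \<longrightarrow> (\<exists>M \<rho>. upper_ad a M \<rho>) \<longrightarrow> (\<exists>\<delta>>0. porosity_free E \<epsilon> c \<delta> a))}"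
      then obtain M \<rho> where a: "a \<in> E" "upper_ad a M \<rho>" "\<not> (\<exists>\<delta>>0. porosity_free E \<epsilon> c \<delta> a)" by blast
      define N where "N = nat \<lceil>max (hnorm a) (max M (1 / \<rho>))\<rceil>"
      have N: "hnorm a \<le> real N" "M \<le> real N" "1 / \<rho> \<le> real N" unfolding N_def by linarith+
      have "\<rho> > 0" "M > 0" using a(2) by (auto simp: upper_ad_def)
      have "upper_ad a (real (Suc N)) (1 / real (Suc N))"
        unfolding upper_ad_def
      proof (intro conjI allI impI)
        fix r :: real assume r: "0 < r" "r < 1 / real (Suc N)"
        have "1 / real (Suc N) \<le> \<rho>" using N(3) \<open>\<rho> > 0\<close> by (simp add: field_simps)
        then have "measure \<mu> (hball a r) \<le> M * r powr s" using a(2) r unfolding upper_ad_def by auto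
        also have "\<dots> \<le> real (Suc N) * r powr s" using N(2) by (intro mult_right_mono) auto
        finally show "measure \<mu> (hball a r) \<le> real (Suc N) * r powr s" .
      qed auto
      then have "a \<in> B N" using a N by (simp add: B_def)
      then show "a \<in> (\<Union>N. S N)" using S(2) by blast
    qed
  qed
qed

text \<open>The sets \<open>nbh xs k\<close> play the role of a countable basis of the weak topology. A point whose tangent
  functionals meet a basic neighbourhood is thus detected by countably many sets \<open>avoids\<close>.\<close>
definition nbh :: "rat list \<Rightarrow> nat \<Rightarrow> (('n heis \<Rightarrow> real) \<Rightarrow> real) set" where
  "nbh xs k = {\<Lambda>. \<forall>j<length xs. \<bar>\<Lambda> (test_fun j) - of_rat (xs ! j)\<bar> < 1 / real (Suc k)}"

definition avoids :: "rat list \<times> nat \<times> nat \<Rightarrow> 'n heis set" where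
  "avoids = (\<lambda>(xs, k, l). {a. \<forall>r. 0 < r \<longrightarrow> r < 1 / real (Suc l) \<longrightarrow> blow a r \<notin> nbh xs k})"

text \<open>The index sets are countable, so all these conditions hold almost everywhere
  simultaneously; \<open>m\<close> and \<open>m'\<close> run through the admissible sizes and
  densities of holes.\<close>

definition typical :: "'n heis \<Rightarrow> bool" where
  "typical a \<longleftrightarrow> (\<forall>(m::nat) (m'::nat) N. a \<in> avoids N \<longrightarrow> (\<exists>M \<rho>. upper_ad a M \<rho>) \<longrightarrow>
     (\<exists>\<delta>>0. porosity_free (avoids N) (1 / real (Suc m)) (1 / real (Suc m')) \<delta> a))"

lemma AE_typical: "AE a in \<mu>. typical a"
  unfolding typical_def by (intro AE_all_countable[THEN iffD2] allI AE_porosity_free) auto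

text \<open>If the translate \<open>?T\<close> were no tangent functional at \<open>a\<close>, the
  blow-ups at \<open>a\<close> would avoid a neighbourhood of it, so \<open>a\<close> lies in one of
  the sets \<open>avoids N\<close>. As \<open>p\<close> is in the support, the ball about
  \<open>a \<odot> hdilation r p\<close> of radius \<open>\<epsilon> * r\<close> is heavy for
  suitable small \<open>r\<close> and contains another point \<open>b\<close> of
  \<open>avoids N\<close>. But the blow-up at \<open>b\<close> is almost the translate by
  \<open>p\<close>, hence in the avoided neighbourhood.\<close>

lemma Tanf_translate:
  assumes ta: "typical a" and a: "upper_ad a M \<rho>" and \<Lambda>: "\<Lambda> \<in> Tanf a" and p: "p \<in> fsupp \<Lambda>"
  shows "(\<lambda>f. \<Lambda> (\<lambda>q. f (- p \<odot> q))) \<in> Tanf a"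
proof (rule ccontr)
  let ?T = "\<lambda>f. \<Lambda> (\<lambda>q. f (- p \<odot> q))"
  assume notin: "?T \<notin> Tanf a"
  obtain r where r: "\<And>i::nat. 0 < r i" "r \<longlonglongrightarrow> 0" "\<And>f. f \<in> Cc \<Longrightarrow> (\<lambda>i. blow a (r i) f) \<longlonglongrightarrow> \<Lambda> f"
    using Tanf_seq[OF a \<Lambda>] by blast
  have pos: "posfun \<Lambda>" by (rule Tanf_posfun[OF \<Lambda>])
  have "posfun ?T" by (rule posfun_compose[OF pos Cc_translate])
  then obtain k where k: "\<And>t. 0 < t \<Longrightarrow> t < 1 / real (Suc k) \<Longrightarrow>
      \<exists>j\<le>k. \<bar>blow a t (test_fun j) - ?T (test_fun j)\<bar> \<ge> 1 / real (Suc k)"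
  proof -
    define D where "D t j = \<bar>blow a t (test_fun j) - ?T (test_fun j)\<bar>" for t j
    have "\<not> (\<forall>k::nat. \<exists>r>0. r < 1 / real (Suc k) \<and> (\<forall>j\<le>k. D r j < 1 / real (Suc k)))"
      using notin \<open>posfun ?T\<close> unfolding Tanf_def D_def by blast
    then have "\<exists>k::nat. \<forall>t. 0 < t \<longrightarrow> t < 1 / real (Suc k) \<longrightarrow> (\<exists>j\<le>k. D t j \<ge> 1 / real (Suc k))"
      by (meson not_le)
    then show thesis using that unfolding D_def by blast
  qed
  define d where "d = 1 / real (Suc k)"
  have d: "d > 0" by (simp add: d_def)
  have "\<exists>x::rat. \<bar>of_rat x - ?T (test_fun j)\<bar> < d / 4" for j
  proof -
    obtain x where "?T (test_fun j) - d / 4 < of_rat x" "of_rat x < ?T (test_fun j) + d / 4"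
      using of_rat_dense[of "?T (test_fun j) - d / 4" "?T (test_fun j) + d / 4"] d by auto
    then show ?thesis by (intro exI[of _ x]) linarith
  qed
  then obtain x :: "nat \<Rightarrow> rat" where x: "\<And>j. \<bar>of_rat (x j) - ?T (test_fun j)\<bar> < d / 4" by metis
  define xs where "xs = map x [0..<Suc k]"
  have xs: "length xs = Suc k" "\<And>j. j \<le> k \<Longrightarrow> xs ! j = x j" by (simp_all add: xs_def del: upt_Suc)
  have d2: "1 / real (Suc (2 * k + 1)) = d / 2" by (simp add: d_def field_simps)
  \<comment> \<open>Index \<open>2 * k + 1\<close> stands for tolerance \<open>d / 2\<close>. With
    rational centres within \<open>d / 4\<close> of \<open>?T\<close> the neighbourhood stays within
    \<open>3 * d / 4\<close> of \<open>?T\<close>, hence is avoided at \<open>a\<close>, and it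
    contains everything within \<open>d / 4\<close>.\<close>
  define N where "N = (xs, 2 * k + 1, k)"
  have aN: "a \<in> avoids N"
    unfolding avoids_def N_def
  proof (clarsimp simp del: of_nat_Suc)
    fix t assume t: "0 < t" "t < 1 / real (Suc k)" "blow a t \<in> nbh xs (Suc (2 * k))"
    then obtain j where j: "j \<le> k" "\<bar>blow a t (test_fun j) - ?T (test_fun j)\<bar> \<ge> d" using k unfolding d_def by blast
    have "\<bar>blow a t (test_fun j) - of_rat (x j)\<bar> < d / 2"
      using t(3) j xs d2 unfolding nbh_def by (auto simp del: of_nat_Suc simp: less_Suc_eq_le)
    then show False using x[of j] j(2) d by linarith
  qed
  \<comment> \<open>uniformity of translations at \<open>p\<close>, for finitely many test functions\<close>
  have unif: "\<exists>e>0. \<forall>\<^sub>F i in sequentially. \<forall>p'\<in>hball p e. \<bar>blow a (r i) (\<lambda>q. test_fun j (- p' \<odot> q)) - ?T (test_fun j)\<bar> < d / 4" for j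
  proof -
    obtain R where R: "\<And>\<eta>. \<eta> > 0 \<Longrightarrow> \<exists>\<epsilon>>0. \<forall>p'\<in>hball p \<epsilon>. \<forall>x. \<bar>test_fun j (- p' \<odot> x) - test_fun j (- p \<odot> x)\<bar> \<le> \<eta> * cutoff R x"
      using translate_uniform[OF test_fun_Cc] by blast
    define L where "L = \<Lambda> (cutoff R)"
    have L: "L \<ge> 0" unfolding L_def by (rule posfun_cutoff[OF pos])
    define \<eta> where "\<eta> = d / (8 * (L + 1))"
    have \<eta>: "\<eta> > 0" using d L by (simp add: \<eta>_def)
    obtain e where e: "e > 0" "\<And>p' x. p' \<in> hball p e \<Longrightarrow> \<bar>test_fun j (- p' \<odot> x) - test_fun j (- p \<odot> x)\<bar> \<le> \<eta> * cutoff R x"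
      using R[OF \<eta>] by blast
    have "\<forall>\<^sub>F i in sequentially. blow a (r i) (cutoff R) < L + 1"
      by (rule order_tendstoD[OF r(3)[OF cutoff_Cc]]) (simp add: L_def)
    moreover have "\<forall>\<^sub>F i in sequentially. dist (blow a (r i) (\<lambda>q. test_fun j (- p \<odot> q))) (?T (test_fun j)) < d / 8"
      using d by (intro tendstoD[OF r(3)] Cc_translate) auto
    ultimately have "\<forall>\<^sub>F i in sequentially. \<forall>p'\<in>hball p e. \<bar>blow a (r i) (\<lambda>q. test_fun j (- p' \<odot> q)) - ?T (test_fun j)\<bar> < d / 4"
    proof eventually_elim
      case (elim i)
      show ?case
      proof
        fix p' assume p': "p' \<in> hball p e"
        have "\<bar>blow a (r i) (\<lambda>q. test_fun j (- p' \<odot> q)) - blow a (r i) (\<lambda>q. test_fun j (- p \<odot> q))\<bar> \<le> \<eta> * blow a (r i) (cutoff R)"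
          using e(2)[OF p'] by (intro posfun_approx[OF posfun_blow[OF r(1)]] Cc_translate) auto
        also have "\<dots> \<le> \<eta> * (L + 1)" using elim(1) \<eta> by (intro mult_left_mono) auto
        also have "\<dots> = d / 8" using L by (simp add: \<eta>_def field_simps)
        finally show "\<bar>blow a (r i) (\<lambda>q. test_fun j (- p' \<odot> q)) - ?T (test_fun j)\<bar> < d / 4"
          using elim(2) unfolding dist_real_def by linarith
      qed
    qed
    then show ?thesis using e(1) by blast
  qed
  define near where "near j e \<longleftrightarrow> (\<forall>\<^sub>F i in sequentially. \<forall>p'\<in>hball p e. \<bar>blow a (r i) (\<lambda>q. test_fun j (- p' \<odot> q)) - ?T (test_fun j)\<bar> < d / 4)" for j e
  have "\<forall>j. \<exists>e>0. near j e" using unif unfolding near_def by blast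
  then obtain e where e0: "\<And>j. e j > 0" and near: "\<And>j. near j (e j)" by metis
  note e = e0 near[unfolded near_def]
  define e0 where "e0 = Min (e ` {..k})"
  have e0: "e0 > 0" "\<And>j. j \<le> k \<Longrightarrow> e0 \<le> e j" using e(1) by (auto simp: e0_def)
  have ev1: "\<forall>\<^sub>F i in sequentially. \<forall>j\<in>{..k}. \<forall>p'\<in>hball p e0. \<bar>blow a (r i) (\<lambda>q. test_fun j (- p' \<odot> q)) - ?T (test_fun j)\<bar> < d / 4"
  proof (rule eventually_ball_finite, simp, rule ballI)
    fix j assume "j \<in> {..k}"
    then have "hball p e0 \<subseteq> hball p (e j)" using e0(2)[of j] by (auto simp: hball_def)
    then show "\<forall>\<^sub>F i in sequentially. \<forall>p'\<in>hball p e0. \<bar>blow a (r i) (\<lambda>q. test_fun j (- p' \<odot> q)) - ?T (test_fun j)\<bar> < d / 4"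
      by (intro eventually_mono[OF e(2)[of j]]) blast
  qed
  obtain m where m: "1 / real (Suc m) < e0" using e0(1) by (metis nat_approx_posE)
  define \<epsilon> where "\<epsilon> = 1 / real (Suc m)"
  have \<epsilon>: "\<epsilon> > 0" "\<epsilon> < e0" using m by (auto simp: \<epsilon>_def)
  \<comment> \<open>A bump at \<open>p\<close> of half the radius, so that it vanishes at distance
    more than \<open>\<epsilon>\<close>; its value under the blow-up bounds the mass of a ball of
    radius \<open>\<epsilon> * r\<close> from below.\<close>
  define f where "f q = bump (\<epsilon> / 2) (- p \<odot> q)" for q
  have f: "f \<in> Cc" unfolding f_def[abs_def] using \<epsilon> by (intro Cc_translate) auto
  have "f p = 1" "\<And>x. 0 \<le> f x" by (simp_all add: f_def bump_bounds)
  then have "0 < \<Lambda> f" using p f unfolding fsupp_def mem_Collect_eq by (metis zero_less_one)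
  \<comment> \<open>The first entry leaves room for passing to the limit in \<open>blow\<close>; the
    second keeps \<open>hdist a ?q = r i * hnorm p\<close> below \<open>r i / c\<close>.\<close>
  define c0 where "c0 = min (\<Lambda> f / 2) (1 / (hnorm p + 1))"
  have c0: "c0 > 0" using \<open>0 < \<Lambda> f\<close> by (simp add: c0_def add_nonneg_pos)
  obtain m' where m': "1 / real (Suc m') < c0" using c0 by (metis nat_approx_posE)
  define c where "c = 1 / real (Suc m')"
  have c: "c > 0" "c < \<Lambda> f / 2" "c < 1 / (hnorm p + 1)" using m' by (auto simp: c_def c0_def)
  obtain \<delta> where \<delta>: "\<delta> > 0" "porosity_free (avoids N) \<epsilon> c \<delta> a"
    using ta aN a unfolding typical_def \<epsilon>_def c_def by blast
  have "\<forall>\<^sub>F i in sequentially. \<Lambda> f / 2 < blow a (r i) f"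
    using \<open>0 < \<Lambda> f\<close> by (intro order_tendstoD[OF r(3)[OF f]]) auto
  moreover have "\<forall>\<^sub>F i in sequentially. r i < min \<delta> d"
    using \<delta>(1) d by (intro order_tendstoD[OF r(2)]) auto
  moreover note ev1
  ultimately have "\<forall>\<^sub>F i in sequentially. False"
  proof eventually_elim
    case (elim i)
    let ?q = "a \<odot> hdilation (r i) p"
    have "blow a (r i) f \<le> r i powr (- s) * measure \<mu> (hball ?q (\<epsilon> * r i))"
    proof (rule blow_le[OF f])
      show "f x = 0" if "hdist p x > \<epsilon>" for x using that \<epsilon> by (simp add: f_def hdist_eq bump_eq_0)
    qed (auto simp: f_def bump_bounds r)
    then have "c \<le> r i powr (- s) * measure \<mu> (hball ?q (\<epsilon> * r i))" using elim(1) c by linarith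
    then have 1: "c * r i powr s \<le> measure \<mu> (hball ?q (\<epsilon> * r i))" using r(1)[of i] by (simp add: powr_minus field_simps)
    have "hdist a ?q = r i * hnorm p" using r(1)[of i] by (simp add: hdist_eq hnorm_hdilation)
    have "hnorm p + 1 > 0" using hnorm_nonneg[of p] by linarith
    then have "c * (hnorm p + 1) < 1" using c(3) by (simp add: pos_less_divide_eq)
    then have "c * hnorm p \<le> 1" using c(1) by (simp add: distrib_left)
    then have "r i * hnorm p \<le> r i * (1 / c)" using c r(1)[of i] by (intro mult_left_mono) (auto simp: field_simps)
    with \<open>hdist a ?q = _\<close> have 2: "hdist a ?q \<le> r i / c" by simp
    obtain b where b: "b \<in> avoids N" "b \<in> hball ?q (\<epsilon> * r i)"
      using \<delta>(2) r(1)[of i] elim(2) 1 2 unfolding porosity_free_def by (metis disjoint_iff min_less_iff_conj)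
    define p' where "p' = blowup a (r i) b"
    have bp: "b = a \<odot> hdilation (r i) p'" using r(1)[of i] by (simp add: p'_def blowup_eq)
    have "hdist (hdilation (r i) p) (hdilation (r i) p') \<le> \<epsilon> * r i" using b(2) unfolding bp by (simp add: hball_def)
    then have "r i * hdist p p' \<le> \<epsilon> * r i"
      using r(1)[of i] by (simp add: hdist_eq hnorm_hdilation flip: hdilation_uminus hdilation_hmul)
    then have "hdist p p' \<le> \<epsilon>" using r(1)[of i] by (simp add: mult.commute)
    then have p': "p' \<in> hball p e0" using \<epsilon> by (simp add: hball_def)
    \<comment> \<open>Seen from \<open>b\<close>, the blow-up is the one at \<open>a\<close>
      translated by \<open>p'\<close>, a point close to \<open>p\<close>, so the uniform estimate
      applies.\<close>
    have "blow b (r i) \<in> nbh xs (2 * k + 1)"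
      unfolding nbh_def
    proof (intro CollectI allI impI)
      fix j assume "j < length xs"
      then have j: "j \<le> k" using xs by simp
      have "\<bar>blow b (r i) (test_fun j) - ?T (test_fun j)\<bar> < d / 4"
        using elim(3) j p' unfolding bp blow_translate[OF r(1)] by blast
      then show "\<bar>blow b (r i) (test_fun j) - of_rat (xs ! j)\<bar> < 1 / real (Suc (2 * k + 1))"
        using x[of j] unfolding d2 xs(2)[OF j] by linarith
    qed
    moreover have "r i < 1 / real (Suc k)" using elim(2) by (simp add: d_def)
    ultimately show False using b(1) r(1)[of i] unfolding avoids_def N_def by blast
  qed
  then show False by simp
qed

end

section \<open>Haar measure on homogeneous subgroups\<close>

text \<open>Lebesgue measure of a \<open>k\<close>-dimensional subspace, described inside the
  ambient space. Scaling is demanded for negative \<open>r\<close> as well; \<open>r = -1\<close>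
  later gives invariance under the group inverse.\<close>

definition subspace_haar :: "'e::euclidean_space set \<Rightarrow> nat \<Rightarrow> 'e measure \<Rightarrow> bool" where
  "subspace_haar W k L \<longleftrightarrow> sets L = sets borel \<and>
    (\<forall>f\<in>borel_measurable borel. \<forall>v\<in>W. (\<integral>\<^sup>+w. f (v + w) \<partial>L) = (\<integral>\<^sup>+w. f w \<partial>L)) \<and>
    (\<forall>f\<in>borel_measurable borel. \<forall>r. r \<noteq> 0 \<longrightarrow> (\<integral>\<^sup>+w. f w \<partial>L) = ennreal (\<bar>r\<bar> ^ k) * (\<integral>\<^sup>+w. f (r *\<^sub>R w) \<partial>L)) \<and>
    (AE w in L. w \<in> W) \<and>
    (\<forall>R. emeasure L (cball 0 R) < \<infinity>) \<and> (\<forall>R>0. 0 < emeasure L (cball 0 R))"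

lemma subspace_haarD:
  assumes "subspace_haar W k L"
  shows "sets L = sets borel"
    and "\<And>f v. f \<in> borel_measurable borel \<Longrightarrow> v \<in> W \<Longrightarrow> (\<integral>\<^sup>+w. f (v + w) \<partial>L) = (\<integral>\<^sup>+w. f w \<partial>L)"
    and "\<And>f r. f \<in> borel_measurable borel \<Longrightarrow> r \<noteq> 0 \<Longrightarrow> (\<integral>\<^sup>+w. f w \<partial>L) = ennreal (\<bar>r\<bar> ^ k) * (\<integral>\<^sup>+w. f (r *\<^sub>R w) \<partial>L)"
    and "AE w in L. w \<in> W"
    and "\<And>R. emeasure L (cball 0 R) < \<infinity>" and "\<And>R. R > 0 \<Longrightarrow> 0 < emeasure L (cball 0 R)"
  using assms unfolding subspace_haar_def by blast+

lemma lborel_translate: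
  "f \<in> borel_measurable borel \<Longrightarrow> (\<integral>\<^sup>+t. f (t + c) \<partial>lborel) = (\<integral>\<^sup>+t. f t \<partial>lborel)" for c :: real
  using nn_integral_real_affine[of f 1 c] by (simp add: add.commute)

text \<open>The product with Lebesgue measure on a new orthonormal direction. Each factor
  contributes its own translation and scaling; orthogonality bounds the coordinates of a point by
  its norm and so gives finite mass on balls.\<close>

lemma subspace_haar_extend:
  fixes b :: "'e::euclidean_space"
  assumes L: "subspace_haar W k L" and W: "subspace W" and b: "norm b = 1" "\<And>w. w \<in> W \<Longrightarrow> w \<bullet> b = 0"
  shows "subspace_haar {w + t *\<^sub>R b | w t. w \<in> W} (Suc k) (distr (L \<Otimes>\<^sub>M lborel) borel (\<lambda>(w, t). w + t *\<^sub>R b))"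
    (is "subspace_haar ?W _ ?L")
proof -
  note D = subspace_haarD[OF L]
  note setsL [measurable_cong] = D(1)
  have [simp]: "space L = UNIV" using sets_eq_imp_space_eq[OF setsL] by simp
  note trans = D(2) and scal = D(3) and AEW = D(4)
  note fin = D(5) and pos = D(6)
  have I: "(\<integral>\<^sup>+w. f w \<partial>?L) = (\<integral>\<^sup>+w. \<integral>\<^sup>+t. f (w + t *\<^sub>R b) \<partial>lborel \<partial>L)" if [measurable]: "f \<in> borel_measurable borel" for f
  proof -
    have "(\<integral>\<^sup>+w. f w \<partial>?L) = (\<integral>\<^sup>+x. f (fst x + snd x *\<^sub>R b) \<partial>(L \<Otimes>\<^sub>M lborel))"
      by (subst nn_integral_distr) (auto simp: case_prod_beta')
    also have "\<dots> = (\<integral>\<^sup>+w. \<integral>\<^sup>+t. f (fst (w, t) + snd (w, t) *\<^sub>R b) \<partial>lborel \<partial>L)"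
      by (rule lborel.nn_integral_fst[symmetric]) measurable
    finally show ?thesis by simp
  qed
  have [measurable, simp]: "cball (0 :: 'e) r \<in> sets L" for r using setsL by simp
  have norm_eq: "(norm (w + t *\<^sub>R b))\<^sup>2 = (norm w)\<^sup>2 + t\<^sup>2" if "w \<in> W" for w t
    using b(2)[OF that] b(1) unfolding power2_norm_eq_inner
    by (simp add: inner_left_distrib inner_right_distrib inner_commute power2_eq_square norm_eq_1)
  show ?thesis
    unfolding subspace_haar_def
  proof (intro conjI ballI allI impI)
    show "sets ?L = sets borel" by simp
  next
    fix f :: "'e \<Rightarrow> ennreal" and v assume [measurable]: "f \<in> borel_measurable borel" and "v \<in> ?W"
    then obtain w0 t0 where v: "v = w0 + t0 *\<^sub>R b" "w0 \<in> W" by blast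
    have "(\<integral>\<^sup>+w. f (v + w) \<partial>?L) = (\<integral>\<^sup>+w. \<integral>\<^sup>+t. f (w0 + w + (t + t0) *\<^sub>R b) \<partial>lborel \<partial>L)"
      by (subst I) (auto simp: v algebra_simps)
    also have "\<dots> = (\<integral>\<^sup>+w. \<integral>\<^sup>+t. f (w0 + w + t *\<^sub>R b) \<partial>lborel \<partial>L)"
      by (subst lborel_translate[where f="\<lambda>t. f (_ + t *\<^sub>R b)"]) auto
    also have "\<dots> = (\<integral>\<^sup>+w. \<integral>\<^sup>+t. f (w + t *\<^sub>R b) \<partial>lborel \<partial>L)"
      by (rule trans[OF _ v(2)]) measurable
    finally show "(\<integral>\<^sup>+w. f (v + w) \<partial>?L) = (\<integral>\<^sup>+w. f w \<partial>?L)" by (simp add: I)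
  next
    fix f :: "'e \<Rightarrow> ennreal" and r :: real assume [measurable]: "f \<in> borel_measurable borel" and r: "r \<noteq> 0"
    have "(\<integral>\<^sup>+w. f w \<partial>?L) = (\<integral>\<^sup>+w. ennreal \<bar>r\<bar> * (\<integral>\<^sup>+t. f (w + (r * t) *\<^sub>R b) \<partial>lborel) \<partial>L)"
      unfolding I[OF \<open>f \<in> _\<close>]
      by (subst nn_integral_real_affine[where c=r and t=0 and f="\<lambda>t. f (_ + t *\<^sub>R b)"]) (use r in auto)
    also have "\<dots> = ennreal (\<bar>r\<bar> ^ k) * (\<integral>\<^sup>+w. ennreal \<bar>r\<bar> * (\<integral>\<^sup>+t. f (r *\<^sub>R w + (r * t) *\<^sub>R b) \<partial>lborel) \<partial>L)"
      by (rule scal[OF _ r]) measurable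
    also have "\<dots> = ennreal (\<bar>r\<bar> ^ k) * (ennreal \<bar>r\<bar> * (\<integral>\<^sup>+w. (\<integral>\<^sup>+t. f (r *\<^sub>R w + (r * t) *\<^sub>R b) \<partial>lborel) \<partial>L))"
      by (subst nn_integral_cmult) auto
    also have "(\<integral>\<^sup>+w. (\<integral>\<^sup>+t. f (r *\<^sub>R w + (r * t) *\<^sub>R b) \<partial>lborel) \<partial>L) = (\<integral>\<^sup>+w. f (r *\<^sub>R w) \<partial>?L)"
      by (subst I) (auto simp: scaleR_add_right)
    finally show "(\<integral>\<^sup>+w. f w \<partial>?L) = ennreal (\<bar>r\<bar> ^ Suc k) * (\<integral>\<^sup>+w. f (r *\<^sub>R w) \<partial>?L)"
      by (simp add: ennreal_mult mult_ac)
  next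
    have "(\<lambda>w. (w - (w \<bullet> b) *\<^sub>R b)) \<in> borel_measurable borel" by measurable
    moreover have "closed W" by (rule closed_subspace[OF W])
    ultimately have "{w. w - (w \<bullet> b) *\<^sub>R b \<in> W} \<in> sets borel"
      using measurable_sets[OF \<open>(\<lambda>w. (w - (w \<bullet> b) *\<^sub>R b)) \<in> borel_measurable borel\<close>, of W] by (simp add: vimage_def borel_closed)
    \<comment> \<open>As the preimage of the closed set \<open>W\<close> under the map that removes
      the \<open>b\<close>-component, the enlarged subspace is a Borel set.\<close>
    moreover have "?W = {w. w - (w \<bullet> b) *\<^sub>R b \<in> W}"
    proof (rule Set.set_eqI, rule iffI)
      fix x assume "x \<in> ?W"
      then obtain w t where x: "w \<in> W" "x = w + t *\<^sub>R b" by blast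
      then have "x \<bullet> b = t" using b by (simp add: inner_left_distrib norm_eq_1)
      then have "x - (x \<bullet> b) *\<^sub>R b = w" using x(2) by simp
      then show "x \<in> {w. w - (w \<bullet> b) *\<^sub>R b \<in> W}" using x(1) by (simp only: mem_Collect_eq)
    next
      fix x assume "x \<in> {w. w - (w \<bullet> b) *\<^sub>R b \<in> W}"
      then show "x \<in> ?W"
        by (intro CollectI exI[of _ "x - (x \<bullet> b) *\<^sub>R b"] exI[of _ "x \<bullet> b"]) simp
    qed
    ultimately have [measurable]: "?W \<in> sets borel" by simp
    have "emeasure ?L (- ?W) = (\<integral>\<^sup>+w. indicator (- ?W) w \<partial>?L)" by (rule nn_integral_indicator[symmetric]) (simp only: sets_distr borel_comp \<open>?W \<in> sets borel\<close>)
    also have "\<dots> = (\<integral>\<^sup>+w. \<integral>\<^sup>+t. indicator (- ?W) (w + t *\<^sub>R b) \<partial>lborel \<partial>L)" by (rule I) measurable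
    also have "\<dots> = (\<integral>\<^sup>+w. 0 \<partial>L)"
    proof (rule nn_integral_cong_AE, use AEW in eventually_elim)
      fix w assume "w \<in> W"
      then have "w + t *\<^sub>R b \<in> ?W" for t by blast
      then have "indicator (- ?W) (w + t *\<^sub>R b) = (0 :: ennreal)" for t by (simp del: mem_Collect_eq)
      then show "(\<integral>\<^sup>+t. indicator (- ?W) (w + t *\<^sub>R b) \<partial>lborel) = 0" by simp
    qed
    finally have "emeasure ?L (- ?W) = 0" by simp
    then have "- ?W \<in> null_sets ?L"
      by (rule null_setsI) (simp only: sets_distr borel_comp \<open>?W \<in> sets borel\<close>)
    then show "AE w in ?L. w \<in> ?W" by (rule AE_I') auto
  next
    fix R :: real
    have "emeasure ?L (cball 0 R) = (\<integral>\<^sup>+w. indicator (cball 0 R) w \<partial>?L)" by simp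
    also have "\<dots> = (\<integral>\<^sup>+w. \<integral>\<^sup>+t. indicator (cball 0 R) (w + t *\<^sub>R b) \<partial>lborel \<partial>L)"
      by (rule I) (intro borel_measurable_indicator borel_closed closed_cball)
    also have "\<dots> \<le> (\<integral>\<^sup>+w. ennreal (2 * \<bar>R\<bar>) * indicator (cball 0 \<bar>R\<bar>) w \<partial>L)"
    proof (rule nn_integral_mono_AE, use AEW in eventually_elim)
      fix w assume w: "w \<in> W"
      have "indicator (cball 0 R) (w + t *\<^sub>R b) \<le> (indicator (cball 0 \<bar>R\<bar>) w * indicator {-\<bar>R\<bar>..\<bar>R\<bar>} t :: ennreal)" for t
      proof (cases "w + t *\<^sub>R b \<in> cball 0 R")
        case True
        then have "(norm (w + t *\<^sub>R b))\<^sup>2 \<le> \<bar>R\<bar>\<^sup>2" by (intro power_mono) auto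
        then have "(norm w)\<^sup>2 \<le> \<bar>R\<bar>\<^sup>2" "\<bar>t\<bar>\<^sup>2 \<le> \<bar>R\<bar>\<^sup>2" unfolding norm_eq[OF w] by (auto intro: order_trans[rotated])
        then have "norm w \<le> \<bar>R\<bar>" "\<bar>t\<bar> \<le> \<bar>R\<bar>" using abs_le_square_iff[of "norm w" R] abs_le_square_iff[of t R] by auto
        then show ?thesis by (auto simp: indicator_def abs_le_iff)
      qed simp
      then have "(\<integral>\<^sup>+t. indicator (cball 0 R) (w + t *\<^sub>R b) \<partial>lborel) \<le> (\<integral>\<^sup>+t. indicator (cball 0 \<bar>R\<bar>) w * indicator {-\<bar>R\<bar>..\<bar>R\<bar>} t \<partial>lborel)"
        by (rule nn_integral_mono)
      also have "\<dots> = indicator (cball 0 \<bar>R\<bar>) w * ennreal (2 * \<bar>R\<bar>)"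
        by (subst nn_integral_cmult) auto
      finally show "(\<integral>\<^sup>+t. indicator (cball 0 R) (w + t *\<^sub>R b) \<partial>lborel) \<le> ennreal (2 * \<bar>R\<bar>) * indicator (cball 0 \<bar>R\<bar>) w"
        by (simp add: mult.commute)
    qed
    also have "\<dots> = ennreal (2 * \<bar>R\<bar>) * emeasure L (cball 0 \<bar>R\<bar>)" by (subst nn_integral_cmult) auto
    also have "\<dots> < \<infinity>" using fin[of "\<bar>R\<bar>"] by (simp add: ennreal_mult_less_top)
    finally show "emeasure ?L (cball 0 R) < \<infinity>" .
  next
    fix R :: real assume R: "R > 0"
    have "0 < ennreal R * emeasure L (cball 0 (R / 2))" using pos[of "R / 2"] R by (simp add: ennreal_zero_less_mult_iff)
    also have "\<dots> = (\<integral>\<^sup>+w. ennreal R * indicator (cball 0 (R / 2)) w \<partial>L)" by (subst nn_integral_cmult) auto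
    also have "\<dots> \<le> (\<integral>\<^sup>+w. \<integral>\<^sup>+t. indicator (cball 0 R) (w + t *\<^sub>R b) \<partial>lborel \<partial>L)"
    proof (rule nn_integral_mono)
      fix w :: 'e
      have "indicator (cball 0 (R / 2)) w * indicator {- (R / 2)..R / 2} t \<le> (indicator (cball 0 R) (w + t *\<^sub>R b) :: ennreal)" for t
      proof (cases "norm w \<le> R / 2 \<and> \<bar>t\<bar> \<le> R / 2")
        case True
        then have "norm (w + t *\<^sub>R b) \<le> R" using norm_triangle_ineq[of w "t *\<^sub>R b"] b(1) by simp
        then show ?thesis by (auto simp: indicator_def)
      qed (auto simp: indicator_def abs_le_iff)
      then have "(\<integral>\<^sup>+t. indicator (cball 0 (R / 2)) w * indicator {- (R / 2)..R / 2} t \<partial>lborel) \<le> (\<integral>\<^sup>+t. indicator (cball 0 R) (w + t *\<^sub>R b) \<partial>lborel)"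
        by (rule nn_integral_mono)
      moreover have "(\<integral>\<^sup>+t. indicator (cball 0 (R / 2)) w * indicator {- (R / 2)..R / 2} t \<partial>lborel) = indicator (cball 0 (R / 2)) w * ennreal R"
        using R by (subst nn_integral_cmult) auto
      ultimately show "ennreal R * indicator (cball 0 (R / 2)) w \<le> (\<integral>\<^sup>+t. indicator (cball 0 R) (w + t *\<^sub>R b) \<partial>lborel)"
        by (simp add: mult.commute)
    qed
    also have "\<dots> = (\<integral>\<^sup>+w. indicator (cball 0 R) w \<partial>?L)"
      by (rule I[symmetric]) (intro borel_measurable_indicator borel_closed closed_cball)
    also have "\<dots> = emeasure ?L (cball 0 R)" by simp
    finally show "0 < emeasure ?L (cball 0 R)" .
  qed
qed

lemma subspace_haar_exists:
  assumes "subspace (W :: 'e::euclidean_space set)" shows "\<exists>L. subspace_haar W (dim W) L"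
proof -
  obtain B where B: "B \<subseteq> W" "pairwise orthogonal B" "\<And>x. x \<in> B \<Longrightarrow> norm x = 1" "independent B" "card B = dim W" "span B = W"
    using orthonormal_basis_subspace[OF assms] by blast
  have "finite B" using B(4) by (rule independent_imp_finite)
  then have "pairwise orthogonal B \<Longrightarrow> (\<And>x. x \<in> B \<Longrightarrow> norm x = 1) \<Longrightarrow> \<exists>L. subspace_haar (span B) (card B) L"
  proof (induction B rule: finite_induct)
    case empty
    \<comment> \<open>The Dirac measure at the origin, as the image of counting measure on one
      point.\<close>
    let ?L = "distr (count_space {()}) borel (\<lambda>_. 0 :: 'e)"
    have I: "(\<integral>\<^sup>+w. f w \<partial>?L) = f 0" if "f \<in> borel_measurable borel" for f :: "'e \<Rightarrow> ennreal"
      using that by (subst nn_integral_distr) (auto simp: nn_integral_count_space_finite)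
    have E: "emeasure ?L (cball 0 R) = (if 0 \<le> R then 1 else 0)" for R
      by (subst emeasure_distr) (auto simp: vimage_def)
    have "subspace_haar {0 :: 'e} 0 ?L"
      unfolding subspace_haar_def
    proof (intro conjI ballI allI impI)
      fix f :: "'e \<Rightarrow> ennreal" and v :: 'e and r :: real assume f: "f \<in> borel_measurable borel"
      have "(\<lambda>w. f (v + w)) \<in> borel_measurable borel" "(\<lambda>w. f (r *\<^sub>R w)) \<in> borel_measurable borel"
        using f by measurable
      then show "v \<in> {0} \<Longrightarrow> (\<integral>\<^sup>+w. f (v + w) \<partial>?L) = (\<integral>\<^sup>+w. f w \<partial>?L)"
        "(\<integral>\<^sup>+w. f w \<partial>?L) = ennreal (\<bar>r\<bar> ^ 0) * (\<integral>\<^sup>+w. f (r *\<^sub>R w) \<partial>?L)"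
        using f by (auto simp: I)
    next
      show "AE w in ?L. w \<in> {0}" by (subst AE_distr_iff) auto
    qed (auto simp: E)
    then show ?case by (auto simp: span_empty)
  next
    case (insert b B)
    then obtain L where L: "subspace_haar (span B) (card B) L" by (auto simp: pairwise_insert)
    have orth: "w \<bullet> b = 0" if "w \<in> span B" for w
    proof -
      have "orthogonal b w"
      proof (rule orthogonal_to_span[OF that])
        fix y assume "y \<in> B" then show "orthogonal b y" using insert.prems(1) insert.hyps(2) by (auto simp: pairwise_insert)
      qed
      then show ?thesis by (simp add: orthogonal_def inner_commute)
    qed
    have "span (insert b B) = {w + t *\<^sub>R b | w t. w \<in> span B}"
    proof (rule Set.set_eqI, rule iffI)
      fix x assume "x \<in> span (insert b B)"
      then obtain t where "x - t *\<^sub>R b \<in> span B" by (auto simp: span_insert)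
      then show "x \<in> {w + t *\<^sub>R b | w t. w \<in> span B}" by (intro CollectI exI[of _ "x - t *\<^sub>R b"] exI[of _ t]) simp
    next
      fix x assume "x \<in> {w + t *\<^sub>R b | w t. w \<in> span B}"
      then obtain w t where "x = w + t *\<^sub>R b" "w \<in> span B" by blast
      then show "x \<in> span (insert b B)" by (auto simp: span_insert intro!: exI[of _ t])
    qed
    then show ?case
      using subspace_haar_extend[OF L subspace_span _ orth] insert by (metis card_insert_disjoint insertI1)
  qed
  then show ?thesis using B by auto
qed

section \<open>Homogeneous subgroups and their Haar measures\<close>

definition hsub :: "((real ^ 'n) \<times> (real ^ 'n)) set \<Rightarrow> bool \<Rightarrow> ('n::finite) heis set" where
  "hsub W vert = {p. fst p \<in> W \<and> (vert \<or> snd p = 0)}"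

text \<open>Homogeneous subgroups are either vertical, \<open>W \<times> \<real>\<close>, or horizontal, \<open>W \<times> {0}\<close> with \<open>W\<close> isotropic.\<close>
definition hsub_adm :: "((real ^ 'n) \<times> (real ^ 'n)) set \<Rightarrow> bool \<Rightarrow> bool" where
  "hsub_adm W vert \<longleftrightarrow> subspace W \<and> (vert \<or> (\<forall>v\<in>W. \<forall>w\<in>W. rot v \<bullet> w = 0))"

text \<open>The vertical direction counts twice because dilations act on it by
  \<open>r\<^sup>2\<close>; this is the exponent by which Haar measure scales.\<close>

definition hom_dim :: "((real ^ ('n::finite)) \<times> (real ^ 'n)) set \<Rightarrow> bool \<Rightarrow> nat" where
  "hom_dim W vert = dim W + (if vert then 2 else 0)"

lemma closed_hsub: assumes "hsub_adm W vert" shows "closed (hsub W vert)"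
proof -
  have "closed W" using assms by (auto simp: hsub_adm_def intro: closed_subspace)
  then have "closed (W \<times> (UNIV :: real set))" "closed (W \<times> {0 :: real})" by (auto intro!: closed_Times)
  moreover have "hsub W vert = (if vert then W \<times> UNIV else W \<times> {0})" by (auto simp: hsub_def)
  ultimately show ?thesis by simp
qed

lemma hsub_hmul: "hsub_adm W vert \<Longrightarrow> p \<in> hsub W vert \<Longrightarrow> q \<in> hsub W vert \<Longrightarrow> p \<odot> q \<in> hsub W vert"
  by (auto simp: hsub_adm_def hsub_def hmul_def hform_rot subspace_add)

lemma hsub_uminus: "hsub_adm W vert \<Longrightarrow> p \<in> hsub W vert \<Longrightarrow> - p \<in> hsub W vert"
  by (auto simp: hsub_adm_def hsub_def subspace_neg)

lemma hsub_hdilation: "hsub_adm W vert \<Longrightarrow> p \<in> hsub W vert \<Longrightarrow> hdilation r p \<in> hsub W vert"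
  by (auto simp: hsub_adm_def hsub_def hdilation_def subspace_scale)

lemma hsub_0: "hsub_adm W vert \<Longrightarrow> 0 \<in> hsub W vert"
  by (auto simp: hsub_adm_def hsub_def subspace_0)

lemma homogeneous_subgroup_hsub:
  assumes "hsub_adm W vert" shows "homogeneous_subgroup (hsub W vert)"
  unfolding homogeneous_subgroup_def
proof (intro conjI allI impI)
  show "subgroup (hsub W vert) heisenberg"
    using assms hsub_hmul hsub_uminus hsub_0
    by (auto simp: subgroup_def heisenberg_mult heisenberg_one inv_heisenberg)
  show "closed (hsub W vert)" by (rule closed_hsub[OF assms])
  fix r :: real assume "0 < r"
  then have "p \<in> hdilation r ` hsub W vert" if "p \<in> hsub W vert" for p
    using hsub_hdilation[OF assms that, of "1 / r"] by (intro image_eqI[of _ _ "hdilation (1 / r) p"]) auto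
  then show "hdilation r ` hsub W vert = hsub W vert" using hsub_hdilation[OF assms] by blast
qed

text \<open>Invariance under inversion is included since it turns left into right invariance, on
  which the uniqueness argument depends.\<close>

definition haar_on :: "('n::finite) heis set \<Rightarrow> nat \<Rightarrow> 'n heis measure \<Rightarrow> bool" where
  "haar_on V m L \<longleftrightarrow> sets L = sets borel \<and>
    (\<forall>f\<in>borel_measurable borel. \<forall>p\<in>V. (\<integral>\<^sup>+q. f (p \<odot> q) \<partial>L) = (\<integral>\<^sup>+q. f q \<partial>L)) \<and>
    (\<forall>f\<in>borel_measurable borel. (\<integral>\<^sup>+q. f (- q) \<partial>L) = (\<integral>\<^sup>+q. f q \<partial>L)) \<and>
    (\<forall>f\<in>borel_measurable borel. \<forall>r>0. (\<integral>\<^sup>+q. f q \<partial>L) = ennreal (r ^ m) * (\<integral>\<^sup>+q. f (hdilation r q) \<partial>L)) \<and>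
    (AE q in L. q \<in> V) \<and>
    (\<forall>R. emeasure L (hball 0 R) < \<infinity>) \<and> (\<forall>R>0. 0 < emeasure L (hball 0 R))"

text \<open>Left multiplication translates the horizontal part and shifts each vertical line by an
  amount depending on that part only, so integrating over the vertical variable first removes the
  shift.\<close>

lemma haar_on_exists_vertical:
  fixes W :: "((real ^ ('n::finite)) \<times> (real ^ 'n)) set"
  assumes L: "subspace_haar W k L" and W: "subspace W"
  shows "haar_on (hsub W True) (k + 2) (L \<Otimes>\<^sub>M lborel)" (is "haar_on ?V _ ?L")
proof -
  note D = subspace_haarD[OF L]
  note setsL [measurable_cong] = D(1)
  have [simp]: "space L = UNIV" using sets_eq_imp_space_eq[OF setsL] by simp
  note trans = D(2) and scal = D(3) and AEW = D(4)
  note fin = D(5) and pos = D(6)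
  have setsP: "sets ?L = sets (borel :: 'n heis measure)"
    by (subst borel_prod[symmetric]) (intro sets_pair_measure_cong setsL sets_lborel)
  have meas: "f \<in> borel_measurable borel \<Longrightarrow> f \<in> borel_measurable (L \<Otimes>\<^sub>M lborel)" for f :: "'n heis \<Rightarrow> ennreal"
    using measurable_cong_sets[OF setsP refl] by blast
  have I: "(\<integral>\<^sup>+q. f q \<partial>?L) = (\<integral>\<^sup>+w. \<integral>\<^sup>+t. f (w, t) \<partial>lborel \<partial>L)" if "f \<in> borel_measurable borel" for f :: "'n heis \<Rightarrow> ennreal"
    by (rule lborel.nn_integral_fst[symmetric]) (rule meas[OF that])
  have inner: "(\<lambda>w. \<integral>\<^sup>+t. f (w, t) \<partial>lborel) \<in> borel_measurable borel" if "f \<in> borel_measurable borel" for f :: "'n heis \<Rightarrow> ennreal"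
    using lborel.borel_measurable_nn_integral_fst[OF meas[OF that]] measurable_cong_sets[OF setsL refl] by blast
  have sec: "(\<lambda>t. f (w, t)) \<in> borel_measurable borel" if "f \<in> borel_measurable borel" for f :: "'n heis \<Rightarrow> ennreal" and w
    by (rule measurable_compose[OF _ that]) (intro borel_measurable_continuous_onI continuous_intros)
  have comp: "(\<lambda>q. f (h q)) \<in> borel_measurable borel" if "f \<in> borel_measurable borel" "continuous_on UNIV h"
    for f :: "'n heis \<Rightarrow> ennreal" and h :: "'n heis \<Rightarrow> 'n heis"
    by (rule measurable_compose[OF _ that(1)]) (rule borel_measurable_continuous_onI[OF that(2)])
  show ?thesis
    unfolding haar_on_def
  proof (intro conjI ballI allI impI setsP)
    fix f :: "'n heis \<Rightarrow> ennreal" and p assume f: "f \<in> borel_measurable borel" and p: "p \<in> ?V"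
    have "(\<integral>\<^sup>+q. f (p \<odot> q) \<partial>?L) = (\<integral>\<^sup>+w. \<integral>\<^sup>+t. f (fst p + w, t + (snd p + 2 * (rot (fst p) \<bullet> w))) \<partial>lborel \<partial>L)"
      by (subst I[OF comp[OF f]]) (auto intro!: continuous_intros simp: hmul_def hform_rot add_ac)
    also have "\<dots> = (\<integral>\<^sup>+w. \<integral>\<^sup>+t. f (fst p + w, t) \<partial>lborel \<partial>L)"
      by (intro nn_integral_cong lborel_translate sec[OF f])
    also have "\<dots> = (\<integral>\<^sup>+w. \<integral>\<^sup>+t. f (w, t) \<partial>lborel \<partial>L)"
      by (rule trans[OF inner[OF f]]) (use p in \<open>simp add: hsub_def\<close>)
    finally show "(\<integral>\<^sup>+q. f (p \<odot> q) \<partial>?L) = (\<integral>\<^sup>+q. f q \<partial>?L)" by (simp add: I[OF f])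
  next
    fix f :: "'n heis \<Rightarrow> ennreal" assume f: "f \<in> borel_measurable borel"
    have "(\<integral>\<^sup>+q. f (- q) \<partial>?L) = (\<integral>\<^sup>+w. \<integral>\<^sup>+t. f (- w, 0 + -1 * t) \<partial>lborel \<partial>L)"
      by (subst I[OF comp[OF f]]) (auto intro!: continuous_intros simp: prod_eq_iff uminus_prod_def)
    also have "\<dots> = (\<integral>\<^sup>+w. \<integral>\<^sup>+t. f (- w, t) \<partial>lborel \<partial>L)"
      by (rule nn_integral_cong) (use nn_integral_real_affine[OF sec[OF f], of "-1" _ 0] in simp)
    also have "\<dots> = (\<integral>\<^sup>+w. \<integral>\<^sup>+t. f (w, t) \<partial>lborel \<partial>L)"
      using scal[OF inner[OF f], of "-1"] by simp
    finally show "(\<integral>\<^sup>+q. f (- q) \<partial>?L) = (\<integral>\<^sup>+q. f q \<partial>?L)" by (simp add: I[OF f])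
  next
    fix f :: "'n heis \<Rightarrow> ennreal" and r :: real assume f: "f \<in> borel_measurable borel" and r: "r > 0"
    have h: "(\<lambda>q. f (hdilation r q)) \<in> borel_measurable borel" by (rule comp[OF f]) (intro continuous_intros)
    have "(\<integral>\<^sup>+q. f q \<partial>?L) = (\<integral>\<^sup>+w. \<integral>\<^sup>+t. f (w, t) \<partial>lborel \<partial>L)" by (rule I[OF f])
    also have "\<dots> = ennreal (\<bar>r\<bar> ^ k) * (\<integral>\<^sup>+w. \<integral>\<^sup>+t. f (r *\<^sub>R w, t) \<partial>lborel \<partial>L)"
      by (rule scal[OF inner[OF f]]) (use r in simp)
    also have "(\<integral>\<^sup>+w. \<integral>\<^sup>+t. f (r *\<^sub>R w, t) \<partial>lborel \<partial>L) = (\<integral>\<^sup>+w. ennreal (r\<^sup>2) * (\<integral>\<^sup>+t. f (r *\<^sub>R w, 0 + r\<^sup>2 * t) \<partial>lborel) \<partial>L)"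
      by (rule nn_integral_cong) (use nn_integral_real_affine[OF sec[OF f], of "r\<^sup>2" _ 0] r in simp)
    also have "\<dots> = ennreal (r\<^sup>2) * (\<integral>\<^sup>+w. (\<integral>\<^sup>+t. f (hdilation r (w, t)) \<partial>lborel) \<partial>L)"
      using inner[OF h] measurable_cong_sets[OF setsL refl, of borel]
      by (subst nn_integral_cmult[symmetric]) (auto simp: hdilation_def)
    also have "(\<integral>\<^sup>+w. (\<integral>\<^sup>+t. f (hdilation r (w, t)) \<partial>lborel) \<partial>L) = (\<integral>\<^sup>+q. f (hdilation r q) \<partial>?L)" by (rule I[OF h, symmetric])
    finally show "(\<integral>\<^sup>+q. f q \<partial>?L) = ennreal (r ^ (k + 2)) * (\<integral>\<^sup>+q. f (hdilation r q) \<partial>?L)"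
      using r by (simp only: power_add ennreal_mult zero_le_power zero_le_power2 abs_of_pos less_imp_le mult.assoc)
  next
    have V: "?V \<in> sets borel" using W by (intro borel_closed closed_hsub) (simp add: hsub_adm_def)
    then have [measurable]: "indicator (- ?V) \<in> borel_measurable (borel :: 'n heis measure)" by measurable
    have "emeasure ?L (- ?V) = (\<integral>\<^sup>+q. indicator (- ?V) q \<partial>?L)"
      using V setsP by (intro nn_integral_indicator[symmetric]) (metis borel_comp)
    also have "\<dots> = (\<integral>\<^sup>+w. \<integral>\<^sup>+t. indicator (- ?V) (w, t) \<partial>lborel \<partial>L)" by (rule I) measurable
    also have "\<dots> = (\<integral>\<^sup>+w. 0 \<partial>L)"
      by (rule nn_integral_cong_AE, use AEW in eventually_elim) (simp add: hsub_def)
    finally have "- ?V \<in> null_sets ?L" using V setsP by (intro null_setsI) (auto simp: borel_comp)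
    then show "AE q in ?L. q \<in> ?V" by (rule AE_I') auto
  next
    fix R :: real
    have "emeasure ?L (hball 0 R) \<le> emeasure ?L (cball 0 \<bar>R\<bar> \<times> {-(R\<^sup>2)..R\<^sup>2})"
    proof (rule emeasure_mono)
      show "hball (0 :: 'n heis) R \<subseteq> cball 0 \<bar>R\<bar> \<times> {- (R\<^sup>2)..R\<^sup>2}"
      proof (rule subsetI)
        fix q :: "'n heis" assume "q \<in> hball 0 R"
        then have q: "hnorm q \<le> R" by (simp add: hball_def)
        then have "(hnorm q)\<^sup>2 \<le> R\<^sup>2" by (intro power_mono) auto
        then show "q \<in> cball 0 \<bar>R\<bar> \<times> {- (R\<^sup>2)..R\<^sup>2}"
          using norm_fst_le_hnorm[of q] abs_snd_le_hnorm[of q] q by (auto simp: mem_Times_iff abs_le_iff)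
      qed
      show "cball 0 \<bar>R\<bar> \<times> {- (R\<^sup>2)..R\<^sup>2} \<in> sets ?L" unfolding setsP by (intro borel_closed closed_Times) auto
    qed
    also have "\<dots> = emeasure L (cball 0 \<bar>R\<bar>) * emeasure lborel {-(R\<^sup>2)..R\<^sup>2}"
      by (rule lborel.emeasure_pair_measure_Times) (auto simp: setsL)
    also have "\<dots> < \<infinity>" using fin[of "\<bar>R\<bar>"] by (simp add: ennreal_mult_less_top)
    finally show "emeasure ?L (hball 0 R) < \<infinity>" .
  next
    fix R :: real assume R: "R > 0"
    \<comment> \<open>With both coordinates at most \<open>S\<close>, the fourth power of the gauge
      is at most twice the fourth power of \<open>R / 2\<close>.\<close>
    define S where "S = min (R / 2) ((R / 2)\<^sup>2)"
    have S: "S > 0" "S \<le> R / 2" "S \<le> (R / 2)\<^sup>2" using R by (auto simp: S_def)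
    have "0 < emeasure L (cball 0 S) * ennreal (2 * S)" using pos[OF S(1)] S(1) by (simp add: ennreal_zero_less_mult_iff)
    also have "\<dots> = emeasure L (cball 0 S) * emeasure lborel {-S..S}" using S by simp
    also have "\<dots> = emeasure ?L (cball 0 S \<times> {-S..S})"
      by (rule lborel.emeasure_pair_measure_Times[symmetric]) (auto simp: setsL)
    also have "\<dots> \<le> emeasure ?L (hball 0 R)"
    proof (rule emeasure_mono)
      show "cball 0 S \<times> {-S..S} \<subseteq> hball (0 :: 'n heis) R"
      proof (rule subsetI)
        fix q :: "'n heis" assume "q \<in> cball 0 S \<times> {-S..S}"
        then have q: "norm (fst q) \<le> S" "\<bar>snd q\<bar> \<le> S" by (auto simp: mem_Times_iff abs_le_iff)
        have "hnorm q ^ 4 \<le> (R / 2) ^ 4 + ((R / 2)\<^sup>2)\<^sup>2"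
          unfolding hnorm_pow4 using q S by (intro add_mono power_mono abs_le_square_iff[THEN iffD1]) auto
        also have "\<dots> \<le> R ^ 4" using R by (simp add: power_divide flip: power_mult)
        finally have "hnorm q \<le> R" using R by (simp add: power_mono_iff)
        then show "q \<in> hball 0 R" by (simp add: hball_def)
      qed
      show "hball 0 R \<in> sets ?L" unfolding setsP by simp
    qed
    finally show "0 < emeasure ?L (hball 0 R)" .
  qed
qed

text \<open>On an isotropic subspace the group form vanishes and the group law is addition. The
  measure is carried by the subspace, so almost everywhere identities are enough.\<close>

lemma haar_on_exists_horizontal:
  fixes W :: "((real ^ ('n::finite)) \<times> (real ^ 'n)) set"
  assumes L: "subspace_haar W k L" and W: "hsub_adm W False"
  shows "haar_on (hsub W False) k (distr L borel (\<lambda>w. (w, 0)))" (is "haar_on ?V _ ?L")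
proof -
  note D = subspace_haarD[OF L]
  note setsL [measurable_cong] = D(1)
  have [simp]: "space L = UNIV" using sets_eq_imp_space_eq[OF setsL] by simp
  note trans = D(2) and scal = D(3) and AEW = D(4)
  have emb [measurable]: "(\<lambda>w. (w, 0)) \<in> measurable borel (borel :: 'n heis measure)"
    by (intro borel_measurable_continuous_onI continuous_intros)
  have I: "(\<integral>\<^sup>+q. f q \<partial>?L) = (\<integral>\<^sup>+w. f (w, 0) \<partial>L)" if [measurable]: "f \<in> borel_measurable borel" for f :: "'n heis \<Rightarrow> ennreal"
    by (rule nn_integral_distr) measurable
  have sec: "(\<lambda>w. f (w, 0)) \<in> borel_measurable borel" if [measurable]: "f \<in> borel_measurable borel" for f :: "'n heis \<Rightarrow> ennreal"
    by measurable
  have comp: "(\<lambda>q. f (h q)) \<in> borel_measurable borel" if "f \<in> borel_measurable borel" "continuous_on UNIV h"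
    for f :: "'n heis \<Rightarrow> ennreal" and h :: "'n heis \<Rightarrow> 'n heis"
    by (rule measurable_compose[OF _ that(1)]) (rule borel_measurable_continuous_onI[OF that(2)])
  have hn: "hnorm (w :: (real^'n) \<times> (real^'n), 0) = norm w" for w
    by (simp add: hnorm_def real_root_power_cancel)
  have ball: "emeasure ?L (hball 0 R) = emeasure L (cball 0 R)" for R
  proof -
    have "(\<lambda>w. (w, 0)) -` hball (0 :: 'n heis) R = cball 0 R" by (auto simp: hball_def hn)
    then show ?thesis by (subst emeasure_distr) (auto simp: setsL)
  qed
  show ?thesis
    unfolding haar_on_def
  proof (intro conjI ballI allI impI)
    show "sets ?L = sets borel" by simp
  next
    fix f :: "'n heis \<Rightarrow> ennreal" and p assume f: "f \<in> borel_measurable borel" and p: "p \<in> ?V"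
    have "(\<integral>\<^sup>+q. f (p \<odot> q) \<partial>?L) = (\<integral>\<^sup>+w. f (p \<odot> (w, 0)) \<partial>L)"
      by (rule I[OF comp[OF f]]) (intro continuous_intros)
    also have "\<dots> = (\<integral>\<^sup>+w. f (fst p + w, 0) \<partial>L)"
    proof (rule nn_integral_cong_AE, use AEW in eventually_elim)
      fix w assume "w \<in> W"
      then show "f (p \<odot> (w, 0)) = f (fst p + w, 0)" using p W by (simp add: hmul_def hform_rot hsub_adm_def hsub_def)
    qed
    also have "\<dots> = (\<integral>\<^sup>+w. f (w, 0) \<partial>L)" by (rule trans[OF sec[OF f]]) (use p in \<open>simp add: hsub_def\<close>)
    finally show "(\<integral>\<^sup>+q. f (p \<odot> q) \<partial>?L) = (\<integral>\<^sup>+q. f q \<partial>?L)" by (simp add: I[OF f])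
  next
    fix f :: "'n heis \<Rightarrow> ennreal" assume f: "f \<in> borel_measurable borel"
    have "(\<integral>\<^sup>+q. f (- q) \<partial>?L) = (\<integral>\<^sup>+w. f (- w, 0) \<partial>L)"
      by (subst I[OF comp[OF f]]) (auto intro!: continuous_intros simp: uminus_prod_def)
    also have "\<dots> = (\<integral>\<^sup>+w. f (w, 0) \<partial>L)" using scal[OF sec[OF f], of "-1"] by simp
    finally show "(\<integral>\<^sup>+q. f (- q) \<partial>?L) = (\<integral>\<^sup>+q. f q \<partial>?L)" by (simp add: I[OF f])
  next
    fix f :: "'n heis \<Rightarrow> ennreal" and r :: real assume f: "f \<in> borel_measurable borel" and r: "r > 0"
    have "(\<integral>\<^sup>+q. f (hdilation r q) \<partial>?L) = (\<integral>\<^sup>+w. f (r *\<^sub>R w, 0) \<partial>L)"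
      by (subst I[OF comp[OF f]]) (auto intro!: continuous_intros simp: hdilation_def)
    then show "(\<integral>\<^sup>+q. f q \<partial>?L) = ennreal (r ^ k) * (\<integral>\<^sup>+q. f (hdilation r q) \<partial>?L)"
      using scal[OF sec[OF f], of r] r by (simp add: I[OF f])
  next
    have "closed ?V" by (rule closed_hsub[OF W])
    then have [measurable]: "?V \<in> sets borel" by (rule borel_closed)
    show "AE q in ?L. q \<in> ?V"
    proof (subst AE_distr_iff)
      show "AE w in L. (w, 0) \<in> ?V" using AEW by eventually_elim (simp add: hsub_def)
    qed (auto simp: setsL cong: measurable_cong_sets)
  qed (simp_all only: ball D(5,6))
qed

lemma haar_on_exists:
  assumes "hsub_adm W vert" obtains L where "haar_on (hsub W vert) (hom_dim W vert) L"
proof -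
  have "subspace W" using assms by (simp add: hsub_adm_def)
  then obtain L where L: "subspace_haar W (dim W) L" using subspace_haar_exists by blast
  show thesis
  proof (cases vert)
    case True
    then show thesis using that haar_on_exists_vertical[OF L] assms by (auto simp: hom_dim_def hsub_adm_def)
  next
    case False
    then show thesis using that haar_on_exists_horizontal[OF L] assms by (auto simp: hom_dim_def)
  qed
qed

lemma integral_from_nn:
  fixes f :: "'a \<Rightarrow> real"
  assumes "integrable M f" "integrable N g"
    "(\<integral>\<^sup>+x. ennreal (f x) \<partial>M) = ennreal c * (\<integral>\<^sup>+x. ennreal (g x) \<partial>N)"
    "(\<integral>\<^sup>+x. ennreal (- f x) \<partial>M) = ennreal c * (\<integral>\<^sup>+x. ennreal (- g x) \<partial>N)" "c \<ge> 0"
  shows "integral\<^sup>L M f = c * integral\<^sup>L N g"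
  using assms by (simp add: real_lebesgue_integral_def enn2real_mult right_diff_distrib)

locale haar =
  fixes V :: "('n::finite) heis set" and m :: nat and L :: "'n heis measure"
  assumes haar: "haar_on V m L"
begin

text \<open>A Haar measure is locally finite, so the facts about integrability of \<open>Cc\<close>
  functions carry over; the locale asks for some positive exponent.\<close>

sublocale heis_measure L 1
proof
  show "sets L = sets borel" using haar by (simp add: haar_on_def)
  fix K :: "'n heis set" assume "compact K"
  then have "bounded K" by (rule compact_imp_bounded)
  then obtain R where R: "\<And>x. x \<in> K \<Longrightarrow> norm x \<le> R" unfolding bounded_iff by blast
  obtain R' where R': "\<And>p :: 'n heis. norm p \<le> R \<Longrightarrow> hnorm p \<le> R'" using hnorm_le_of_norm by metis
  then have "K \<subseteq> hball 0 R'" using R by (auto simp: hball_def)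
  then have "emeasure L K \<le> emeasure L (hball 0 R')" using haar by (intro emeasure_mono) (auto simp: haar_on_def)
  also have "\<dots> < \<infinity>" using haar by (simp add: haar_on_def)
  finally show "emeasure L K < \<infinity>" .
qed simp

definition Hf :: "('n heis \<Rightarrow> real) \<Rightarrow> real" where
  "Hf f = (LINT q|L. f q)"

lemma posfun_Hf: "posfun Hf"
  unfolding posfun_def Hf_def
  by (intro conjI ballI allI impI Bochner_Integration.integral_add integrable_Cc Bochner_Integration.integral_nonneg)
    (auto simp: integrable_Cc)

lemma AE_V: "AE q in L. q \<in> V"
  using haar by (simp add: haar_on_def)

lemma Cc_borel: "f \<in> Cc \<Longrightarrow> f \<in> borel_measurable borel"
  by (intro borel_measurable_continuous_onI Cc_cont)

lemma Hf_left: assumes "f \<in> Cc" "p \<in> V" shows "Hf (\<lambda>q. f (p \<odot> q)) = Hf f"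
proof -
  have "Hf (\<lambda>q. f (p \<odot> q)) = 1 * Hf f"
    unfolding Hf_def
  proof (rule integral_from_nn)
    have [measurable]: "f \<in> borel_measurable borel" by (rule Cc_borel[OF assms(1)])
    have inv: "(\<integral>\<^sup>+q. g (p \<odot> q) \<partial>L) = (\<integral>\<^sup>+q. g q \<partial>L)" if "g \<in> borel_measurable borel" for g
      using haar assms(2) that by (simp add: haar_on_def)
    show "(\<integral>\<^sup>+x. ennreal (f (p \<odot> x)) \<partial>L) = ennreal 1 * (\<integral>\<^sup>+x. ennreal (f x) \<partial>L)"
      using inv[of "\<lambda>x. ennreal (f x)"] by simp
    show "(\<integral>\<^sup>+x. ennreal (- f (p \<odot> x)) \<partial>L) = ennreal 1 * (\<integral>\<^sup>+x. ennreal (- f x) \<partial>L)"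
      using inv[of "\<lambda>x. ennreal (- f x)"] by simp
  qed (use assms in \<open>auto intro: integrable_Cc Cc_translate\<close>)
  then show ?thesis by simp
qed

lemma Hf_hdilation: assumes "f \<in> Cc" "r > 0" shows "Hf f = r ^ m * Hf (\<lambda>q. f (hdilation r q))"
  unfolding Hf_def
proof (rule integral_from_nn)
  have [measurable]: "f \<in> borel_measurable borel" by (rule Cc_borel[OF assms(1)])
  have inv: "(\<integral>\<^sup>+q. g q \<partial>L) = ennreal (r ^ m) * (\<integral>\<^sup>+q. g (hdilation r q) \<partial>L)" if "g \<in> borel_measurable borel" for g
    using haar that assms(2) by (simp add: haar_on_def)
  show "(\<integral>\<^sup>+x. ennreal (f x) \<partial>L) = ennreal (r ^ m) * (\<integral>\<^sup>+x. ennreal (f (hdilation r x)) \<partial>L)"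
    using inv[of "\<lambda>x. ennreal (f x)"] by simp
  show "(\<integral>\<^sup>+x. ennreal (- f x) \<partial>L) = ennreal (r ^ m) * (\<integral>\<^sup>+x. ennreal (- f (hdilation r x)) \<partial>L)"
    using inv[of "\<lambda>x. ennreal (- f x)"] by simp
qed (use assms in \<open>auto intro: integrable_Cc Cc_hdilation\<close>)

lemma Hf_mono_on_V:
  assumes "f \<in> Cc" "g \<in> Cc" "\<And>q. q \<in> V \<Longrightarrow> f q \<le> g q" shows "Hf f \<le> Hf g"
  unfolding Hf_def
  by (intro integral_mono_AE integrable_Cc assms) (use AE_V assms(3) in \<open>auto elim: eventually_mono\<close>)

lemma Hf_bump_pos: "0 < Hf (bump 1)"
proof -
  have "0 < emeasure L (hball 0 1)" using haar by (simp add: haar_on_def)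
  then have "0 < measure L (hball 0 1)" by (simp add: emeasure_hball)
  also have "measure L (hball 0 1) = (LINT q|L. indicator (hball 0 1) q)" by simp
  also have "\<dots> \<le> Hf (bump 1)" unfolding Hf_def
    by (intro integral_mono integrable_indicator_hball integrable_Cc bump_Cc)
      (auto simp: indicator_def hball_def bump_eq_1 bump_bounds)
  finally show ?thesis .
qed

end

section \<open>Carriers of minimal dimension\<close>

definition dilf :: "real \<Rightarrow> real \<Rightarrow> (('n::finite heis \<Rightarrow> real) \<Rightarrow> real) \<Rightarrow> (('n heis \<Rightarrow> real) \<Rightarrow> real)" where
  "dilf s t \<Lambda> = (\<lambda>f. t powr (- s) * \<Lambda> (\<lambda>q. f (hdilation (1 / t) q)))"

definition trf :: "'n::finite heis \<Rightarrow> (('n heis \<Rightarrow> real) \<Rightarrow> real) \<Rightarrow> (('n heis \<Rightarrow> real) \<Rightarrow> real)" where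
  "trf p \<Lambda> = (\<lambda>f. \<Lambda> (\<lambda>q. f (- p \<odot> q)))"

lemma fsupp_trf: "x \<in> fsupp (trf p \<Lambda>) \<longleftrightarrow> p \<odot> x \<in> fsupp \<Lambda>"
proof
  assume x: "x \<in> fsupp (trf p \<Lambda>)"
  show "p \<odot> x \<in> fsupp \<Lambda>"
    unfolding fsupp_def
  proof (intro CollectI ballI impI)
    fix f :: "'a heis \<Rightarrow> real" assume f: "f \<in> Cc" "\<forall>x. 0 \<le> f x" "0 < f (p \<odot> x)"
    have "(\<lambda>q. f (p \<odot> q)) \<in> Cc" by (rule Cc_translate[OF f(1)])
    then have "0 < trf p \<Lambda> (\<lambda>q. f (p \<odot> q))"
      using x[unfolded fsupp_def mem_Collect_eq, rule_format, of "\<lambda>q. f (p \<odot> q)"] f by simp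
    then show "0 < \<Lambda> f" by (simp add: trf_def)
  qed
next
  assume x: "p \<odot> x \<in> fsupp \<Lambda>"
  show "x \<in> fsupp (trf p \<Lambda>)"
    unfolding fsupp_def
  proof (intro CollectI ballI impI)
    fix f :: "'a heis \<Rightarrow> real" assume f: "f \<in> Cc" "\<forall>x. 0 \<le> f x" "0 < f x"
    have "(\<lambda>q. f (- p \<odot> q)) \<in> Cc" by (rule Cc_translate[OF f(1)])
    moreover have "\<forall>q. 0 \<le> f (- p \<odot> q)" "0 < f (- p \<odot> (p \<odot> x))" using f by simp_all
    ultimately show "0 < trf p \<Lambda> f"
      using x[unfolded fsupp_def mem_Collect_eq, rule_format, of "\<lambda>q. f (- p \<odot> q)"] by (simp add: trf_def)
  qed
qed

lemma fsupp_dilf: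
  assumes "t > 0" shows "x \<in> fsupp (dilf s t \<Lambda>) \<longleftrightarrow> hdilation t x \<in> fsupp \<Lambda>"
proof
  assume x: "x \<in> fsupp (dilf s t \<Lambda>)"
  show "hdilation t x \<in> fsupp \<Lambda>"
    unfolding fsupp_def
  proof (intro CollectI ballI impI)
    fix f :: "'a heis \<Rightarrow> real" assume f: "f \<in> Cc" "\<forall>x. 0 \<le> f x" "0 < f (hdilation t x)"
    have "(\<lambda>q. f (hdilation t q)) \<in> Cc" by (rule Cc_hdilation[OF f(1) assms])
    then have "0 < dilf s t \<Lambda> (\<lambda>q. f (hdilation t q))"
      using x[unfolded fsupp_def mem_Collect_eq, rule_format, of "\<lambda>q. f (hdilation t q)"] f by simp
    then show "0 < \<Lambda> f" using assms by (simp add: dilf_def zero_less_mult_iff)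
  qed
next
  assume x: "hdilation t x \<in> fsupp \<Lambda>"
  show "x \<in> fsupp (dilf s t \<Lambda>)"
    unfolding fsupp_def
  proof (intro CollectI ballI impI)
    fix f :: "'a heis \<Rightarrow> real" assume f: "f \<in> Cc" "\<forall>x. 0 \<le> f x" "0 < f x"
    have "(\<lambda>q. f (hdilation (1 / t) q)) \<in> Cc" using assms by (intro Cc_hdilation[OF f(1)]) simp
    moreover have "\<forall>q. 0 \<le> f (hdilation (1 / t) q)" "0 < f (hdilation (1 / t) (hdilation t x))" using f assms by simp_all
    ultimately have "0 < \<Lambda> (\<lambda>q. f (hdilation (1 / t) q))"
      using x[unfolded fsupp_def mem_Collect_eq, rule_format, of "\<lambda>q. f (hdilation (1 / t) q)"] by simp
    then show "0 < dilf s t \<Lambda> f" using assms by (simp add: dilf_def)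
  qed
qed

text \<open>The component of the Riesz kernel along a horizontal vector. Arbitrary \<open>v\<close>
  are allowed because the normal of the half space at a hole is not a coordinate direction; the
  factor \<open>\<sigma>\<close> of the vertical kernel likewise selects upper or lower half
  space.\<close>

definition kern_h :: "real \<Rightarrow> (real ^ 'n) \<times> (real ^ 'n) \<Rightarrow> ('n::finite) heis \<Rightarrow> real" where
  "kern_h s v q = (fst q \<bullet> v) / hnorm q powr (s + 1)"

definition kern_v :: "real \<Rightarrow> real \<Rightarrow> ('n::finite) heis \<Rightarrow> real" where
  "kern_v s \<sigma> q = \<sigma> * snd q / hnorm q powr (s + 2)"

lemma borel_measurable_hnorm [measurable]: "hnorm \<in> borel_measurable borel"
  by (intro borel_measurable_continuous_onI continuous_on_hnorm continuous_on_id)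

lemma homogeneous_kernel_h: "homogeneous_kernel s (kern_h s v)"
  unfolding homogeneous_kernel_def
proof (intro conjI allI impI)
  show "kern_h s v \<in> borel_measurable borel"
  proof -
    have [measurable]: "(\<lambda>q :: 'a heis. fst q \<bullet> v) \<in> borel_measurable borel"
      by (intro borel_measurable_continuous_onI continuous_intros)
    show ?thesis unfolding kern_h_def[abs_def] by measurable
  qed
  show "continuous_on (- {0}) (kern_h s v)"
    unfolding kern_h_def[abs_def] by (intro continuous_intros) auto
  have "\<bar>kern_h s v q\<bar> \<le> norm v * hnorm q powr (- s)" for q
  proof (cases "q = 0")
    case False
    have "\<bar>fst q \<bullet> v\<bar> \<le> norm (fst q) * norm v" by (rule Cauchy_Schwarz_ineq2)
    also have "\<dots> \<le> hnorm q * norm v" by (intro mult_right_mono norm_fst_le_hnorm) auto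
    finally have "\<bar>kern_h s v q\<bar> \<le> hnorm q * norm v / hnorm q powr (s + 1)"
      unfolding kern_h_def abs_divide by (intro divide_mono) (use False in auto)
    also have "\<dots> = norm v * hnorm q powr (- s)" using False by (simp add: powr_add powr_minus field_simps)
    finally show ?thesis .
  qed (simp add: kern_h_def)
  then show "\<exists>C. \<forall>q. \<bar>kern_h s v q\<bar> \<le> C * hnorm q powr - s" by blast
  fix r :: real and q assume "0 < r"
  then show "kern_h s v (hdilation r q) = r powr (- s) * kern_h s v q"
    unfolding kern_h_def hnorm_hdilation[OF less_imp_le[OF \<open>0 < r\<close>]]
    by (simp add: hdilation_def powr_mult powr_add powr_minus field_simps)
qed

lemma homogeneous_kernel_v: "homogeneous_kernel s (kern_v s \<sigma> :: ('n::finite) heis \<Rightarrow> real)"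
  unfolding homogeneous_kernel_def
proof (intro conjI allI impI)
  show "(kern_v s \<sigma> :: 'n heis \<Rightarrow> real) \<in> borel_measurable borel"
  proof -
    have [measurable]: "(\<lambda>q :: 'n heis. \<sigma> * snd q) \<in> borel_measurable borel"
      by (intro borel_measurable_continuous_onI continuous_intros)
    show ?thesis unfolding kern_v_def[abs_def]
      by (intro borel_measurable_divide powr_real_measurable borel_measurable_hnorm borel_measurable_const) fact
  qed
  show "continuous_on (- {0}) (kern_v s \<sigma> :: 'n heis \<Rightarrow> real)"
    unfolding kern_v_def[abs_def] by (intro continuous_intros) auto
  have "\<bar>kern_v s \<sigma> q\<bar> \<le> \<bar>\<sigma>\<bar> * hnorm q powr (- s)" for q :: "'n heis"
  proof (cases "q = 0")
    case False
    have "\<bar>kern_v s \<sigma> q\<bar> \<le> \<bar>\<sigma>\<bar> * (hnorm q)\<^sup>2 / hnorm q powr (s + 2)"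
      unfolding kern_v_def abs_divide abs_mult
      by (intro divide_mono mult_left_mono abs_snd_le_hnorm) (use False in auto)
    also have "\<dots> = \<bar>\<sigma>\<bar> * hnorm q powr (- s)"
      using False by (simp add: powr_add powr_minus field_simps powr_numeral)
    finally show ?thesis .
  qed (simp add: kern_v_def)
  then show "\<exists>C. \<forall>q :: 'n heis. \<bar>kern_v s \<sigma> q\<bar> \<le> C * hnorm q powr - s" by blast
  fix r :: real and q :: "'n heis" assume "0 < r"
  then show "kern_v s \<sigma> (hdilation r q) = r powr (- s) * kern_v s \<sigma> q"
    unfolding kern_v_def hnorm_hdilation[OF less_imp_le[OF \<open>0 < r\<close>]]
    by (simp add: hdilation_def powr_mult powr_add powr_minus field_simps powr_numeral)
qed

lemma kern_h_sign: "0 \<le> kern_h s v q \<longleftrightarrow> 0 \<le> fst q \<bullet> v"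
  and kern_v_sign: "0 \<le> kern_v s \<sigma> q \<longleftrightarrow> 0 \<le> \<sigma> * snd q"
  by (cases "q = 0"; simp add: kern_h_def kern_v_def zero_le_divide_iff)+

lemma kern_h_0: "kern_h s v q = 0 \<longleftrightarrow> fst q \<bullet> v = 0"
  and kern_v_0: "kern_v s \<sigma> q = 0 \<longleftrightarrow> \<sigma> * snd q = 0"
  by (cases "q = 0"; simp add: kern_h_def kern_v_def)+

text \<open>The two distances are not uniformly equivalent: a small right factor moves far points by
  large euclidean amounts. Written as a function of the increment \<open>x\<close> and the base
  point, and cut off to bounded \<open>x\<close>, the translated \<open>g\<close> has compact
  support and is uniformly continuous.\<close>

lemma hdist_uniform:
  fixes g :: "('n::finite) heis \<Rightarrow> real"
  assumes "g \<in> Cc" "\<eta> > 0"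
  obtains \<delta> where "\<delta> > 0" "\<And>p q. hdist p q < \<delta> \<Longrightarrow> \<bar>g p - g q\<bar> \<le> \<eta>"
proof -
  obtain R where R: "R > 0" "\<And>x. R < hnorm x \<Longrightarrow> g x = 0" using Cc_supp_hnorm[OF assms(1)] by blast
  define F where "F x = bump 1 (fst x) * g (snd x \<odot> fst x)" for x :: "'n heis \<times> 'n heis"
  have F: "F \<in> Cc"
  proof (rule Cc_prodI[where R="(R + 2) + (R + 2)\<^sup>2"])
    have "continuous_on UNIV (\<lambda>x :: 'n heis \<times> 'n heis. g (snd x \<odot> fst x))"
      by (rule continuous_on_compose2[OF Cc_cont[OF assms(1)]]) (auto intro!: continuous_intros)
    then show "continuous_on UNIV F" unfolding F_def[abs_def] by (intro continuous_intros)
    fix x p :: "'n heis" assume "R + 2 + (R + 2)\<^sup>2 < norm x \<or> R + 2 + (R + 2)\<^sup>2 < norm p"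
    then have big: "R + 2 < hnorm x \<or> R + 2 < hnorm p"
      using norm_le_of_hnorm[of x "R + 2"] norm_le_of_hnorm[of p "R + 2"] by linarith
    show "F (x, p) = 0"
    proof (cases "2 \<le> hnorm x")
      case False
      have "hnorm ((p \<odot> x) \<odot> - x) \<le> hnorm (p \<odot> x) + hnorm (- x)" by (rule hnorm_triangle)
      then have "R < hnorm (p \<odot> x)" using big False R(1) by (simp add: hmul_assoc)
      then show ?thesis using R by (simp add: F_def)
    qed (simp add: F_def bump_eq_0)
  qed
  obtain \<delta> where \<delta>: "\<delta> > 0" "\<And>x y. dist x y < \<delta> \<Longrightarrow> \<bar>F x - F y\<bar> < \<eta>" using Cc_uniform[OF F assms(2)] by blast
  obtain e where e: "e > 0" "hball (0 :: 'n heis) e \<subseteq> ball 0 \<delta>" using hdist_ball_subset[of "ball 0 \<delta>" 0] \<delta>(1) by auto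
  show thesis
  proof (rule that[of "min e 1"])
    fix p q :: "'n heis" assume pq: "hdist p q < min e 1"
    define x where "x = - p \<odot> q"
    have x: "hnorm x < e" "hnorm x \<le> 1" "q = p \<odot> x" using pq by (auto simp: x_def hdist_eq)
    then have "x \<in> ball 0 \<delta>" by (intro subsetD[OF e(2)]) (simp add: hball_def)
    then have "dist (0, p) (x, p) < \<delta>" by (simp add: dist_Pair_Pair)
    from \<delta>(2)[OF this] show "\<bar>g p - g q\<bar> \<le> \<eta>" using x by (simp add: F_def bump_eq_1)
  qed (use e in auto)
qed

lemma small_powr:
  fixes a \<epsilon> \<delta> :: real assumes "a > 0" "\<epsilon> > 0" "\<delta> > 0"
  obtains r where "0 < r" "r < \<delta>" "r powr a < \<epsilon>"
proof -
  define r where "r = min (\<delta> / 2) ((\<epsilon> / 2) powr (1 / a))"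
  have r: "0 < r" "r < \<delta>" using assms by (auto simp: r_def)
  have "r powr a \<le> ((\<epsilon> / 2) powr (1 / a)) powr a" using assms r by (intro powr_mono2) (auto simp: r_def)
  also have "\<dots> = \<epsilon> / 2" using assms by (simp add: powr_powr)
  finally show thesis using r assms by (intro that[of r]) auto
qed

text \<open>Collects what the geometric part uses about the tangent functionals at one point. Bounds
  at the unit bump and truncations about the origin suffice, since dilations and translations carry
  them to all scales and all support points.\<close>

locale tangent_class =
  fixes \<C> :: "(('n::finite heis \<Rightarrow> real) \<Rightarrow> real) set" and s c C :: real
  assumes s_pos: "s > 0" and c_pos: "c > 0"
    and nonempty: "\<C> \<noteq> {}"
    and pos: "\<Lambda> \<in> \<C> \<Longrightarrow> posfun \<Lambda>"
    and seq_compact: "(\<And>i::nat. \<Lambda>i i \<in> \<C>) \<Longrightarrow> \<exists>\<sigma> N. strict_mono \<sigma> \<and> N \<in> \<C> \<and> (\<forall>f\<in>Cc. (\<lambda>i. \<Lambda>i (\<sigma> i) f) \<longlonglongrightarrow> N f)"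
    and dil: "\<Lambda> \<in> \<C> \<Longrightarrow> t > 0 \<Longrightarrow> dilf s t \<Lambda> \<in> \<C>"
    and tr: "\<Lambda> \<in> \<C> \<Longrightarrow> p \<in> fsupp \<Lambda> \<Longrightarrow> trf p \<Lambda> \<in> \<C>"
    and ad: "\<Lambda> \<in> \<C> \<Longrightarrow> c \<le> \<Lambda> (bump 1)" "\<Lambda> \<in> \<C> \<Longrightarrow> \<Lambda> (bump 1) \<le> C"
    and ker_h: "\<exists>K. \<forall>\<Lambda>\<in>\<C>. \<forall>t. 0 < t \<longrightarrow> t \<le> 1 \<longrightarrow> \<bar>\<Lambda> (\<lambda>q. kern_h s v q * annulus_cutoff t q)\<bar> \<le> K"
    and ker_v: "\<exists>K. \<forall>\<Lambda>\<in>\<C>. \<forall>t. 0 < t \<longrightarrow> t \<le> 1 \<longrightarrow> \<bar>\<Lambda> (\<lambda>q. kern_v s \<sigma> q * annulus_cutoff t q)\<bar> \<le> K"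
begin

lemma bump_bounds_scaled:
  assumes "\<Lambda> \<in> \<C>" "r > 0" shows "c * r powr s \<le> \<Lambda> (bump r)" "\<Lambda> (bump r) \<le> C * r powr s"
proof -
  have "dilf s r \<Lambda> (bump 1) = r powr (- s) * \<Lambda> (bump r)"
    using assms by (simp add: dilf_def bump_hdilation)
  then have "c \<le> r powr (- s) * \<Lambda> (bump r)" "r powr (- s) * \<Lambda> (bump r) \<le> C"
    using ad[OF dil[OF assms]] by auto
  then show "c * r powr s \<le> \<Lambda> (bump r)" "\<Lambda> (bump r) \<le> C * r powr s"
    using assms by (auto simp: powr_minus field_simps)
qed

lemma zero_in_fsupp: assumes "\<Lambda> \<in> \<C>" shows "0 \<in> fsupp \<Lambda>"
proof (rule ccontr)
  assume "0 \<notin> fsupp \<Lambda>"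
  then have "0 \<in> - fsupp \<Lambda>" by simp
  moreover have "open (- fsupp \<Lambda>)" using closed_fsupp[OF pos[OF assms]] by auto
  ultimately obtain e where e: "e > 0" "hball 0 e \<subseteq> - fsupp \<Lambda>" using hdist_ball_subset by blast
  have "0 < c * (e / 2) powr s" using c_pos e by simp
  also have "\<dots> \<le> \<Lambda> (bump (e / 2))" using e by (intro bump_bounds_scaled[OF assms]) auto
  finally have "\<Lambda> (bump (e / 2)) \<noteq> 0" by simp
  then obtain p where p: "p \<in> fsupp \<Lambda>" "bump (e / 2) p \<noteq> 0"
    using fsupp_meets[OF pos[OF assms] bump_Cc] e by (metis half_gt_zero)
  then have "hnorm p < e" using bump_eq_0[of "e / 2" p] e by force
  then have "p \<in> hball 0 e" by (simp add: hball_def)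
  then show False using p(1) e(2) by blast
qed

definition blows_to :: "(('n heis \<Rightarrow> real) \<Rightarrow> real) \<Rightarrow> (('n heis \<Rightarrow> real) \<Rightarrow> real) \<Rightarrow> bool" where
  "blows_to \<Lambda> N \<longleftrightarrow> (\<exists>t :: nat \<Rightarrow> real. (\<forall>i. 0 < t i) \<and> t \<longlonglongrightarrow> 0 \<and> (\<forall>f\<in>Cc. (\<lambda>i. dilf s (t i) \<Lambda> f) \<longlonglongrightarrow> N f))"

lemma blows_to_exists:
  assumes "\<Lambda> \<in> \<C>" obtains N where "N \<in> \<C>" "blows_to \<Lambda> N"
proof -
  have "dilf s (1 / real (Suc i)) \<Lambda> \<in> \<C>" for i using assms by (intro dil) auto
  from seq_compact[of "\<lambda>i. dilf s (1 / real (Suc i)) \<Lambda>", OF this]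
  obtain \<sigma> N where N: "strict_mono \<sigma>" "N \<in> \<C>" "\<forall>f\<in>Cc. (\<lambda>i. dilf s (1 / real (Suc (\<sigma> i))) \<Lambda> f) \<longlonglongrightarrow> N f"
    by blast
  have "(\<lambda>i. 1 / real (Suc (\<sigma> i))) \<longlonglongrightarrow> 0"
    using LIMSEQ_subseq_LIMSEQ[OF LIMSEQ_Suc[OF lim_1_over_n] N(1)] by (simp add: o_def)
  then have "blows_to \<Lambda> N" unfolding blows_to_def using N(3) by (intro exI[of _ "\<lambda>i. 1 / real (Suc (\<sigma> i))"]) auto
  then show thesis using N that by blast
qed

text \<open>Transfers an inequality to the blow-up. The scale \<open>t\<close> enters
  \<open>\<Psi>\<close> as a variable, so joint continuity lets a leading-order term be read off at
  \<open>t = 0\<close>. Points of the limit support are approached by points of the rescaled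
  supports.\<close>

lemma blows_to_ineq:
  fixes \<Psi> :: "real \<times> 'n heis \<Rightarrow> real"
  assumes \<Lambda>: "\<Lambda> \<in> \<C>" and N: "blows_to \<Lambda> N" and cont: "continuous_on UNIV \<Psi>"
    and ge: "\<And>t q. 0 < t \<Longrightarrow> hdilation t q \<in> fsupp \<Lambda> \<Longrightarrow> 0 \<le> \<Psi> (t, q)" and p: "p \<in> fsupp N"
  shows "0 \<le> \<Psi> (0, p)"
proof (rule ccontr)
  assume "\<not> 0 \<le> \<Psi> (0, p)"
  then have "(0, p) \<in> {x. \<Psi> x < 0}" by simp
  moreover have "open {x. \<Psi> x < 0}" using cont by (intro open_Collect_less) auto
  ultimately obtain A B where AB: "open A" "open B" "0 \<in> A" "p \<in> B" "A \<times> B \<subseteq> {x. \<Psi> x < 0}"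
    by (metis SigmaE2 open_prod_elim)
  obtain t where t: "\<And>i::nat. 0 < t i" "t \<longlonglongrightarrow> 0" "\<And>f. f \<in> Cc \<Longrightarrow> (\<lambda>i. dilf s (t i) \<Lambda> f) \<longlonglongrightarrow> N f"
    using N unfolding blows_to_def by blast
  have "\<forall>\<^sub>F i in sequentially. t i \<in> A" using t(2) AB by (rule_tac topological_tendstoD)
  moreover have "\<forall>\<^sub>F i in sequentially. fsupp (dilf s (t i) \<Lambda>) \<inter> B \<noteq> {}"
    by (rule fsupp_lim[of "\<lambda>i. dilf s (t i) \<Lambda>", OF pos[OF dil[OF \<Lambda> t(1)]] t(3) p AB(2,4)])
  ultimately have "\<forall>\<^sub>F i in sequentially. False"
  proof eventually_elim
    case (elim i)
    then obtain q where q: "q \<in> fsupp (dilf s (t i) \<Lambda>)" "q \<in> B" by blast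
    then have "0 \<le> \<Psi> (t i, q)" using ge[OF t(1)] by (simp add: fsupp_dilf[OF t(1)])
    moreover have "(t i, q) \<in> A \<times> B" using elim q by blast
    ultimately show False using AB(5) by force
  qed
  then show False by simp
qed

lemma blows_to_subset:
  assumes \<Lambda>: "\<Lambda> \<in> \<C>" and N: "blows_to \<Lambda> N" and S: "closed S" "\<And>t q. 0 < t \<Longrightarrow> hdilation t q \<in> S \<Longrightarrow> q \<in> S" "fsupp \<Lambda> \<subseteq> S"
  shows "fsupp N \<subseteq> S"
proof -
  obtain t where t: "\<And>i::nat. 0 < t i" "t \<longlonglongrightarrow> 0" "\<And>f. f \<in> Cc \<Longrightarrow> (\<lambda>i. dilf s (t i) \<Lambda> f) \<longlonglongrightarrow> N f"
    using N unfolding blows_to_def by blast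
  show ?thesis
  proof (rule fsupp_lim_closed[of "\<lambda>i. dilf s (t i) \<Lambda>", OF pos[OF dil[OF \<Lambda> t(1)]] t(3) S(1)])
    show "fsupp (dilf s (t i) \<Lambda>) \<subseteq> S" for i using S(2)[OF t(1)] S(3) by (auto simp: fsupp_dilf[OF t(1)])
  qed
qed

lemma blows_to_hsub:
  assumes "\<Lambda> \<in> \<C>" "blows_to \<Lambda> N" "hsub_adm W vert" "fsupp \<Lambda> \<subseteq> hsub W vert"
  shows "fsupp N \<subseteq> hsub W vert"
proof (rule blows_to_subset[OF assms(1,2) closed_hsub[OF assms(3)] _ assms(4)])
  fix t :: real and q assume "0 < t" "hdilation t q \<in> hsub W vert"
  then show "q \<in> hsub W vert" using hsub_hdilation[OF assms(3), of "hdilation t q" "1 / t"] by simp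
qed

text \<open>If the kernel has a sign on the support, the truncated integrals are monotone in the
  truncation parameter; being bounded they converge, so the mass of the kernel on small annuli
  tends to zero.\<close>
lemma sign_collapse:
  assumes \<Lambda>: "\<Lambda> \<in> \<C>" and N: "blows_to \<Lambda> N" "N \<in> \<C>" and k: "homogeneous_kernel s k"
    and K: "\<And>t. 0 < t \<Longrightarrow> t \<le> 1 \<Longrightarrow> \<bar>\<Lambda> (\<lambda>q. k q * annulus_cutoff t q)\<bar> \<le> K"
    and sgn: "\<And>q. q \<in> fsupp \<Lambda> \<Longrightarrow> 0 \<le> k q" "\<And>q. q \<in> fsupp N \<Longrightarrow> 0 \<le> k q"
    and p: "p \<in> fsupp N" "p \<noteq> 0"
  shows "k p = 0"
proof (rule ccontr)
  assume "k p \<noteq> 0"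
  then have kp: "k p > 0" using sgn(2)[OF p(1)] by simp
  define J where "J t = \<Lambda> (\<lambda>q. k q * annulus_cutoff t q)" for t
  have pL: "posfun \<Lambda>" and pN: "posfun N" using pos \<Lambda> N by auto
  have bump_mono: "bump r q \<le> bump r' q" if "0 < r" "r \<le> r'" for r r' and q :: "'n heis"
  proof -
    have "hnorm q / r' \<le> hnorm q / r" using that by (intro divide_left_mono) auto
    then show ?thesis by (auto simp: bump_def)
  qed
  have Jmono: "J t' \<le> J t" if "0 < t" "t \<le> t'" "t' \<le> 1" for t t'
    unfolding J_def
  proof (rule fsupp_mono[OF pL])
    show "(\<lambda>q. k q * annulus_cutoff t' q) \<in> Cc" "(\<lambda>q. k q * annulus_cutoff t q) \<in> Cc"
      using that by (auto intro!: kernel_annulus_Cc[OF k])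
    fix q assume "q \<in> fsupp \<Lambda>"
    then show "k q * annulus_cutoff t' q \<le> k q * annulus_cutoff t q"
      using sgn(1) bump_mono[OF that(1,2), of q] by (intro mult_left_mono) (auto simp: annulus_cutoff_def)
  qed
  \<comment> \<open>With this radius the difference of bumps in \<open>f\<close> is 1 at
    \<open>p\<close>: the larger bump is 1 on its closed ball, the smaller one is 0 from twice its
    radius on.\<close>
  define R where "R = hnorm p"
  have R: "R > 0" using p by (simp add: R_def)
  define f where "f q = k q * (bump R q - bump (R / 2) q)" for q
  have f: "f \<in> Cc" unfolding f_def[abs_def]
    by (rule Cc_times_vanishing[of k _ "R / 2"]) (use k R in \<open>auto simp: homogeneous_kernel_def bump_eq_1\<close>)
  have df: "dilf s t \<Lambda> f = J (R / 2 * t) - J (R * t)" if t: "0 < t" "R * t \<le> 1" for t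
  proof -
    have e: "t powr (- s) * f (hdilation (1 / t) q) = k q * annulus_cutoff (R / 2 * t) q - k q * annulus_cutoff (R * t) q" for q
    proof -
      have "k (hdilation (1 / t) q) = (1 / t) powr (- s) * k q" using k t by (simp add: homogeneous_kernel_def)
      moreover have "(1 / t) powr (- s) = t powr s" using t by (simp add: powr_minus powr_divide)
      ultimately have "f (hdilation (1 / t) q) = t powr s * (k q * (bump (R * t) q - bump (R / 2 * t) q))"
        using t by (simp add: f_def bump_hdilation)
      then have "t powr (- s) * f (hdilation (1 / t) q) = k q * (bump (R * t) q - bump (R / 2 * t) q)"
        using t by (simp add: powr_minus)
      then show ?thesis by (simp add: annulus_cutoff_def right_diff_distrib)
    qed
    have "dilf s t \<Lambda> f = \<Lambda> (\<lambda>q. t powr (- s) * f (hdilation (1 / t) q))"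
      unfolding dilf_def using t by (intro posfun_cmult[OF pL, symmetric] Cc_hdilation f) auto
    also have "\<dots> = J (R / 2 * t) - J (R * t)"
      unfolding e J_def using t R by (intro posfun_diff[OF pL] kernel_annulus_Cc[OF k]) auto
    finally show ?thesis .
  qed
  obtain t where t: "\<And>i::nat. 0 < t i" "t \<longlonglongrightarrow> 0" "\<And>f. f \<in> Cc \<Longrightarrow> (\<lambda>i. dilf s (t i) \<Lambda> f) \<longlonglongrightarrow> N f"
    using N(1) unfolding blows_to_def by blast
  define S where "S = Sup (J ` {0<..1})"
  have bdd: "bdd_above (J ` {0<..1})" using K by (intro bdd_aboveI[of _ K]) (auto simp: J_def abs_le_iff)
  have Jle: "J u \<le> S" if "0 < u" "u \<le> 1" for u unfolding S_def using that bdd by (intro cSup_upper) auto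
  have "N f \<le> 0 + e" if "e > 0" for e
  proof -
    have "S - e < S" using that by simp
    then obtain u where u: "0 < u" "u \<le> 1" "S - e < J u"
      unfolding S_def using less_cSupD[of "J ` {0<..1}" "S - e"] S_def by auto
    have "\<forall>\<^sub>F i in sequentially. t i < u / R" using u R by (intro order_tendstoD[OF t(2)]) auto
    then have "\<forall>\<^sub>F i in sequentially. dilf s (t i) \<Lambda> f \<le> e"
    proof eventually_elim
      case (elim i)
      then have Rt: "R * t i \<le> u" "0 < R * t i" "R / 2 * t i \<le> R * t i" using R t(1)[of i] by (auto simp: field_simps)
      then have "J u \<le> J (R * t i)" using u by (intro Jmono) auto
      moreover have "J (R / 2 * t i) \<le> S" using Rt u R t(1)[of i] by (intro Jle) auto
      ultimately show ?case using df[OF t(1)[of i]] Rt u by linarith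
    qed
    then have "N f \<le> e" using t(3)[OF f] by (intro tendsto_upperbound[of _ _ sequentially]) auto
    then show ?thesis by simp
  qed
  then have "N f \<le> 0" by (rule field_le_epsilon)
  moreover have "0 < N (\<lambda>q. max 0 (f q))"
  proof -
    have "f p = k p" using R by (simp add: f_def R_def bump_eq_1 bump_eq_0)
    then have "0 < max 0 (f p)" using kp by simp
    then show ?thesis using p(1) Cc_pos[OF f] unfolding fsupp_def by simp
  qed
  moreover have "N (\<lambda>q. max 0 (f q)) \<le> N f"
  proof (rule fsupp_mono[OF pN])
    fix q assume "q \<in> fsupp N"
    then have "0 \<le> f q" unfolding f_def using sgn(2) bump_mono[of "R / 2" R q] R by (intro mult_nonneg_nonneg) auto
    then show "max 0 (f q) \<le> f q" by simp
  qed (use f in auto)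
  ultimately show False by linarith
qed

text \<open>The half space is closed and invariant under dilations, so the blow-up lies in it too,
  and the kernel component along its normal has a sign on both supports.\<close>

lemma collapse_h:
  assumes \<Lambda>: "\<Lambda> \<in> \<C>" and half: "\<And>q. q \<in> fsupp \<Lambda> \<Longrightarrow> 0 \<le> fst q \<bullet> v" and N: "N \<in> \<C>" "blows_to \<Lambda> N" and q: "q \<in> fsupp N"
  shows "fst q \<bullet> v = 0"
proof (cases "q = 0")
  case False
  have cl: "closed {q :: 'n heis. 0 \<le> fst q \<bullet> v}" by (intro closed_Collect_le continuous_intros)
  have sub: "fsupp N \<subseteq> {q. 0 \<le> fst q \<bullet> v}"
  proof (rule blows_to_subset[OF \<Lambda> N(2) cl])
    show "q \<in> {q. 0 \<le> fst q \<bullet> v}" if "0 < t" "hdilation t q \<in> {q. 0 \<le> fst q \<bullet> v}" for t q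
      using that by (simp add: hdilation_def zero_le_mult_iff)
  qed (use half in auto)
  obtain K where "\<forall>\<Lambda>\<in>\<C>. \<forall>t. 0 < t \<longrightarrow> t \<le> 1 \<longrightarrow> \<bar>\<Lambda> (\<lambda>q. kern_h s v q * annulus_cutoff t q)\<bar> \<le> K" using ker_h by blast
  then have "kern_h s v q = 0"
    using \<Lambda> half sub by (intro sign_collapse[OF \<Lambda> N(2,1) homogeneous_kernel_h _ _ _ q False]) (auto simp: kern_h_sign)
  then show ?thesis by (simp add: kern_h_0)
qed simp

lemma collapse_v:
  assumes \<Lambda>: "\<Lambda> \<in> \<C>" and half: "\<And>q. q \<in> fsupp \<Lambda> \<Longrightarrow> 0 \<le> \<sigma> * snd q" and N: "N \<in> \<C>" "blows_to \<Lambda> N" and q: "q \<in> fsupp N"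
  shows "\<sigma> * snd q = 0"
proof (cases "q = 0")
  case False
  have cl: "closed {q :: 'n heis. 0 \<le> \<sigma> * snd q}" by (intro closed_Collect_le continuous_intros)
  have sub: "fsupp N \<subseteq> {q. 0 \<le> \<sigma> * snd q}"
  proof (rule blows_to_subset[OF \<Lambda> N(2) cl])
    show "q \<in> {q. 0 \<le> \<sigma> * snd q}" if t: "0 < t" "hdilation t q \<in> {q. 0 \<le> \<sigma> * snd q}" for t q
    proof -
      have "0 \<le> t\<^sup>2 * (\<sigma> * snd q)" using t by (simp add: hdilation_def mult_ac)
      then show ?thesis using t by (simp add: zero_le_mult_iff[of "t\<^sup>2"])
    qed
  qed (use half in auto)
  obtain K where "\<forall>\<Lambda>\<in>\<C>. \<forall>t. 0 < t \<longrightarrow> t \<le> 1 \<longrightarrow> \<bar>\<Lambda> (\<lambda>q. kern_v s \<sigma> q * annulus_cutoff t q)\<bar> \<le> K" using ker_v by blast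
  then have "kern_v s \<sigma> q = 0"
    using \<Lambda> half sub by (intro sign_collapse[OF \<Lambda> N(2,1) homogeneous_kernel_v _ _ _ q False]) (auto simp: kern_v_sign)
  then show ?thesis by (simp add: kern_v_0)
qed simp

section \<open>Geometry at a hole and reduction of the carrier\<close>

lemma hsub_Int_hyperplane:
  assumes adm: "hsub_adm W vert" and w: "w \<in> W" "w \<bullet> v \<noteq> 0"
  shows "hsub_adm {x\<in>W. x \<bullet> v = 0} vert" "dim {x\<in>W. x \<bullet> v = 0} < dim W"
proof -
  have W: "subspace W" using adm by (simp add: hsub_adm_def)
  have sub: "subspace {x\<in>W. x \<bullet> v = 0}"
    using W by (auto simp: subspace_def inner_left_distrib)
  then show "hsub_adm {x\<in>W. x \<bullet> v = 0} vert" using adm by (auto simp: hsub_adm_def)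
  have "span {x\<in>W. x \<bullet> v = 0} \<noteq> span W" using w sub W by (auto simp: span_eq_iff[THEN iffD2])
  moreover have "span {x\<in>W. x \<bullet> v = 0} \<subseteq> span W" by (rule span_mono) auto
  ultimately show "dim {x\<in>W. x \<bullet> v = 0} < dim W" by (intro dim_psubset) auto
qed

text \<open>The gauge \<open>hnorm (b \<odot> _)\<close> is expanded along dilations at \<open>0\<close>; its linear part is the inner
  product with the vector in the conclusion.\<close>
lemma hnorm_expansion:
  fixes b q :: "('a::finite) heis"
  shows "hnorm (b \<odot> hdilation t q) ^ 4 - hnorm b ^ 4 =
    t * (2 * (norm (fst b))\<^sup>2 * (2 * (fst b \<bullet> fst q) + t * (fst q \<bullet> fst q)) + t * (2 * (fst b \<bullet> fst q) + t * (fst q \<bullet> fst q))\<^sup>2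
       + 2 * snd b * (2 * (rot (fst b) \<bullet> fst q) + t * snd q) + t * (2 * (rot (fst b) \<bullet> fst q) + t * snd q)\<^sup>2)"
proof -
  define n where "n = fst b \<bullet> fst b"
  have n: "(norm (fst b))\<^sup>2 = n" by (simp add: n_def power2_norm_eq_inner)
  have p4: "norm x ^ 4 = (x \<bullet> x)\<^sup>2" for x :: "(real ^ 'a) \<times> (real ^ 'a)"
    by (simp add: power2_norm_eq_inner[symmetric] flip: power_mult)
  have "(fst b + t *\<^sub>R fst q) \<bullet> (fst b + t *\<^sub>R fst q) = n + t * (2 * (fst b \<bullet> fst q) + t * (fst q \<bullet> fst q))"
    by (simp add: n_def inner_left_distrib inner_right_distrib inner_commute[of "fst q" "fst b"] algebra_simps)
  then show ?thesis
    unfolding hnorm_pow4 p4 n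
    by (simp add: hmul_def hdilation_def hform_rot n_def[symmetric]) (simp add: power2_eq_square algebra_simps)
qed

text \<open>With \<open>b = - x \<odot> a\<close> for a hole centre \<open>x\<close> and a nearest
  support point \<open>a\<close>, the assumption says that the translated support stays outside the
  touching ball. Dividing the expansion of the gauge by \<open>t\<close> leaves at
  \<open>t = 0\<close> the horizontal derivative of \<open>hnorm ^ 4\<close> at
  \<open>b\<close>.\<close>

lemma hole_half_space:
  assumes \<Lambda>: "\<Lambda> \<in> \<C>" and N: "blows_to \<Lambda> N" and out: "\<And>q. q \<in> fsupp \<Lambda> \<Longrightarrow> hnorm b \<le> hnorm (b \<odot> q)" and q: "q \<in> fsupp N"
  shows "0 \<le> fst q \<bullet> (4 * (norm (fst b))\<^sup>2) *\<^sub>R fst b + fst q \<bullet> (4 * snd b) *\<^sub>R rot (fst b)"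
proof -
  let ?\<Psi> = "\<lambda>x :: real \<times> 'n heis. let t = fst x; q = snd x; X = 2 * (fst b \<bullet> fst q) + t * (fst q \<bullet> fst q);
       Y = 2 * (rot (fst b) \<bullet> fst q) + t * snd q in
     2 * (norm (fst b))\<^sup>2 * X + t * X\<^sup>2 + 2 * snd b * Y + t * Y\<^sup>2"
  have "0 \<le> ?\<Psi> (0, q)"
  proof (rule blows_to_ineq[OF \<Lambda> N _ _ q])
    show "continuous_on UNIV ?\<Psi>" unfolding Let_def by (intro continuous_intros)
    fix t :: real and q assume t: "0 < t" "hdilation t q \<in> fsupp \<Lambda>"
    have "0 \<le> hnorm (b \<odot> hdilation t q) ^ 4 - hnorm b ^ 4" using out[OF t(2)] by (simp add: power_mono)
    then show "0 \<le> ?\<Psi> (t, q)" using t(1) unfolding hnorm_expansion by (simp add: Let_def zero_le_mult_iff)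
  qed
  then show ?thesis by (simp add: inner_commute)
qed

text \<open>At a pole the first-order term is zero and the expansion starts with the square of
  \<open>t\<close>; its coefficient is twice the product of the vertical coordinates.\<close>

lemma hole_half_space_pole:
  assumes \<Lambda>: "\<Lambda> \<in> \<C>" and N: "blows_to \<Lambda> N" and b: "fst b = 0" and out: "\<And>q. q \<in> fsupp \<Lambda> \<Longrightarrow> hnorm b \<le> hnorm (b \<odot> q)" and q: "q \<in> fsupp N"
  shows "0 \<le> snd b * snd q"
proof -
  let ?\<Psi> = "\<lambda>x :: real \<times> 'n heis. let t = fst x; q = snd x in t\<^sup>2 * (fst q \<bullet> fst q)\<^sup>2 + 2 * (snd b * snd q) + t\<^sup>2 * (snd q)\<^sup>2"
  have "0 \<le> ?\<Psi> (0, q)"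
  proof (rule blows_to_ineq[OF \<Lambda> N _ _ q])
    show "continuous_on UNIV ?\<Psi>" unfolding Let_def by (intro continuous_intros)
    fix t :: real and q assume t: "0 < t" "hdilation t q \<in> fsupp \<Lambda>"
    have "0 \<le> hnorm (b \<odot> hdilation t q) ^ 4 - hnorm b ^ 4" using out[OF t(2)] by (simp add: power_mono)
    also have "\<dots> = t\<^sup>2 * ?\<Psi> (t, q)" unfolding hnorm_expansion by (simp add: b rot_simps Let_def power2_eq_square algebra_simps)
    finally show "0 \<le> ?\<Psi> (t, q)" using t(1) by (simp add: zero_le_mult_iff[of "t\<^sup>2"])
  qed
  then show ?thesis by simp
qed

text \<open>After translation by \<open>p\<close> the vertical coordinate of
  \<open>p \<odot> hdilation t q\<close> combines a term of order \<open>t\<close> from the group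
  form and one of order \<open>t\<^sup>2\<close> from \<open>snd q\<close>. Its vanishing therefore
  forces the first coefficient to vanish in the limit.\<close>

lemma flat_blow_up:
  assumes \<Lambda>: "\<Lambda> \<in> \<C>" and flat: "\<And>q. q \<in> fsupp \<Lambda> \<Longrightarrow> snd q = 0" and p: "p \<in> fsupp \<Lambda>"
    and N: "blows_to (trf p \<Lambda>) N" and q: "q \<in> fsupp N"
  shows "fst q \<bullet> rot (fst p) = 0"
proof -
  have sp: "snd p = 0" by (rule flat[OF p])
  have \<Lambda>': "trf p \<Lambda> \<in> \<C>" by (rule tr[OF \<Lambda> p])
  have eq: "t * snd q + 2 * (rot (fst p) \<bullet> fst q) = 0" if t: "0 < t" "hdilation t q \<in> fsupp (trf p \<Lambda>)" for t q
  proof -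
    have "snd (p \<odot> hdilation t q) = 0" using flat t by (simp add: fsupp_trf)
    then have "t * (t * snd q + 2 * (rot (fst p) \<bullet> fst q)) = 0"
      by (simp add: hmul_def hform_rot hdilation_def sp power2_eq_square algebra_simps)
    then show ?thesis using t by simp
  qed
  have "0 \<le> (\<lambda>x. fst x * snd (snd x) + 2 * (rot (fst p) \<bullet> fst (snd x))) (0, q)"
    by (rule blows_to_ineq[OF \<Lambda>' N _ _ q]) (auto simp: eq intro!: continuous_intros)
  moreover have "0 \<le> (\<lambda>x. - (fst x * snd (snd x) + 2 * (rot (fst p) \<bullet> fst (snd x)))) (0, q)"
    by (rule blows_to_ineq[OF \<Lambda>' N _ _ q]) (auto simp: eq intro!: continuous_intros)
  ultimately show ?thesis by (simp add: inner_commute)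
qed

definition carries :: "((real ^ 'n) \<times> (real ^ 'n)) set \<Rightarrow> bool \<Rightarrow> bool" where
  "carries W vert \<longleftrightarrow> hsub_adm W vert \<and> (\<exists>\<Lambda>\<in>\<C>. fsupp \<Lambda> \<subseteq> hsub W vert)"

text \<open>The euclidean dimension, in contrast to \<open>hom_dim\<close>. It serves as the
  quantity to minimise: cutting \<open>W\<close> by a hyperplane and dropping the vertical direction
  both decrease it.\<close>

definition lin_dim :: "((real ^ 'n) \<times> (real ^ 'n)) set \<Rightarrow> bool \<Rightarrow> nat" where
  "lin_dim W vert = dim W + (if vert then 1 else 0)"

lemma smaller_carrier:
  assumes adm: "hsub_adm W vert" and w: "w \<in> W" "w \<bullet> v \<noteq> 0" and \<Lambda>: "\<Lambda> \<in> \<C>" "fsupp \<Lambda> \<subseteq> hsub W vert"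
    "\<And>q. q \<in> fsupp \<Lambda> \<Longrightarrow> fst q \<bullet> v = 0"
  shows "\<exists>W' vert'. carries W' vert' \<and> lin_dim W' vert' < lin_dim W vert"
proof (intro exI conjI)
  show "carries {x\<in>W. x \<bullet> v = 0} vert" unfolding carries_def
    using hsub_Int_hyperplane(1)[OF adm w] \<Lambda> by (auto simp: hsub_def intro!: bexI[of _ \<Lambda>])
  show "lin_dim {x\<in>W. x \<bullet> v = 0} vert < lin_dim W vert"
    using hsub_Int_hyperplane(2)[OF adm w] by (simp add: lin_dim_def)
qed

lemma hole_reduces:
  assumes adm: "hsub_adm W vert" and \<Lambda>: "\<Lambda> \<in> \<C>" "fsupp \<Lambda> \<subseteq> hsub W vert" and x: "x \<in> hsub W vert" "x \<notin> fsupp \<Lambda>"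
  shows "\<exists>W' vert'. carries W' vert' \<and> lin_dim W' vert' < lin_dim W vert"
proof -
  define S where "S = fsupp \<Lambda>"
  have S: "closed S" "0 \<in> S" using closed_fsupp[OF pos[OF \<Lambda>(1)]] zero_in_fsupp[OF \<Lambda>(1)] by (auto simp: S_def)
  have cpt: "compact (hball x (hnorm x) \<inter> S)" by (intro compact_Int_closed compact_hball S)
  have "hdist x 0 = hnorm x" by (simp add: hdist_eq)
  then have "0 \<in> hball x (hnorm x) \<inter> S" using S by (simp add: hball_def)
  \<comment> \<open>Minimising over the compact part within distance \<open>hnorm x\<close> is
    enough: the origin is a support point at exactly that distance.\<close>
  then obtain a where a: "a \<in> hball x (hnorm x) \<inter> S" "\<And>y. y \<in> hball x (hnorm x) \<inter> S \<Longrightarrow> hdist x a \<le> hdist x y"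
    using continuous_attains_inf[OF cpt, of "hdist x"] continuous_on_hdist[OF continuous_on_const continuous_on_id] by blast
  have amin: "hdist x a \<le> hdist x y" if "y \<in> S" for y
    using a that by (cases "hdist x y \<le> hnorm x") (auto simp: hball_def)
  define b where "b = - x \<odot> a"
  have aS: "a \<in> fsupp \<Lambda>" using a by (simp add: S_def)
  have aV: "a \<in> hsub W vert" using aS \<Lambda> by blast
  have bV: "b \<in> hsub W vert" unfolding b_def by (intro hsub_hmul hsub_uminus adm x aV)
  have b0: "b \<noteq> 0"
  proof
    assume "b = 0"
    then have "hdist x a = 0" by (simp add: hdist_eq b_def)
    then show False using aS x by (simp add: hdist_eq_0_iff)
  qed
  have \<Lambda>1: "trf a \<Lambda> \<in> \<C>" by (rule tr[OF \<Lambda>(1) aS])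
  have sub1: "fsupp (trf a \<Lambda>) \<subseteq> hsub W vert"
  proof
    fix q assume "q \<in> fsupp (trf a \<Lambda>)"
    then have "a \<odot> q \<in> hsub W vert" using \<Lambda>(2) by (auto simp: fsupp_trf)
    then have "- a \<odot> (a \<odot> q) \<in> hsub W vert" by (rule hsub_hmul[OF adm hsub_uminus[OF adm aV]])
    then show "q \<in> hsub W vert" by simp
  qed
  have out: "hnorm b \<le> hnorm (b \<odot> q)" if "q \<in> fsupp (trf a \<Lambda>)" for q
    using amin[of "a \<odot> q"] that by (simp add: S_def fsupp_trf hdist_eq b_def hmul_assoc)
  obtain N1 where N1: "N1 \<in> \<C>" "blows_to (trf a \<Lambda>) N1" using blows_to_exists[OF \<Lambda>1] by blast
  \<comment> \<open>The first blow-up lies in a half space; only the second one, taken of a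
    functional with this one-sided support, collapses to the boundary.\<close>
  obtain N2 where N2: "N2 \<in> \<C>" "blows_to N1 N2" using blows_to_exists[OF N1(1)] by blast
  have subN1: "fsupp N1 \<subseteq> hsub W vert" by (rule blows_to_hsub[OF \<Lambda>1 N1(2) adm sub1])
  have subN2: "fsupp N2 \<subseteq> hsub W vert" by (rule blows_to_hsub[OF N1(1) N2(2) adm subN1])
  have W: "subspace W" using adm by (simp add: hsub_adm_def)
  show ?thesis
  proof (cases "fst b = 0")
    case False
    define u where "u = (4 * (norm (fst b))\<^sup>2) *\<^sub>R fst b + (4 * snd b) *\<^sub>R rot (fst b)"
    have half: "0 \<le> fst q \<bullet> u" if "q \<in> fsupp N1" for q
      using hole_half_space[OF \<Lambda>1 N1(2) out that] by (simp add: u_def inner_right_distrib)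
    have "fst q \<bullet> u = 0" if "q \<in> fsupp N2" for q by (rule collapse_h[OF N1(1) half N2 that])
    \<comment> \<open>The inner product is 4 times the fourth power of \<open>norm (fst b)\<close>,
      so \<open>fst b\<close>, which lies in \<open>W\<close>, witnesses that the hyperplane cuts
      \<open>W\<close> properly.\<close>
    moreover have "fst b \<bullet> u \<noteq> 0"
      using False by (simp add: u_def inner_right_distrib inner_commute[of "fst b" "rot (fst b)"])
    moreover have "fst b \<in> W" using bV by (simp add: hsub_def)
    ultimately show ?thesis using smaller_carrier[OF adm _ _ N2(1) subN2] by blast
  next
    case True
    then have sb: "snd b \<noteq> 0" using b0 by (auto simp: prod_eq_iff)
    then have v: "vert" using bV by (simp add: hsub_def)
    have half: "0 \<le> snd b * snd q" if "q \<in> fsupp N1" for q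
      by (rule hole_half_space_pole[OF \<Lambda>1 N1(2) True out that])
    have flat: "snd q = 0" if "q \<in> fsupp N2" for q
      using collapse_v[OF N1(1) half N2 that] sb by simp
    show ?thesis
    proof (cases "\<exists>p\<in>fsupp N2. \<exists>w\<in>W. w \<bullet> rot (fst p) \<noteq> 0")
      case True
      then obtain p w where p: "p \<in> fsupp N2" and w: "w \<in> W" "w \<bullet> rot (fst p) \<noteq> 0" by blast
      have N3: "trf p N2 \<in> \<C>" by (rule tr[OF N2(1) p])
      have subN3: "fsupp (trf p N2) \<subseteq> hsub W vert"
      proof
        fix q assume "q \<in> fsupp (trf p N2)"
        then have "p \<in> hsub W vert" "p \<odot> q \<in> hsub W vert" using subN2 p by (auto simp: fsupp_trf)
        then have "- p \<odot> (p \<odot> q) \<in> hsub W vert" using hsub_hmul[OF adm hsub_uminus[OF adm]] by blast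
        then show "q \<in> hsub W vert" by simp
      qed
      obtain N4 where N4: "N4 \<in> \<C>" "blows_to (trf p N2) N4" using blows_to_exists[OF N3] by blast
      have "fst q \<bullet> rot (fst p) = 0" if "q \<in> fsupp N4" for q by (rule flat_blow_up[OF N2(1) flat p N4(2) that])
      then show ?thesis using smaller_carrier[OF adm w N4(1) blows_to_hsub[OF N3 N4(2) adm subN3]] by blast
    next
      case False
      \<comment> \<open>The radical of the symplectic form on \<open>W\<close>. In this case all
        horizontal parts of the flat support lie in it, and being isotropic it carries a horizontal
        subgroup; the vertical direction is lost even if \<open>W0 = W\<close>.\<close>
      define W0 where "W0 = {y\<in>W. \<forall>w\<in>W. w \<bullet> rot y = 0}"
      have "subspace W0" using W by (auto simp: W0_def subspace_def rot_simps inner_right_distrib)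
      then have "hsub_adm W0 False" by (auto simp: hsub_adm_def W0_def inner_commute)
      moreover have "fsupp N2 \<subseteq> hsub W0 False"
      proof
        fix q assume q: "q \<in> fsupp N2"
        then have "fst q \<in> W" using subN2 by (auto simp: hsub_def)
        then show "q \<in> hsub W0 False" using False q flat by (auto simp: hsub_def W0_def)
      qed
      ultimately have "carries W0 False" using N2(1) by (auto simp: carries_def)
      moreover have "dim W0 \<le> dim W" by (rule dim_subset) (auto simp: W0_def)
      ultimately show ?thesis using v by (intro exI[of _ W0] exI[of _ False]) (simp add: lin_dim_def)
    qed
  qed
qed

lemma minimal_carrier:
  obtains W vert where "carries W vert" "\<And>\<Lambda>. \<Lambda> \<in> \<C> \<Longrightarrow> fsupp \<Lambda> \<subseteq> hsub W vert \<Longrightarrow> fsupp \<Lambda> = hsub W vert"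
proof -
  have "carries UNIV True" using nonempty by (auto simp: carries_def hsub_adm_def hsub_def)
  then have "\<exists>x. carries (fst x) (snd x)" by (intro exI[of _ "(UNIV, True)"]) simp
  then obtain x where x: "carries (fst x) (snd x)" "\<And>y. carries (fst y) (snd y) \<Longrightarrow> lin_dim (fst x) (snd x) \<le> lin_dim (fst y) (snd y)"
    using ex_has_least_nat[of "\<lambda>x. carries (fst x) (snd x)" _ "\<lambda>x. lin_dim (fst x) (snd x)"] by blast
  have "fsupp \<Lambda> = hsub (fst x) (snd x)" if \<Lambda>: "\<Lambda> \<in> \<C>" "fsupp \<Lambda> \<subseteq> hsub (fst x) (snd x)" for \<Lambda>
  proof (rule ccontr)
    assume "fsupp \<Lambda> \<noteq> hsub (fst x) (snd x)"
    then obtain y where "y \<in> hsub (fst x) (snd x)" "y \<notin> fsupp \<Lambda>" using \<Lambda> by blast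
    then obtain W' vert' where "carries W' vert'" "lin_dim W' vert' < lin_dim (fst x) (snd x)"
      using hole_reduces[OF _ \<Lambda>] x(1) unfolding carries_def by blast
    then show False using x(2)[of "(W', vert')"] by simp
  qed
  then show thesis using x(1) that by blast
qed

end

section \<open>Averaging against Haar measure\<close>

text \<open>By Fubini the average equals \<open>\<Lambda> h\<close>, where \<open>h\<close> is a
  convolution of \<open>g\<close> with a bump under Haar measure. The bump is symmetric and Haar
  measure is invariant, so for \<open>q\<close> in \<open>V\<close> its mass about \<open>q\<close>
  is \<open>r ^ m * Hf (bump 1)\<close>, and uniform continuity replaces \<open>g p\<close> by
  \<open>g q\<close>. Estimates on \<open>V\<close> suffice because \<open>V\<close> is the
  support.\<close>

lemma (in haar) convolution_limit:
  assumes pos: "posfun \<Lambda>" and supp: "fsupp \<Lambda> = V" and inv: "\<And>p. p \<in> V \<Longrightarrow> - p \<in> V"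
    and g: "g \<in> Cc" and \<eta>: "\<eta> > 0"
  obtains \<delta> where "\<delta> > 0" "\<And>r. 0 < r \<Longrightarrow> r < \<delta> \<Longrightarrow>
    \<bar>Hf (\<lambda>p. g p * \<Lambda> (\<lambda>q. bump r (- p \<odot> q))) - r ^ m * Hf (bump 1) * \<Lambda> g\<bar> \<le> \<eta> * r ^ m"
proof -
  obtain R where R: "R > 0" "\<And>x. R < hnorm x \<Longrightarrow> g x = 0" using Cc_supp_hnorm[OF g] by blast
  \<comment> \<open>Dominates the error region: for \<open>r < 1\<close> the bump reaches less than
    2 beyond the support of \<open>g\<close>, so outside radius \<open>R + 2\<close> both
    \<open>h\<close> and \<open>g\<close> vanish.\<close>
  define \<psi> where "\<psi> = (bump (R + 2) :: 'n heis \<Rightarrow> real)"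
  have \<psi>: "\<psi> \<in> Cc" "\<And>q. 0 \<le> \<psi> q" "\<And>q. hnorm q \<le> R + 2 \<Longrightarrow> \<psi> q = 1"
    using R(1) by (auto simp: \<psi>_def bump_bounds bump_eq_1)
  define \<kappa> where "\<kappa> = Hf (bump 1)"
  have \<kappa>: "\<kappa> > 0" by (simp add: \<kappa>_def Hf_bump_pos)
  define D where "D = \<Lambda> \<psi>"
  have D: "D \<ge> 0" unfolding D_def using \<psi> by (intro posfun_nonneg[OF pos])
  define \<eta>' where "\<eta>' = \<eta> / (\<kappa> * (D + 1))"
  have \<eta>': "\<eta>' > 0" using \<eta> \<kappa> D by (simp add: \<eta>'_def)
  obtain \<delta>0 where \<delta>0: "\<delta>0 > 0" "\<And>p q. hdist p q < \<delta>0 \<Longrightarrow> \<bar>g p - g q\<bar> \<le> \<eta>'" using hdist_uniform[OF g \<eta>'] by blast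
  show thesis
  proof (rule that[of "min 1 (\<delta>0 / 2)"])
    fix r :: real assume r0: "0 < r" "r < min 1 (\<delta>0 / 2)"
    then have r: "0 < r" "r < 1" "2 * r < \<delta>0" by auto
    define F where "F x = g (fst x) * bump r (- fst x \<odot> snd x)" for x :: "'n heis \<times> 'n heis"
    have F: "F \<in> Cc" unfolding F_def[abs_def] by (rule Cc_translation_kernel[OF bump_Cc[OF r(1)] g])
    define h where "h q = Hf (\<lambda>p. F (p, q))" for q
    have h: "h \<in> Cc" unfolding h_def[abs_def] using Cc_partial_posfun[OF posfun_Hf Cc_swap[OF F]] by simp
    have "Hf (\<lambda>p. g p * \<Lambda> (\<lambda>q. bump r (- p \<odot> q))) = Hf (\<lambda>p. \<Lambda> (\<lambda>q. F (p, q)))"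
      unfolding F_def by (simp add: posfun_cmult[OF pos Cc_translate[OF bump_Cc[OF r(1)]]])
    also have "\<dots> = \<Lambda> h" unfolding h_def[abs_def] by (rule posfun_Fubini[OF posfun_Hf pos F])
    finally have eq: "Hf (\<lambda>p. g p * \<Lambda> (\<lambda>q. bump r (- p \<odot> q))) = \<Lambda> h" .
    have bnd: "\<bar>h q - r ^ m * \<kappa> * g q\<bar> \<le> \<eta>' * (r ^ m * \<kappa>) * \<psi> q" if q: "q \<in> V" for q
    proof -
      define B where "B p = bump r (- q \<odot> p)" for p
      have Beq: "bump r (- p \<odot> q) = B p" for p
      proof -
        have "- (- p \<odot> q) = - q \<odot> p" by (simp add: uminus_hmul)
        then show ?thesis unfolding B_def by (metis bump_uminus)
      qed
      have B: "B \<in> Cc" unfolding B_def[abs_def] by (intro Cc_translate bump_Cc r)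
      have B0: "B p = 0" if "2 * r \<le> hdist p q" for p
        using that r Beq[of p] by (simp add: hdist_eq bump_eq_0)
      have Bnn: "0 \<le> B p" for p by (simp add: B_def bump_bounds)
      have HB: "Hf B = r ^ m * \<kappa>"
      proof -
        have "Hf B = Hf (bump r)" unfolding B_def[abs_def] by (rule Hf_left[OF bump_Cc[OF r(1)] inv[OF q]])
        also have "\<dots> = r ^ m * Hf (\<lambda>q. bump r (hdilation r q))" by (rule Hf_hdilation[OF bump_Cc[OF r(1)] r(1)])
        also have "(\<lambda>q. bump r (hdilation r q)) = (bump 1 :: 'n heis \<Rightarrow> real)"
          using r(1) by (simp add: fun_eq_iff bump_def hnorm_hdilation)
        finally show ?thesis by (simp add: \<kappa>_def)
      qed
      have hq: "h q = Hf (\<lambda>p. g p * B p)" by (simp add: h_def F_def Beq)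
      show ?thesis
      proof (cases "hnorm q \<le> R + 2")
        case True
        have C1: "(\<lambda>p. g p * B p) \<in> Cc" by (rule Cc_mult_cont[OF B Cc_cont[OF g]])
        have "\<bar>Hf (\<lambda>p. g p * B p - g q * B p)\<bar> \<le> Hf (\<lambda>p. \<eta>' * B p)"
        proof (rule posfun_abs[OF posfun_Hf])
          fix p
          show "\<bar>g p * B p - g q * B p\<bar> \<le> \<eta>' * B p"
          proof (cases "hdist p q < \<delta>0")
            case True
            then have "\<bar>g p - g q\<bar> * B p \<le> \<eta>' * B p" using \<delta>0(2) Bnn by (intro mult_right_mono) auto
            then show ?thesis using Bnn[of p] by (simp add: abs_mult flip: left_diff_distrib)
          next
            case False
            then show ?thesis using B0[of p] r by simp
          qed
        qed (use C1 B in auto)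
        then have "\<bar>Hf (\<lambda>p. g p * B p) - g q * Hf B\<bar> \<le> \<eta>' * Hf B"
          using C1 B by (simp add: posfun_diff[OF posfun_Hf] posfun_cmult[OF posfun_Hf])
        then show ?thesis using True \<psi>(3)[of q] unfolding hq HB by (simp add: mult_ac)
      next
        case False
        have "g p * B p = 0" for p
        proof (cases "hdist p q < 2")
          case True
          have "hdist 0 q \<le> hdist 0 p + hdist p q" by (rule hdist_triangle)
          then have "R < hnorm p" using True False by simp
          then show ?thesis by (simp add: R)
        qed (use B0[of p] r in simp)
        then have "(\<lambda>p. g p * B p) = (\<lambda>p. 0)" by blast
        then have "h q = 0" unfolding hq by (simp only: posfun_0[OF posfun_Hf])
        moreover have "g q = 0" using False R by simp
        ultimately show ?thesis using \<eta>' \<kappa> r \<psi>(2)[of q] by simp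
      qed
    qed
    have C2: "(\<lambda>q. r ^ m * \<kappa> * g q) \<in> Cc" "(\<lambda>q. \<eta>' * (r ^ m * \<kappa>) * \<psi> q) \<in> Cc" using g \<psi> by auto
    have "\<Lambda> (\<lambda>q. h q - r ^ m * \<kappa> * g q) \<le> \<Lambda> (\<lambda>q. \<eta>' * (r ^ m * \<kappa>) * \<psi> q)"
      by (rule fsupp_mono[OF pos Cc_diff[OF h C2(1)] C2(2)]) (use bnd supp in \<open>force simp: abs_le_iff\<close>)
    moreover have "\<Lambda> (\<lambda>q. r ^ m * \<kappa> * g q - h q) \<le> \<Lambda> (\<lambda>q. \<eta>' * (r ^ m * \<kappa>) * \<psi> q)"
      by (rule fsupp_mono[OF pos Cc_diff[OF C2(1) h] C2(2)]) (use bnd supp in \<open>force simp: abs_le_iff\<close>)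
    ultimately have "\<bar>\<Lambda> h - r ^ m * \<kappa> * \<Lambda> g\<bar> \<le> \<eta>' * (r ^ m * \<kappa>) * D"
      using g \<psi> h C2 by (simp add: posfun_diff[OF pos] posfun_cmult[OF pos] D_def)
    also have "\<eta>' * (r ^ m * \<kappa>) * D = r ^ m * (\<eta>' * \<kappa>) * D" by simp
    also have "\<eta>' * \<kappa> = \<eta> / (D + 1)" using \<kappa> by (simp add: \<eta>'_def)
    also have "r ^ m * (\<eta> / (D + 1)) * D = r ^ m * (\<eta> * (D / (D + 1)))" by simp
    also have "\<dots> \<le> r ^ m * (\<eta> * 1)" using \<eta> D r by (intro mult_left_mono) auto
    finally show "\<bar>Hf (\<lambda>p. g p * \<Lambda> (\<lambda>q. bump r (- p \<odot> q))) - r ^ m * Hf (bump 1) * \<Lambda> g\<bar> \<le> \<eta> * r ^ m"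
      unfolding eq \<kappa>_def by (simp add: mult.commute)
  qed (use \<delta>0 in auto)
qed

context tangent_class begin

lemma haar_in_class:
  "\<exists>W vert L c0 N. hsub_adm W vert \<and> haar_on (hsub W vert) (hom_dim W vert) L \<and> s = real (hom_dim W vert) \<and>
     c0 > 0 \<and> N \<in> \<C> \<and> (\<forall>f\<in>Cc. N f = c0 * (LINT q|L. f q))"
proof -
  obtain W vert where car: "carries W vert" and full: "\<And>\<Lambda>. \<Lambda> \<in> \<C> \<Longrightarrow> fsupp \<Lambda> \<subseteq> hsub W vert \<Longrightarrow> fsupp \<Lambda> = hsub W vert"
    using minimal_carrier by blast
  define V where "V = hsub W vert"
  define m where "m = hom_dim W vert"
  have adm: "hsub_adm W vert" using car by (simp add: carries_def)
  obtain L where L: "haar_on V m L" using haar_on_exists[OF adm] by (auto simp: V_def m_def)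
  interpret haar V m L by standard (rule L)
  have inv: "- p \<in> V" if "p \<in> V" for p using hsub_uminus[OF adm] that by (simp add: V_def)
  \<comment> \<open>By minimality every member has support exactly \<open>V\<close>, so this
    subclass is invariant under translation by all points of \<open>V\<close>; the support of the
    individual member no longer enters.\<close>
  define \<C>V where "\<C>V = {\<Lambda>\<in>\<C>. fsupp \<Lambda> \<subseteq> V}"
  have suppV: "fsupp \<Lambda> = V" if "\<Lambda> \<in> \<C>V" for \<Lambda> using full that by (auto simp: \<C>V_def V_def)
  have inC: "\<Lambda> \<in> \<C>" if "\<Lambda> \<in> \<C>V" for \<Lambda> using that by (simp add: \<C>V_def)
  have trV: "trf p \<Lambda> \<in> \<C>V" if "\<Lambda> \<in> \<C>V" "p \<in> V" for \<Lambda> p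
  proof -
    have "q \<in> V" if "p \<odot> q \<in> V" for q
      using hsub_hmul[OF adm, of "- p" "p \<odot> q"] inv[OF \<open>p \<in> V\<close>] that by (simp add: V_def)
    then have "fsupp (trf p \<Lambda>) \<subseteq> V" using suppV[OF \<open>\<Lambda> \<in> \<C>V\<close>] by (auto simp: fsupp_trf)
    moreover have "trf p \<Lambda> \<in> \<C>" using tr[OF inC] suppV that by blast
    ultimately show ?thesis by (simp add: \<C>V_def)
  qed
  have dilV: "dilf s t \<Lambda> \<in> \<C>V" if "\<Lambda> \<in> \<C>V" "t > 0" for \<Lambda> t
  proof -
    have "q \<in> V" if "hdilation t q \<in> V" for q
      using hsub_hdilation[OF adm, of "hdilation t q" "1 / t"] \<open>t > 0\<close> that by (simp add: V_def)
    then have "fsupp (dilf s t \<Lambda>) \<subseteq> V" using suppV[OF \<open>\<Lambda> \<in> \<C>V\<close>] by (auto simp: fsupp_dilf[OF \<open>t > 0\<close>])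
    then show ?thesis using dil[OF inC] that by (simp add: \<C>V_def)
  qed
  define \<kappa> where "\<kappa> = Hf (bump 1)"
  have \<kappa>: "\<kappa> > 0" by (simp add: \<kappa>_def Hf_bump_pos)
  have trf_eq: "\<Lambda> (\<lambda>q. bump r (- p \<odot> q)) = trf p \<Lambda> (bump r)" for \<Lambda> p r by (simp add: trf_def)
  obtain \<Lambda>0 where \<Lambda>0: "\<Lambda>0 \<in> \<C>V" using car by (auto simp: carries_def \<C>V_def V_def)
  have conv_Cc: "(\<lambda>p. g p * \<Lambda> (\<lambda>q. bump r (- p \<odot> q))) \<in> Cc" if "posfun \<Lambda>" "g \<in> Cc" "r > 0" for \<Lambda> g r
  proof -
    have "(\<lambda>p. \<Lambda> (\<lambda>q. g (fst (p, q)) * bump r (- fst (p, q) \<odot> snd (p, q)))) \<in> Cc"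
      by (rule Cc_partial_posfun[OF that(1) Cc_translation_kernel[OF bump_Cc[OF that(3)] that(2)]])
    then show ?thesis by (simp add: posfun_cmult[OF that(1) Cc_translate[OF bump_Cc[OF that(3)]]])
  qed
  have "s = real m"
  proof -
    have pos0: "posfun \<Lambda>0" by (rule pos[OF inC[OF \<Lambda>0]])
    \<comment> \<open>The average of the translated bumps divided by \<open>r ^ m\<close> tends to
      \<open>l\<close>; for small \<open>r\<close> it stays between \<open>l / 2\<close> and
      \<open>3 / 2 * l\<close>. It also lies between constant multiples of \<open>r powr s\<close>,
      so letting \<open>r\<close> tend to 0 excludes both \<open>s > m\<close> and
      \<open>s < m\<close>.\<close>
    define l where "l = \<kappa> * \<Lambda>0 (bump 1)"
    have l: "l > 0" using \<kappa> ad(1)[OF inC[OF \<Lambda>0]] c_pos by (simp add: l_def)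
    have C: "C > 0" using ad[OF inC[OF \<Lambda>0]] c_pos by linarith
    obtain \<delta> where \<delta>: "\<delta> > 0" "\<And>r. 0 < r \<Longrightarrow> r < \<delta> \<Longrightarrow>
      \<bar>Hf (\<lambda>p. bump 1 p * \<Lambda>0 (\<lambda>q. bump r (- p \<odot> q))) - r ^ m * Hf (bump 1) * \<Lambda>0 (bump 1)\<bar> \<le> l / 2 * r ^ m"
      using convolution_limit[OF pos0 suppV[OF \<Lambda>0] inv bump_Cc[of 1], of "l / 2"] l by auto
    have I: "c * r powr s * \<kappa> \<le> 3 / 2 * l * r powr real m" "l / 2 * r powr real m \<le> C * r powr s * \<kappa>"
      if r: "0 < r" "r < \<delta>" for r
    proof -
      let ?I = "Hf (\<lambda>p. bump 1 p * \<Lambda>0 (\<lambda>q. bump r (- p \<odot> q)))"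
      have cc: "(\<lambda>p. bump 1 p * \<Lambda>0 (\<lambda>q. bump r (- p \<odot> q))) \<in> Cc" by (rule conv_Cc[OF pos0 _ r(1)]) simp
      have "Hf (\<lambda>p. c * r powr s * bump 1 p) \<le> ?I"
      proof (rule Hf_mono_on_V[OF _ cc])
        fix p assume "p \<in> V"
        then have "c * r powr s \<le> \<Lambda>0 (\<lambda>q. bump r (- p \<odot> q))"
          unfolding trf_eq by (intro bump_bounds_scaled inC trV \<Lambda>0 r)
        then show "c * r powr s * bump 1 p \<le> bump 1 p * \<Lambda>0 (\<lambda>q. bump r (- p \<odot> q))"
          by (subst mult.commute[of "bump 1 p"]) (intro mult_right_mono bump_bounds)
      qed simp
      moreover have "?I \<le> Hf (\<lambda>p. C * r powr s * bump 1 p)"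
      proof (rule Hf_mono_on_V[OF cc])
        fix p assume "p \<in> V"
        then have "\<Lambda>0 (\<lambda>q. bump r (- p \<odot> q)) \<le> C * r powr s"
          unfolding trf_eq by (intro bump_bounds_scaled inC trV \<Lambda>0 r)
        then show "bump 1 p * \<Lambda>0 (\<lambda>q. bump r (- p \<odot> q)) \<le> C * r powr s * bump 1 p"
          by (subst mult.commute[of "bump 1 p"]) (intro mult_right_mono bump_bounds)
      qed simp
      moreover have H: "Hf (\<lambda>p. a * bump 1 p) = a * \<kappa>" for a by (simp add: posfun_cmult[OF posfun_Hf] \<kappa>_def)
      moreover have l': "r ^ m * Hf (bump 1) * \<Lambda>0 (bump 1) = l * r ^ m" by (simp add: l_def \<kappa>_def mult_ac)
      ultimately have "c * r powr s * \<kappa> \<le> ?I" "?I \<le> C * r powr s * \<kappa>" "\<bar>?I - l * r ^ m\<bar> \<le> l / 2 * r ^ m"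
        using \<delta>(2)[OF r] unfolding H l' by blast+
      then have "c * r powr s * \<kappa> \<le> 3 / 2 * l * r ^ m" "l / 2 * r ^ m \<le> C * r powr s * \<kappa>"
        unfolding abs_le_iff by (auto simp: algebra_simps)
      then show "c * r powr s * \<kappa> \<le> 3 / 2 * l * r powr real m" "l / 2 * r powr real m \<le> C * r powr s * \<kappa>"
        using r(1) by (simp_all add: powr_realpow)
    qed
    show ?thesis
    proof (rule antisym; rule ccontr)
      assume "\<not> s \<le> real m"
      then have a: "s - real m > 0" by simp
      have e: "l / (2 * C * \<kappa>) > 0" using l C \<kappa> by simp
      obtain r where r: "0 < r" "r < \<delta>" "r powr (s - real m) < l / (2 * C * \<kappa>)" using small_powr[OF a e \<delta>(1)] by blast
      have "r powr s = r powr (s - real m) * r powr real m" by (simp flip: powr_add)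
      then have "l / 2 * r powr real m \<le> C * \<kappa> * r powr (s - real m) * r powr real m" using I(2)[OF r(1,2)] by (simp add: mult_ac)
      then have "l / 2 \<le> C * \<kappa> * r powr (s - real m)" using r(1) by simp
      also have "\<dots> < l / 2" using r(3) C \<kappa> by (simp add: field_simps)
      finally show False by simp
    next
      assume "\<not> real m \<le> s"
      then have a: "real m - s > 0" by simp
      have e: "c * \<kappa> / (3 / 2 * l) > 0" using l c_pos \<kappa> by simp
      obtain r where r: "0 < r" "r < \<delta>" "r powr (real m - s) < c * \<kappa> / (3 / 2 * l)" using small_powr[OF a e \<delta>(1)] by blast
      have "r powr real m = r powr (real m - s) * r powr s" by (simp flip: powr_add)
      then have "c * \<kappa> * r powr s \<le> 3 / 2 * l * r powr (real m - s) * r powr s" using I(1)[OF r(1,2)] by (simp add: mult_ac)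
      then have "c * \<kappa> \<le> 3 / 2 * l * r powr (real m - s)" using r(1) by simp
      also have "\<dots> < c * \<kappa>" using r(3) l c_pos \<kappa> by (simp add: field_simps)
      finally show False by simp
    qed
  qed
  \<comment> \<open>maximise the mass of the unit bump\<close>
  define \<theta> where "\<theta> = Sup ((\<lambda>\<Lambda>. \<Lambda> (bump 1)) ` \<C>V)"
  have bdd: "bdd_above ((\<lambda>\<Lambda>. \<Lambda> (bump 1)) ` \<C>V)" using ad(2) inC by (intro bdd_aboveI[of _ C]) auto
  have le\<theta>: "\<Lambda> (bump 1) \<le> \<theta>" if "\<Lambda> \<in> \<C>V" for \<Lambda> unfolding \<theta>_def using that bdd by (intro cSup_upper) auto
  have "\<forall>i::nat. \<exists>\<Lambda>\<in>\<C>V. \<theta> - 1 / real (Suc i) < \<Lambda> (bump 1)"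
  proof
    fix i :: nat
    have "\<theta> - 1 / real (Suc i) < Sup ((\<lambda>\<Lambda>. \<Lambda> (bump 1)) ` \<C>V)" by (simp add: \<theta>_def[symmetric])
    from less_cSupD[OF _ this] show "\<exists>\<Lambda>\<in>\<C>V. \<theta> - 1 / real (Suc i) < \<Lambda> (bump 1)" using \<Lambda>0 by blast
  qed
  then obtain \<Lambda>i where \<Lambda>i: "\<And>i::nat. \<Lambda>i i \<in> \<C>V" "\<And>i. \<theta> - 1 / real (Suc i) < \<Lambda>i i (bump 1)" by metis
  obtain \<sigma> M where M: "strict_mono \<sigma>" "M \<in> \<C>" "\<And>f. f \<in> Cc \<Longrightarrow> (\<lambda>i. \<Lambda>i (\<sigma> i) f) \<longlonglongrightarrow> M f"
    using seq_compact[of \<Lambda>i, OF inC[OF \<Lambda>i(1)]] by blast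
  have "fsupp M \<subseteq> V"
    by (rule fsupp_lim_closed[of "\<lambda>i. \<Lambda>i (\<sigma> i)", OF pos[OF inC[OF \<Lambda>i(1)]] M(3)])
      (use closed_hsub[OF adm] suppV[OF \<Lambda>i(1)] in \<open>auto simp: V_def\<close>)
  then have MV: "M \<in> \<C>V" using M by (simp add: \<C>V_def)
  have posM: "posfun M" by (rule pos[OF M(2)])
  have M\<theta>: "M (bump 1) = \<theta>"
  proof (rule antisym[OF le\<theta>[OF MV]])
    have "(\<lambda>i. \<theta> - 1 / real (Suc (\<sigma> i))) \<longlonglongrightarrow> \<theta> - 0"
      using LIMSEQ_subseq_LIMSEQ[OF LIMSEQ_Suc[OF lim_1_over_n] M(1)] by (intro tendsto_diff tendsto_const) (simp add: o_def)
    moreover have "\<theta> - 1 / real (Suc (\<sigma> i)) \<le> \<Lambda>i (\<sigma> i) (bump 1)" for i using \<Lambda>i(2)[of "\<sigma> i"] by simp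
    ultimately show "\<theta> \<le> M (bump 1)" using M(3)[OF bump_Cc, of 1] by (intro LIMSEQ_le[of _ \<theta> "\<lambda>i. \<Lambda>i (\<sigma> i) (bump 1)"]) auto
  qed
  have \<theta>: "\<theta> > 0" using ad(1)[OF M(2)] c_pos M\<theta> by linarith
  \<comment> \<open>Dilating a translate of \<open>M\<close> stays in the subclass, so no translated
    bump of radius \<open>r\<close> has mass above \<open>\<theta> * r ^ m\<close>. Averaging
    against \<open>g\<close> and passing to the limit turns this into domination by Haar
    measure.\<close>
  have dom: "\<kappa> * M g \<le> \<theta> * Hf g" if g: "g \<in> Cc" "\<And>q. 0 \<le> g q" for g
  proof (rule field_le_epsilon)
    fix e :: real assume e: "e > 0"
    obtain \<delta> where \<delta>: "\<delta> > 0" "\<And>r. 0 < r \<Longrightarrow> r < \<delta> \<Longrightarrow>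
      \<bar>Hf (\<lambda>p. g p * M (\<lambda>q. bump r (- p \<odot> q))) - r ^ m * Hf (bump 1) * M g\<bar> \<le> e * r ^ m"
      using convolution_limit[OF posM suppV[OF MV] inv g(1) e] by blast
    define r where "r = \<delta> / 2"
    have r: "0 < r" "r < \<delta>" using \<delta> by (auto simp: r_def)
    have "Hf (\<lambda>p. g p * M (\<lambda>q. bump r (- p \<odot> q))) \<le> Hf (\<lambda>p. \<theta> * r ^ m * g p)"
    proof (rule Hf_mono_on_V[OF conv_Cc[OF posM g(1) r(1)]])
      fix p assume p: "p \<in> V"
      have "dilf s r (trf p M) (bump 1) \<le> \<theta>" by (intro le\<theta> dilV trV MV p r)
      then have "r powr (- s) * M (\<lambda>q. bump r (- p \<odot> q)) \<le> \<theta>"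
        using r by (simp add: dilf_def bump_hdilation trf_eq)
      then have "M (\<lambda>q. bump r (- p \<odot> q)) \<le> \<theta> * r ^ m"
        using r \<open>s = real m\<close> by (simp add: powr_minus powr_realpow field_simps)
      then show "g p * M (\<lambda>q. bump r (- p \<odot> q)) \<le> \<theta> * r ^ m * g p"
        using g(2)[of p] by (subst mult.commute) (rule mult_right_mono)
    qed (use g in auto)
    also have "\<dots> = \<theta> * r ^ m * Hf g" using g by (simp add: posfun_cmult[OF posfun_Hf])
    finally have "r ^ m * \<kappa> * M g - e * r ^ m \<le> \<theta> * r ^ m * Hf g"
      using \<delta>(2)[OF r] unfolding \<kappa>_def abs_le_iff by linarith
    then have "r ^ m * (\<kappa> * M g - e) \<le> r ^ m * (\<theta> * Hf g)" by (simp add: algebra_simps)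
    then have "\<kappa> * M g - e \<le> \<theta> * Hf g" using r(1) by simp
    then show "\<kappa> * M g \<le> \<theta> * Hf g + e" by simp
  qed
  \<comment> \<open>Domination is an equality for \<open>bump 1\<close>, which is 1 on the unit ball
    and hence lies above \<open>f\<close> up to a factor \<open>B\<close>. Applied to
    \<open>B * bump 1 - f\<close> it gives the reverse inequality for \<open>f\<close>.\<close>
  have eq_nonneg: "\<kappa> * M f = \<theta> * Hf f" if f: "f \<in> Cc" "\<And>q. 0 \<le> f q" "\<And>q. 1 < hnorm q \<Longrightarrow> f q = 0" for f
  proof (rule antisym[OF dom[OF f(1,2)]])
    obtain B S where B: "B > 0" "\<And>x. \<bar>f x\<bar> \<le> B * cutoff S x" using Cc_le_cutoff[OF f(1)] by metis
    have le: "f q \<le> B * bump 1 q" for q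
    proof (cases "hnorm q \<le> 1")
      case True
      have "f q \<le> B * 1" using B(2)[of q] mult_left_mono[OF cutoff_props(2)[of S q], of B] B(1) by linarith
      then show ?thesis using True by (simp add: bump_eq_1)
    next
      case False
      then show ?thesis using f(3)[of q] B(1) bump_bounds(1)[of 1 q] by simp
    qed
    let ?d = "\<lambda>q. B * bump 1 q - f q"
    have "?d \<in> Cc" using f(1) by simp
    then have "\<kappa> * M ?d \<le> \<theta> * Hf ?d" using le by (intro dom) auto
    moreover have "M ?d = B * \<theta> - M f" using f(1) by (simp add: posfun_diff[OF posM] posfun_cmult[OF posM] M\<theta>)
    moreover have "Hf ?d = B * \<kappa> - Hf f" using f(1) by (simp add: posfun_diff[OF posfun_Hf] posfun_cmult[OF posfun_Hf] \<kappa>_def)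
    ultimately show "\<theta> * Hf f \<le> \<kappa> * M f" by (simp add: algebra_simps)
  qed
  define c0 where "c0 = \<theta> / \<kappa>"
  have c0: "c0 > 0" using \<theta> \<kappa> by (simp add: c0_def)
  have eq: "M f = c0 * Hf f" if f: "f \<in> Cc" "\<And>q. 1 < hnorm q \<Longrightarrow> f q = 0" for f
  proof -
    have P: "M (\<lambda>q. max 0 (f q)) = c0 * Hf (\<lambda>q. max 0 (f q))"
      using eq_nonneg[of "\<lambda>q. max 0 (f q)"] f \<kappa> by (simp add: c0_def field_simps)
    have nf: "(\<lambda>q. - f q) \<in> Cc" using Cc_cmult[OF f(1), of "-1"] by simp
    have Q: "M (\<lambda>q. max 0 (- f q)) = c0 * Hf (\<lambda>q. max 0 (- f q))"
      using eq_nonneg[OF Cc_pos[OF nf]] f \<kappa> by (simp add: c0_def field_simps)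
    have e: "f = (\<lambda>q. max 0 (f q) - max 0 (- f q))" by (auto simp: max_def)
    have "M f = M (\<lambda>q. max 0 (f q)) - M (\<lambda>q. max 0 (- f q))"
      by (subst e) (rule posfun_diff[OF posM Cc_pos[OF f(1)] Cc_pos[OF nf]])
    moreover have "Hf f = Hf (\<lambda>q. max 0 (f q)) - Hf (\<lambda>q. max 0 (- f q))"
      by (subst e) (rule posfun_diff[OF posfun_Hf Cc_pos[OF f(1)] Cc_pos[OF nf]])
    ultimately show ?thesis using P Q by (simp add: right_diff_distrib)
  qed
  \<comment> \<open>Equality with Haar measure is known only for functions supported in the unit
    ball. Blowing up brings every test function there, and as \<open>s = m\<close> the normalisation
    cancels the scaling of Haar measure.\<close>
  obtain N where N: "N \<in> \<C>" "blows_to M N" using blows_to_exists[OF M(2)] by blast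
  have "N f = c0 * Hf f" if f: "f \<in> Cc" for f
  proof -
    obtain R where R: "R > 0" "\<And>x. R < hnorm x \<Longrightarrow> f x = 0" using Cc_supp_hnorm[OF f] by blast
    obtain t where t: "\<And>i::nat. 0 < t i" "t \<longlonglongrightarrow> 0" "\<And>f. f \<in> Cc \<Longrightarrow> (\<lambda>i. dilf s (t i) M f) \<longlonglongrightarrow> N f"
      using N(2) unfolding blows_to_def by blast
    have "\<forall>\<^sub>F i in sequentially. t i < 1 / R" using R by (intro order_tendstoD[OF t(2)]) auto
    then have "\<forall>\<^sub>F i in sequentially. dilf s (t i) M f = c0 * Hf f"
    proof eventually_elim
      case (elim i)
      let ?f = "\<lambda>q. f (hdilation (1 / t i) q)"
      have fC: "?f \<in> Cc" using t(1)[of i] by (intro Cc_hdilation f) auto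
      have "M ?f = c0 * Hf ?f"
      proof (rule eq[OF fC])
        fix q :: "'n heis" assume "1 < hnorm q"
        then have "1 / t i < hnorm (hdilation (1 / t i) q)" using t(1)[of i] by (simp add: hnorm_hdilation field_simps)
        moreover have "R < 1 / t i" using elim R t(1)[of i] by (simp add: field_simps)
        ultimately show "f (hdilation (1 / t i) q) = 0" by (intro R) linarith
      qed
      moreover have "Hf ?f = t i ^ m * Hf f" using Hf_hdilation[OF fC t(1)[of i]] t(1)[of i] by simp
      ultimately show ?case using t(1)[of i] \<open>s = real m\<close> by (simp add: dilf_def powr_minus powr_realpow)
    qed
    then have "(\<lambda>i. dilf s (t i) M f) \<longlonglongrightarrow> c0 * Hf f" by (rule tendsto_eventually)
    then show ?thesis using t(3)[OF f] LIMSEQ_unique by blast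
  qed
  then show ?thesis using adm L N(1) c0 \<open>s = real m\<close> unfolding Hf_def V_def m_def by blast
qed

end

section \<open>Hausdorff measure on homogeneous subgroups\<close>

lemma diam_power_0: "diam_power d t {} = 0"
  by (simp add: diam_power_def)

lemma hausdorff_content_le:
  "A \<subseteq> (\<Union>i. E i) \<Longrightarrow> (\<And>i. diam_wrt d (E i) \<le> ennreal \<delta>) \<Longrightarrow> hausdorff_content d t \<delta> A \<le> (\<Sum>i. diam_power d t (E i))"
  unfolding hausdorff_content_def by (rule INF_lower) auto

lemma hausdorff_content_mono: "A \<subseteq> B \<Longrightarrow> hausdorff_content d t \<delta> A \<le> hausdorff_content d t \<delta> B"
  unfolding hausdorff_content_def by (rule INF_superset_mono) auto

lemma hausdorff_content_antimono: "\<delta> \<le> \<delta>' \<Longrightarrow> hausdorff_content d t \<delta>' A \<le> hausdorff_content d t \<delta> A"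
  unfolding hausdorff_content_def by (rule INF_superset_mono) (auto intro: order_trans[OF _ ennreal_leI])

lemma hausdorff_content_empty: "\<delta> > 0 \<Longrightarrow> hausdorff_content d t \<delta> {} = 0"
  using hausdorff_content_le[of "{}" "\<lambda>_::nat. {}" d \<delta> t] by (simp add: diam_power_0 diam_wrt_def)

lemma hausdorff_content_subadditive:
  fixes A :: "nat \<Rightarrow> 'a set"
  shows "hausdorff_content d t \<delta> (\<Union>n. A n) \<le> (\<Sum>n. hausdorff_content d t \<delta> (A n))"
proof (rule ennreal_le_epsilon)
  let ?h = "hausdorff_content d t \<delta>"
  fix e :: real assume e: "0 < e" and fin: "(\<Sum>n. ?h (A n)) < top_class.top"
  have "\<exists>E. A n \<subseteq> (\<Union>i::nat. E i) \<and> (\<forall>i. diam_wrt d (E i) \<le> ennreal \<delta>) \<and> (\<Sum>i. diam_power d t (E i)) \<le> ?h (A n) + e * (1/2)^Suc n" for n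
  proof -
    have "?h (A n) < top_class.top" using fin by (auto simp: less_top dest!: ennreal_suminf_lessD)
    then have "?h (A n) < ?h (A n) + e * (1/2)^Suc n" using e by (auto simp: less_top)
    then show ?thesis unfolding hausdorff_content_def INF_less_iff by (auto intro: less_imp_le)
  qed
  then obtain E where E: "\<And>n. A n \<subseteq> (\<Union>i::nat. E n i)" "\<And>n i. diam_wrt d (E n i) \<le> ennreal \<delta>"
    "\<And>n. (\<Sum>i. diam_power d t (E n i)) \<le> ?h (A n) + e * (1/2)^Suc n" by metis
  define C where "C = case_prod E o prod_decode"
  have "(\<Union>n. A n) \<subseteq> (\<Union>i. C i)"
  proof
    fix x assume "x \<in> (\<Union>n. A n)"
    then obtain n i where "x \<in> E n i" using E(1) by blast
    then have "x \<in> C (prod_encode (n, i))" by (simp add: C_def)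
    then show "x \<in> (\<Union>i. C i)" by blast
  qed
  then have "?h (\<Union>n. A n) \<le> (\<Sum>i. diam_power d t (C i))"
    by (rule hausdorff_content_le) (simp add: C_def E split: prod.split)
  also have "\<dots> = (\<Sum>i. (\<lambda>(n, i). diam_power d t (E n i)) (prod_decode i))"
    by (simp add: C_def case_prod_beta)
  also have "\<dots> = (\<Sum>n. \<Sum>i. diam_power d t (E n i))"
    by (rule suminf_ennreal_2dimen) simp
  also have "\<dots> \<le> (\<Sum>n. ?h (A n) + e * (1/2) ^ Suc n)"
    using E by (intro suminf_le) auto
  also have "\<dots> = (\<Sum>n. ?h (A n)) + (\<Sum>n. ennreal e * ennreal ((1/2) ^ Suc n))"
    using e by (subst suminf_add[symmetric])
      (auto simp del: ennreal_suminf_cmult simp add: ennreal_mult[symmetric])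
  also have "\<dots> = (\<Sum>n. ?h (A n)) + e"
    unfolding ennreal_suminf_cmult
    by (subst suminf_ennreal_eq[OF zero_le_power power_half_series]) auto
  finally show "?h (\<Union>n. A n) \<le> (\<Sum>n. ?h (A n)) + e" .
qed

lemma hausdorff_measure_mono: "A \<subseteq> B \<Longrightarrow> hausdorff_measure d t A \<le> hausdorff_measure d t B"
  unfolding hausdorff_measure_def by (intro SUP_mono) (auto intro: hausdorff_content_mono)

lemma hausdorff_content_le_measure: "\<delta> > 0 \<Longrightarrow> hausdorff_content d t \<delta> A \<le> hausdorff_measure d t A"
  unfolding hausdorff_measure_def by (rule SUP_upper) auto

lemma hausdorff_measure_subadditive:
  fixes A :: "nat \<Rightarrow> 'a set"
  shows "hausdorff_measure d t (\<Union>n. A n) \<le> (\<Sum>n. hausdorff_measure d t (A n))"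
  unfolding hausdorff_measure_def[of d t "\<Union>n. A n"]
proof (rule SUP_least)
  fix \<delta> :: real assume "\<delta> \<in> {0<..}"
  then have "(\<Sum>n. hausdorff_content d t \<delta> (A n)) \<le> (\<Sum>n. hausdorff_measure d t (A n))"
    by (intro suminf_le hausdorff_content_le_measure) auto
  then show "hausdorff_content d t \<delta> (\<Union>n. A n) \<le> (\<Sum>n. hausdorff_measure d t (A n))"
    by (rule order_trans[OF hausdorff_content_subadditive])
qed

lemma hausdorff_measure_empty [simp]: "hausdorff_measure d t {} = 0"
  unfolding hausdorff_measure_def by (simp add: hausdorff_content_empty)

lemma hausdorff_measure_Un: "hausdorff_measure d t (A \<union> B) \<le> hausdorff_measure d t A + hausdorff_measure d t B"
proof -
  define S where "S n = (if n = 0 then A else if n = 1 then B else {})" for n :: nat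
  have "A \<union> B \<subseteq> (\<Union>n. S n)" by (auto simp: S_def intro: UN_I[of 0] UN_I[of 1])
  then have "hausdorff_measure d t (A \<union> B) \<le> hausdorff_measure d t (\<Union>n. S n)" by (rule hausdorff_measure_mono)
  also have "\<dots> \<le> (\<Sum>n. hausdorff_measure d t (S n))" by (rule hausdorff_measure_subadditive)
  also have "\<dots> = (\<Sum>n\<in>{0, 1}. hausdorff_measure d t (S n))"
    by (rule suminf_finite) (auto simp: S_def)
  finally show ?thesis by (simp add: S_def)
qed

lemma dist_le_diam_wrt: "x \<in> E \<Longrightarrow> y \<in> E \<Longrightarrow> ennreal (d x y) \<le> diam_wrt d E"
  unfolding diam_wrt_def by (meson SUP_upper order_trans)

text \<open>A covering set of diameter less than \<open>\<epsilon>\<close> cannot meet both sets, so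
  every fine cover of the union splits into separate covers of \<open>A\<close> and \<open>B\<close>
  without loss.\<close>

lemma hausdorff_measure_separated:
  assumes "\<epsilon> > 0" and sep: "\<And>x y. x \<in> A \<Longrightarrow> y \<in> B \<Longrightarrow> \<epsilon> \<le> d x y"
  shows "hausdorff_measure d t A + hausdorff_measure d t B \<le> hausdorff_measure d t (A \<union> B)"
proof -
  have *: "hausdorff_content d t \<delta> A + hausdorff_content d t \<delta> B \<le> hausdorff_content d t \<delta> (A \<union> B)"
    if \<delta>: "0 < \<delta>" "\<delta> < \<epsilon>" for \<delta>
    unfolding hausdorff_content_def[of d t \<delta> "A \<union> B"]
  proof (rule INF_greatest, clarify)
    fix E :: "nat \<Rightarrow> 'a set" assume E: "A \<union> B \<subseteq> (\<Union>i. E i)" "\<forall>i. diam_wrt d (E i) \<le> ennreal \<delta>"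
    define EA where "EA i = (if E i \<inter> A = {} then {} else E i)" for i
    define EB where "EB i = (if E i \<inter> A = {} then E i else {})" for i
    have noAB: "E i \<inter> B = {}" if ne: "E i \<inter> A \<noteq> {}" for i
    proof (rule ccontr)
      assume "E i \<inter> B \<noteq> {}"
      with ne obtain x y where xy: "x \<in> E i" "x \<in> A" "y \<in> E i" "y \<in> B" by blast
      then have "ennreal (d x y) \<le> ennreal \<delta>" using order_trans[OF dist_le_diam_wrt E(2)[rule_format]] by blast
      then have "d x y \<le> \<delta>" using \<delta>(1) by (simp add: ennreal_le_iff)
      then show False using sep[OF xy(2,4)] \<delta> by simp
    qed
    have "x \<in> (\<Union>i. EA i)" if "x \<in> A" for x
    proof -
      obtain i where "x \<in> E i" using E(1) \<open>x \<in> A\<close> by blast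
      then have "x \<in> EA i" using \<open>x \<in> A\<close> by (auto simp: EA_def)
      then show ?thesis by blast
    qed
    then have "A \<subseteq> (\<Union>i. EA i)" by blast
    moreover have "x \<in> (\<Union>i. EB i)" if "x \<in> B" for x
    proof -
      obtain i where "x \<in> E i" using E(1) \<open>x \<in> B\<close> by blast
      then have "x \<in> EB i" using \<open>x \<in> B\<close> noAB[of i] by (auto simp: EB_def)
      then show ?thesis by blast
    qed
    then have "B \<subseteq> (\<Union>i. EB i)" by blast
    moreover have "diam_wrt d (EA i) \<le> ennreal \<delta>" "diam_wrt d (EB i) \<le> ennreal \<delta>" for i
      using E(2) by (auto simp: EA_def EB_def diam_wrt_def)
    moreover note \<open>A \<subseteq> (\<Union>i. EA i)\<close>
    ultimately have "hausdorff_content d t \<delta> A + hausdorff_content d t \<delta> B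
        \<le> (\<Sum>i. diam_power d t (EA i)) + (\<Sum>i. diam_power d t (EB i))"
      by (intro add_mono hausdorff_content_le)
    also have "\<dots> = (\<Sum>i. diam_power d t (EA i) + diam_power d t (EB i))" by (rule suminf_add) auto
    also have "(\<lambda>i. diam_power d t (EA i) + diam_power d t (EB i)) = (\<lambda>i. diam_power d t (E i))"
      by (auto simp: fun_eq_iff EA_def EB_def diam_power_0)
    finally show "hausdorff_content d t \<delta> A + hausdorff_content d t \<delta> B \<le> (\<Sum>i. diam_power d t (E i))" .
  qed
  \<comment> \<open>Independent scales for the two sets, so that the two suprema can be taken one
    after the other.\<close>
  have "hausdorff_content d t \<delta> A + hausdorff_content d t \<delta>' B \<le> hausdorff_measure d t (A \<union> B)"
    if "\<delta> > 0" "\<delta>' > 0" for \<delta> \<delta>'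
  proof -
    define \<delta>0 where "\<delta>0 = min (min \<delta> \<delta>') (\<epsilon> / 2)"
    have \<delta>0: "\<delta>0 > 0" "\<delta>0 < \<epsilon>" "\<delta>0 \<le> \<delta>" "\<delta>0 \<le> \<delta>'" using that assms by (auto simp: \<delta>0_def)
    have "hausdorff_content d t \<delta> A + hausdorff_content d t \<delta>' B \<le> hausdorff_content d t \<delta>0 A + hausdorff_content d t \<delta>0 B"
      using \<delta>0 by (intro add_mono hausdorff_content_antimono)
    also have "\<dots> \<le> hausdorff_content d t \<delta>0 (A \<union> B)" using \<delta>0 by (intro *)
    also have "\<dots> \<le> hausdorff_measure d t (A \<union> B)" using \<delta>0 by (intro hausdorff_content_le_measure)
    finally show ?thesis .
  qed
  note le = this
  have le': "hausdorff_measure d t A + hausdorff_content d t \<delta>' B \<le> hausdorff_measure d t (A \<union> B)" if "\<delta>' > 0" for \<delta>'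
    unfolding hausdorff_measure_def[of d t A]
    by (subst ennreal_SUP_add_left[symmetric]) (use le that in \<open>auto intro!: SUP_least\<close>)
  show ?thesis
    unfolding hausdorff_measure_def[of d t B]
    by (subst ennreal_SUP_add_right) (use le' in \<open>auto intro!: SUP_least\<close>)
qed

text \<open>Caratheodory's criterion. With \<open>A\<^sub>n\<close> the part of \<open>A\<close> at distance at least \<open>1/(n+1)\<close> from the closed set,
  the part of \<open>A\<^sub>n\<^sub>+\<^sub>2\<close> outside \<open>A\<^sub>n\<^sub>+\<^sub>1\<close> is separated from \<open>A\<^sub>n\<close>, so that the measures of these
  shells telescope.\<close>
lemma closed_caratheodory:
  fixes F :: "('n::finite) heis set"
  assumes F: "closed F"
  shows "hausdorff_measure hdist t (A \<inter> F) + hausdorff_measure hdist t (A - F) \<le> hausdorff_measure hdist t A"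
proof (cases "hausdorff_measure hdist t A = top_class.top")
  case False
  let ?h = "hausdorff_measure (hdist :: 'n heis \<Rightarrow> _) t"
  have fin: "?h B < top_class.top" if "B \<subseteq> A" for B using hausdorff_measure_mono[OF that] False by (metis less_top order_le_less_trans)
  define An where "An n = {x\<in>A. \<forall>y\<in>F. 1 / real (Suc n) \<le> hdist x y}" for n
  define a where "a n = enn2real (?h (An n))" for n
  have AnA: "An n \<subseteq> A" for n by (auto simp: An_def)
  have ha: "?h (An n) = ennreal (a n)" for n using fin[OF AnA] by (simp add: a_def)
  have An_mono: "An n \<subseteq> An k" if "n \<le> k" for n k
  proof -
    have "1 / real (Suc k) \<le> 1 / real (Suc n)" using that by (simp add: frac_le)
    then show ?thesis by (force simp: An_def)
  qed
  have amono: "a n \<le> a k" if "n \<le> k" for n k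
    using hausdorff_measure_mono[OF An_mono[OF that], of hdist t] unfolding ha by (simp add: ennreal_le_iff a_def)
  have a0: "0 \<le> a n" for n by (simp add: a_def)
  define b where "b n = enn2real (?h (An (Suc n) - An n))" for n
  have hb: "?h (An (Suc n) - An n) = ennreal (b n)" for n
  proof -
    have "An (Suc n) - An n \<subseteq> A" using AnA by blast
    then show ?thesis using fin by (simp add: b_def)
  qed
  have b0: "0 \<le> b n" for n by (simp add: b_def)
  have shell: "b (Suc n) \<le> a (Suc (Suc n)) - a n" for n
  proof -
    define \<epsilon> where "\<epsilon> = 1 / real (Suc n) - 1 / real (Suc (Suc n))"
    have "1 / real (Suc (Suc n)) < 1 / real (Suc n)" by (intro divide_strict_left_mono) auto
    then have \<epsilon>: "\<epsilon> > 0" unfolding \<epsilon>_def by linarith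
    have "?h (An n) + ?h (An (Suc (Suc n)) - An (Suc n)) \<le> ?h (An n \<union> (An (Suc (Suc n)) - An (Suc n)))"
    proof (rule hausdorff_measure_separated[OF \<epsilon>])
      fix x z assume x: "x \<in> An n" and z: "z \<in> An (Suc (Suc n)) - An (Suc n)"
      then obtain y where y: "y \<in> F" "hdist z y < 1 / real (Suc (Suc n))" by (force simp: An_def not_le)
      have "1 / real (Suc n) \<le> hdist x y" using x y by (simp add: An_def)
      also have "\<dots> \<le> hdist x z + hdist z y" by (rule hdist_triangle)
      finally show "\<epsilon> \<le> hdist x z" using y(2) by (simp add: \<epsilon>_def)
    qed
    also have "\<dots> \<le> ?h (An (Suc (Suc n)))" using An_mono[of n "Suc (Suc n)"] by (intro hausdorff_measure_mono) auto
    finally have "ennreal (a n + b (Suc n)) \<le> ennreal (a (Suc (Suc n)))" unfolding ha hb using a0 b0 by simp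
    then show ?thesis using a0 by (simp add: ennreal_le_iff)
  qed
  define l where "l = Sup (range a)"
  have bdd: "bdd_above (range a)"
  proof (rule bdd_aboveI[of _ "enn2real (?h A)"])
    fix x assume "x \<in> range a"
    then obtain n where "x = a n" by blast
    then show "x \<le> enn2real (?h A)" unfolding a_def
      using hausdorff_measure_mono[OF AnA] fin[OF order_refl] by (simp add: enn2real_mono)
  qed
  have al: "a n \<le> l" for n unfolding l_def using bdd by (intro cSup_upper) auto
  have union: "(\<Union>n. An n) = A - F"
  proof (intro equalityI subsetI)
    fix x assume "x \<in> (\<Union>n. An n)"
    then obtain n where n: "x \<in> An n" by blast
    then have "x \<notin> F" using hdist_self[of x] by (force simp: An_def)
    then show "x \<in> A - F" using n by (simp add: An_def)
  next
    fix x assume x: "x \<in> A - F"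
    then obtain e where e: "e > 0" "hball x e \<subseteq> - F" using hdist_ball_subset[of "- F" x] F by (auto simp: open_Compl)
    obtain n where n: "1 / real (Suc n) < e" using e(1) by (metis nat_approx_posE)
    have "1 / real (Suc n) \<le> hdist x y" if "y \<in> F" for y
    proof -
      have "y \<notin> hball x e" using e(2) that by blast
      then show ?thesis using n by (simp add: hball_def)
    qed
    then have "x \<in> An n" using x by (simp add: An_def)
    then show "x \<in> (\<Union>n. An n)" by blast
  qed
  have tail: "?h (A - F) \<le> ennreal (2 * l - a n)" for n
  proof -
    define S where "S k = (if k = 0 then An (Suc n) else An (Suc (n + k)) - An (n + k))" for k
    have "A - F \<subseteq> (\<Union>k. S k)"
    proof
      fix x assume "x \<in> A - F"
      then have ex: "\<exists>k. x \<in> An k" using union by blast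
      define k where "k = (LEAST k. x \<in> An k)"
      have k: "x \<in> An k" "\<And>j. j < k \<Longrightarrow> x \<notin> An j" unfolding k_def using LeastI_ex[OF ex] not_less_Least by auto
      show "x \<in> (\<Union>k. S k)"
      proof (cases "k \<le> Suc n")
        case True
        then have "x \<in> S 0" using An_mono k(1) by (auto simp: S_def)
        then show ?thesis by blast
      next
        case False
        then have "S (k - Suc n) = An k - An (k - 1)" by (simp add: S_def)
        then have "x \<in> S (k - Suc n)" using k False by simp
        then show ?thesis by blast
      qed
    qed
    then have "?h (A - F) \<le> (\<Sum>k. ?h (S k))" by (rule order_trans[OF hausdorff_measure_mono hausdorff_measure_subadditive])
    also have "\<dots> \<le> ennreal (2 * l - a n)"
    proof (rule suminf_le_const[OF summableI])
      fix N
      have S: "?h (S k) = ennreal (if k = 0 then a (Suc n) else b (n + k))" for k by (simp add: S_def ha hb)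
      \<comment> \<open>The bounds for the shells telescope with step 2, leaving two upper terms;
        replacing both by \<open>l\<close> produces the factor 2.\<close>
      have tele: "(\<Sum>k<Suc N. if k = 0 then a (Suc n) else b (n + k)) \<le> a (n + N) + a (Suc (n + N)) - a n" for N
      proof (induction N)
        case (Suc N)
        have "(\<Sum>k<Suc (Suc N). if k = 0 then a (Suc n) else b (n + k)) = (\<Sum>k<Suc N. if k = 0 then a (Suc n) else b (n + k)) + b (Suc (n + N))"
          by simp
        also have "\<dots> \<le> (a (n + N) + a (Suc (n + N)) - a n) + (a (Suc (Suc (n + N))) - a (n + N))"
          by (intro add_mono Suc.IH shell)
        finally show ?case by simp
      qed simp
      have "(\<Sum>k<Suc N. if k = 0 then a (Suc n) else b (n + k)) \<le> 2 * l - a n"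
        using tele[of N] al[of "n + N"] al[of "Suc (n + N)"] by linarith
      then have "ennreal (\<Sum>k<Suc N. if k = 0 then a (Suc n) else b (n + k)) \<le> ennreal (2 * l - a n)"
        by (rule ennreal_leI)
      moreover have "(\<Sum>k<N. ?h (S k)) \<le> (\<Sum>k<Suc N. ?h (S k))" unfolding sum.lessThan_Suc by simp
      moreover have "(\<Sum>k<Suc N. ?h (S k)) = ennreal (\<Sum>k<Suc N. if k = 0 then a (Suc n) else b (n + k))"
        unfolding S using a0 b0 by (intro sum_ennreal) auto
      ultimately show "(\<Sum>k<N. ?h (S k)) \<le> ennreal (2 * l - a n)" by (simp only: order_trans)
    qed
    finally show ?thesis .
  qed
  have main: "?h (A \<inter> F) + ennreal (a n) \<le> ?h A" for n
  proof -
    have "?h (A \<inter> F) + ?h (An n) \<le> ?h ((A \<inter> F) \<union> An n)"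
      by (rule hausdorff_measure_separated[of "1 / real (Suc n)"]) (auto simp: An_def hdist_commute)
    also have "\<dots> \<le> ?h A" using AnA by (intro hausdorff_measure_mono) auto
    finally show ?thesis unfolding ha .
  qed
  define h1 where "h1 = enn2real (?h (A \<inter> F))"
  define h2 where "h2 = enn2real (?h (A - F))"
  define h3 where "h3 = enn2real (?h A)"
  have h: "?h (A \<inter> F) = ennreal h1" "?h (A - F) = ennreal h2" "?h A = ennreal h3" "0 \<le> h1" "0 \<le> h2" "0 \<le> h3"
    using fin[of "A \<inter> F"] fin[of "A - F"] fin[of A] by (auto simp: h1_def h2_def h3_def)
  have 1: "h1 + a n \<le> h3" for n using main[of n] unfolding h using h(4,6) a0 by (simp add: ennreal_le_iff flip: ennreal_plus)
  have 2: "h2 \<le> 2 * l - a n" for n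
  proof -
    have "0 \<le> 2 * l - a n" using al[of n] a0[of n] by linarith
    then show ?thesis using tail[of n] unfolding h by (simp add: ennreal_le_iff)
  qed
  \<comment> \<open>Taking the supremum of \<open>a n\<close> turns the two families of inequalities
    into \<open>h1 + l \<le> h3\<close> and \<open>h2 \<le> l\<close>.\<close>
  have "l \<le> h3 - h1" unfolding l_def using 1 by (intro cSup_least) (auto simp: algebra_simps)
  moreover have "l \<le> 2 * l - h2"
  proof -
    have "a n \<le> 2 * l - h2" for n using 2[of n] by linarith
    then have "Sup (range a) \<le> 2 * l - h2" by (intro cSup_least) auto
    then show ?thesis by (simp add: l_def)
  qed
  ultimately have "h1 + h2 \<le> h3" by linarith
  then show ?thesis unfolding h using h by (simp add: ennreal_le_iff flip: ennreal_plus)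
qed simp

lemma borel_caratheodory:
  "sets (borel :: ('n::finite) heis measure) \<subseteq> lambda_system UNIV UNIV (hausdorff_measure hdist t)"
  "measure_space UNIV (lambda_system UNIV UNIV (hausdorff_measure (hdist :: 'n heis \<Rightarrow> _) t)) (hausdorff_measure hdist t)"
proof -
  let ?h = "hausdorff_measure (hdist :: 'n heis \<Rightarrow> _) t"
  have oms: "outer_measure_space UNIV ?h"
    unfolding outer_measure_space_def positive_def increasing_def countably_subadditive_def
    using hausdorff_measure_mono hausdorff_measure_subadditive by auto
  interpret P: sigma_algebra UNIV "UNIV :: 'n heis set set" by (simp add: sigma_algebra_Pow flip: Pow_UNIV)
  show ms: "measure_space UNIV (lambda_system UNIV UNIV ?h) ?h" by (rule P.caratheodory_lemma[OF oms])
  have cl: "F \<in> lambda_system UNIV UNIV ?h" if "closed F" for F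
  proof -
    have "?h (F \<inter> A) + ?h ((UNIV - F) \<inter> A) = ?h A" for A
    proof (rule antisym)
      show "?h (F \<inter> A) + ?h ((UNIV - F) \<inter> A) \<le> ?h A"
        using closed_caratheodory[OF that, of t A] by (simp add: Int_commute Diff_eq)
      have "?h A \<le> ?h ((F \<inter> A) \<union> ((UNIV - F) \<inter> A))" by (rule hausdorff_measure_mono) auto
      also have "\<dots> \<le> ?h (F \<inter> A) + ?h ((UNIV - F) \<inter> A)" by (rule hausdorff_measure_Un)
      finally show "?h A \<le> ?h (F \<inter> A) + ?h ((UNIV - F) \<inter> A)" .
    qed
    then show ?thesis by (simp add: lambda_system_def)
  qed
  have sa: "sigma_algebra UNIV (lambda_system UNIV UNIV ?h)" using ms by (simp add: measure_space_def)
  show "sets borel \<subseteq> lambda_system UNIV UNIV ?h"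
  proof -
    have "Collect closed \<subseteq> lambda_system UNIV UNIV ?h" using cl by blast
    then have "sigma_sets UNIV (Collect closed) \<subseteq> lambda_system UNIV UNIV ?h"
      by (rule sigma_algebra.sigma_sets_subset[OF sa])
    moreover have "sets (borel :: 'n heis measure) = sigma_sets UNIV (Collect closed)"
      unfolding borel_eq_closed by (rule sets_measure_of) simp
    ultimately show ?thesis by simp
  qed
qed

lemma hausdorff_measure_left:
  fixes A :: "('n::finite) heis set"
  shows "hausdorff_measure hdist t ((\<odot>) p ` A) = hausdorff_measure hdist t A"
proof -
  have le: "hausdorff_measure hdist t ((\<odot>) p ` A) \<le> hausdorff_measure hdist t A" for p and A :: "'n heis set"
    unfolding hausdorff_measure_def
  proof (rule SUP_mono, rule bexI)
    fix \<delta> :: real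
    show "hausdorff_content hdist t \<delta> ((\<odot>) p ` A) \<le> hausdorff_content hdist t \<delta> A"
      unfolding hausdorff_content_def[of _ _ _ A]
    proof (rule INF_greatest, clarify)
      fix E :: "nat \<Rightarrow> 'n heis set" assume E: "A \<subseteq> (\<Union>i. E i)" "\<forall>i. diam_wrt hdist (E i) \<le> ennreal \<delta>"
      have d: "diam_wrt hdist ((\<odot>) p ` E i) = diam_wrt hdist (E i)" for i by (simp add: diam_wrt_def image_comp o_def)
      have "hausdorff_content hdist t \<delta> ((\<odot>) p ` A) \<le> (\<Sum>i. diam_power hdist t ((\<odot>) p ` E i))"
      proof (rule hausdorff_content_le)
        have "(\<odot>) p ` A \<subseteq> (\<odot>) p ` (\<Union>i. E i)" using E(1) by (rule image_mono)
        then show "(\<odot>) p ` A \<subseteq> (\<Union>i. (\<odot>) p ` E i)" by (simp add: image_UN)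
      qed (use E in \<open>simp add: d\<close>)
      also have "\<dots> = (\<Sum>i. diam_power hdist t (E i))" unfolding diam_power_def d by simp
      finally show "hausdorff_content hdist t \<delta> ((\<odot>) p ` A) \<le> (\<Sum>i. diam_power hdist t (E i))" .
    qed
  qed
  have "A = (\<odot>) (- p) ` (\<odot>) p ` A" by (simp add: image_comp o_def)
  then have "hausdorff_measure hdist t A \<le> hausdorff_measure hdist t ((\<odot>) p ` A)" using le by metis
  then show ?thesis using le by (intro antisym)
qed

context heis_measure begin

lemma sigma_finite: "sigma_finite_measure \<mu>"
proof
  have "(\<Union>n::nat. hball 0 (real n)) = (UNIV :: 'n heis set)"
    by (auto simp: hball_def real_arch_simple)
  then show "\<exists>A. countable A \<and> A \<subseteq> sets \<mu> \<and> \<Union> A = space \<mu> \<and> (\<forall>a\<in>A. emeasure \<mu> a \<noteq> \<infinity>)"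
    by (intro exI[of _ "range (\<lambda>n::nat. hball 0 (real n))"]) (auto simp: emeasure_hball)
qed

end

section \<open>Hausdorff measure compared with Haar measure\<close>

locale haar_group = haar V m L for V :: "('n::finite) heis set" and m :: nat and L :: "'n heis measure" +
  assumes m_pos: "m > 0" and closed_V: "closed V"
    and V_hmul: "p \<in> V \<Longrightarrow> q \<in> V \<Longrightarrow> p \<odot> q \<in> V" and V_uminus: "p \<in> V \<Longrightarrow> - p \<in> V"
begin

lemma left_nn: "f \<in> borel_measurable borel \<Longrightarrow> p \<in> V \<Longrightarrow> (\<integral>\<^sup>+q. f (p \<odot> q) \<partial>L) = (\<integral>\<^sup>+q. f q \<partial>L)"
  and uminus_nn: "f \<in> borel_measurable borel \<Longrightarrow> (\<integral>\<^sup>+q. f (- q) \<partial>L) = (\<integral>\<^sup>+q. f q \<partial>L)"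
  and dil_nn: "f \<in> borel_measurable borel \<Longrightarrow> r > 0 \<Longrightarrow> (\<integral>\<^sup>+q. f q \<partial>L) = ennreal (r ^ m) * (\<integral>\<^sup>+q. f (hdilation r q) \<partial>L)"
  using haar unfolding haar_on_def by blast+

lemma V_borel [measurable]: "V \<in> sets borel" by (rule borel_closed[OF closed_V])

lemma measurable_compose_cont:
  fixes f :: "'n heis \<Rightarrow> ennreal"
  shows "f \<in> borel_measurable borel \<Longrightarrow> continuous_on UNIV h \<Longrightarrow> (\<lambda>q. f (h q)) \<in> borel_measurable borel"
  by (rule measurable_compose[of h]) (auto intro: borel_measurable_continuous_onI)

text \<open>Right translation is left translation by the inverse, conjugated by inversion, and all
  three preserve the measure.\<close>

lemma right_nn:
  assumes f: "f \<in> borel_measurable borel" and p: "p \<in> V" shows "(\<integral>\<^sup>+q. f (q \<odot> p) \<partial>L) = (\<integral>\<^sup>+q. f q \<partial>L)"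
proof -
  have "(\<integral>\<^sup>+q. f (q \<odot> p) \<partial>L) = (\<integral>\<^sup>+q. f (- q \<odot> p) \<partial>L)"
    by (rule uminus_nn[symmetric]) (intro measurable_compose_cont[OF f] continuous_intros)
  also have "\<dots> = (\<integral>\<^sup>+q. f (- (- p \<odot> q)) \<partial>L)" by (simp add: uminus_hmul)
  also have "\<dots> = (\<integral>\<^sup>+q. f (- q) \<partial>L)"
    by (rule left_nn[of "\<lambda>q. f (- q)"]) (intro measurable_compose_cont[OF f] continuous_intros V_uminus p)+
  also have "\<dots> = (\<integral>\<^sup>+q. f q \<partial>L)" by (rule uminus_nn[OF f])
  finally show ?thesis .
qed

lemma ind_meas: "(indicator (hball p r) :: 'n heis \<Rightarrow> ennreal) \<in> borel_measurable borel"
  by (intro borel_measurable_indicator hball_borel)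

lemma L_hball: assumes "p \<in> V" "r > 0" shows "emeasure L (hball p r) = ennreal (r ^ m) * emeasure L (hball 0 1)"
proof -
  have "emeasure L (hball p r) = (\<integral>\<^sup>+q. indicator (hball p r) q \<partial>L)" by simp
  also have "\<dots> = (\<integral>\<^sup>+q. indicator (hball 0 r) (- p \<odot> q) \<partial>L)"
    by (intro nn_integral_cong) (simp add: indicator_def hball_def hdist_eq)
  also have "\<dots> = (\<integral>\<^sup>+q. indicator (hball 0 r) q \<partial>L)" by (rule left_nn[OF ind_meas V_uminus[OF assms(1)]])
  also have "\<dots> = ennreal (r ^ m) * (\<integral>\<^sup>+q. indicator (hball 0 r) (hdilation r q) \<partial>L)" by (rule dil_nn[OF ind_meas assms(2)])
  also have "(\<integral>\<^sup>+q. indicator (hball 0 r) (hdilation r q) \<partial>L) = (\<integral>\<^sup>+q. indicator (hball 0 1) q \<partial>L)"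
    using assms(2) by (intro nn_integral_cong) (simp add: indicator_def hball_def hnorm_hdilation)
  finally show ?thesis by simp
qed

definition "L1 = measure L (hball 0 1)"

lemma L1_pos: "L1 > 0"
proof -
  have "0 < emeasure L (hball 0 1)" using haar by (simp add: haar_on_def)
  then show ?thesis by (simp add: L1_def emeasure_hball)
qed

lemma L_hball': assumes "p \<in> V" "r > 0" shows "measure L (hball p r) = r ^ m * L1"
  using L_hball[OF assms] assms(2) unfolding emeasure_hball L1_def by (simp add: ennreal_mult[symmetric])

text \<open>A packing bound: disjoint balls of equal radius about points of \<open>V\<close> have
  equal Haar mass and lie in a fixed ball, so their number is at most a multiple of
  \<open>\<delta> powr (- real m)\<close>. Exponent \<open>t = real m\<close> gives finiteness,
  larger \<open>t\<close> nullity.\<close>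

lemma content_upper:
  assumes t: "t \<ge> real m"
  obtains K where "\<And>\<delta>. 0 < \<delta> \<Longrightarrow> \<delta> \<le> 1 \<Longrightarrow> hausdorff_content hdist t \<delta> (hball 0 R \<inter> V) \<le> ennreal (K * \<delta> powr (t - real m))"
proof -
  define M where "M = measure L (hball 0 (R + 1))"
  define K where "K = 10 ^ m * (M / L1)"
  have "hausdorff_content hdist t \<delta> (hball 0 R \<inter> V) \<le> ennreal (K * \<delta> powr (t - real m))" if \<delta>: "0 < \<delta>" "\<delta> \<le> 1" for \<delta>
  proof -
    \<comment> \<open>Enlargement by 5 and passage from radius to diameter cost a factor 10, which
      also appears in \<open>K\<close>.\<close>
    define \<epsilon> where "\<epsilon> = \<delta> / 10"
    have \<epsilon>: "0 < \<epsilon>" "\<epsilon> \<le> 1" "10 * \<epsilon> = \<delta>" using \<delta> by (auto simp: \<epsilon>_def)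
    let ?I = "hball 0 R \<inter> V"
    obtain J where J: "J \<subseteq> ?I" "countable J" "disjoint_family_on (\<lambda>a. hball a \<epsilon>) J"
      "\<And>i. i \<in> ?I \<Longrightarrow> \<exists>j\<in>J. hball i \<epsilon> \<subseteq> hball j (5 * \<epsilon>)"
      using hball_Vitali[of ?I "\<lambda>_. \<epsilon>" \<epsilon> "\<lambda>a. a"] \<epsilon> by auto
    have cardF: "real (card F) * (\<epsilon> ^ m * L1) \<le> M" if F: "finite F" "F \<subseteq> J" for F
    proof -
      have "disjoint_family_on (\<lambda>a. hball a \<epsilon>) F" using J(3) F(2) unfolding disjoint_family_on_def by blast
      then have "measure L (\<Union>a\<in>F. hball a \<epsilon>) = (\<Sum>a\<in>F. measure L (hball a \<epsilon>))"
        using F(1) by (intro measure_finite_Union) (auto simp: emeasure_hball)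
      also have "\<dots> = (\<Sum>a\<in>F. \<epsilon> ^ m * L1)" using F J(1) \<epsilon> by (intro sum.cong L_hball' refl) auto
      also have "\<dots> = real (card F) * (\<epsilon> ^ m * L1)" by simp
      finally have "real (card F) * (\<epsilon> ^ m * L1) = measure L (\<Union>a\<in>F. hball a \<epsilon>)" by simp
      also have "\<dots> \<le> M" unfolding M_def
      proof (rule measure_mono_fmeasurable)
        show "(\<Union>a\<in>F. hball a \<epsilon>) \<subseteq> hball 0 (R + 1)"
        proof
          fix x assume "x \<in> (\<Union>a\<in>F. hball a \<epsilon>)"
          then obtain a where a: "a \<in> F" "hdist a x \<le> \<epsilon>" by (auto simp: hball_def)
          have "hdist 0 x \<le> hdist 0 a + hdist a x" by (rule hdist_triangle)
          moreover have "hdist 0 a \<le> R" using a J(1) F(2) by (auto simp: hball_def)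
          ultimately show "x \<in> hball 0 (R + 1)" using a \<epsilon> by (simp add: hball_def)
        qed
      qed (use F in \<open>auto intro!: sets.finite_UN\<close>)
      finally show ?thesis .
    qed
    have "finite J"
    proof (rule ccontr)
      assume "infinite J"
      obtain n :: nat where n: "M / (\<epsilon> ^ m * L1) < real n" using reals_Archimedean2 by blast
      obtain F where "finite F" "F \<subseteq> J" "card F = n" using infinite_arbitrarily_large[OF \<open>infinite J\<close>] by blast
      then have "real n * (\<epsilon> ^ m * L1) \<le> M" using cardF by blast
      moreover have "\<epsilon> ^ m * L1 > 0" using \<epsilon> L1_pos by simp
      ultimately show False using n by (simp add: field_simps)
    qed
    define E where "E k = (if k < card J then hball (from_nat_into J k) (5 * \<epsilon>) else {})" for k
    have bij: "bij_betw (from_nat_into J) {..<card J} J" using \<open>finite J\<close> by (rule bij_betw_from_nat_into_finite)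
    have cov: "?I \<subseteq> (\<Union>k. E k)"
    proof
      fix x assume x: "x \<in> ?I"
      then obtain j where j: "j \<in> J" "hball x \<epsilon> \<subseteq> hball j (5 * \<epsilon>)" using J(4) by blast
      have "j \<in> from_nat_into J ` {..<card J}" using bij j(1) by (simp add: bij_betw_def)
      then obtain k where k: "k < card J" "from_nat_into J k = j" by blast
      have "x \<in> hball x \<epsilon>" using \<epsilon> by (simp add: hball_def)
      then have "x \<in> E k" using j k by (auto simp: E_def)
      then show "x \<in> (\<Union>k. E k)" by blast
    qed
    have diam: "diam_wrt hdist (E k) \<le> ennreal \<delta>" for k
      unfolding diam_wrt_def
    proof (intro SUP_least ennreal_leI)
      fix x y assume xy: "x \<in> E k" "y \<in> E k"
      let ?c = "from_nat_into J k"
      have "hdist ?c x \<le> 5 * \<epsilon>" "hdist ?c y \<le> 5 * \<epsilon>" using xy by (auto simp: E_def hball_def split: if_splits)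
      then show "hdist x y \<le> \<delta>" using hdist_triangle[of x y ?c] hdist_commute[of x ?c] \<epsilon>(3) by linarith
    qed
    have pw: "diam_power hdist t (E k) \<le> ennreal (\<delta> powr t)" for k
    proof -
      have "t > 0" using t m_pos by linarith
      moreover have "enn2real (diam_wrt hdist (E k)) \<le> \<delta>" using diam[of k] \<delta>(1) by (simp add: enn2real_leI)
      ultimately show ?thesis unfolding diam_power_def using \<delta> by (auto intro!: ennreal_leI powr_mono2)
    qed
    have "hausdorff_content hdist t \<delta> ?I \<le> (\<Sum>k. diam_power hdist t (E k))" by (rule hausdorff_content_le[OF cov diam])
    also have "\<dots> = (\<Sum>k<card J. diam_power hdist t (E k))"
      by (rule suminf_finite) (auto simp: E_def diam_power_0)
    also have "\<dots> \<le> (\<Sum>k<card J. ennreal (\<delta> powr t))" by (intro sum_mono pw)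
    also have "\<dots> = ennreal (real (card J) * \<delta> powr t)" by (simp add: ennreal_mult ennreal_of_nat_eq_real_of_nat)
    also have "\<dots> \<le> ennreal (K * \<delta> powr (t - real m))"
    proof (rule ennreal_leI)
      have "real (card J) * (\<epsilon> ^ m * L1) \<le> M" by (rule cardF[OF \<open>finite J\<close> order_refl])
      then have "real (card J) \<le> M / (\<epsilon> ^ m * L1)" using \<epsilon> L1_pos by (simp add: pos_le_divide_eq)
      also have "\<dots> = K / \<delta> ^ m" using \<delta> by (simp add: K_def \<epsilon>_def power_divide mult.commute)
      finally have "real (card J) * \<delta> powr t \<le> K / \<delta> ^ m * \<delta> powr t" using \<delta> by (intro mult_right_mono) auto
      also have "\<dots> = K * \<delta> powr (t - real m)" using \<delta> by (simp add: powr_diff powr_realpow)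
      finally show "real (card J) * \<delta> powr t \<le> K * \<delta> powr (t - real m)" .
    qed
    finally show ?thesis .
  qed
  then show thesis using that by blast
qed

lemma hausdorff_finite: "hausdorff_measure hdist (real m) (hball 0 R \<inter> V) < \<infinity>"
proof -
  obtain K where K: "\<And>\<delta>. 0 < \<delta> \<Longrightarrow> \<delta> \<le> 1 \<Longrightarrow> hausdorff_content hdist (real m) \<delta> (hball 0 R \<inter> V) \<le> ennreal (K * \<delta> powr (real m - real m))"
    using content_upper[of "real m" R] by auto
  have "hausdorff_measure hdist (real m) (hball 0 R \<inter> V) \<le> ennreal K"
    unfolding hausdorff_measure_def
  proof (rule SUP_least)
    fix \<delta> :: real assume "\<delta> \<in> {0<..}"
    then have "hausdorff_content hdist (real m) \<delta> (hball 0 R \<inter> V) \<le> hausdorff_content hdist (real m) (min \<delta> 1) (hball 0 R \<inter> V)"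
      by (intro hausdorff_content_antimono) auto
    also have "\<dots> \<le> ennreal K" using K[of "min \<delta> 1"] \<open>\<delta> \<in> {0<..}\<close> by (auto split: if_splits simp: min_def)
    finally show "hausdorff_content hdist (real m) \<delta> (hball 0 R \<inter> V) \<le> ennreal K" .
  qed
  also have "\<dots> < \<infinity>" by simp
  finally show ?thesis .
qed

lemma hausdorff_null: assumes "t > real m" shows "hausdorff_measure hdist t V = 0"
proof -
  have null: "hausdorff_measure hdist t (hball 0 R \<inter> V) = 0" for R
  proof -
    obtain K where K: "\<And>\<delta>. 0 < \<delta> \<Longrightarrow> \<delta> \<le> 1 \<Longrightarrow> hausdorff_content hdist t \<delta> (hball 0 R \<inter> V) \<le> ennreal (K * \<delta> powr (t - real m))"
      using content_upper[of t R] assms by auto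
    have small: "hausdorff_content hdist t \<delta> (hball 0 R \<inter> V) \<le> 0 + ennreal e" if "\<delta> > 0" "e > 0" for \<delta> e
    proof -
      have "e / (\<bar>K\<bar> + 1) > 0" "t - real m > 0" using that assms by auto
      then obtain r where r: "0 < r" "r < min \<delta> 1" "r powr (t - real m) < e / (\<bar>K\<bar> + 1)" using small_powr[of "t - real m" "e / (\<bar>K\<bar> + 1)" "min \<delta> 1"] \<open>\<delta> > 0\<close> by auto
      have "hausdorff_content hdist t \<delta> (hball 0 R \<inter> V) \<le> hausdorff_content hdist t r (hball 0 R \<inter> V)"
        using r by (intro hausdorff_content_antimono) auto
      also have "\<dots> \<le> ennreal (K * r powr (t - real m))" using r by (intro K) auto
      also have "\<dots> \<le> ennreal e"
      proof (rule ennreal_leI)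
        have "K * r powr (t - real m) \<le> (\<bar>K\<bar> + 1) * r powr (t - real m)" by (intro mult_right_mono) auto
        also have "\<dots> \<le> e" using r(3) by (simp add: field_simps)
        finally show "K * r powr (t - real m) \<le> e" .
      qed
      finally show ?thesis by simp
    qed
    have "hausdorff_content hdist t \<delta> (hball 0 R \<inter> V) \<le> 0" if "\<delta> > 0" for \<delta>
      by (rule ennreal_le_epsilon) (rule small[OF that])
    then have "hausdorff_measure hdist t (hball 0 R \<inter> V) \<le> 0"
      unfolding hausdorff_measure_def by (intro SUP_least) simp
    then show ?thesis by simp
  qed
  have "V \<subseteq> (\<Union>n::nat. hball 0 (real n) \<inter> V)" by (auto simp: hball_def real_arch_simple)
  then have "hausdorff_measure hdist t V \<le> (\<Sum>n. hausdorff_measure hdist t (hball 0 (real n) \<inter> V))"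
    by (rule order_trans[OF hausdorff_measure_mono hausdorff_measure_subadditive])
  then show ?thesis by (simp add: null)
qed

lemma L_point: assumes "p \<in> V" shows "emeasure L (hball p 0) = 0"
proof -
  have small: "emeasure L (hball p 0) \<le> 0 + ennreal e" if e: "e > 0" for e
  proof -
    define r where "r = min 1 (e / L1)"
    have r: "0 < r" "r \<le> 1" "r * L1 \<le> e" using e L1_pos by (auto simp: r_def min_def field_simps)
    have "emeasure L (hball p 0) \<le> emeasure L (hball p r)" using r by (intro emeasure_mono borel_sets hball_borel) (auto simp: hball_def)
    also have "\<dots> = ennreal (r ^ m * L1)" using L_hball'[OF assms r(1)] by (simp add: emeasure_hball)
    also have "\<dots> \<le> ennreal e"
    proof (rule ennreal_leI)
      have "r ^ m \<le> r ^ 1" using r m_pos by (intro power_decreasing) auto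
      then have "r ^ m * L1 \<le> r * L1" using L1_pos by (intro mult_right_mono) auto
      then show "r ^ m * L1 \<le> e" using r by simp
    qed
    finally show ?thesis by simp
  qed
  have "emeasure L (hball p 0) \<le> 0" by (rule ennreal_le_epsilon) (rule small)
  then show ?thesis by simp
qed

text \<open>The mass distribution principle with constant 1. A set of diameter
  \<open>d \<le> 1\<close> that meets \<open>V\<close> has its trace in a ball of radius
  \<open>d\<close> about a point of \<open>V\<close>, of Haar mass \<open>d ^ m * L1\<close>, which
  is at most \<open>d powr t * L1\<close>. A cover of the unit ball of \<open>V\<close> must have
  total mass at least \<open>L1\<close>.\<close>

lemma content_lower:
  assumes t: "0 < t" "t \<le> real m"
  shows "1 \<le> hausdorff_content hdist t 1 (hball 0 1 \<inter> V)"
  unfolding hausdorff_content_def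
proof (rule INF_greatest)
  fix E :: "nat \<Rightarrow> 'n heis set"
  assume "E \<in> {E. hball 0 1 \<inter> V \<subseteq> \<Union> (range E) \<and> (\<forall>i. diam_wrt hdist (E i) \<le> ennreal 1)}"
  then have E: "hball 0 1 \<inter> V \<subseteq> (\<Union>i. E i)" "\<forall>i. diam_wrt hdist (E i) \<le> ennreal 1" by blast+
  define dd where "dd i = enn2real (diam_wrt hdist (E i))" for i
  have diam_eq: "diam_wrt hdist (E i) = ennreal (dd i)" for i
    using E(2)[rule_format, of i] by (auto simp: dd_def top_unique intro!: ennreal_enn2real[symmetric] simp: less_top[symmetric])
  have dd: "0 \<le> dd i" "dd i \<le> 1" for i using E(2)[rule_format, of i] unfolding diam_eq by (auto simp: dd_def)
  define x where "x i = (SOME p. p \<in> E i \<inter> V)" for i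
  have x: "x i \<in> E i \<inter> V" if "E i \<inter> V \<noteq> {}" for i unfolding x_def using that by (meson ex_in_conv someI_ex)
  define S where "S i = (if E i \<inter> V = {} then {} else hball (x i) (dd i))" for i
  have ES: "E i \<inter> V \<subseteq> S i" for i
  proof
    fix y assume y: "y \<in> E i \<inter> V"
    then have ne: "E i \<inter> V \<noteq> {}" by blast
    then have "ennreal (hdist (x i) y) \<le> ennreal (dd i)" using dist_le_diam_wrt[of "x i" "E i" y hdist] x y by (simp add: diam_eq)
    then show "y \<in> S i" using ne dd by (simp add: S_def hball_def ennreal_le_iff)
  qed
  have LS: "emeasure L (S i) \<le> diam_power hdist t (E i) * ennreal L1" for i
  \<comment> \<open>A set of diameter 0 contributes 0 to the sum, so its trace on \<open>V\<close>
    has to be Haar null; this is where single points being null is used.\<close>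
  proof (cases "E i \<inter> V = {} \<or> dd i = 0")
    case True
    then have "emeasure L (S i) = 0" using L_point[of "x i"] x[of i] by (cases "E i \<inter> V = {}") (simp_all add: S_def)
    then show ?thesis by simp
  next
    case False
    then have d: "0 < dd i" using dd(1)[of i] by linarith
    have "dd i ^ m = dd i powr real m" using d by (simp add: powr_realpow)
    also have "\<dots> \<le> dd i powr t" using t d dd(2)[of i] by (intro powr_mono') auto
    finally have "dd i ^ m * L1 \<le> dd i powr t * L1" using L1_pos by (intro mult_right_mono) auto
    then have "ennreal (dd i ^ m * L1) \<le> ennreal (dd i powr t * L1)" by (rule ennreal_leI)
    moreover have "emeasure L (S i) = ennreal (dd i ^ m * L1)"
      using False x[of i] L_hball'[of "x i" "dd i"] d by (simp add: S_def emeasure_hball)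
    moreover have "diam_power hdist t (E i) = ennreal (dd i powr t)" using False t by (auto simp: diam_power_def dd_def)
    ultimately show ?thesis using L1_pos by (simp add: ennreal_mult)
  qed
  have "ennreal L1 = emeasure L (hball 0 1)" by (simp add: L1_def emeasure_hball)
  also have "\<dots> \<le> emeasure L (\<Union>i. S i)"
  proof (rule emeasure_mono_AE)
    show "AE q in L. q \<in> hball 0 1 \<longrightarrow> q \<in> (\<Union>i. S i)" using AE_V
    proof eventually_elim
      case (elim q)
      then show ?case using E(1) ES by blast
    qed
    show "(\<Union>i. S i) \<in> sets L" by (intro sets.countable_UN) (auto simp: S_def)
  qed
  also have "\<dots> \<le> (\<Sum>i. emeasure L (S i))" by (rule emeasure_subadditive_countably) (auto simp: S_def)
  also have "\<dots> \<le> (\<Sum>i. diam_power hdist t (E i) * ennreal L1)" by (intro suminf_le LS) auto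
  also have "\<dots> = (\<Sum>i. diam_power hdist t (E i)) * ennreal L1" by simp
  finally have le: "1 * ennreal L1 \<le> (\<Sum>i. diam_power hdist t (E i)) * ennreal L1" by simp
  show "1 \<le> (\<Sum>i. diam_power hdist t (E i))"
  proof (rule ccontr)
    assume "\<not> 1 \<le> (\<Sum>i. diam_power hdist t (E i))"
    then have "(\<Sum>i. diam_power hdist t (E i)) * ennreal L1 < 1 * ennreal L1"
      using L1_pos by (intro ennreal_mult_strict_right_mono) auto
    then show False using le by simp
  qed
qed

lemma hausdorff_pos:
  assumes "0 < t" "t \<le> real m" shows "1 \<le> hausdorff_measure hdist t (hball 0 1 \<inter> V)" "1 \<le> hausdorff_measure hdist t V"
proof -
  have "hausdorff_content hdist t 1 (hball 0 1 \<inter> V) \<le> hausdorff_measure hdist t (hball 0 1 \<inter> V)"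
    by (rule hausdorff_content_le_measure) simp
  then show 1: "1 \<le> hausdorff_measure hdist t (hball 0 1 \<inter> V)" using content_lower[OF assms] by simp
  have "hausdorff_measure hdist t (hball 0 1 \<inter> V) \<le> hausdorff_measure hdist t V"
    by (rule hausdorff_measure_mono) simp
  then show "1 \<le> hausdorff_measure hdist t V" using 1 by (rule order_trans[rotated])
qed

lemma hausdorff_dim_V: "hausdorff_dim hdist V = of_nat m"
proof -
  have eq: "{t. 0 < t \<and> hausdorff_measure hdist t V = 0} = {real m<..}"
  proof (intro equalityI subsetI)
    fix t assume "t \<in> {t. 0 < t \<and> hausdorff_measure hdist t V = 0}"
    then show "t \<in> {real m<..}" using hausdorff_pos(2)[of t] by (cases "t \<le> real m") auto
  next
    fix t assume "t \<in> {real m<..}"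
    then have "real m < t" by simp
    then show "t \<in> {t. 0 < t \<and> hausdorff_measure hdist t V = 0}" using hausdorff_null[of t] by simp
  qed
  show ?thesis
    unfolding hausdorff_dim_def eq
  proof (rule antisym)
    show "Inf (ennreal ` {real m<..}) \<le> of_nat m"
    proof (rule ennreal_le_epsilon)
      fix e :: real assume "0 < e"
      then have "Inf (ennreal ` {real m<..}) \<le> ennreal (real m + e)" by (intro INF_lower) auto
      also have "\<dots> = of_nat m + ennreal e" using \<open>0 < e\<close> by (simp add: ennreal_of_nat_eq_real_of_nat)
      finally show "Inf (ennreal ` {real m<..}) \<le> of_nat m + ennreal e" .
    qed
    show "of_nat m \<le> Inf (ennreal ` {real m<..})"
      by (rule INF_greatest) (auto simp: ennreal_of_nat_eq_real_of_nat intro!: ennreal_leI)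
  qed
qed

definition HV :: "'n heis measure" where
  "HV = measure_of UNIV (sets borel) (\<lambda>A. hausdorff_measure hdist (real m) (A \<inter> V))"

lemma sets_HV [simp]: "sets HV = sets borel"
  unfolding HV_def using sets.sets_measure_of_eq[of "borel :: 'n heis measure"] by simp

text \<open>\<open>measure_of\<close> yields the intended values only for a countably additive
  function, which is what the Caratheodory criterion supplies on Borel sets.\<close>

lemma emeasure_HV: assumes "A \<in> sets borel" shows "emeasure HV A = hausdorff_measure hdist (real m) (A \<inter> V)"
  unfolding HV_def
proof (rule emeasure_measure_of_sigma)
  let ?h = "hausdorff_measure (hdist :: 'n heis \<Rightarrow> _) (real m)"
  show "sigma_algebra UNIV (sets (borel :: 'n heis measure))"
    using sets.sigma_algebra_axioms[of "borel :: 'n heis measure"] by simp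
  show "positive (sets borel) (\<lambda>A. ?h (A \<inter> V))" by (simp add: positive_def)
  show "countably_additive (sets borel) (\<lambda>A. ?h (A \<inter> V))"
    unfolding countably_additive_def
  proof (intro allI impI)
    fix A :: "nat \<Rightarrow> 'n heis set" assume A: "range A \<subseteq> sets borel" "disjoint_family A" "(\<Union>i. A i) \<in> sets borel"
    have ca: "countably_additive (lambda_system UNIV UNIV ?h) ?h"
      using borel_caratheodory(2)[where ?'n='n and t="real m"] by (simp add: measure_space_def)
    have r: "range (\<lambda>i. A i \<inter> V) \<subseteq> sets borel" using A(1) by auto
    then have "range (\<lambda>i. A i \<inter> V) \<subseteq> lambda_system UNIV UNIV ?h" using borel_caratheodory(1)[where t="real m"] by blast
    moreover have "disjoint_family (\<lambda>i. A i \<inter> V)" using A(2) by (auto simp: disjoint_family_on_def)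
    moreover have "(\<Union>i. A i \<inter> V) \<in> lambda_system UNIV UNIV ?h"
      using borel_caratheodory(1)[where t="real m"] sets.countable_UN[OF r] by blast
    ultimately have "(\<Sum>i. ?h (A i \<inter> V)) = ?h (\<Union>i. A i \<inter> V)" using ca unfolding countably_additive_def by blast
    then show "(\<Sum>i. ?h (A i \<inter> V)) = ?h ((\<Union>i. A i) \<inter> V)" by simp
  qed
qed (rule assms)

lemma HV_heis_measure: "heis_measure HV 1"
proof
  fix K :: "'n heis set" assume "compact K"
  then have "bounded K" by (rule compact_imp_bounded)
  then obtain R where R: "\<And>x. x \<in> K \<Longrightarrow> norm x \<le> R" unfolding bounded_iff by blast
  obtain R' where R': "\<And>p :: 'n heis. norm p \<le> R \<Longrightarrow> hnorm p \<le> R'" using hnorm_le_of_norm by metis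
  then have "K \<subseteq> hball 0 R'" using R by (auto simp: hball_def)
  then have "emeasure HV K \<le> emeasure HV (hball 0 R')" by (intro emeasure_mono) auto
  also have "\<dots> < \<infinity>" using hausdorff_finite by (simp add: emeasure_HV)
  finally show "emeasure HV K < \<infinity>" .
qed auto

lemma HV_left:
  assumes f: "f \<in> borel_measurable borel" and p: "p \<in> V" shows "(\<integral>\<^sup>+q. f (p \<odot> q) \<partial>HV) = (\<integral>\<^sup>+q. f q \<partial>HV)"
proof -
  have sp: "space HV = UNIV" using sets_eq_imp_space_eq[OF sets_HV] by simp
  have tm: "(\<lambda>q. p \<odot> q) \<in> measurable HV borel"
  proof -
    have "(\<lambda>q. p \<odot> q) \<in> measurable borel borel" by (intro borel_measurable_continuous_onI continuous_intros)
    then show ?thesis using measurable_cong_sets[OF sets_HV refl] by blast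
  qed
  have "distr HV borel (\<lambda>q. p \<odot> q) = HV"
  proof (rule measure_eqI)
    fix A assume "A \<in> sets (distr HV borel (\<lambda>q. p \<odot> q))"
    then have A: "A \<in> sets borel" by simp
    have "emeasure (distr HV borel (\<lambda>q. p \<odot> q)) A = emeasure HV ((\<lambda>q. p \<odot> q) -` A)"
      using emeasure_distr[OF tm A] by (simp add: sp)
    also have "\<dots> = hausdorff_measure hdist (real m) ((\<lambda>q. p \<odot> q) -` A \<inter> V)"
      using measurable_sets[OF tm A] by (intro emeasure_HV) (simp add: sp)
    also have "\<dots> = hausdorff_measure hdist (real m) ((\<odot>) p ` ((\<lambda>q. p \<odot> q) -` A \<inter> V))" by (rule hausdorff_measure_left[symmetric])
    also have "(\<odot>) p ` ((\<lambda>q. p \<odot> q) -` A \<inter> V) = A \<inter> V"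
    proof (intro equalityI subsetI)
      fix x assume "x \<in> A \<inter> V"
      then have "x = p \<odot> (- p \<odot> x)" "- p \<odot> x \<in> (\<lambda>q. p \<odot> q) -` A \<inter> V" using p V_hmul V_uminus by auto
      then show "x \<in> (\<odot>) p ` ((\<lambda>q. p \<odot> q) -` A \<inter> V)" by blast
    next
      fix x assume "x \<in> (\<odot>) p ` ((\<lambda>q. p \<odot> q) -` A \<inter> V)"
      then show "x \<in> A \<inter> V" using V_hmul[OF p] by blast
    qed
    finally show "emeasure (distr HV borel (\<lambda>q. p \<odot> q)) A = emeasure HV A" by (simp add: emeasure_HV[OF A])
  qed simp
  then have "(\<integral>\<^sup>+q. f q \<partial>HV) = (\<integral>\<^sup>+q. f q \<partial>distr HV borel (\<lambda>q. p \<odot> q))" by simp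
  also have "\<dots> = (\<integral>\<^sup>+q. f (p \<odot> q) \<partial>HV)" by (rule nn_integral_distr[OF tm]) (use f in simp)
  finally show ?thesis by simp
qed

text \<open>Uniqueness of Haar measure, by Fubini for \<open>f x * g (y\<^sup>-\<^sup>1 x)\<close>.\<close>
lemma HV_L:
  assumes f: "f \<in> borel_measurable borel" and g: "g \<in> borel_measurable borel"
  shows "(\<integral>\<^sup>+x. f x \<partial>HV) * (\<integral>\<^sup>+y. g y \<partial>L) = (\<integral>\<^sup>+x. g x \<partial>HV) * (\<integral>\<^sup>+y. f y \<partial>L)"
proof -
  interpret HV: heis_measure HV 1 by (rule HV_heis_measure)
  interpret pair_sigma_finite HV L
    using HV.sigma_finite sigma_finite by (simp add: pair_sigma_finite_def)
  have setsP: "sets (HV \<Otimes>\<^sub>M L) = sets (borel :: ('n heis \<times> 'n heis) measure)"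
    by (subst borel_prod[symmetric]) (intro sets_pair_measure_cong sets_HV sets_\<mu>)
  have fst_m: "(\<lambda>z :: 'n heis \<times> 'n heis. h (F z)) \<in> borel_measurable (HV \<Otimes>\<^sub>M L)"
    if "h \<in> borel_measurable borel" "continuous_on UNIV F" for h :: "'n heis \<Rightarrow> ennreal" and F
  proof -
    have "(\<lambda>z. h (F z)) \<in> borel_measurable borel"
      by (rule measurable_compose[OF borel_measurable_continuous_onI[OF that(2)] that(1)])
    then show ?thesis using measurable_cong_sets[OF setsP refl] by blast
  qed
  have m1: "(\<lambda>(x, y). f x * g (- y \<odot> x)) \<in> borel_measurable (HV \<Otimes>\<^sub>M L)"
    unfolding case_prod_beta by (intro borel_measurable_times_ennreal fst_m f g continuous_intros)
  have m2: "(\<lambda>(x, y). f (y \<odot> x) * g x) \<in> borel_measurable (HV \<Otimes>\<^sub>M L)"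
    unfolding case_prod_beta by (intro borel_measurable_times_ennreal fst_m f g continuous_intros)
  have AEH: "AE x in HV. x \<in> V"
  proof (rule AE_I'[of "- V"])
    show "- V \<in> null_sets HV" by (intro null_setsI) (auto simp: emeasure_HV borel_comp)
  qed auto
  have fL: "f \<in> borel_measurable HV" "g \<in> borel_measurable HV" by (intro HV.borel_meas f g)+
  \<comment> \<open>For \<open>L\<close> the variable sits in \<open>- y \<odot> x\<close>:
    inversion followed by right invariance removes \<open>x\<close>. For \<open>HV\<close> only left
    invariance is used, in the substitution of \<open>inner2\<close>.\<close>
  have inner1: "(\<integral>\<^sup>+y. f x * g (- y \<odot> x) \<partial>L) = f x * (\<integral>\<^sup>+y. g y \<partial>L)" if x: "x \<in> V" for x
  proof -
    have gm: "(\<lambda>y. g (h y)) \<in> borel_measurable L" if "continuous_on UNIV h" for h :: "'n heis \<Rightarrow> 'n heis"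
      by (rule borel_meas[OF measurable_compose_cont[OF g that]])
    have "(\<integral>\<^sup>+y. f x * g (- y \<odot> x) \<partial>L) = f x * (\<integral>\<^sup>+y. g (- y \<odot> x) \<partial>L)"
      by (rule nn_integral_cmult) (intro gm continuous_intros)
    also have "(\<integral>\<^sup>+y. g (- y \<odot> x) \<partial>L) = (\<integral>\<^sup>+y. g (y \<odot> x) \<partial>L)"
      by (rule uminus_nn[of "\<lambda>y. g (y \<odot> x)"]) (intro measurable_compose_cont[OF g] continuous_intros)
    also have "\<dots> = (\<integral>\<^sup>+y. g y \<partial>L)" by (rule right_nn[OF g x])
    finally show ?thesis .
  qed
  have inner2: "(\<integral>\<^sup>+x. f x * g (- y \<odot> x) \<partial>HV) = (\<integral>\<^sup>+x. f (y \<odot> x) * g x \<partial>HV)" if y: "y \<in> V" for y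
  proof -
    have "(\<lambda>x. f x * g (- y \<odot> x)) \<in> borel_measurable borel"
      by (intro borel_measurable_times_ennreal f measurable_compose_cont[OF g] continuous_intros)
    from HV_left[OF this y] show ?thesis by simp
  qed
  have inner3: "(\<integral>\<^sup>+y. f (y \<odot> x) * g x \<partial>L) = g x * (\<integral>\<^sup>+y. f y \<partial>L)" if x: "x \<in> V" for x
  proof -
    have "(\<lambda>y. f (y \<odot> x)) \<in> borel_measurable L"
      by (intro borel_meas measurable_compose_cont[OF f] continuous_intros)
    then have "(\<integral>\<^sup>+y. f (y \<odot> x) * g x \<partial>L) = (\<integral>\<^sup>+y. f (y \<odot> x) \<partial>L) * g x" by (rule nn_integral_multc)
    then show ?thesis by (simp add: right_nn[OF f x] mult.commute)
  qed
  have "(\<integral>\<^sup>+x. f x \<partial>HV) * (\<integral>\<^sup>+y. g y \<partial>L) = (\<integral>\<^sup>+x. f x * (\<integral>\<^sup>+y. g y \<partial>L) \<partial>HV)" by (rule nn_integral_multc[symmetric]) (rule fL)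
  also have "\<dots> = (\<integral>\<^sup>+x. \<integral>\<^sup>+y. f x * g (- y \<odot> x) \<partial>L \<partial>HV)"
    by (rule nn_integral_cong_AE, use AEH in eventually_elim) (simp add: inner1)
  also have "\<dots> = (\<integral>\<^sup>+y. \<integral>\<^sup>+x. f x * g (- y \<odot> x) \<partial>HV \<partial>L)" by (rule Fubini'[OF m1, symmetric])
  also have "\<dots> = (\<integral>\<^sup>+y. \<integral>\<^sup>+x. f (y \<odot> x) * g x \<partial>HV \<partial>L)"
    by (rule nn_integral_cong_AE, use AE_V in eventually_elim) (simp add: inner2)
  also have "\<dots> = (\<integral>\<^sup>+x. \<integral>\<^sup>+y. f (y \<odot> x) * g x \<partial>L \<partial>HV)" by (rule Fubini'[OF m2])
  also have "\<dots> = (\<integral>\<^sup>+x. g x * (\<integral>\<^sup>+y. f y \<partial>L) \<partial>HV)"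
    by (rule nn_integral_cong_AE, use AEH in eventually_elim) (simp add: inner3)
  also have "\<dots> = (\<integral>\<^sup>+x. g x \<partial>HV) * (\<integral>\<^sup>+y. f y \<partial>L)" by (rule nn_integral_multc) (rule fL)
  finally show ?thesis .
qed

text \<open>Uniqueness is tested on the unit ball, whose Hausdorff measure on \<open>V\<close> is
  finite and at least 1, so that dividing by it is legitimate.\<close>

lemma hausdorff_eq_haar:
  obtains \<kappa> where "\<kappa> > 0" "\<And>A. A \<in> sets borel \<Longrightarrow> emeasure L A = ennreal \<kappa> * hausdorff_measure hdist (real m) (A \<inter> V)"
proof -
  define h where "h = enn2real (emeasure HV (hball 0 1))"
  have h: "emeasure HV (hball 0 1) = ennreal h" "1 \<le> h"
  proof -
    have fin: "emeasure HV (hball 0 1) < top_class.top" using hausdorff_finite[of 1] by (simp add: emeasure_HV)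
    then show e: "emeasure HV (hball 0 1) = ennreal h" by (simp add: h_def)
    have "1 \<le> emeasure HV (hball 0 1)" using hausdorff_pos(1)[of "real m"] m_pos by (simp add: emeasure_HV)
    then show "1 \<le> h" unfolding e using ennreal_le_iff2[of 1 h] by simp
  qed
  have "emeasure L A = ennreal (L1 / h) * hausdorff_measure hdist (real m) (A \<inter> V)" if A: "A \<in> sets borel" for A
  proof -
    have i: "(indicator A :: 'n heis \<Rightarrow> ennreal) \<in> borel_measurable borel" using A by simp
    have "emeasure HV A * emeasure L (hball 0 1) = emeasure HV (hball 0 1) * emeasure L A"
      using HV_L[OF i ind_meas[of 0 1]] A by simp
    then have e: "emeasure HV A * ennreal L1 = ennreal h * emeasure L A" by (simp add: h L1_def emeasure_hball)
    have "emeasure L A = ennreal (1 / h) * (ennreal h * emeasure L A)"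
      using h(2) by (simp add: mult.assoc[symmetric] flip: ennreal_mult)
    also have "\<dots> = ennreal (1 / h) * (emeasure HV A * ennreal L1)" by (simp only: e)
    also have "\<dots> = (ennreal (1 / h) * ennreal L1) * emeasure HV A" by (simp only: mult_ac)
    also have "ennreal (1 / h) * ennreal L1 = ennreal (L1 / h)"
      using h(2) L1_pos by (simp flip: ennreal_mult)
    finally show ?thesis by (simp add: emeasure_HV[OF A])
  qed
  moreover have "L1 / h > 0" using L1_pos h(2) by simp
  ultimately show thesis using that by blast
qed

end

section \<open>Tangent measures\<close>

text \<open>Inner regularity of open sets comes from a compact exhaustion. For outer regularity the
  measure is restricted to balls \<open>B n\<close>, where it is finite and the regularity theorem
  for finite Borel measures applies, with errors that sum to \<open>e\<close>.\<close>

lemma radon_measureI: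
  fixes \<nu> :: "'a::euclidean_space measure"
  assumes sets: "sets \<nu> = sets borel" and fin: "\<And>K. compact K \<Longrightarrow> emeasure \<nu> K < \<infinity>"
  shows "radon_measure \<nu>"
  unfolding radon_measure_def
proof (intro conjI allI impI ballI)
  have sp: "space \<nu> = UNIV" using sets_eq_imp_space_eq[OF sets] by simp
  have bs: "A \<in> sets borel \<Longrightarrow> A \<in> sets \<nu>" for A by (simp add: sets)
  fix U :: "'a set" assume U: "open U"
  obtain K where K: "\<And>n. compact (K n)" "\<And>n. K n \<subseteq> interior (K (Suc n))" "(\<Union>n. K n) = U"
    using open_Union_compact_subsets[OF U] by metis
  have "incseq K" using K(2) interior_subset by (intro incseq_SucI) (rule order_trans)
  note K = K(1) this K(3)
  show "emeasure \<nu> U = (SUP K\<in>{K. compact K \<and> K \<subseteq> U}. emeasure \<nu> K)"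
  proof (rule antisym)
    have "emeasure \<nu> U = (SUP n. emeasure \<nu> (K n))"
      unfolding K(3)[symmetric] using K by (intro SUP_emeasure_incseq[symmetric]) (auto intro!: bs borel_compact)
    also have "\<dots> \<le> (SUP K\<in>{K. compact K \<and> K \<subseteq> U}. emeasure \<nu> K)"
      using K by (intro SUP_mono) (auto intro!: bexI[of _ "K _"])
    finally show "emeasure \<nu> U \<le> (SUP K\<in>{K. compact K \<and> K \<subseteq> U}. emeasure \<nu> K)" .
    show "(SUP K\<in>{K. compact K \<and> K \<subseteq> U}. emeasure \<nu> K) \<le> emeasure \<nu> U"
      using U by (intro SUP_least emeasure_mono bs) auto
  qed
next
  have sp: "space \<nu> = UNIV" using sets_eq_imp_space_eq[OF sets] by simp
  have bs: "A \<in> sets borel \<Longrightarrow> A \<in> sets \<nu>" for A by (simp add: sets)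
  fix A :: "'a set" assume A: "A \<in> sets borel"
  show "emeasure \<nu> A = (INF U\<in>{U. open U \<and> A \<subseteq> U}. emeasure \<nu> U)"
  proof (rule antisym)
    show "emeasure \<nu> A \<le> (INF U\<in>{U. open U \<and> A \<subseteq> U}. emeasure \<nu> U)"
      by (intro INF_greatest emeasure_mono bs) auto
    show "(INF U\<in>{U. open U \<and> A \<subseteq> U}. emeasure \<nu> U) \<le> emeasure \<nu> A"
    proof (rule ennreal_le_epsilon)
      fix e :: real assume e: "0 < e"
      define B where "B n = ball (0::'a) (real (Suc n))" for n
      have Bb: "B n \<in> sets borel" for n by (simp add: B_def)
      define \<nu>n where "\<nu>n n = density \<nu> (indicator (B n))" for n
      have em: "emeasure (\<nu>n n) X = emeasure \<nu> (X \<inter> B n)" if "X \<in> sets borel" for X n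
        unfolding \<nu>n_def using that Bb by (subst emeasure_density) (auto simp: sets sp indicator_inter_arith[symmetric] mult.commute intro!: bs borel_measurable_indicator)
      have "\<exists>U. open U \<and> A \<inter> B n \<subseteq> U \<and> emeasure \<nu> (U \<inter> B n - A) \<le> ennreal (e * (1/2) ^ Suc n)" for n
      proof -
        have sn: "sets (\<nu>n n) = sets borel" by (simp add: \<nu>n_def sets)
        have BU: "B n \<subseteq> cball 0 (real (Suc n))" by (auto simp: B_def)
        have finB: "emeasure \<nu> (X \<inter> B n) < \<infinity>" for X
        proof -
          have "emeasure \<nu> (X \<inter> B n) \<le> emeasure \<nu> (cball 0 (real (Suc n)))" using BU by (intro emeasure_mono bs) auto
          also have "\<dots> < \<infinity>" by (intro fin) auto
          finally show ?thesis .
        qed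
        have "emeasure (\<nu>n n) (space (\<nu>n n)) \<noteq> \<infinity>"
          using finB[of UNIV] em[of UNIV n] sets_eq_imp_space_eq[OF sn] by simp
        then have "emeasure (\<nu>n n) (A \<inter> B n) = (INF U\<in>{U. A \<inter> B n \<subseteq> U \<and> open U}. emeasure (\<nu>n n) U)"
          using A Bb by (intro outer_regular[OF sn]) auto
        moreover have "emeasure (\<nu>n n) (A \<inter> B n) < emeasure (\<nu>n n) (A \<inter> B n) + ennreal (e * (1/2) ^ Suc n)"
          using e finB[of A] A Bb by (simp add: em ennreal_add_left_cancel_less less_top)
        ultimately obtain U where U: "A \<inter> B n \<subseteq> U" "open U"
          "emeasure (\<nu>n n) U < emeasure (\<nu>n n) (A \<inter> B n) + ennreal (e * (1/2) ^ Suc n)"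
          unfolding INF_less_iff by (metis (no_types, lifting) INF_less_iff mem_Collect_eq)
        have Ub: "U \<in> sets borel" using U by auto
        have "emeasure \<nu> (U \<inter> B n) < emeasure \<nu> (A \<inter> B n) + ennreal (e * (1/2) ^ Suc n)"
          using U(3) A Bb Ub by (simp add: em Int_assoc)
        moreover have "emeasure \<nu> (U \<inter> B n) = emeasure \<nu> (A \<inter> B n) + emeasure \<nu> (U \<inter> B n - A)"
        proof -
          have "(A \<inter> B n) \<union> (U \<inter> B n - A) = U \<inter> B n" using U(1) by auto
          then show ?thesis using A Bb Ub by (subst plus_emeasure) (auto intro!: bs)
        qed
        ultimately have "emeasure \<nu> (U \<inter> B n - A) < ennreal (e * (1/2) ^ Suc n)"
          by (simp add: ennreal_add_left_cancel_less)
        then show ?thesis using U by (intro exI[of _ U]) auto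
      qed
      then obtain U where U: "\<And>n. open (U n)" "\<And>n. A \<inter> B n \<subseteq> U n" "\<And>n. emeasure \<nu> (U n \<inter> B n - A) \<le> ennreal (e * (1/2) ^ Suc n)"
        by metis
      \<comment> \<open>The excess of \<open>U n\<close> over \<open>A\<close> is controlled inside
        \<open>B n\<close> only, hence the intersection; as the balls are open, the union remains
        open.\<close>
      define W where "W = (\<Union>n. U n \<inter> B n)"
      have Wo: "open W" unfolding W_def B_def using U by auto
      have Wb: "W \<in> sets borel" using Wo by auto
      have AW: "A \<subseteq> W"
      proof
        fix x assume x: "x \<in> A"
        obtain n :: nat where "norm x \<le> real n" using real_arch_simple by blast
        then have "x \<in> B n" by (simp add: B_def)
        then show "x \<in> W" using U(2) x unfolding W_def by blast
      qed
      have "emeasure \<nu> (W - A) \<le> (\<Sum>n. emeasure \<nu> (U n \<inter> B n - A))"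
      proof -
        have "W - A = (\<Union>n. U n \<inter> B n - A)" by (auto simp: W_def)
        then show ?thesis using U(1) A Bb by (simp only:) (rule emeasure_subadditive_countably, auto intro!: bs)
      qed
      also have "\<dots> \<le> (\<Sum>n. ennreal (e * (1/2) ^ Suc n))" by (intro suminf_le U) auto
      also have "\<dots> = (\<Sum>n. ennreal e * ennreal ((1/2) ^ Suc n))" using e by (simp add: ennreal_mult[symmetric])
      also have "\<dots> = ennreal e"
        unfolding ennreal_suminf_cmult by (subst suminf_ennreal_eq[OF zero_le_power power_half_series]) auto
      finally have le: "emeasure \<nu> (W - A) \<le> ennreal e" .
      have "emeasure \<nu> W = emeasure \<nu> A + emeasure \<nu> (W - A)"
        using AW A Wb by (subst plus_emeasure) (auto simp: Un_absorb1 intro!: bs)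
      also have "\<dots> \<le> emeasure \<nu> A + ennreal e" using le by (intro add_left_mono)
      finally have "emeasure \<nu> W \<le> emeasure \<nu> A + ennreal e" .
      moreover have "(INF U\<in>{U. open U \<and> A \<subseteq> U}. emeasure \<nu> U) \<le> emeasure \<nu> W" using Wo AW by (intro INF_lower) auto
      ultimately show "(INF U\<in>{U. open U \<and> A \<subseteq> U}. emeasure \<nu> U) \<le> emeasure \<nu> A + ennreal e" by (rule order_trans[rotated])
    qed
  qed
qed (use assms in auto)

section \<open>From the hypotheses on the measure to tangent measures\<close>

lemma riesz_kernel_fst: "fst (riesz_kernel s q) \<bullet> v = kern_h s v q"
  and riesz_kernel_snd: "\<sigma> * snd (riesz_kernel s q) = kern_v s \<sigma> q"
  by (simp_all add: riesz_kernel_def kern_h_def kern_v_def field_simps)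

context heis_measure begin

text \<open>A bounded linear map may be taken under the Bochner integral once the integrand is
  integrable. Off \<open>hball a \<epsilon>\<close> each of the two parts of the kernel is at most
  \<open>\<epsilon> powr (- s)\<close>, and \<open>hball a 1\<close> has finite mass.\<close>

lemma truncated_riesz_inner:
  assumes "0 < \<epsilon>"
  shows "(LINT q:hball a 1 - hball a \<epsilon>|\<mu>. kern_h s v (- a \<odot> q)) = fst (truncated_riesz s \<mu> \<epsilon> a) \<bullet> v"
    and "(LINT q:hball a 1 - hball a \<epsilon>|\<mu>. kern_v s \<sigma> (- a \<odot> q)) = \<sigma> * snd (truncated_riesz s \<mu> \<epsilon> a)"
proof -
  define D where "D = hball a 1 - hball a \<epsilon>"
  define G where "G q = indicator D q *\<^sub>R riesz_kernel s (- a \<odot> q)" for q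
  have Db: "D \<in> sets borel" by (simp add: D_def)
  have tr: "truncated_riesz s \<mu> \<epsilon> a = (LINT q|\<mu>. G q)"
    by (simp add: truncated_riesz_def set_lebesgue_integral_def G_def D_def inv_heisenberg heisenberg_mult)
  have rk: "(riesz_kernel s :: 'n heis \<Rightarrow> 'n heis) \<in> borel_measurable borel"
  proof -
    have f: "(fst :: 'n heis \<Rightarrow> _) \<in> borel_measurable borel" "(snd :: 'n heis \<Rightarrow> _) \<in> borel_measurable borel"
      by (intro borel_measurable_continuous_onI continuous_intros)+
    show ?thesis unfolding riesz_kernel_def[abs_def] divide_inverse
      by (intro borel_measurable_Pair borel_measurable_scaleR borel_measurable_times borel_measurable_inverse
        powr_real_measurable borel_measurable_hnorm borel_measurable_const f)
  qed
  have "(\<lambda>q. - a \<odot> q) \<in> measurable borel borel" by (intro borel_measurable_continuous_onI continuous_intros)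
  from measurable_compose[OF this rk] have "(\<lambda>q. riesz_kernel s (- a \<odot> q)) \<in> borel_measurable borel" .
  then have "G \<in> borel_measurable borel" unfolding G_def[abs_def] using Db
    by (intro borel_measurable_scaleR borel_measurable_indicator)
  then have Gm: "G \<in> borel_measurable \<mu>" using measurable_cong_sets[OF sets_\<mu> refl] by blast
  have bound: "norm (G q) \<le> 2 * \<epsilon> powr (- s) * indicator (hball a 1) q" for q
  proof (cases "q \<in> D")
    case True
    define p where "p = - a \<odot> q"
    have p: "\<epsilon> < hnorm p" using True by (simp add: D_def p_def hball_def hdist_eq)
    then have p0: "hnorm p > 0" using assms by linarith
    have le: "hnorm p powr (- s) \<le> \<epsilon> powr (- s)" using p assms s_pos by (intro powr_mono2') auto
    have "norm (riesz_kernel s p) \<le> norm (fst (riesz_kernel s p)) + norm (snd (riesz_kernel s p))"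
      by (metis norm_Pair_le prod.collapse)
    also have "norm (fst (riesz_kernel s p)) \<le> hnorm p / hnorm p powr (s + 1)"
      using norm_fst_le_hnorm[of p] p0 by (simp add: riesz_kernel_def divide_inverse mult.commute)
    also have "\<dots> = hnorm p powr (- s)" using p0 by (simp add: powr_add powr_minus field_simps)
    also have "norm (snd (riesz_kernel s p)) \<le> (hnorm p)\<^sup>2 / hnorm p powr (s + 2)"
      using abs_snd_le_hnorm[of p] p0 by (simp add: riesz_kernel_def divide_right_mono)
    also have "\<dots> = hnorm p powr (- s)" using p0 by (simp add: powr_add powr_minus powr_numeral field_simps)
    finally have "norm (riesz_kernel s p) \<le> 2 * \<epsilon> powr (- s)" using le by simp
    then show ?thesis using True by (simp add: G_def D_def p_def)
  qed (simp add: G_def)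
  have Gi: "integrable \<mu> G"
  proof (rule Bochner_Integration.integrable_bound[OF _ Gm])
    show "integrable \<mu> (\<lambda>q. 2 * \<epsilon> powr (- s) * indicator (hball a 1) q :: real)"
      by (intro integrable_mult_right integrable_indicator_hball)
    show "AE q in \<mu>. norm (G q) \<le> norm (2 * \<epsilon> powr (- s) * indicator (hball a 1) q :: real)"
      using bound by (auto intro!: AE_I2 intro: order_trans)
  qed
  have inner_left: "x \<bullet> (v, 0) = fst x \<bullet> v" for x :: "'n heis" by (subst inner_prod_def) simp
  have "fst (truncated_riesz s \<mu> \<epsilon> a) \<bullet> v = (LINT q|\<mu>. G q) \<bullet> (v, 0)" unfolding tr inner_left ..
  also have "\<dots> = (LINT q|\<mu>. G q \<bullet> (v, 0))" using Gi by simp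
  also have "\<dots> = (LINT q|\<mu>. indicator D q *\<^sub>R kern_h s v (- a \<odot> q))"
    unfolding inner_left by (simp add: G_def riesz_kernel_fst)
  finally show "(LINT q:hball a 1 - hball a \<epsilon>|\<mu>. kern_h s v (- a \<odot> q)) = fst (truncated_riesz s \<mu> \<epsilon> a) \<bullet> v"
    unfolding set_lebesgue_integral_def D_def[symmetric] by simp
  have "\<sigma> * snd (truncated_riesz s \<mu> \<epsilon> a) = (LINT q|\<mu>. G q) \<bullet> (0, \<sigma>)" unfolding tr by (simp add: inner_prod_def)
  also have "\<dots> = (LINT q|\<mu>. G q \<bullet> (0, \<sigma>))" using Gi by simp
  also have "\<dots> = (LINT q|\<mu>. indicator D q *\<^sub>R kern_v s \<sigma> (- a \<odot> q))"
    by (simp add: G_def inner_prod_def riesz_kernel_snd[symmetric] mult_ac)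
  finally show "(LINT q:hball a 1 - hball a \<epsilon>|\<mu>. kern_v s \<sigma> (- a \<odot> q)) = \<sigma> * snd (truncated_riesz s \<mu> \<epsilon> a)"
    unfolding set_lebesgue_integral_def D_def[symmetric] by simp
qed

lemma density_bounds:
  assumes "0 < Liminf (at_right 0) (\<lambda>r. emeasure \<mu> (hball a r) / ennreal (r powr s))"
    and "Limsup (at_right 0) (\<lambda>r. emeasure \<mu> (hball a r) / ennreal (r powr s)) < \<infinity>"
  obtains M \<rho> c where "upper_ad a M \<rho>" "c > 0" "\<And>r. 0 < r \<Longrightarrow> r < \<rho> \<Longrightarrow> c * r powr s \<le> measure \<mu> (hball a r)"
proof -
  let ?q = "\<lambda>r. emeasure \<mu> (hball a r) / ennreal (r powr s)"
  have qr: "?q r = ennreal (measure \<mu> (hball a r) / r powr s)" if "r > 0" for r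
    using that by (simp add: emeasure_hball divide_ennreal)
  obtain y where y: "Limsup (at_right 0) ?q < y" "y < \<infinity>" using dense[OF assms(2)] by blast
  define M where "M = enn2real y + 1"
  have yM: "y \<le> ennreal M" using y(2) unfolding M_def
    by (subst ennreal_enn2real[symmetric, of y]) (auto intro!: ennreal_leI simp: less_top)
  obtain z where z: "0 < z" "z < Liminf (at_right 0) ?q" using dense[OF assms(1)] by blast
  have zf: "z < \<infinity>" using z(2) by (metis infinity_ennreal_def less_top order_less_le_trans not_less_iff_gr_or_eq top_greatest)
  define c where "c = enn2real z"
  have c: "c > 0" "z = ennreal c" using z(1) zf by (auto simp: c_def enn2real_positive_iff less_top)
  have "\<forall>\<^sub>F r in at_right 0. ?q r < y" using Limsup_lessD[OF y(1)] .
  moreover have "\<forall>\<^sub>F r in at_right 0. z < ?q r" using less_LiminfD[OF z(2)] .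
  ultimately have "\<forall>\<^sub>F r in at_right 0. ?q r < y \<and> z < ?q r" by (rule eventually_conj)
  then obtain \<rho> where \<rho>: "\<rho> > 0" "\<And>r. 0 < r \<Longrightarrow> r < \<rho> \<Longrightarrow> ?q r < y \<and> z < ?q r"
    unfolding eventually_at_right_field by auto
  have b: "c * r powr s \<le> measure \<mu> (hball a r) \<and> measure \<mu> (hball a r) \<le> M * r powr s" if r: "0 < r" "r < \<rho>" for r
  proof -
    have "ennreal (measure \<mu> (hball a r) / r powr s) \<le> ennreal M" using \<rho>(2)[OF r] yM unfolding qr[OF r(1)] by (meson less_imp_le order_trans)
    moreover have "M \<ge> 0" by (simp add: M_def)
    ultimately have 1: "measure \<mu> (hball a r) / r powr s \<le> M" by (simp add: ennreal_le_iff)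
    have "ennreal c \<le> ennreal (measure \<mu> (hball a r) / r powr s)" using \<rho>(2)[OF r] unfolding qr[OF r(1)] c(2)[symmetric] by (blast intro: less_imp_le)
    then have "c \<le> measure \<mu> (hball a r) / r powr s" by (subst (asm) ennreal_le_iff) auto
    then show ?thesis using 1 r by (simp add: field_simps)
  qed
  have "M > 0" unfolding M_def by (rule add_nonneg_pos) auto
  then show thesis using that[of M \<rho> c] b \<rho>(1) c(1) by (auto simp: upper_ad_def)
qed

lemma tangent_class_Tanf:
  assumes ta: "typical a" and up: "upper_ad a M \<rho>" and c: "c > 0" "\<And>r. 0 < r \<Longrightarrow> r < \<rho> \<Longrightarrow> c * r powr s \<le> measure \<mu> (hball a r)"
    and T: "\<And>\<epsilon>. 0 < \<epsilon> \<Longrightarrow> \<epsilon> < 1 \<Longrightarrow> hnorm (truncated_riesz s \<mu> \<epsilon> a) \<le> T"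
  shows "tangent_class (Tanf a) s c (M * 2 powr s)"
proof
  fix \<Lambda> assume \<Lambda>: "\<Lambda> \<in> Tanf a"
  show "posfun \<Lambda>" by (rule Tanf_posfun[OF \<Lambda>])
  show "c \<le> \<Lambda> (bump 1)" by (rule Tanf_bump_ge[OF up \<Lambda> c(2)])
  show "\<Lambda> (bump 1) \<le> M * 2 powr s" by (rule Tanf_bump_le[OF up \<Lambda>])
  show "dilf s t \<Lambda> \<in> Tanf a" if "t > 0" for t unfolding dilf_def by (rule Tanf_dilate[OF up \<Lambda> that])
  show "trf p \<Lambda> \<in> Tanf a" if "p \<in> fsupp \<Lambda>" for p unfolding trf_def by (rule Tanf_translate[OF ta up \<Lambda> that])
next
  fix \<Lambda> :: "nat \<Rightarrow> _" assume \<Lambda>: "\<And>i. \<Lambda> i \<in> Tanf a"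
  show "\<exists>\<sigma> N. strict_mono \<sigma> \<and> N \<in> Tanf a \<and> (\<forall>f\<in>Cc. (\<lambda>i. \<Lambda> (\<sigma> i) f) \<longlonglongrightarrow> N f)"
  proof (rule Tanf_compact[where \<Lambda> = \<Lambda>, OF up \<Lambda>])
    fix \<sigma> :: "nat \<Rightarrow> nat" and N :: "('n heis \<Rightarrow> real) \<Rightarrow> real"
    assume "strict_mono \<sigma>" "N \<in> Tanf a" "\<And>f. f \<in> Cc \<Longrightarrow> (\<lambda>i. \<Lambda> (\<sigma> i) f) \<longlonglongrightarrow> N f"
    then show ?thesis by (intro exI[of _ \<sigma>] exI[of _ N]) simp
  qed
next
  fix v :: "(real ^ 'n) \<times> (real ^ 'n)"
  have "\<bar>LINT q:hball a 1 - hball a \<epsilon>|\<mu>. kern_h s v (- a \<odot> q)\<bar> \<le> T * norm v" if e: "0 < \<epsilon>" "\<epsilon> < 1" for \<epsilon>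
  proof -
    have "\<bar>fst (truncated_riesz s \<mu> \<epsilon> a) \<bullet> v\<bar> \<le> norm (fst (truncated_riesz s \<mu> \<epsilon> a)) * norm v" by (rule Cauchy_Schwarz_ineq2)
    also have "\<dots> \<le> T * norm v" using norm_fst_le_hnorm[of "truncated_riesz s \<mu> \<epsilon> a"] T[OF e] by (intro mult_right_mono norm_ge_zero) linarith
    finally show ?thesis unfolding truncated_riesz_inner(1)[OF e(1)] .
  qed
  then show "\<exists>K. \<forall>\<Lambda>\<in>Tanf a. \<forall>t. 0 < t \<longrightarrow> t \<le> 1 \<longrightarrow> \<bar>\<Lambda> (\<lambda>q. kern_h s v q * annulus_cutoff t q)\<bar> \<le> K"
  proof (rule Tanf_kernel_bound[OF up homogeneous_kernel_h])
    fix C assume "\<And>\<Lambda> t. \<Lambda> \<in> Tanf a \<Longrightarrow> 0 < t \<Longrightarrow> t \<le> 1 \<Longrightarrow> \<bar>\<Lambda> (\<lambda>q. kern_h s v q * annulus_cutoff t q)\<bar> \<le> C"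
    then show ?thesis by (intro exI[of _ C]) simp
  qed
next
  fix \<sigma> :: real
  \<comment> \<open>The bound on the truncations is in the gauge, which controls the vertical
    coordinate only through its square; hence \<open>T\<^sup>2\<close>.\<close>
  have "\<bar>LINT q:hball a 1 - hball a \<epsilon>|\<mu>. kern_v s \<sigma> (- a \<odot> q)\<bar> \<le> \<bar>\<sigma>\<bar> * T\<^sup>2" if e: "0 < \<epsilon>" "\<epsilon> < 1" for \<epsilon>
  proof -
    have "(hnorm (truncated_riesz s \<mu> \<epsilon> a))\<^sup>2 \<le> T\<^sup>2" using T[OF e] by (intro power_mono) auto
    then have "\<bar>snd (truncated_riesz s \<mu> \<epsilon> a)\<bar> \<le> T\<^sup>2" using abs_snd_le_hnorm[of "truncated_riesz s \<mu> \<epsilon> a"] by linarith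
    then show ?thesis unfolding truncated_riesz_inner(2)[OF e(1)] abs_mult by (rule mult_left_mono) simp
  qed
  then show "\<exists>K. \<forall>\<Lambda>\<in>Tanf a. \<forall>t. 0 < t \<longrightarrow> t \<le> 1 \<longrightarrow> \<bar>\<Lambda> (\<lambda>q. kern_v s \<sigma> q * annulus_cutoff t q)\<bar> \<le> K"
  proof (rule Tanf_kernel_bound[OF up homogeneous_kernel_v])
    fix C assume "\<And>\<Lambda> t. \<Lambda> \<in> Tanf a \<Longrightarrow> 0 < t \<Longrightarrow> t \<le> 1 \<Longrightarrow> \<bar>\<Lambda> (\<lambda>q. kern_v s \<sigma> q * annulus_cutoff t q)\<bar> \<le> C"
    then show ?thesis by (intro exI[of _ C]) simp
  qed
qed (use s_pos c Tanf_nonempty[OF up] in auto)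

lemma integral_blowup_scaled:
  fixes \<phi> :: "'n heis \<Rightarrow> real"
  assumes "\<phi> \<in> Cc" "r > 0" "k \<ge> 0"
  shows "(LINT x|scale_measure (ennreal k) (distr \<mu> borel (blowup a r)). \<phi> x) = k * (LINT q|\<mu>. \<phi> (blowup a r q))"
proof -
  let ?D = "distr \<mu> borel (blowup a r)"
  have tm: "blowup a r \<in> measurable \<mu> borel"
  proof -
    have "continuous_on UNIV (blowup a r)" unfolding blowup_eq[abs_def] by (intro continuous_intros)
    then have "blowup a r \<in> measurable borel borel" by (rule borel_measurable_continuous_onI)
    then show ?thesis using measurable_cong_sets[OF sets_\<mu> refl] by blast
  qed
  have \<phi>: "\<phi> \<in> borel_measurable borel" using assms(1) by (intro borel_measurable_continuous_onI Cc_cont)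
  have "scale_measure (ennreal k) ?D = density ?D (\<lambda>_. ennreal k)"
    by (rule measure_eqI) (auto simp: emeasure_density_const)
  then have "(LINT x|scale_measure (ennreal k) ?D. \<phi> x) = (LINT x|?D. k *\<^sub>R \<phi> x)"
    using assms \<phi> by (simp add: integral_density)
  also have "\<dots> = k * (LINT x|?D. \<phi> x)" by simp
  also have "(LINT x|?D. \<phi> x) = (LINT q|\<mu>. \<phi> (blowup a r q))" by (rule integral_distr[OF tm \<phi>])
  finally show ?thesis .
qed

lemma Tan_haar:
  assumes ta: "typical a" and up: "upper_ad a M \<rho>" and c: "c > 0" "\<And>r. 0 < r \<Longrightarrow> r < \<rho> \<Longrightarrow> c * r powr s \<le> measure \<mu> (hball a r)"
    and T: "\<And>\<epsilon>. 0 < \<epsilon> \<Longrightarrow> \<epsilon> < 1 \<Longrightarrow> hnorm (truncated_riesz s \<mu> \<epsilon> a) \<le> T"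
  shows "\<exists>m. s = real m \<and> Tan \<mu> a \<inter> haar_measures m \<noteq> {}"
proof -
  interpret tangent_class "Tanf a" s c "M * 2 powr s" by (rule tangent_class_Tanf[OF ta up c T])
  obtain W vert L c0 N where H: "hsub_adm W vert" "haar_on (hsub W vert) (hom_dim W vert) L" "s = real (hom_dim W vert)"
    "c0 > 0" "N \<in> Tanf a" "\<And>f. f \<in> Cc \<Longrightarrow> N f = c0 * (LINT q|L. f q)"
    using haar_in_class by metis
  define V where "V = hsub W vert"
  define m where "m = hom_dim W vert"
  have m0: "m > 0" using H(3) s_pos by (simp add: m_def)
  interpret V: haar_group V m L
  proof
    show "haar_on V m L" using H by (simp add: V_def m_def)
  qed (use H(1) m0 in \<open>auto simp: V_def intro: closed_hsub hsub_hmul hsub_uminus\<close>)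
  obtain \<kappa> where \<kappa>: "\<kappa> > 0" "\<And>A. A \<in> sets borel \<Longrightarrow> emeasure L A = ennreal \<kappa> * hausdorff_measure hdist (real m) (A \<inter> V)"
    using V.hausdorff_eq_haar by blast
  \<comment> \<open>The limit functional is represented by a multiple of Haar measure, so a measure
    is at hand without a representation theorem. The constants of the tangent sequence are the
    \<open>r i powr (- s)\<close> hidden in \<open>blow\<close>.\<close>
  define \<nu> where "\<nu> = density L (\<lambda>_. ennreal c0)"
  have sets\<nu>: "sets \<nu> = sets borel" using V.sets_\<mu> by (simp add: \<nu>_def)
  have em: "emeasure \<nu> A = ennreal c0 * emeasure L A" if "A \<in> sets borel" for A
    using that V.sets_\<mu> by (simp add: \<nu>_def emeasure_density_const)
  have "\<nu> \<in> haar_measures m"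
    unfolding haar_measures_def
  proof (intro CollectI conjI exI[of _ "c0 * \<kappa>"] exI[of _ V] ballI sets\<nu>)
    show "0 < c0 * \<kappa>" using H(4) \<kappa>(1) by simp
    show "homogeneous_subgroup V" unfolding V_def by (rule homogeneous_subgroup_hsub[OF H(1)])
    show "hausdorff_dim hdist V = of_nat m" by (rule V.hausdorff_dim_V)
    fix A :: "'n heis set" assume "A \<in> sets borel"
    then show "emeasure \<nu> A = ennreal (c0 * \<kappa>) * hausdorff_measure hdist (real m) (A \<inter> V)"
      using H(4) \<kappa> by (simp add: em ennreal_mult mult.assoc)
  qed
  moreover have "\<nu> \<in> Tan \<mu> a"
  proof -
    have "radon_measure \<nu>"
    proof (rule radon_measureI[OF sets\<nu>])
      fix K :: "'n heis set" assume K: "compact K"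
      then have "emeasure L K < \<infinity>" by (rule V.fin_compact)
      then show "emeasure \<nu> K < \<infinity>" using K by (simp add: em borel_compact ennreal_mult_less_top)
    qed
    moreover have "emeasure \<nu> UNIV > 0"
    proof -
      have "0 < emeasure L (hball 0 1)" using V.haar by (simp add: haar_on_def)
      also have "\<dots> \<le> emeasure L UNIV" using V.space_\<mu> by (metis emeasure_space)
      finally show ?thesis using H(4) by (simp add: em ennreal_zero_less_mult_iff)
    qed
    moreover obtain r where r: "\<And>i::nat. 0 < r i" "r \<longlonglongrightarrow> 0" "\<And>f. f \<in> Cc \<Longrightarrow> (\<lambda>i. blow a (r i) f) \<longlonglongrightarrow> N f"
      using Tanf_seq[OF up H(5)] by blast
    moreover have "weakly_converges (\<lambda>i. scale_measure (ennreal (r i powr (- s))) (distr \<mu> borel (blowup a (r i)))) \<nu>"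
      unfolding weakly_converges_def
    proof (intro allI impI)
      fix \<phi> :: "'n heis \<Rightarrow> real" assume \<phi>: "continuous_on UNIV \<phi>" "compact (closure {x. \<phi> x \<noteq> 0})"
      have "bounded (closure {x. \<phi> x \<noteq> 0})" using \<phi>(2) by (rule compact_imp_bounded)
      then obtain R where R: "\<And>x. x \<in> closure {x. \<phi> x \<noteq> 0} \<Longrightarrow> norm x \<le> R" unfolding bounded_iff by blast
      have \<phi>C: "\<phi> \<in> Cc"
      proof (rule CcI[OF \<phi>(1)])
        fix x :: "'n heis" assume "R < norm x"
        then have "x \<notin> closure {x. \<phi> x \<noteq> 0}" using R[of x] by linarith
        then have "x \<notin> {x. \<phi> x \<noteq> 0}" using closure_subset[of "{x. \<phi> x \<noteq> 0}"] by (meson subsetD)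
        then show "\<phi> x = 0" by simp
      qed
      have "(LINT x|\<nu>. \<phi> x) = N \<phi>"
      proof -
        have "\<phi> \<in> borel_measurable L" using V.Cc_borel[OF \<phi>C] by simp
        then show ?thesis unfolding \<nu>_def H(6)[OF \<phi>C] using H(4) by (simp add: integral_density)
      qed
      moreover have "(LINT x|scale_measure (ennreal (r i powr (- s))) (distr \<mu> borel (blowup a (r i))). \<phi> x) = blow a (r i) \<phi>" for i
        unfolding blow_def by (rule integral_blowup_scaled[OF \<phi>C r(1)]) simp
      ultimately show "(\<lambda>i. LINT x|scale_measure (ennreal (r i powr (- s))) (distr \<mu> borel (blowup a (r i))). \<phi> x) \<longlonglongrightarrow> (LINT x|\<nu>. \<phi> x)"
        using r(3)[OF \<phi>C] by simp
    qed
    moreover have "0 < r i powr (- s)" for i using r(1)[of i] by simp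
    ultimately show ?thesis unfolding Tan_def
      by (intro CollectI conjI exI[of _ "\<lambda>i. r i powr (- s)"] exI[of _ r]) auto
  qed
  ultimately show ?thesis using H(3) unfolding m_def by blast
qed

end

theorem theorem3p1:
  fixes s :: real and \<mu> :: "('n::finite) heis measure"
  assumes "0 < s" and "s < 2 * real CARD('n) + 2"
    and "radon_measure \<mu>" and "emeasure \<mu> UNIV > 0"
    and "AE p in \<mu>.
      0 < Liminf (at_right 0) (\<lambda>r. emeasure \<mu> (hball p r) / ennreal (r powr s)) \<and>
      Liminf (at_right 0) (\<lambda>r. emeasure \<mu> (hball p r) / ennreal (r powr s))
        \<le> Limsup (at_right 0) (\<lambda>r. emeasure \<mu> (hball p r) / ennreal (r powr s)) \<and>
      Limsup (at_right 0) (\<lambda>r. emeasure \<mu> (hball p r) / ennreal (r powr s)) < \<infinity> \<and>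
      (SUP \<epsilon>\<in>{0<..<1}. ennreal (hnorm (truncated_riesz s \<mu> \<epsilon> p))) < \<infinity>"
  shows "\<exists>m::nat. s = real m \<and> 1 \<le> m \<and> m \<le> 2 * CARD('n) + 1 \<and>
    (AE a in \<mu>. Tan \<mu> a \<inter> haar_measures m \<noteq> {})"
proof -
  interpret heis_measure \<mu> s
    by standard (use assms in \<open>auto simp: radon_measure_def\<close>)
  \<comment> \<open>At this stage the dimension may depend on the point; it is pinned down by
    \<open>s\<close> once a single point is known to exist.\<close>
  have AE_m: "AE a in \<mu>. \<exists>m. s = real m \<and> Tan \<mu> a \<inter> haar_measures m \<noteq> {}"
    using AE_typical assms(5)
  proof eventually_elim
    case (elim a)
    obtain M \<rho> c where ad: "upper_ad a M \<rho>" "c > 0" "\<And>r. 0 < r \<Longrightarrow> r < \<rho> \<Longrightarrow> c * r powr s \<le> measure \<mu> (hball a r)"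
      using density_bounds[of a] elim(2) by blast
    define S where "S = (SUP \<epsilon>\<in>{0<..<1}. ennreal (hnorm (truncated_riesz s \<mu> \<epsilon> a)))"
    have S: "S < \<infinity>" using elim(2) by (simp add: S_def)
    have T: "hnorm (truncated_riesz s \<mu> \<epsilon> a) \<le> enn2real S" if "0 < \<epsilon>" "\<epsilon> < 1" for \<epsilon>
    proof -
      have "ennreal (hnorm (truncated_riesz s \<mu> \<epsilon> a)) \<le> S" unfolding S_def using that by (intro SUP_upper) auto
      also have "S = ennreal (enn2real S)" using S by simp
      finally show ?thesis by (simp add: ennreal_le_iff)
    qed
    show ?case by (rule Tan_haar[OF elim(1) ad(1) ad(2) ad(3) T])
  qed
  \<comment> \<open>A nonzero measure cannot satisfy an almost everywhere statement vacuously, so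
    some point has the property.\<close>
  have "\<exists>a m. s = real m \<and> Tan \<mu> a \<inter> haar_measures m \<noteq> {}"
  proof (rule ccontr)
    assume "\<not> ?thesis"
    then have "AE a in \<mu>. False" using AE_m by (auto elim: eventually_mono)
    then have "ae_filter \<mu> = bot" by (simp add: trivial_limit_def)
    then show False using assms(4) by (simp add: ae_filter_eq_bot_iff)
  qed
  then obtain m where m: "s = real m" by blast
  have "AE a in \<mu>. Tan \<mu> a \<inter> haar_measures m \<noteq> {}"
    using AE_m by eventually_elim (use m in auto)
  moreover have "1 \<le> m" "m \<le> 2 * CARD('n) + 1" using assms(1,2) unfolding m by linarith+
  ultimately show ?thesis using m by blast
qed



end
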